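(* Let $0<\alpha<1/2$, let $H$ be a separable real Hilbert space, let $Q$ be a positive, self-adjoint trace class operator on $H$, and let $(W(t):t\in[0,1])$ be a $Q$-Wiener process with values in $H$ (its trajectories lie almost surely in $C_\alpha^0([0,1];H)$). For $\varepsilon\in(0,1]$ let $\mu_\varepsilon$ be the law of $\sqrt\varepsilon\,W$ on $C_\alpha^0([0,1];H)$. Then $(\mu_\varepsilon)_{\varepsilon\in(0,1]}$ satisfies a large deviation principle on $(C_\alpha^0([0,1];H),\lVert\cdot\rVert_\alpha)$ with good rate function $$I(F)=\inf\left\{\frac12\int_0^1\lVert U(s)\rVert_{H_0}^2\,ds:\ U\in L^2([0,1];H_0),\ F(\cdot)=\int_0^\cdot U(s)\,ds\right\},\qquad F\in C_\alpha^0([0,1];H),$$ where $\inf\emptyset=\infty$.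
   Context: $H$ is a separable real Hilbert space with inner product $\langle\cdot,\cdot\rangle$ and norm $\lVert\cdot\rVert_H$. $$C_\alpha^0([0,1];H)=\Big\{F:[0,1]\to H:\ F(0)=0,\ \lim_{\delta\to0}\sup_{t\ne s,\,|t-s|<\delta}\frac{\lVert F(t)-F(s)\rVert_H}{|t-s|^\alpha}=0\Big\},$$ normed by $\lVert F\rVert_\alpha=\sup_{0\le s<t\le1}\lVert F(t)-F(s)\rVert_H/|t-s|^\alpha$. A random variable $X$ in $H$ is $\mathcal N(m,Q)$-distributed if $E[\exp(i\langle h,X\rangle)]=\exp(i\langle h,m\rangle-\tfrac12\langle Qh,h\rangle)$ for all $h\in H$. A $Q$-Wiener process is an $H$-valued stochastic process $(W(t):t\in[0,1])$ with $W(0)=0$, continuous trajectories, independent increments, and $W(t)-W(s)\sim\mathcal N(0,(t-s)Q)$ for $s\le t$. $H_0:=Q^{1/2}H$ with inner product $\langle x,y\rangle_{H_0}:=\langle Q^{-1/2}x,Q^{-1/2}y\rangle_H$ (if $Q$ is not injective, $Q^{-1/2}$ is the pseudo-inverse, i.e. $Q^{-1/2}x$ is the preimage of $x$ under $Q^{1/2}$ that is orthogonal to $\ker Q^{1/2}$), and induced norm $\lVert\cdot\rVert_{H_0}$. $L^2([0,1];H_0)$ is the space of measurable $U:[0,1]\to H_0$ with $\int_0^1\lVert U(s)\rVert_{H_0}^2ds<\infty$. Large deviations: for a Hausdorff topological space $X$ with Borel $\sigma$-algebra $\mathcal B$, a rate function is a lower semicontinuous function $I:X\to[0,\infty]$ (all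 level sets $\{I\le C\}$, $C\ge0$, closed); it is good if all level sets $\{I\le C\}$ are compact. Write $I(A)=\inf_{x\in A}I(x)$. A family $(\mu_\varepsilon)$ of probability measures on $(X,\mathcal B)$ satisfies the large deviation principle (LDP) with rate function $I$ if $\limsup_{\varepsilon\to0}\varepsilon\log\mu_\varepsilon(A)\le -I(A)$ for every closed $A\subset X$ and $\liminf_{\varepsilon\to0}\varepsilon\log\mu_\varepsilon(G)\ge -I(G)$ for every open $G\subset X$. *)

theory Defs
  imports "HOL-Probability.Probability"
begin

section \<open>Operators on a real Hilbert space\<close>

definition selfadjoint_op :: "('h::real_inner \<Rightarrow> 'h) \<Rightarrow> bool" where
  "selfadjoint_op T \<longleftrightarrow> (\<forall>x y. T x \<bullet> y = x \<bullet> T y)"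

definition positive_op :: "('h::real_inner \<Rightarrow> 'h) \<Rightarrow> bool" where
  "positive_op T \<longleftrightarrow> (\<forall>x. 0 \<le> T x \<bullet> x)"

definition op_sqrt :: "('h::real_inner \<Rightarrow> 'h) \<Rightarrow> 'h \<Rightarrow> 'h" where
  "op_sqrt T = (THE R. bounded_linear R \<and> selfadjoint_op R \<and> positive_op R \<and> R \<circ> R = T)"

definition op_abs :: "('h::real_inner \<Rightarrow> 'h) \<Rightarrow> 'h \<Rightarrow> 'h" where
  "op_abs T = op_sqrt (adjoint T \<circ> T)"

definition hilbert_basis :: "'h::real_inner set \<Rightarrow> bool" where
  "hilbert_basis B \<longleftrightarrow>
     pairwise orthogonal B \<and> (\<forall>e\<in>B. norm e = 1) \<and> closure (span B) = UNIV"

text \<open>The trace of a positive operator does not depend on the basis, so asking for one basis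
  or for all bases amounts to the same.\<close>

definition trace_class :: "('h::real_inner \<Rightarrow> 'h) \<Rightarrow> bool" where
  "trace_class T \<longleftrightarrow>
     bounded_linear T \<and> (\<exists>B. hilbert_basis B \<and> (\<lambda>e. op_abs T e \<bullet> e) summable_on B)"

definition op_pinv :: "('h::real_inner \<Rightarrow> 'h) \<Rightarrow> 'h \<Rightarrow> 'h" where
  "op_pinv R x = (THE y. R y = x \<and> (\<forall>k. R k = 0 \<longrightarrow> y \<bullet> k = 0))"


section \<open>Gaussian random variables and Wiener processes\<close>

definition gaussian_rv ::
  "'w measure \<Rightarrow> 'h::{real_inner, banach, polish_space} \<Rightarrow> ('h \<Rightarrow> 'h) \<Rightarrow> ('w \<Rightarrow> 'h) \<Rightarrow> bool" where
  "gaussian_rv M m Q X \<longleftrightarrow>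
     X \<in> borel_measurable M \<and>
     (\<forall>h. (LINT \<omega>|M. exp (\<i> * complex_of_real (h \<bullet> X \<omega>))) =
          exp (\<i> * complex_of_real (h \<bullet> m) - complex_of_real (Q h \<bullet> h / 2)))"

definition independent_increments ::
  "'w measure \<Rightarrow> (real \<Rightarrow> 'w \<Rightarrow> 'h::{real_inner, banach, polish_space}) \<Rightarrow> bool" where
  "independent_increments M W \<longleftrightarrow>
     (\<forall>n (t :: nat \<Rightarrow> real). 0 \<le> t 0 \<and> (\<forall>i<n. t i < t (Suc i)) \<and> t n \<le> 1 \<longrightarrow>
        prob_space.indep_vars M (\<lambda>_. borel) (\<lambda>i \<omega>. W (t (Suc i)) \<omega> - W (t i) \<omega>) {..<n})"

definition Q_Wiener_process ::
  "'w measure \<Rightarrow> ('h \<Rightarrow> 'h) \<Rightarrow> (real \<Rightarrow> 'w \<Rightarrow> 'h::{real_inner, banach, polish_space}) \<Rightarrow> bool" where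
  "Q_Wiener_process M Q W \<longleftrightarrow>
     prob_space M \<and>
     (\<forall>t\<in>{0..1}. W t \<in> borel_measurable M) \<and>
     (\<forall>\<omega>\<in>space M. W 0 \<omega> = 0) \<and>
     (\<forall>\<omega>\<in>space M. continuous_on {0..1} (\<lambda>t. W t \<omega>)) \<and>
     independent_increments M W \<and>
     (\<forall>s t. 0 \<le> s \<and> s \<le> t \<and> t \<le> 1 \<longrightarrow>
        gaussian_rv M 0 (\<lambda>x. (t - s) *\<^sub>R Q x) (\<lambda>\<omega>. W t \<omega> - W s \<omega>))"


section \<open>The little Hoelder space\<close>

text \<open>A function on the unit interval is represented by its extension that is \<^const>\<open>undefined\<close>
  elsewhere, so that equality is equality on the interval.  The exponent is a
  real parameter, which is why the space is a set with a metric and not a type.\<close>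

definition holder_modulus :: "real \<Rightarrow> (real \<Rightarrow> 'h::real_normed_vector) \<Rightarrow> real \<Rightarrow> ennreal" where
  "holder_modulus \<alpha> F \<delta> =
     (SUP (s, t) \<in> {(s, t). s \<in> {0..1} \<and> t \<in> {0..1} \<and> t \<noteq> s \<and> \<bar>t - s\<bar> < \<delta>}.
        ennreal (norm (F t - F s) / \<bar>t - s\<bar> powr \<alpha>))"

definition holder0 :: "real \<Rightarrow> (real \<Rightarrow> 'h::real_normed_vector) set" where
  "holder0 \<alpha> = {F \<in> extensional {0..1}. F 0 = 0 \<and> (holder_modulus \<alpha> F \<longlongrightarrow> 0) (at_right 0)}"

text \<open>The supremum is taken in the extended reals, so that the norm is defined (with junk
  value 0) on all functions; on differences of elements of the space it is finite.\<close>

definition holder_norm :: "real \<Rightarrow> (real \<Rightarrow> 'h::real_normed_vector) \<Rightarrow> real" where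
  "holder_norm \<alpha> F =
     enn2real (SUP (s, t) \<in> {(s, t). 0 \<le> s \<and> s < t \<and> t \<le> 1}.
       ennreal (norm (F t - F s) / \<bar>t - s\<bar> powr \<alpha>))"

definition holder_dist ::
  "real \<Rightarrow> (real \<Rightarrow> 'h::real_normed_vector) \<Rightarrow> (real \<Rightarrow> 'h) \<Rightarrow> real" where
  "holder_dist \<alpha> F G = holder_norm \<alpha> (\<lambda>t. F t - G t)"

definition holder_topology :: "real \<Rightarrow> (real \<Rightarrow> 'h::real_normed_vector) topology" where
  "holder_topology \<alpha> = Metric_space.mtopology (holder0 \<alpha>) (holder_dist \<alpha>)"

lemma holder0_bound:
  fixes F :: "real \<Rightarrow> 'h::real_normed_vector"
  assumes "0 < \<alpha>" and F: "F \<in> holder0 \<alpha>"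
  obtains K where "\<And>s t. 0 \<le> s \<Longrightarrow> s < t \<Longrightarrow> t \<le> 1 \<Longrightarrow> norm (F t - F s) / \<bar>t - s\<bar> powr \<alpha> \<le> K"
proof -
  have "(holder_modulus \<alpha> F \<longlongrightarrow> 0) (at_right 0)"
    using F by (simp add: holder0_def)
  then have "\<forall>\<^sub>F \<delta> in at_right 0. holder_modulus \<alpha> F \<delta> < 1"
    by (rule order_tendstoD) simp
  then obtain b where b: "b > 0" "\<And>\<delta>. 0 < \<delta> \<Longrightarrow> \<delta> < b \<Longrightarrow> holder_modulus \<alpha> F \<delta> < 1"
    by (auto simp: eventually_at_right_field)
  define d where "d = b / 2"
  have d: "d > 0" "holder_modulus \<alpha> F d < 1"
    using b by (auto simp: d_def)
  have near: "norm (F t - F s) / \<bar>t - s\<bar> powr \<alpha> \<le> 1"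
    if "s \<in> {0..1}" "t \<in> {0..1}" "t \<noteq> s" "\<bar>t - s\<bar> < d" for s t
  proof -
    have "ennreal (norm (F t - F s) / \<bar>t - s\<bar> powr \<alpha>) \<le> holder_modulus \<alpha> F d"
      unfolding holder_modulus_def by (rule SUP_upper2[where i = "(s, t)"]) (use that in auto)
    also have "\<dots> \<le> ennreal 1"
      using d by simp
    finally show ?thesis
      by (simp del: ennreal_1)
  qed
  have near': "norm (F t - F s) \<le> \<bar>t - s\<bar> powr \<alpha>"
    if "s \<in> {0..1}" "t \<in> {0..1}" "\<bar>t - s\<bar> < d" for s t
    using near[of s t] that by (cases "t = s") (auto simp: field_simps)
  have "continuous_on {0..1} F"
    unfolding continuous_on_def
  proof
    fix s :: real assume s: "s \<in> {0..1}"
    show "(F \<longlongrightarrow> F s) (at s within {0..1})"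
    proof (rule LIM_zero_cancel, rule Lim_null_comparison)
      show "\<forall>\<^sub>F t in at s within {0..1}. norm (F t - F s) \<le> \<bar>t - s\<bar> powr \<alpha>"
        unfolding eventually_at
        by (rule exI[of _ d]) (use d near' s in \<open>auto simp: dist_real_def\<close>)
      have "((\<lambda>t. \<bar>t - s\<bar>) \<longlongrightarrow> \<bar>s - s\<bar>) (at s within {0..1})"
        by (intro tendsto_intros)
      then have "((\<lambda>t. \<bar>t - s\<bar> powr \<alpha>) \<longlongrightarrow> \<bar>s - s\<bar> powr \<alpha>) (at s within {0..1})"
        by (rule tendsto_powr2) (use \<open>0 < \<alpha>\<close> in auto)
      then show "((\<lambda>t. \<bar>t - s\<bar> powr \<alpha>) \<longlongrightarrow> 0) (at s within {0..1})"
        using \<open>0 < \<alpha>\<close> by simp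
    qed
  qed
  then have "bounded (F ` {0..1})"
    by (intro compact_imp_bounded compact_continuous_image) auto
  then obtain N where N: "\<And>t. t \<in> {0..1} \<Longrightarrow> norm (F t) \<le> N"
    unfolding bounded_iff by blast
  have "N \<ge> 0"
    using N[of 0] norm_ge_zero[of "F 0"] by (simp del: norm_ge_zero)
  have far: "norm (F t - F s) / \<bar>t - s\<bar> powr \<alpha> \<le> 2 * N / d powr \<alpha>"
    if "s \<in> {0..1}" "t \<in> {0..1}" "\<bar>t - s\<bar> \<ge> d" for s t
  proof (rule frac_le)
    show "norm (F t - F s) \<le> 2 * N"
      using norm_triangle_ineq4[of "F t" "F s"] N[of t] N[of s] that by simp
    show "d powr \<alpha> \<le> \<bar>t - s\<bar> powr \<alpha>"
      using that d \<open>0 < \<alpha>\<close> by (intro powr_mono2) auto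
  qed (use \<open>N \<ge> 0\<close> d in auto)
  show ?thesis
  proof (rule that[of "max 1 (2 * N / d powr \<alpha>)"])
    fix s t :: real assume "0 \<le> s" "s < t" "t \<le> 1"
    then show "norm (F t - F s) / \<bar>t - s\<bar> powr \<alpha> \<le> max 1 (2 * N / d powr \<alpha>)"
      using near[of s t] far[of s t] by (cases "\<bar>t - s\<bar> < d") (auto simp: le_max_iff_disj)
  qed
qed

lemma Metric_space_holder0:
  assumes "0 < \<alpha>"
  shows "Metric_space (holder0 \<alpha> :: (real \<Rightarrow> 'h::real_normed_vector) set) (holder_dist \<alpha>)"
proof -
  define P :: "(real \<times> real) set" where "P = {(s, t). 0 \<le> s \<and> s < t \<and> t \<le> 1}"
  define q :: "(real \<Rightarrow> 'h) \<Rightarrow> real \<times> real \<Rightarrow> ennreal"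
    where "q F = (\<lambda>(s, t). ennreal (norm (F t - F s) / \<bar>t - s\<bar> powr \<alpha>))" for F
  have dist: "holder_dist \<alpha> F G = enn2real (SUP p\<in>P. q (\<lambda>t. F t - G t) p)" for F G
    by (simp add: holder_dist_def holder_norm_def P_def q_def)
  have tri: "q (\<lambda>t. F t - H t) p \<le> q (\<lambda>t. F t - G t) p + q (\<lambda>t. G t - H t) p" for F G H p
  proof -
    obtain s t where p: "p = (s, t)" by fastforce
    have "norm ((F t - H t) - (F s - H s)) \<le>
        norm ((F t - G t) - (F s - G s)) + norm ((G t - H t) - (G s - H s))"
      using norm_triangle_ineq[of "(F t - G t) - (F s - G s)" "(G t - H t) - (G s - H s)"]
      by (simp add: algebra_simps)
    then have "norm ((F t - H t) - (F s - H s)) / \<bar>t - s\<bar> powr \<alpha> \<le>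
        norm ((F t - G t) - (F s - G s)) / \<bar>t - s\<bar> powr \<alpha> +
        norm ((G t - H t) - (G s - H s)) / \<bar>t - s\<bar> powr \<alpha>"
      by (simp add: add_divide_distrib[symmetric] divide_right_mono)
    then show ?thesis
      by (simp add: p q_def ennreal_plus[symmetric] ennreal_leI del: ennreal_plus)
  qed
  have sym: "q (\<lambda>t. F t - G t) = q (\<lambda>t. G t - F t)" for F G
  proof -
    have "norm (F t - G t - (F s - G s)) = norm (G t - F t - (G s - F s))" for s t
      using norm_minus_cancel[of "F t - G t - (F s - G s)"] by (simp add: algebra_simps)
    then show ?thesis
      by (simp add: q_def)
  qed
  have SUP_tri: "(SUP p\<in>P. q (\<lambda>t. F t - H t) p) \<le>
      (SUP p\<in>P. q (\<lambda>t. F t - G t) p) + (SUP p\<in>P. q (\<lambda>t. G t - H t) p)" for F G H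
    by (intro SUP_least order_trans[OF tri[of F H _ G]] add_mono SUP_upper)
  have finite0: "(SUP p\<in>P. q F p) < top" if F: "F \<in> holder0 \<alpha>" for F
  proof -
    obtain K where K: "\<And>s t. 0 \<le> s \<Longrightarrow> s < t \<Longrightarrow> t \<le> 1 \<Longrightarrow> norm (F t - F s) / \<bar>t - s\<bar> powr \<alpha> \<le> K"
      using holder0_bound[OF assms F] by blast
    have "(SUP p\<in>P. q F p) \<le> ennreal K"
      by (rule SUP_least) (auto simp: P_def q_def intro!: ennreal_leI K)
    also have "\<dots> < top"
      by simp
    finally show ?thesis .
  qed
  have fin: "(SUP p\<in>P. q (\<lambda>t. F t - G t) p) < top"
    if "F \<in> holder0 \<alpha>" "G \<in> holder0 \<alpha>" for F G
    using SUP_tri[of F G "\<lambda>_. 0"] finite0[OF that(1)] finite0[OF that(2)] sym[of "\<lambda>_. 0" G]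
    by (simp add: order.strict_trans1)
  show ?thesis
  proof
    fix F G :: "real \<Rightarrow> 'h"
    show "0 \<le> holder_dist \<alpha> F G" "holder_dist \<alpha> F G = holder_dist \<alpha> G F"
      by (simp_all add: dist sym[of F G])
  next
    fix F G :: "real \<Rightarrow> 'h" assume FG: "F \<in> holder0 \<alpha>" "G \<in> holder0 \<alpha>"
    then have z: "F 0 = 0" "G 0 = 0" and ext: "F \<in> extensional {0..1}" "G \<in> extensional {0..1}"
      by (auto simp: holder0_def)
    show "holder_dist \<alpha> F G = 0 \<longleftrightarrow> F = G"
    proof
      assume "holder_dist \<alpha> F G = 0"
      then have "(SUP p\<in>P. q (\<lambda>t. F t - G t) p) = 0"
        using fin[OF FG] by (simp only: dist enn2real_eq_0_iff less_top[symmetric]) blast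
      then have 0: "q (\<lambda>t. F t - G t) p = 0" if "p \<in> P" for p
        using SUP_upper[OF that, of "q (\<lambda>t. F t - G t)"] by simp
      show "F = G"
      proof (rule extensionalityI[OF ext])
        fix t :: real assume "t \<in> {0..1}"
        then show "F t = G t"
          using 0[of "(0, t)"] z by (cases "t = 0") (auto simp: P_def q_def)
      qed
    qed (simp add: dist q_def case_prod_unfold SUP_constant bot_ennreal)
  next
    fix F G H :: "real \<Rightarrow> 'h"
    assume FGH: "F \<in> holder0 \<alpha>" "G \<in> holder0 \<alpha>" "H \<in> holder0 \<alpha>"
    show "holder_dist \<alpha> F H \<le> holder_dist \<alpha> F G + holder_dist \<alpha> G H"
      unfolding dist using SUP_tri[of F H G] fin FGH
      by (subst enn2real_plus[symmetric]) (auto intro!: enn2real_mono)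
  qed
qed


section \<open>The space of square integrable paths with values in the reproducing space\<close>

definition H0_carrier :: "('h::real_inner \<Rightarrow> 'h) \<Rightarrow> 'h set" where
  "H0_carrier Q = range (op_sqrt Q)"

definition H0_inner :: "('h::real_inner \<Rightarrow> 'h) \<Rightarrow> 'h \<Rightarrow> 'h \<Rightarrow> real" where
  "H0_inner Q x y = op_pinv (op_sqrt Q) x \<bullet> op_pinv (op_sqrt Q) y"

definition H0_norm :: "('h::real_inner \<Rightarrow> 'h) \<Rightarrow> 'h \<Rightarrow> real" where
  "H0_norm Q x = sqrt (H0_inner Q x x)"

definition H0_topology :: "('h::real_inner \<Rightarrow> 'h) \<Rightarrow> 'h topology" where
  "H0_topology Q = Metric_space.mtopology (H0_carrier Q) (\<lambda>x y. H0_norm Q (x - y))"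

definition borel_of :: "'x topology \<Rightarrow> 'x measure" where
  "borel_of X = sigma (topspace X) {U. openin X U}"

definition L2_H0 :: "('h::real_inner \<Rightarrow> 'h) \<Rightarrow> (real \<Rightarrow> 'h) set" where
  "L2_H0 Q =
     {U \<in> measurable (restrict_space lborel {0..1}) (borel_of (H0_topology Q)).
        (\<integral>\<^sup>+s\<in>{0..1}. ennreal ((H0_norm Q (U s))\<^sup>2) \<partial>lborel) < \<infinity>}"


section \<open>Large deviations\<close>

definition rate_function :: "'x topology \<Rightarrow> ('x \<Rightarrow> ennreal) \<Rightarrow> bool" where
  "rate_function X I \<longleftrightarrow> (\<forall>C\<ge>0. closedin X {x \<in> topspace X. I x \<le> ennreal C})"

definition good_rate_function :: "'x topology \<Rightarrow> ('x \<Rightarrow> ennreal) \<Rightarrow> bool" where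
  "good_rate_function X I \<longleftrightarrow>
     rate_function X I \<and> (\<forall>C\<ge>0. compactin X {x \<in> topspace X. I x \<le> ennreal C})"

definition log_ereal :: "real \<Rightarrow> ereal" where
  "log_ereal p = (if p = 0 then - \<infinity> else ereal (ln p))"

definition LDP :: "'x topology \<Rightarrow> (real \<Rightarrow> 'x measure) \<Rightarrow> ('x \<Rightarrow> ennreal) \<Rightarrow> bool" where
  "LDP X \<mu> I \<longleftrightarrow>
     Hausdorff_space X \<and> rate_function X I \<and>
     (\<forall>\<epsilon>\<in>{0<..1}. prob_space (\<mu> \<epsilon>) \<and> sets (\<mu> \<epsilon>) = sets (borel_of X)) \<and>
     (\<forall>A. closedin X A \<longrightarrow>
        Limsup (at_right 0) (\<lambda>\<epsilon>. ereal \<epsilon> * log_ereal (measure (\<mu> \<epsilon>) A))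
          \<le> - enn2ereal (INF x\<in>A. I x)) \<and>
     (\<forall>G. openin X G \<longrightarrow>
        Liminf (at_right 0) (\<lambda>\<epsilon>. ereal \<epsilon> * log_ereal (measure (\<mu> \<epsilon>) G))
          \<ge> - enn2ereal (INF x\<in>G. I x))"


section \<open>Laws of the scaled process and the rate function\<close>

text \<open>For a Wiener process the path map need not send every point of \<^term>\<open>space M\<close> into the
  Hoelder space, only almost every one.  The constant \<^const>\<open>distr\<close> still gives the law: it maps
  a Borel set \<open>A\<close> to the measure of the preimage of \<open>A\<close>, provided these preimages are events.\<close>

definition scaled_law ::
  "real \<Rightarrow> 'w measure \<Rightarrow> (real \<Rightarrow> 'w \<Rightarrow> 'h::real_normed_vector) \<Rightarrow> real \<Rightarrow> (real \<Rightarrow> 'h) measure" where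
  "scaled_law \<alpha> M W \<epsilon> =
     distr M (borel_of (holder_topology \<alpha>)) (\<lambda>\<omega>. \<lambda>t\<in>{0..1}. sqrt \<epsilon> *\<^sub>R W t \<omega>)"

text \<open>The integral of \<open>U\<close> is computed in the ambient space, into which the space of values
  embeds continuously.\<close>

definition schilder_rate ::
  "('h \<Rightarrow> 'h) \<Rightarrow> (real \<Rightarrow> 'h::{real_inner, banach, polish_space}) \<Rightarrow> ennreal" where
  "schilder_rate Q F =
     (INF U \<in> {U \<in> L2_H0 Q. \<forall>t\<in>{0..1}. F t = (LINT s:{0..t}|lborel. U s)}.
        (1 / 2) * (\<integral>\<^sup>+s\<in>{0..1}. ennreal ((H0_norm Q (U s))\<^sup>2) \<partial>lborel))"

end

theory Submission
  imports Defs
begin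

text \<open>Let \<open>E\<close> be an orthonormal eigenbasis of \<open>Q\<close>.  The Hoelder norm is compared with weighted
  dyadic increments.  The rate of a path is half the limit of its dyadic energies, the weighted
  square sums of the coordinates of its increments at level \<open>n\<close>: a bound on the energies makes
  the dyadic slopes a Cauchy sequence in \<open>L\<^sup>2\<close>, and it bounds the increments by a multiple of
  \<open>2 powr (- n / 2)\<close>, which for \<open>\<alpha> < 1 / 2\<close> gives compact level sets.

  Upper bound: up to an event of probability \<open>O(exp (- l / \<epsilon>))\<close>, the scaled path is uniformly close
  in the Hoelder norm to the interpolation at a fixed level of a projection to finitely many
  coordinates.  The rate of that interpolation is \<open>\<epsilon>/2\<close> times a sum of finitely many squared
  independent standard normal variables, whose tail is estimated by an exponential moment.  A closed
  set has positive distance from a compact level set disjoint from it.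

  Lower bound: among the translates of a symmetric finite-dimensional Gaussian event, the translate by
  \<open>m\<close> has at least \<open>exp (- norm m ^ 2 / 2)\<close> times the probability of the centred one.  Letting the
  level and the number of coordinates grow bounds the probability of a Hoelder ball around a path of
  finite rate, with no appeal to the full Cameron--Martin theorem.\<close>

section \<open>Orthonormal systems\<close>

text \<open>The level and the coordinates are fixed before \<open>\<epsilon>\<close> tends to 0, so
  every discarded event must be small at a prescribed exponential rate. For the dyadic condition
  this comes from the ratio \<open>\<rho>\<close> of squared tolerance to variance. It equals
  \<open>2 powr (1 - 2 * \<alpha>)\<close>, which exceeds 1 because \<open>\<alpha> < 1 / 2\<close>,
  and the exponent at level \<open>n\<close> is a multiple of
  \<open>\<rho> ^ n / \<epsilon>\<close>. For the omitted coordinates it comes from the tail of the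
  trace. What remains is a chi-square variable, whose exponential moment of order
  \<open>a / 2\<close> is finite only for \<open>a < 1\<close>; the loss is absorbed by the gap
  between two rates \<open>l < l'\<close>. Each energy is a continuous function of finitely many
  values of the path, which makes lower semicontinuity of the rate visible. Three obstacles come
  from the definitions: \<open>op_sqrt\<close> is a definite description, so positive square roots
  have to be unique; the trace is summable in some basis, which need not consist of eigenvectors;
  and the path map lands in the Hoelder space only almost surely, so its law is computed through a
  modification.\<close>

definition orthonormal :: "'h::real_inner set \<Rightarrow> bool" where
  "orthonormal B \<longleftrightarrow> pairwise orthogonal B \<and> (\<forall>e\<in>B. norm e = 1)"

definition oproj :: "'h::real_inner set \<Rightarrow> 'h \<Rightarrow> 'h" where
  "oproj J x = (\<Sum>e\<in>J. (x \<bullet> e) *\<^sub>R e)"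

lemma hilbert_basis_orthonormal: "hilbert_basis B \<Longrightarrow> orthonormal B"
  by (simp add: hilbert_basis_def orthonormal_def)

lemma orthonormal_inner:
  assumes "orthonormal B" "a \<in> B" "b \<in> B"
  shows "a \<bullet> b = (if a = b then 1 else 0)"
  using assms by (auto simp: orthonormal_def pairwise_def orthogonal_def norm_eq_1)

lemma orthonormal_sum_inner:
  assumes B: "orthonormal B" and J: "finite J" "J \<subseteq> B" and e: "e \<in> B"
  shows "(\<Sum>a\<in>J. c a *\<^sub>R a) \<bullet> e = (if e \<in> J then c e else 0)"
proof -
  have "(\<Sum>a\<in>J. c a *\<^sub>R a) \<bullet> e = (\<Sum>a\<in>J. if a = e then c a else 0)"
    unfolding inner_sum_left
    by (intro sum.cong refl) (use J e orthonormal_inner[OF B] in auto)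
  then show ?thesis
    using J by simp
qed

lemma orthonormal_norm_sum:
  assumes B: "orthonormal B" and J: "finite J" "J \<subseteq> B"
  shows "(norm (\<Sum>a\<in>J. c a *\<^sub>R a))\<^sup>2 = (\<Sum>a\<in>J. (c a)\<^sup>2)"
proof -
  have "(\<Sum>a\<in>J. c a *\<^sub>R a) \<bullet> (\<Sum>a\<in>J. c a *\<^sub>R a) = (\<Sum>e\<in>J. c e * c e)"
    unfolding inner_sum_right
    by (rule sum.cong[OF refl]) (use J orthonormal_sum_inner[OF B J] in auto)
  then show ?thesis
    by (simp add: power2_norm_eq_inner flip: power2_eq_square)
qed

lemma oproj_inner:
  assumes "orthonormal B" "finite J" "J \<subseteq> B" "e \<in> B"
  shows "oproj J x \<bullet> e = (if e \<in> J then x \<bullet> e else 0)"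
  unfolding oproj_def by (rule orthonormal_sum_inner[OF assms])

lemma norm_oproj:
  assumes "orthonormal B" "finite J" "J \<subseteq> B"
  shows "(norm (oproj J x))\<^sup>2 = (\<Sum>e\<in>J. (x \<bullet> e)\<^sup>2)"
  unfolding oproj_def by (rule orthonormal_norm_sum[OF assms])

lemma norm_diff_oproj:
  assumes "orthonormal B" "finite J" "J \<subseteq> B"
  shows "(norm (x - oproj J x))\<^sup>2 = (norm x)\<^sup>2 - (\<Sum>e\<in>J. (x \<bullet> e)\<^sup>2)"
proof -
  have "x \<bullet> oproj J x = (\<Sum>e\<in>J. (x \<bullet> e)\<^sup>2)"
    by (simp add: oproj_def inner_sum_right power2_eq_square)
  moreover have "oproj J x \<bullet> oproj J x = (\<Sum>e\<in>J. (x \<bullet> e)\<^sup>2)"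
    using norm_oproj[OF assms] by (simp add: power2_norm_eq_inner)
  ultimately show ?thesis
    by (simp add: power2_norm_eq_inner inner_diff_left inner_diff_right inner_commute)
qed

lemma bessel_inequality:
  assumes "orthonormal B" "finite J" "J \<subseteq> B"
  shows "(\<Sum>e\<in>J. (x \<bullet> e)\<^sup>2) \<le> (norm x)\<^sup>2"
  using norm_diff_oproj[OF assms, of x] zero_le_power2[of "norm (x - oproj J x)"] by linarith

lemma norm_oproj_le:
  assumes "orthonormal B" "finite J" "J \<subseteq> B"
  shows "norm (oproj J x) \<le> norm x"
  using bessel_inequality[OF assms, of x] norm_oproj[OF assms, of x]
  by (metis norm_ge_zero power2_le_imp_le)

lemma bounded_linear_oproj: "bounded_linear (oproj J)"
  unfolding oproj_def
  by (intro bounded_linear_sum bounded_linear_scaleR_const bounded_linear_inner_left)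

lemma oproj_diff: "oproj J (x - y) = oproj J x - oproj J y"
  by (rule linear_diff[OF bounded_linear.linear[OF bounded_linear_oproj]])

lemma oproj_scaleR: "oproj J (c *\<^sub>R x) = c *\<^sub>R oproj J x"
  by (rule linear_cmul[OF bounded_linear.linear[OF bounded_linear_oproj]])

text \<open>The projection fixes \<open>y\<close>, so \<open>x\<close> and \<open>x - y\<close> have
  the same residual, and a residual is never longer than the vector it comes from.\<close>

lemma oproj_best:
  assumes B: "orthonormal B" and J: "finite J" "J \<subseteq> B" and y: "y \<in> span J"
  shows "norm (x - oproj J x) \<le> norm (x - y)"
proof -
  obtain c where y: "y = (\<Sum>e\<in>J. c e *\<^sub>R e)"
    using y J by (auto simp: span_finite)
  have "oproj J y = y"
    unfolding oproj_def using orthonormal_sum_inner[OF B J] J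
    by (subst (2) y) (auto intro!: sum.cong simp: y subset_iff)
  then have eq: "x - oproj J x = (x - y) - oproj J (x - y)"
    by (simp add: oproj_diff)
  have "(norm (x - oproj J x))\<^sup>2 \<le> (norm (x - y))\<^sup>2"
    unfolding eq norm_diff_oproj[OF B J] using sum_nonneg[of J "\<lambda>e. ((x - y) \<bullet> e)\<^sup>2"] by simp
  then show ?thesis
    by (rule power2_le_imp_le) simp
qed

text \<open>Tails are expressed through finite sets disjoint from \<open>J\<close>, the form in
  which coordinate sums are estimated throughout.\<close>

lemma summable_on_tail:
  fixes f :: "'a \<Rightarrow> real"
  assumes f: "f summable_on B" "\<And>x. x \<in> B \<Longrightarrow> 0 \<le> f x" and d: "d > 0"
  obtains J where "finite J" "J \<subseteq> B" "\<And>G. finite G \<Longrightarrow> G \<subseteq> B - J \<Longrightarrow> sum f G < d"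
proof -
  obtain J where J: "finite J" "J \<subseteq> B" "dist (sum f J) (infsum f B) \<le> d / 2"
    using infsum_finite_approximation[OF f(1), of "d / 2"] d by auto
  show thesis
  proof (rule that[OF J(1,2)])
    fix G assume G: "finite G" "G \<subseteq> B - J"
    have "sum f J + sum f G = sum f (J \<union> G)"
      using G J by (subst sum.union_disjoint) auto
    also have "\<dots> \<le> infsum f B"
      by (rule finite_sum_le_infsum) (use f G J in auto)
    finally show "sum f G < d"
      using J(3) d by (simp add: dist_real_def abs_if split: if_splits)
  qed
qed

text \<open>By Pythagoras two partial sums containing a common finite set differ by at most a tail
  of the square sum. \<open>B\<close> may be uncountable here, so the Cauchy property is that of a
  filter of finite sets and not of a sequence.\<close>

lemma riesz_fischer:
  fixes B :: "'h::{real_inner,banach} set"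
  assumes B: "orthonormal B" and c: "(\<lambda>e. (c e)\<^sup>2) summable_on B"
  shows "(\<lambda>e. c e *\<^sub>R e) summable_on B"
proof -
  let ?f = "\<lambda>e. c e *\<^sub>R e"
  have "\<exists>P. eventually P (finite_subsets_at_top B) \<and>
              (\<forall>F F'. P F \<and> P F' \<longrightarrow> dist (sum ?f F) (sum ?f F') < d)" if "d > 0" for d
  proof -
    obtain J where J: "finite J" "J \<subseteq> B" "\<And>G. finite G \<Longrightarrow> G \<subseteq> B - J \<Longrightarrow> (\<Sum>e\<in>G. (c e)\<^sup>2) < (d / 2)\<^sup>2"
      by (rule summable_on_tail[OF c, of "(d / 2)\<^sup>2"]) (use \<open>d > 0\<close> in auto)
    have near: "dist (sum ?f F) (sum ?f J) < d / 2" if F: "finite F" "J \<subseteq> F" "F \<subseteq> B" for F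
    proof -
      have "(dist (sum ?f F) (sum ?f J))\<^sup>2 = (norm (sum ?f (F - J)))\<^sup>2"
        unfolding dist_norm using F by (subst sum_diff) auto
      also have "\<dots> = (\<Sum>e\<in>F - J. (c e)\<^sup>2)"
        by (rule orthonormal_norm_sum[OF B]) (use F in auto)
      also have "\<dots> < (d / 2)\<^sup>2"
        using F by (intro J) auto
      finally show ?thesis
        by (rule power2_less_imp_less) (use \<open>d > 0\<close> in simp)
    qed
    have "eventually (\<lambda>F. finite F \<and> J \<subseteq> F \<and> F \<subseteq> B) (finite_subsets_at_top B)"
      unfolding eventually_finite_subsets_at_top using J by auto
    moreover have "dist (sum ?f F) (sum ?f F') < d"
      if "finite F \<and> J \<subseteq> F \<and> F \<subseteq> B" "finite F' \<and> J \<subseteq> F' \<and> F' \<subseteq> B" for F F'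
    proof -
      have "dist (sum ?f F) (sum ?f J) < d / 2" "dist (sum ?f F') (sum ?f J) < d / 2"
        using near that by blast+
      then show ?thesis
        by (rule dist_triangle_half_l)
    qed
    ultimately show ?thesis
      by (intro exI[of _ "\<lambda>F. finite F \<and> J \<subseteq> F \<and> F \<subseteq> B"] conjI) simp_all
  qed
  then have "cauchy_filter (filtermap (sum ?f) (finite_subsets_at_top B))"
    by (simp add: cauchy_filter_metric_filtermap)
  moreover have "Topological_Spaces.complete (UNIV::'h set)"
    by (rule complete_UNIV)
  ultimately obtain L where "(sum ?f \<longlongrightarrow> L) (finite_subsets_at_top B)"
    using complete_uniform[where S=UNIV] by (force simp add: filterlim_def)
  then show ?thesis
    using summable_on_def has_sum_def by blast
qed

lemma bessel_summable:
  assumes B: "orthonormal B"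
  shows "(\<lambda>e. (x \<bullet> e)\<^sup>2) summable_on B"
  by (rule nonneg_bdd_above_summable_on)
    (auto intro!: bdd_aboveI[of _ "(norm x)\<^sup>2"] bessel_inequality[OF B])

text \<open>An element of the span within \<open>d\<close> of \<open>x\<close> involves finitely
  many basis vectors, and by \<open>oproj_best\<close> every projection onto a larger finite set is
  at least as close.\<close>

lemma hilbert_basis_expansion:
  assumes B: "hilbert_basis B"
  shows "((\<lambda>e. (x \<bullet> e) *\<^sub>R e) has_sum x) B"
  unfolding has_sum_def
proof (rule tendstoI)
  fix d :: real assume d: "d > 0"
  note on = hilbert_basis_orthonormal[OF B]
  have "x \<in> closure (span B)"
    using B by (simp add: hilbert_basis_def)
  then obtain y where y: "y \<in> span B" "dist y x < d"
    using d unfolding closure_approachable by blast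
  from y(1) obtain J r where J: "finite J" "J \<subseteq> B" "y = (\<Sum>a\<in>J. r a *\<^sub>R a)"
    unfolding span_explicit by blast
  have "dist (oproj F x) x < d" if F: "finite F" "J \<subseteq> F" "F \<subseteq> B" for F
  proof -
    have "y \<in> span F"
      unfolding J(3) using F by (intro span_sum span_scale span_base) auto
    from oproj_best[OF on F(1,3) this, of x] show ?thesis
      using y(2) by (simp add: dist_norm norm_minus_commute)
  qed
  then show "eventually (\<lambda>F. dist (\<Sum>e\<in>F. (x \<bullet> e) *\<^sub>R e) x < d) (finite_subsets_at_top B)"
    unfolding eventually_finite_subsets_at_top oproj_def using J by blast
qed

lemma hilbert_basis_inner:
  assumes B: "hilbert_basis B"
  shows "((\<lambda>e. (x \<bullet> e) * (y \<bullet> e)) has_sum (x \<bullet> y)) B"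
  using has_sum_bounded_linear[OF bounded_linear_inner_right[of y] hilbert_basis_expansion[OF B, of x]]
  by (simp add: inner_commute)

lemma hilbert_basis_parseval:
  assumes B: "hilbert_basis B"
  shows "((\<lambda>e. (x \<bullet> e)\<^sup>2) has_sum (norm x)\<^sup>2) B"
  using hilbert_basis_inner[OF B, of x x] by (simp add: power2_norm_eq_inner flip: power2_eq_square)

lemma hilbert_basis_eqI:
  assumes B: "hilbert_basis B" and "\<And>e. e \<in> B \<Longrightarrow> x \<bullet> e = y \<bullet> e"
  shows "x = y"
proof -
  have "((\<lambda>e. ((x - y) \<bullet> e)\<^sup>2) has_sum 0) B"
    by (rule has_sum_0) (use assms(2) in \<open>simp add: inner_diff_left\<close>)
  from has_sum_unique[OF this hilbert_basis_parseval[OF B]] show ?thesis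
    by simp
qed

text \<open>Parseval for the residual, whose coordinates vanish on \<open>J\<close> and agree with
  those of \<open>x\<close> elsewhere. This turns estimates on finite coordinate sets into norm
  estimates.\<close>

lemma norm_diff_oproj_le:
  assumes B: "hilbert_basis B" and J: "finite J" "J \<subseteq> B"
    and le: "\<And>G. finite G \<Longrightarrow> G \<subseteq> B - J \<Longrightarrow> (\<Sum>e\<in>G. (x \<bullet> e)\<^sup>2) \<le> d"
  shows "(norm (x - oproj J x))\<^sup>2 \<le> d"
proof -
  note on = hilbert_basis_orthonormal[OF B]
  let ?y = "x - oproj J x"
  have y: "?y \<bullet> e = (if e \<in> J then 0 else x \<bullet> e)" if "e \<in> B" for e
    using oproj_inner[OF on J that] by (simp add: inner_diff_left)
  have "(\<Sum>e\<in>F. (?y \<bullet> e)\<^sup>2) \<le> d" if F: "finite F" "F \<subseteq> B" for F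
  proof -
    have "(\<Sum>e\<in>F. (?y \<bullet> e)\<^sup>2) = (\<Sum>e\<in>F - J. (x \<bullet> e)\<^sup>2)"
      using F by (intro sum.mono_neutral_cong_right) (auto simp: y subset_iff)
    also have "\<dots> \<le> d"
      using F by (intro le) auto
    finally show ?thesis .
  qed
  with hilbert_basis_parseval[OF B, of ?y] show ?thesis
    by (rule has_sum_le_finite_sums)
qed

text \<open>By induction the box is the Minkowski sum of a compact segment and a compact box of
  lower dimension.\<close>

lemma compact_span_box:
  fixes f :: "'a \<Rightarrow> 'h::real_normed_vector"
  assumes "finite J"
  shows "compact {\<Sum>e\<in>J. c e *\<^sub>R f e | c. \<forall>e\<in>J. \<bar>c e\<bar> \<le> (K::real)}"
  using assms
proof (induction J)
  case empty
  then show ?case by simp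
next
  case (insert a J)
  have 1: "compact ((\<lambda>t. t *\<^sub>R f a) ` {-K..K})"
    by (intro compact_continuous_image continuous_intros) auto
  have "{\<Sum>e\<in>insert a J. c e *\<^sub>R f e | c. \<forall>e\<in>insert a J. \<bar>c e\<bar> \<le> K} =
    {x + y | x y. x \<in> (\<lambda>t. t *\<^sub>R f a) ` {-K..K} \<and> y \<in> {\<Sum>e\<in>J. c e *\<^sub>R f e | c. \<forall>e\<in>J. \<bar>c e\<bar> \<le> K}}"
    (is "?L = ?R")
  proof
    show "?L \<subseteq> ?R"
      using insert.hyps by (auto simp: abs_le_iff) force
    show "?R \<subseteq> ?L"
    proof
      fix z assume "z \<in> ?R"
      then obtain t c where z: "z = t *\<^sub>R f a + (\<Sum>e\<in>J. c e *\<^sub>R f e)" "\<bar>t\<bar> \<le> K" "\<forall>e\<in>J. \<bar>c e\<bar> \<le> K"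
        by (auto simp: abs_le_iff)
      have "(\<Sum>e\<in>J. c e *\<^sub>R f e) = (\<Sum>e\<in>J. (c(a := t)) e *\<^sub>R f e)"
        using insert.hyps by (intro sum.cong) auto
      then show "z \<in> ?L"
        using z insert.hyps by (intro CollectI exI[of _ "c(a := t)"]) auto
    qed
  qed
  with compact_sums[OF 1 insert.IH] show ?case
    by simp
qed

text \<open>The projections of \<open>S\<close> lie in a compact coordinate box; a finite
  \<open>d / 2\<close> net of the box is a \<open>d\<close> net of \<open>S\<close> once the
  projection error is below \<open>d / 2\<close>.\<close>

lemma totally_bounded_oproj:
  fixes B :: "'h::real_inner set"
  assumes B: "orthonormal B" and K: "\<And>x. x \<in> S \<Longrightarrow> norm x \<le> K"
    and approx: "\<And>d. d > 0 \<Longrightarrow> \<exists>J. finite J \<and> J \<subseteq> B \<and> (\<forall>x\<in>S. norm (x - oproj J x) < d)"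
    and d: "d > 0"
  shows "\<exists>k. finite k \<and> S \<subseteq> (\<Union>x\<in>k. ball x d)"
proof -
  obtain J where J: "finite J" "J \<subseteq> B" "\<And>x. x \<in> S \<Longrightarrow> norm (x - oproj J x) < d / 2"
    using approx[of "d / 2"] d by auto
  have "compact {\<Sum>e\<in>J. c e *\<^sub>R e | c. \<forall>e\<in>J. \<bar>c e\<bar> \<le> K}" (is "compact ?C")
    by (rule compact_span_box[OF J(1)])
  then obtain k where k: "finite k" "?C \<subseteq> (\<Union>x\<in>k. ball x (d / 2))"
    unfolding compact_eq_totally_bounded using d by (meson half_gt_zero)
  have "S \<subseteq> (\<Union>x\<in>k. ball x d)"
  proof
    fix x assume x: "x \<in> S"
    have "\<bar>x \<bullet> e\<bar> \<le> K" if "e \<in> J" for e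
    proof -
      have "norm e = 1" using J B that by (auto simp: orthonormal_def)
      then show ?thesis
        using Cauchy_Schwarz_ineq2[of x e] K[OF x] by simp
    qed
    then have "oproj J x \<in> ?C"
      unfolding oproj_def by blast
    then obtain y where y: "y \<in> k" "dist y (oproj J x) < d / 2"
      using k by auto
    have "dist y x < d"
      using dist_triangle[of y x "oproj J x"] y(2) J(3)[OF x] dist_commute[of x "oproj J x"]
      by (simp add: dist_norm)
    then show "x \<in> (\<Union>x\<in>k. ball x d)"
      using y(1) by auto
  qed
  with k(1) show ?thesis by blast
qed

lemma compact_closure_totally_bounded:
  fixes S :: "'h::complete_space set"
  assumes "\<And>d. d > 0 \<Longrightarrow> \<exists>k. finite k \<and> S \<subseteq> (\<Union>x\<in>k. ball x d)"
  shows "compact (closure S)"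
  unfolding compact_eq_totally_bounded
proof (intro conjI allI impI)
  show "Topological_Spaces.complete (closure S)"
    by (simp add: complete_eq_closed)
  fix d :: real assume d: "d > 0"
  then obtain k where k: "finite k" "S \<subseteq> (\<Union>x\<in>k. ball x (d / 2))"
    using assms[of "d / 2"] by auto
  have "closure S \<subseteq> (\<Union>x\<in>k. cball x (d / 2))"
    by (rule closure_minimal) (use k in \<open>auto intro!: closed_UN simp: subset_iff less_imp_le\<close>, meson less_imp_le)
  also have "\<dots> \<subseteq> (\<Union>x\<in>k. ball x d)"
    using d by (auto intro!: UN_mono)
  finally show "\<exists>k. finite k \<and> closure S \<subseteq> (\<Union>x\<in>k. ball x d)"
    using k by blast
qed

section \<open>Spectral theory of trace class operators\<close>

lemma tendsto_null_sandwich: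
  fixes f g :: "nat \<Rightarrow> real"
  assumes "g \<longlonglongrightarrow> 0" "\<And>n. 0 \<le> f n" "\<And>n. f n \<le> g n"
  shows "f \<longlonglongrightarrow> 0"
  by (rule tendsto_sandwich[OF _ _ tendsto_const assms(1)]) (use assms(2,3) in auto)

lemma quadratic_nonneg_discriminant:
  fixes a b c :: real
  assumes "\<And>t. 0 \<le> a + 2 * b * t + c * t\<^sup>2" and "c \<ge> 0"
  shows "b\<^sup>2 \<le> a * c"
proof (cases "c = 0")
  case True
  have "b = 0"
  proof (rule ccontr)
    assume "b \<noteq> 0"
    then show False
      \<comment> \<open>At this argument the affine function takes the value
        \<open>-1\<close>.\<close>
      using assms(1)[of "- (a + 1) / (2 * b)"] True by simp
  qed
  with True show ?thesis by simp
next
  case False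
  then have c: "c > 0" using assms by simp
  have "0 \<le> a - b\<^sup>2 / c"
    using assms(1)[of "- b / c"] c by (simp add: power2_eq_square field_simps)
  with c show ?thesis by (simp add: field_simps)
qed

lemma positive_op_cauchy_schwarz:
  assumes A: "bounded_linear A" "selfadjoint_op A" "positive_op A"
  shows "(A x \<bullet> y)\<^sup>2 \<le> (A x \<bullet> x) * (A y \<bullet> y)"
proof (rule quadratic_nonneg_discriminant)
  interpret A: bounded_linear A by fact
  have "A y \<bullet> x = A x \<bullet> y"
    using A(2) by (metis selfadjoint_op_def inner_commute)
  then have "A (x + t *\<^sub>R y) \<bullet> (x + t *\<^sub>R y) = A x \<bullet> x + 2 * (A x \<bullet> y) * t + (A y \<bullet> y) * t\<^sup>2" for t
    by (simp add: A.add A.scaleR inner_simps power2_eq_square algebra_simps)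
  moreover have "0 \<le> A (x + t *\<^sub>R y) \<bullet> (x + t *\<^sub>R y)" for t
    using A(3) by (simp add: positive_op_def)
  ultimately show "0 \<le> A x \<bullet> x + 2 * (A x \<bullet> y) * t + (A y \<bullet> y) * t\<^sup>2" for t
    by simp
  show "0 \<le> A y \<bullet> y"
    using A(3) by (simp add: positive_op_def)
qed

text \<open>Cauchy-Schwarz for the form \<open>A x \<bullet> y\<close> at \<open>y = A x\<close>,
  with one factor \<open>(norm (A x))\<^sup>2\<close> cancelled. The form is bounded only at
  \<open>A x\<close>, so the bound may come from an invariant subspace.\<close>

lemma positive_op_norm_sq_le:
  assumes A: "bounded_linear A" "selfadjoint_op A" "positive_op A"
    and le: "A (A x) \<bullet> A x \<le> N * (norm (A x))\<^sup>2" and N: "N \<ge> 0"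
  shows "(norm (A x))\<^sup>2 \<le> N * (A x \<bullet> x)"
proof (cases "A x = 0")
  case False
  have "((norm (A x))\<^sup>2)\<^sup>2 = (A x \<bullet> A x)\<^sup>2"
    by (simp add: power2_norm_eq_inner)
  also have "\<dots> \<le> (A x \<bullet> x) * (A (A x) \<bullet> A x)"
    by (rule positive_op_cauchy_schwarz[OF A])
  also have "\<dots> \<le> (A x \<bullet> x) * (N * (norm (A x))\<^sup>2)"
    using A(3) le by (intro mult_left_mono) (auto simp: positive_op_def)
  finally have "(norm (A x))\<^sup>2 * (norm (A x))\<^sup>2 \<le> (N * (A x \<bullet> x)) * (norm (A x))\<^sup>2"
    by (simp add: power2_eq_square mult_ac)
  then show ?thesis
    by (rule mult_right_le_imp_le) (use False in simp)
qed (use N A in \<open>simp add: positive_op_def\<close>)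

text \<open>\<open>N\<close> is the supremum of the form on the unit sphere of \<open>V\<close>. A
  unit vector \<open>x\<close> that almost attains it is almost an eigenvector, because
  \<open>positive_op_norm_sq_le\<close> bounds the squared residual by
  \<open>N * (N - A x \<bullet> x)\<close>. Without compactness nothing converges yet, which is why
  the result is a sequence; it serves both the uniqueness of square roots and the existence of
  eigenvectors.\<close>

lemma positive_op_approx_eigenvector:
  fixes A :: "'h::real_inner \<Rightarrow> 'h"
  assumes A: "bounded_linear A" "selfadjoint_op A" "positive_op A"
    and V: "subspace V" "\<And>x. x \<in> V \<Longrightarrow> A x \<in> V" and v: "v \<in> V" "v \<noteq> 0"
  obtains N x where "N \<ge> 0" "\<And>n. x n \<in> V" "\<And>n. norm (x n) = 1"
    "(\<lambda>n::nat. A (x n) - N *\<^sub>R x n) \<longlonglongrightarrow> 0"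
    "\<And>y. y \<in> V \<Longrightarrow> A y \<bullet> y \<le> N * (norm y)\<^sup>2"
proof -
  interpret A: bounded_linear A by fact
  obtain K where K: "\<And>x. norm (A x) \<le> norm x * K"
    using A.bounded by blast
  define S where "S = (\<lambda>x. A x \<bullet> x) ` {x \<in> V. norm x = 1}"
  have bdd: "bdd_above S"
  proof (rule bdd_aboveI)
    fix s assume "s \<in> S"
    then obtain x where "norm x = 1" "s = A x \<bullet> x" by (auto simp: S_def)
    then show "s \<le> K"
      using norm_cauchy_schwarz[of "A x" x] K[of x] by simp
  qed
  have unit: "(1 / norm y) *\<^sub>R y \<in> {x \<in> V. norm x = 1}" if "y \<in> V" "y \<noteq> 0" for y
    using that V(1) by (auto simp: subspace_scale)
  have ne: "S \<noteq> {}"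
    using unit[OF v] by (auto simp: S_def)
  define N where "N = Sup S"
  have upper: "A y \<bullet> y \<le> N * (norm y)\<^sup>2" if y: "y \<in> V" for y
  proof (cases "y = 0")
    case False
    have "A ((1 / norm y) *\<^sub>R y) \<bullet> ((1 / norm y) *\<^sub>R y) \<in> S"
      unfolding S_def using unit[OF y False] by (rule imageI)
    then have "A ((1 / norm y) *\<^sub>R y) \<bullet> ((1 / norm y) *\<^sub>R y) \<le> N"
      unfolding N_def by (rule cSup_upper[OF _ bdd])
    with False show ?thesis
      by (simp add: A.scaleR field_simps power2_eq_square)
  qed (simp add: A.zero)
  have N: "N \<ge> 0"
  proof -
    have "0 \<le> A v \<bullet> v" using A(3) by (simp add: positive_op_def)
    also have "\<dots> \<le> N * (norm v)\<^sup>2" by (rule upper[OF v(1)])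
    finally show ?thesis using v(2) by (simp add: zero_le_mult_iff)
  qed
  have "\<exists>x\<in>{x \<in> V. norm x = 1}. N - 1 / real (Suc n) < A x \<bullet> x" for n
  proof -
    have "N - 1 / real (Suc n) < Sup S" by (simp add: N_def)
    then show ?thesis
      unfolding less_cSup_iff[OF ne bdd] by (auto simp: S_def)
  qed
  then have "\<forall>n. \<exists>x. x \<in> V \<and> norm x = 1 \<and> N - 1 / real (Suc n) < A x \<bullet> x"
    by blast
  then obtain x where "\<forall>n. x n \<in> V \<and> norm (x n) = 1 \<and> N - 1 / real (Suc n) < A (x n) \<bullet> x n"
    unfolding choice_iff by blast
  then have x: "\<And>n. x n \<in> V" "\<And>n. norm (x n) = 1"
      "\<And>n. N - 1 / real (Suc n) < A (x n) \<bullet> x n"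
    by blast+
  have "(\<lambda>n. (norm (A (x n) - N *\<^sub>R x n))\<^sup>2) \<longlonglongrightarrow> 0"
  proof (rule tendsto_sandwich[OF _ _ tendsto_const])
    have "(norm (A (x n) - N *\<^sub>R x n))\<^sup>2 \<le> N * (1 / real (Suc n))" for n
    proof -
      have "(norm (A (x n) - N *\<^sub>R x n))\<^sup>2 = (norm (A (x n)))\<^sup>2 - 2 * N * (A (x n) \<bullet> x n) + N * N * (norm (x n))\<^sup>2"
        by (simp add: power2_norm_eq_inner inner_simps inner_commute algebra_simps)
      also have "\<dots> \<le> N * (A (x n) \<bullet> x n) - 2 * N * (A (x n) \<bullet> x n) + N * N"
        using positive_op_norm_sq_le[OF A upper N, of "x n"] V(2)[OF x(1)] x(2) by simp
      also have "\<dots> = N * (N - A (x n) \<bullet> x n)"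
        by (simp add: algebra_simps)
      also have "\<dots> \<le> N * (1 / real (Suc n))"
        using x(3)[of n] N by (intro mult_left_mono) auto
      finally show ?thesis .
    qed
    then show "\<forall>\<^sub>F n in sequentially. (norm (A (x n) - N *\<^sub>R x n))\<^sup>2 \<le> N * (1 / real (Suc n))"
      by simp
    show "(\<lambda>n. N * (1 / real (Suc n))) \<longlonglongrightarrow> 0"
      using tendsto_mult[OF tendsto_const[of N] LIMSEQ_inverse_real_of_nat] by (simp add: inverse_eq_divide)
  qed simp
  then have "(\<lambda>n. sqrt ((norm (A (x n) - N *\<^sub>R x n))\<^sup>2)) \<longlonglongrightarrow> sqrt 0"
    by (rule tendsto_real_sqrt)
  then have "(\<lambda>n. A (x n) - N *\<^sub>R x n) \<longlonglongrightarrow> 0"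
    by (simp add: tendsto_norm_zero_iff)
  with N x upper show thesis
    by (intro that[of N x]) auto
qed

text \<open>\<open>S\<close> and \<open>T\<close> are not known to commute. With
  \<open>D = S - T\<close> the hypothesis gives \<open>S (D x) = - D (T x)\<close> and
  \<open>T (D x) = - D (S x)\<close>, so the products of \<open>S x\<close> and of
  \<open>T x\<close> with \<open>D (D x)\<close> are at most 0. If \<open>D\<close> is nonzero,
  \<open>D (D x)\<close> has approximate eigenvectors \<open>x n\<close> for some
  \<open>m > 0\<close>; along them \<open>S (x n)\<close> and \<open>T (x n)\<close> tend to 0,
  hence so does \<open>D (x n)\<close>, which contradicts \<open>m > 0\<close>.\<close>

lemma positive_sqrt_unique:
  fixes S T :: "'h::real_inner \<Rightarrow> 'h"
  assumes S: "bounded_linear S" "selfadjoint_op S" "positive_op S"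
    and T: "bounded_linear T" "selfadjoint_op T" "positive_op T"
    and eq: "S \<circ> S = T \<circ> T"
  shows "S = T"
proof (rule ccontr)
  assume "S \<noteq> T"
  then obtain v where v: "S v \<noteq> T v" by blast
  interpret S: bounded_linear S by fact
  interpret T: bounded_linear T by fact
  define D where "D x = S x - T x" for x
  have SST: "S (S x) = T (T x)" for x
    using eq by (metis comp_apply)
  interpret D: bounded_linear D
    unfolding D_def by (intro bounded_linear_sub S T)
  have Dsa: "D x \<bullet> y = x \<bullet> D y" for x y
    using S(2) T(2) by (simp add: D_def inner_simps selfadjoint_op_def)
  have SD: "S (D x) = - D (T x)" and TD: "T (D x) = - D (S x)" for x
    by (simp_all add: D_def S.diff T.diff SST)
  have D2: "bounded_linear (\<lambda>x. D (D x))" "selfadjoint_op (\<lambda>x. D (D x))" "positive_op (\<lambda>x. D (D x))"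
  proof -
    show "bounded_linear (\<lambda>x. D (D x))"
      by (rule bounded_linear_compose[OF D.bounded_linear_axioms D.bounded_linear_axioms])
    show "selfadjoint_op (\<lambda>x. D (D x))"
      by (simp add: selfadjoint_op_def Dsa)
    have "D (D x) \<bullet> x = D x \<bullet> D x" for x by (rule Dsa)
    then show "positive_op (\<lambda>x. D (D x))"
      by (simp add: positive_op_def)
  qed
  have "v \<noteq> 0" using v by (auto simp: S.zero T.zero)
  then obtain m x where m: "m \<ge> 0" and x: "\<And>n::nat. norm (x n) = 1"
    and lim: "(\<lambda>n. D (D (x n)) - m *\<^sub>R x n) \<longlonglongrightarrow> 0"
    and le: "\<And>y. D (D y) \<bullet> y \<le> m * (norm y)\<^sup>2"
    using positive_op_approx_eigenvector[OF D2, of UNIV v] by auto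
  have "m \<noteq> 0"
  proof
    assume "m = 0"
    then have "D v \<bullet> D v \<le> 0"
      using le[of v] by (simp add: Dsa)
    then have "D v = 0"
      by (metis inner_gt_zero_iff not_less)
    with v show False by (simp add: D_def)
  qed
  with m have m: "m > 0" by simp
  define r where "r n = norm (D (D (x n)) - m *\<^sub>R x n)" for n
  have r: "r \<longlonglongrightarrow> 0"
    using tendsto_norm[OF lim] by (simp add: r_def[abs_def])
  \<comment> \<open>Replacing \<open>m *\<^sub>R x n\<close> by \<open>D (D (x n))\<close> up to the
    error \<open>r n\<close> bounds \<open>m * (A (x n) \<bullet> x n)\<close> by
    \<open>K * r n\<close>, and for a positive operator a small form value means a small
    image.\<close>
  have small: "(\<lambda>n. A (x n)) \<longlonglongrightarrow> 0"
    if A: "bounded_linear A" "selfadjoint_op A" "positive_op A"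
      and neg: "\<And>x. A x \<bullet> D (D x) \<le> 0" for A
  proof -
    interpret A: bounded_linear A by fact
    obtain K where K: "K > 0" "\<And>x. norm (A x) \<le> norm x * K"
      using A.pos_bounded by blast
    have "A y \<bullet> y \<le> K * (norm y)\<^sup>2" for y
      using norm_cauchy_schwarz[of "A y" y] mult_right_mono[OF K(2)[of y], of "norm y"]
      by (simp add: power2_eq_square mult_ac)
    then have sq: "(norm (A y))\<^sup>2 \<le> K * (A y \<bullet> y)" for y
      using K(1) by (intro positive_op_norm_sq_le[OF A]) auto
    have le: "(norm (A (x n)))\<^sup>2 \<le> K * (K * r n / m)" for n
    proof -
      have "m * (A (x n) \<bullet> x n) = A (x n) \<bullet> D (D (x n)) - A (x n) \<bullet> (D (D (x n)) - m *\<^sub>R x n)"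
        by (simp add: inner_simps)
      also have "\<dots> \<le> norm (A (x n)) * r n"
        using neg[of "x n"] Cauchy_Schwarz_ineq2[of "A (x n)" "D (D (x n)) - m *\<^sub>R x n"]
        by (simp add: r_def)
      also have "\<dots> \<le> K * r n"
        using K(2)[of "x n"] x[of n] by (intro mult_right_mono) (auto simp: r_def)
      finally have "A (x n) \<bullet> x n \<le> K * r n / m"
        using m by (simp add: field_simps)
      with sq[of "x n"] K(1) show ?thesis
        by (meson less_imp_le mult_left_mono order_trans)
    qed
    have "(\<lambda>n. K * (K * r n / m)) \<longlonglongrightarrow> 0"
      using r m by (auto intro!: tendsto_eq_intros)
    from tendsto_null_sandwich[OF this zero_le_power2 le]
    have "(\<lambda>n. (norm (A (x n)))\<^sup>2) \<longlonglongrightarrow> 0" .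
    then have "(\<lambda>n. sqrt ((norm (A (x n)))\<^sup>2)) \<longlonglongrightarrow> sqrt 0"
      by (rule tendsto_real_sqrt)
    then show ?thesis
      by (simp add: tendsto_norm_zero_iff)
  qed
  have "T x \<bullet> D (D x) \<le> 0" for x
  proof -
    have "0 \<le> S (D x) \<bullet> D x" using S(3) by (simp add: positive_op_def)
    also have "\<dots> = - (T x \<bullet> D (D x))" by (simp add: SD Dsa)
    finally show ?thesis by simp
  qed
  from small[OF T this] have Tx: "(\<lambda>n. T (x n)) \<longlonglongrightarrow> 0" .
  have "S x \<bullet> D (D x) \<le> 0" for x
  proof -
    have "0 \<le> T (D x) \<bullet> D x" using T(3) by (simp add: positive_op_def)
    also have "\<dots> = - (S x \<bullet> D (D x))" by (simp add: TD Dsa)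
    finally show ?thesis by simp
  qed
  from small[OF S this] have Sx: "(\<lambda>n. S (x n)) \<longlonglongrightarrow> 0" .
  have "(\<lambda>n. D (x n)) \<longlonglongrightarrow> 0"
    unfolding D_def using tendsto_diff[OF Sx Tx] by simp
  from D.tendsto[OF this] have "(\<lambda>n. D (D (x n))) \<longlonglongrightarrow> 0"
    by (simp add: D.zero)
  from tendsto_diff[OF this lim] have "(\<lambda>n. m *\<^sub>R x n) \<longlonglongrightarrow> 0"
    by simp
  from tendsto_norm[OF this] have "(\<lambda>n. m) \<longlonglongrightarrow> 0"
    using m x by simp
  then have "m = 0"
    by (simp only: LIMSEQ_const_iff)
  with m show False
    by simp
qed

lemma op_sqrt_unique:
  assumes "bounded_linear R" "selfadjoint_op R" "positive_op R" "R \<circ> R = T"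
  shows "op_sqrt T = R"
  unfolding op_sqrt_def
  by (rule the_equality) (use assms positive_sqrt_unique in blast)+

text \<open>This makes the abstract trace condition a condition on the diagonal of the operator
  itself.\<close>

lemma op_abs_positive:
  assumes "bounded_linear T" "selfadjoint_op T" "positive_op T"
  shows "op_abs T = T"
proof -
  have "adjoint T = T"
    using assms(2) by (intro adjoint_unique) (simp add: selfadjoint_op_def)
  then show ?thesis
    unfolding op_abs_def by (intro op_sqrt_unique assms) simp
qed

text \<open>For \<open>norm y \<le> 1\<close> the squared coordinate
  \<open>(Q y \<bullet> e)\<^sup>2\<close> is at most \<open>K * (Q e \<bullet> e)\<close>, a
  summable bound independent of \<open>y\<close>. Hence finite projections approximate the image of
  the ball uniformly, in whatever basis the trace is given.\<close>

lemma positive_trace_compact: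
  fixes Q :: "'h::{real_inner,banach} \<Rightarrow> 'h"
  assumes Q: "bounded_linear Q" "selfadjoint_op Q" "positive_op Q"
    and B: "hilbert_basis B" and tr: "(\<lambda>e. Q e \<bullet> e) summable_on B"
  shows "compact (closure (Q ` cball 0 1))"
proof (rule compact_closure_totally_bounded)
  interpret Q: bounded_linear Q by fact
  note on = hilbert_basis_orthonormal[OF B]
  obtain K where K: "K > 0" "\<And>x. norm (Q x) \<le> norm x * K"
    using Q.pos_bounded by blast
  have "Q y \<bullet> y \<le> K * (norm y)\<^sup>2" for y
    using norm_cauchy_schwarz[of "Q y" y] mult_right_mono[OF K(2)[of y], of "norm y"]
    by (simp add: power2_eq_square mult_ac)
  then have sq: "(norm (Q y))\<^sup>2 \<le> K * (Q y \<bullet> y)" for y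
    using K(1) by (intro positive_op_norm_sq_le[OF Q]) auto
  fix d :: real assume d: "d > 0"
  then show "\<exists>k. finite k \<and> Q ` cball 0 1 \<subseteq> (\<Union>x\<in>k. ball x d)"
  proof (rule totally_bounded_oproj[OF on, of _ K, rotated 2])
    fix x assume "x \<in> Q ` cball 0 1"
    then obtain y where y: "norm y \<le> 1" "x = Q y" by auto
    then show "norm x \<le> K"
      using order_trans[OF K(2)[of y] mult_right_mono[OF y(1), of K]] K(1) by (simp add: y(2))
  next
    fix d :: real assume d: "d > 0"
    have "\<And>e. e \<in> B \<Longrightarrow> 0 \<le> Q e \<bullet> e"
      using Q(3) by (simp add: positive_op_def)
    then obtain J where J: "finite J" "J \<subseteq> B"
        "\<And>G. finite G \<Longrightarrow> G \<subseteq> B - J \<Longrightarrow> (\<Sum>e\<in>G. Q e \<bullet> e) < (d / 2)\<^sup>2 / K"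
      by (rule summable_on_tail[OF tr, of "(d / 2)\<^sup>2 / K"]) (use d K(1) in auto)
    have "norm (Q y - oproj J (Q y)) < d" if y: "norm y \<le> 1" for y
    proof -
      have "(norm (Q y - oproj J (Q y)))\<^sup>2 \<le> (d / 2)\<^sup>2"
      proof (rule norm_diff_oproj_le[OF B J(1,2)])
        fix G assume G: "finite G" "G \<subseteq> B - J"
        have "(\<Sum>e\<in>G. (Q y \<bullet> e)\<^sup>2) \<le> (\<Sum>e\<in>G. K * (Q e \<bullet> e))"
        proof (rule sum_mono)
          fix e assume "e \<in> G"
          have "(Q y \<bullet> e)\<^sup>2 = (y \<bullet> Q e)\<^sup>2"
            using Q(2) by (simp add: selfadjoint_op_def)
          also have "\<dots> \<le> (norm y * norm (Q e))\<^sup>2"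
            using Cauchy_Schwarz_ineq2[of y "Q e"] by (intro power2_le_iff_abs_le[THEN iffD2]) auto
          also have "\<dots> \<le> (norm (Q e))\<^sup>2"
            using y by (intro power_mono mult_left_le_one_le) auto
          also have "\<dots> \<le> K * (Q e \<bullet> e)" by (rule sq)
          finally show "(Q y \<bullet> e)\<^sup>2 \<le> K * (Q e \<bullet> e)" .
        qed
        also have "\<dots> = K * (\<Sum>e\<in>G. Q e \<bullet> e)"
          by (simp add: sum_distrib_left)
        also have "\<dots> \<le> K * ((d / 2)\<^sup>2 / K)"
          using J(3)[OF G] K(1) by (intro mult_left_mono) auto
        also have "\<dots> = (d / 2)\<^sup>2" using K(1) by simp
        finally show "(\<Sum>e\<in>G. (Q y \<bullet> e)\<^sup>2) \<le> (d / 2)\<^sup>2" .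
      qed
      then have "norm (Q y - oproj J (Q y)) \<le> d / 2"
        by (rule power2_le_imp_le) (use d in simp)
      with d show ?thesis by simp
    qed
    with J(1,2) show "\<exists>J. finite J \<and> J \<subseteq> B \<and> (\<forall>x\<in>Q ` cball 0 1. norm (x - oproj J x) < d)"
      by auto
  qed
qed

text \<open>If \<open>N = 0\<close>, the operator vanishes on \<open>V\<close> and any unit vector
  will do. Otherwise a subsequence of \<open>Q (x n)\<close> converges by compactness, and then so
  does \<open>x n\<close>, which differs from it by a factor \<open>N\<close> and a null
  sequence.\<close>

lemma positive_compact_eigenvector:
  fixes Q :: "'h::real_inner \<Rightarrow> 'h"
  assumes Q: "bounded_linear Q" "selfadjoint_op Q" "positive_op Q"
    and cpt: "compact (closure (Q ` cball 0 1))"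
    and V: "subspace V" "closed V" "\<And>x. x \<in> V \<Longrightarrow> Q x \<in> V" and v: "v \<in> V" "v \<noteq> 0"
  obtains x l where "x \<in> V" "norm x = 1" "Q x = l *\<^sub>R x"
proof -
  interpret Q: bounded_linear Q by fact
  obtain N x where N: "N \<ge> 0" and x: "\<And>n. x n \<in> V" "\<And>n. norm (x n) = 1"
    and lim: "(\<lambda>n::nat. Q (x n) - N *\<^sub>R x n) \<longlonglongrightarrow> 0"
    and le: "\<And>y. y \<in> V \<Longrightarrow> Q y \<bullet> y \<le> N * (norm y)\<^sup>2"
    using positive_op_approx_eigenvector[OF Q V(1,3) v] by blast
  show thesis
  proof (cases "N = 0")
    case True
    have "(norm (Q v))\<^sup>2 \<le> 0 * (Q v \<bullet> v)"
      using le[OF V(3)[OF v(1)]] True by (intro positive_op_norm_sq_le[OF Q]) auto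
    then have "Q v = 0" by simp
    then have "Q ((1 / norm v) *\<^sub>R v) = 0 *\<^sub>R ((1 / norm v) *\<^sub>R v)"
      by (simp only: Q.scaleR scaleR_zero_right scaleR_zero_left)
    moreover have "(1 / norm v) *\<^sub>R v \<in> V" "norm ((1 / norm v) *\<^sub>R v) = 1"
      using v V(1) by (auto simp: subspace_scale)
    ultimately show thesis by (intro that)
  next
    case False
    have "\<forall>n. Q (x n) \<in> closure (Q ` cball 0 1)"
      using x(2) by (auto intro!: closure_subset[THEN subsetD])
    then obtain y and r :: "nat \<Rightarrow> nat" where "strict_mono r" "((\<lambda>n. Q (x n)) \<circ> r) \<longlonglongrightarrow> y"
      using cpt[unfolded compact_def, rule_format, of "\<lambda>n. Q (x n)"] by blast
    then have r: "strict_mono r" "(\<lambda>n. Q (x (r n))) \<longlonglongrightarrow> y"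
      by (simp_all add: o_def)
    have "(\<lambda>n. Q (x (r n)) - N *\<^sub>R x (r n)) \<longlonglongrightarrow> 0"
      using LIMSEQ_subseq_LIMSEQ[OF lim r(1)] by (simp add: o_def)
    from tendsto_diff[OF r(2) this] have "(\<lambda>n. N *\<^sub>R x (r n)) \<longlonglongrightarrow> y"
      by simp
    from tendsto_scaleR[OF tendsto_const[of "1 / N"] this]
    have xr: "(\<lambda>n. x (r n)) \<longlonglongrightarrow> (1 / N) *\<^sub>R y"
      using False by simp
    define z where "z = (1 / N) *\<^sub>R y"
    have "z \<in> V"
      unfolding z_def using V(2) _ xr by (rule closed_sequentially) (rule x(1))
    moreover have "norm z = 1"
    proof -
      have "(\<lambda>n. 1) \<longlonglongrightarrow> norm z"
        using tendsto_norm[OF xr] x(2) by (simp add: z_def)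
      then show ?thesis by (simp only: LIMSEQ_const_iff)
    qed
    moreover have "Q z = N *\<^sub>R z"
      using LIMSEQ_unique[OF Q.tendsto[OF xr] r(2)] False by (simp add: z_def)
    ultimately show thesis by (intro that)
  qed
qed

text \<open>The Fourier series \<open>z\<close> of \<open>x\<close> converges by
  \<open>riesz_fischer\<close>, and \<open>x - z\<close> is orthogonal to \<open>E\<close>, hence
  zero.\<close>

lemma maximal_orthonormal_basis:
  fixes E :: "'h::{real_inner,banach} set"
  assumes E: "orthonormal E" and max: "\<And>y. (\<forall>e\<in>E. y \<bullet> e = 0) \<Longrightarrow> y = 0"
  shows "hilbert_basis E"
proof -
  have "x \<in> closure (span E)" for x
  proof -
    have s: "(\<lambda>e. (x \<bullet> e) *\<^sub>R e) summable_on E"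
      by (rule riesz_fischer[OF E bessel_summable[OF E]])
    define z where "z = (\<Sum>\<^sub>\<infinity>e\<in>E. (x \<bullet> e) *\<^sub>R e)"
    have z: "((\<lambda>e. (x \<bullet> e) *\<^sub>R e) has_sum z) E"
      unfolding z_def using s by (rule has_sum_infsum)
    have "z \<bullet> a = x \<bullet> a" if a: "a \<in> E" for a
    proof -
      have "((\<lambda>e. ((x \<bullet> e) *\<^sub>R e) \<bullet> a) has_sum (z \<bullet> a)) E"
        by (rule has_sum_bounded_linear[OF bounded_linear_inner_left z])
      moreover have "((\<lambda>e. ((x \<bullet> e) *\<^sub>R e) \<bullet> a) has_sum (x \<bullet> a)) E"
        by (subst has_sum_cong_neutral[where T="{a}" and g="\<lambda>e. x \<bullet> e"])
          (use a orthonormal_inner[OF E] in \<open>auto intro!: has_sum_finiteI\<close>)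
      ultimately show ?thesis by (rule has_sum_unique)
    qed
    then have "x = z"
      using max[of "x - z"] by (simp add: inner_diff_left)
    moreover have "z \<in> closure (span E)"
    proof (rule Lim_in_closed_set[OF closed_closure _ _ z[unfolded has_sum_def]])
      show "\<forall>\<^sub>F F in finite_subsets_at_top E. (\<Sum>e\<in>F. (x \<bullet> e) *\<^sub>R e) \<in> closure (span E)"
      proof (rule eventually_finite_subsets_at_top_weakI)
        fix F assume "finite F" "F \<subseteq> E"
        then have "(\<Sum>e\<in>F. (x \<bullet> e) *\<^sub>R e) \<in> span E"
          by (intro span_sum span_scale span_base) auto
        then show "(\<Sum>e\<in>F. (x \<bullet> e) *\<^sub>R e) \<in> closure (span E)"
          using closure_subset by blast
      qed
    qed simp
    ultimately show ?thesis by (simp only:)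
  qed
  then have "closure (span E) = UNIV" by (rule UNIV_eq_I[symmetric])
  with E show ?thesis
    by (simp add: hilbert_basis_def orthonormal_def)
qed

text \<open>Zorn's lemma gives a maximal orthonormal set of eigenvectors. Its orthogonal complement
  is closed and, by self-adjointness, invariant; were it nonzero, an eigenvector inside it would
  enlarge the set.\<close>

lemma eigenbasis_exists:
  fixes Q :: "'h::{real_inner,banach} \<Rightarrow> 'h"
  assumes Q: "bounded_linear Q" "selfadjoint_op Q" "positive_op Q"
    and cpt: "compact (closure (Q ` cball 0 1))"
  obtains E l where "hilbert_basis E" "\<And>e. e \<in> E \<Longrightarrow> Q e = l e *\<^sub>R e"
proof -
  interpret Q: bounded_linear Q by fact
  define A where "A = {E. orthonormal E \<and> (\<forall>e\<in>E. \<exists>l. Q e = l *\<^sub>R e)}"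
  have "\<exists>E\<in>A. \<forall>X\<in>A. E \<subseteq> X \<longrightarrow> X = E"
  proof (rule subset_Zorn')
    fix C assume C: "subset.chain A C"
    then have CA: "\<And>X. X \<in> C \<Longrightarrow> X \<in> A" and tot: "\<And>X Y. X \<in> C \<Longrightarrow> Y \<in> C \<Longrightarrow> X \<subseteq> Y \<or> Y \<subseteq> X"
      by (auto simp: subset.chain_def)
    have "orthogonal x y" if xy: "x \<in> \<Union> C" "y \<in> \<Union> C" "x \<noteq> y" for x y
    proof -
      obtain X Y where "X \<in> C" "Y \<in> C" "x \<in> X" "y \<in> Y" using xy by blast
      then obtain Z where "Z \<in> C" "x \<in> Z" "y \<in> Z" using tot by blast
      then show ?thesis
        using CA[of Z] xy(3) by (auto simp: A_def orthonormal_def pairwise_def)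
    qed
    moreover have "norm e = 1 \<and> (\<exists>l. Q e = l *\<^sub>R e)" if "e \<in> \<Union> C" for e
      using that CA by (auto simp: A_def orthonormal_def)
    ultimately show "\<Union> C \<in> A"
      by (auto simp: A_def orthonormal_def pairwise_def)
  qed
  then obtain E where E: "E \<in> A" and max: "\<And>X. X \<in> A \<Longrightarrow> E \<subseteq> X \<Longrightarrow> X = E" by blast
  have on: "orthonormal E" using E by (simp add: A_def)
  have "\<forall>e\<in>E. \<exists>l. Q e = l *\<^sub>R e"
    using E by (simp add: A_def)
  then obtain l where "\<forall>e\<in>E. Q e = l e *\<^sub>R e"
    unfolding bchoice_iff by blast
  then have l: "\<And>e. e \<in> E \<Longrightarrow> Q e = l e *\<^sub>R e" by blast
  define V where "V = {y. \<forall>e\<in>E. y \<bullet> e = 0}"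
  have V: "subspace V" "closed V"
  proof -
    show "subspace V" by (auto simp: V_def subspace_def inner_simps)
    have "V = (\<Inter>e\<in>E. {y. y \<bullet> e = 0})" by (auto simp: V_def)
    then show "closed V"
      by (auto intro!: closed_INT closed_Collect_eq continuous_intros)
  qed
  have QV: "Q x \<in> V" if "x \<in> V" for x
  proof -
    have "Q x \<bullet> e = 0" if e: "e \<in> E" for e
    proof -
      have "Q x \<bullet> e = x \<bullet> Q e" using Q(2) by (simp add: selfadjoint_op_def)
      also have "\<dots> = 0" using \<open>x \<in> V\<close> e by (simp add: l V_def)
      finally show ?thesis .
    qed
    then show ?thesis by (simp add: V_def)
  qed
  have "y = 0" if y: "\<forall>e\<in>E. y \<bullet> e = 0" for y
  proof (rule ccontr)
    assume "y \<noteq> 0"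
    moreover have "y \<in> V" using y by (simp add: V_def)
    ultimately obtain x m where x: "x \<in> V" "norm x = 1" "Q x = m *\<^sub>R x"
      using positive_compact_eigenvector[OF Q cpt V QV] by blast
    have "insert x E \<in> A"
      using x E unfolding A_def V_def orthonormal_def
      by (auto simp: pairwise_insert orthogonal_def inner_commute)
    then have "x \<in> E" using max[of "insert x E"] by blast
    then have "x \<bullet> x = 0" using x(1) by (auto simp: V_def)
    with x(2) show False by simp
  qed
  then have "hilbert_basis E"
    by (rule maximal_orthonormal_basis[OF on])
  with l show thesis by (intro that)
qed

text \<open>Distinct members have distance \<open>sqrt 2\<close>, so the balls of radius
  \<open>1 / 2\<close> around them are disjoint, and a second countable space has only countably
  many disjoint open sets. Countability lets null sets be collected over the basis.\<close>

lemma orthonormal_countable: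
  fixes E :: "'h::{real_inner,second_countable_topology} set"
  assumes E: "orthonormal E"
  shows "countable E"
proof -
  have d: "dist a b > 1" if "a \<in> E" "b \<in> E" "a \<noteq> b" for a b
  proof -
    have "(dist a b)\<^sup>2 = 2"
      using that orthonormal_inner[OF E, of a a] orthonormal_inner[OF E, of a b] orthonormal_inner[OF E, of b b]
        orthonormal_inner[OF E, of b a]
      by (simp add: dist_norm power2_norm_eq_inner inner_simps)
    then have "1\<^sup>2 < (dist a b)\<^sup>2" by simp
    then show ?thesis by (rule power2_less_imp_less) simp
  qed
  have inj: "inj_on (\<lambda>e. ball e (1 / 2 :: real)) E"
  proof (rule inj_onI, rule ccontr)
    fix a b assume ab: "a \<in> E" "b \<in> E" "ball a (1 / 2) = ball b (1 / 2 :: real)" "a \<noteq> b"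
    have "b \<in> ball a (1 / 2)" unfolding ab(3) by simp
    with d[OF ab(1,2,4)] show False by simp
  qed
  have "countable ((\<lambda>e. ball e (1 / 2 :: real)) ` E)"
  proof (rule countable_disjoint_open_subsets)
    show "disjoint ((\<lambda>e. ball e (1 / 2 :: real)) ` E)"
    proof (rule pairwiseI)
      fix X Y assume "X \<in> (\<lambda>e. ball e (1 / 2 :: real)) ` E" "Y \<in> (\<lambda>e. ball e (1 / 2 :: real)) ` E" "X \<noteq> Y"
      then obtain a b where ab: "a \<in> E" "b \<in> E" "X = ball a (1 / 2)" "Y = ball b (1 / 2)" by blast
      with \<open>X \<noteq> Y\<close> have "a \<noteq> b" by auto
      show "disjnt X Y"
        unfolding disjnt_iff ab(3,4)
      proof (intro allI notI)
        fix x assume "x \<in> ball a (1 / 2) \<and> x \<in> ball b (1 / 2)"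
        then show False
          using d[OF ab(1,2) \<open>a \<noteq> b\<close>] dist_triangle2[of a b x] by simp
      qed
    qed
  qed auto
  then show ?thesis
    using inj by (rule countable_image_inj_on)
qed

text \<open>The square root and the pseudo-inverse are both built by prescribing
  coordinates.\<close>

lemma hilbert_basis_coords:
  fixes E :: "'h::{real_inner,banach} set"
  assumes E: "hilbert_basis E" and c: "(\<lambda>e. (c e)\<^sup>2) summable_on E"
  shows "\<exists>z. \<forall>e\<in>E. z \<bullet> e = c e"
proof (intro exI ballI)
  note on = hilbert_basis_orthonormal[OF E]
  fix a assume a: "a \<in> E"
  have z: "((\<lambda>e. c e *\<^sub>R e) has_sum (\<Sum>\<^sub>\<infinity>e\<in>E. c e *\<^sub>R e)) E"
    using riesz_fischer[OF on c] by (rule has_sum_infsum)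
  have "((\<lambda>e. (c e *\<^sub>R e) \<bullet> a) has_sum ((\<Sum>\<^sub>\<infinity>e\<in>E. c e *\<^sub>R e) \<bullet> a)) E"
    by (rule has_sum_bounded_linear[OF bounded_linear_inner_left z])
  moreover have "((\<lambda>e. (c e *\<^sub>R e) \<bullet> a) has_sum (c a)) E"
    by (subst has_sum_cong_neutral[where T="{a}" and g="\<lambda>e. c e"])
      (use a orthonormal_inner[OF on] in \<open>auto intro!: has_sum_finiteI\<close>)
  ultimately show "(\<Sum>\<^sub>\<infinity>e\<in>E. c e *\<^sub>R e) \<bullet> a = c a"
    by (rule has_sum_unique)
qed

lemma has_sum_finite_sum:
  fixes f :: "'a \<Rightarrow> 'b \<Rightarrow> real"
  assumes "finite J" "\<And>e. (f e has_sum s e) A"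
  shows "((\<lambda>x. \<Sum>e\<in>J. f e x) has_sum (\<Sum>e\<in>J. s e)) A"
  using assms(1) by induction (auto intro!: has_sum_add assms(2))

section \<open>Eigenbasis, square root and pseudo-inverse of the covariance\<close>

locale trace_operator =
  fixes Q :: "'h::{real_inner,banach,polish_space} \<Rightarrow> 'h"
  assumes Q_pos: "positive_op Q" and Q_sa: "selfadjoint_op Q" and Q_tc: "trace_class Q"
begin

lemma bounded_linear_Q: "bounded_linear Q"
  using Q_tc by (simp add: trace_class_def)

lemma trace_summable: "\<exists>B. hilbert_basis B \<and> (\<lambda>e. Q e \<bullet> e) summable_on B"
  using Q_tc op_abs_positive[OF bounded_linear_Q Q_sa Q_pos] by (simp add: trace_class_def)

text \<open>Writing the eigenvalue as \<open>Q e \<bullet> e\<close> makes it a function of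
  \<open>e\<close>, so only the basis has to be chosen.\<close>

definition E :: "'h set" where
  "E = (SOME E. hilbert_basis E \<and> (\<forall>e\<in>E. Q e = (Q e \<bullet> e) *\<^sub>R e))"

definition lam :: "'h \<Rightarrow> real" where "lam e = Q e \<bullet> e"

lemma E_props: "hilbert_basis E \<and> (\<forall>e\<in>E. Q e = (Q e \<bullet> e) *\<^sub>R e)"
  unfolding E_def
proof (rule someI_ex)
  obtain B where "hilbert_basis B" "(\<lambda>e. Q e \<bullet> e) summable_on B"
    using trace_summable by blast
  from positive_trace_compact[OF bounded_linear_Q Q_sa Q_pos this]
  obtain E l where E: "hilbert_basis E" "\<And>e. e \<in> E \<Longrightarrow> Q e = l e *\<^sub>R e"
    using eigenbasis_exists[OF bounded_linear_Q Q_sa Q_pos] by blast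
  have "Q e = (Q e \<bullet> e) *\<^sub>R e" if "e \<in> E" for e
    using orthonormal_inner[OF hilbert_basis_orthonormal[OF E(1)] that that] E(2)[OF that] by simp
  with E(1) show "\<exists>E. hilbert_basis E \<and> (\<forall>e\<in>E. Q e = (Q e \<bullet> e) *\<^sub>R e)" by blast
qed

lemma E_basis: "hilbert_basis E" and Q_eigen: "e \<in> E \<Longrightarrow> Q e = lam e *\<^sub>R e"
  using E_props by (auto simp: lam_def)

lemmas E_orthonormal = hilbert_basis_orthonormal[OF E_basis]

lemma E_inner: "a \<in> E \<Longrightarrow> b \<in> E \<Longrightarrow> a \<bullet> b = (if a = b then 1 else 0)"
  by (rule orthonormal_inner[OF E_orthonormal])

lemma E_norm: "e \<in> E \<Longrightarrow> norm e = 1"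
  using E_orthonormal by (simp add: orthonormal_def)

lemma countable_E: "countable E"
  by (rule orthonormal_countable[OF E_orthonormal])

lemma lam_nonneg: "0 \<le> lam e"
  using Q_pos by (simp add: lam_def positive_op_def)

lemma Q_inner: "e \<in> E \<Longrightarrow> Q x \<bullet> e = lam e * (x \<bullet> e)"
  using Q_sa Q_eigen[of e] by (simp add: selfadjoint_op_def)

lemma lam_bounded: "\<exists>K. \<forall>e\<in>E. lam e \<le> K"
proof -
  obtain K where "\<And>x. norm (Q x) \<le> norm x * K"
    using bounded_linear.bounded[OF bounded_linear_Q] by blast
  then have "lam e \<le> K" if "e \<in> E" for e
    using norm_cauchy_schwarz[of "Q e" e] E_norm[OF that] unfolding lam_def
    by (metis mult.left_neutral mult.right_neutral order_trans)
  then show ?thesis by blast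
qed

lemma R_exists: "\<exists>z. \<forall>e\<in>E. z \<bullet> e = sqrt (lam e) * (x \<bullet> e)"
proof (rule hilbert_basis_coords[OF E_basis])
  obtain K where K: "\<forall>e\<in>E. lam e \<le> K" using lam_bounded by blast
  have "(\<lambda>e. K * (x \<bullet> e)\<^sup>2) summable_on E"
    by (intro summable_on_cmult_right bessel_summable E_orthonormal)
  then show "(\<lambda>e. (sqrt (lam e) * (x \<bullet> e))\<^sup>2) summable_on E"
    by (rule summable_on_comparison_test)
      (use K lam_nonneg in \<open>auto simp: power_mult_distrib mult_right_mono\<close>)
qed

text \<open>The diagonal square root of \<open>Q\<close>; uniqueness identifies it with
  \<open>op_sqrt Q\<close> in \<open>op_sqrt_Q\<close>.\<close>

definition R :: "'h \<Rightarrow> 'h" where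
  "R x = (SOME z. \<forall>e\<in>E. z \<bullet> e = sqrt (lam e) * (x \<bullet> e))"

lemma R_inner: "e \<in> E \<Longrightarrow> R x \<bullet> e = sqrt (lam e) * (x \<bullet> e)"
  using someI_ex[OF R_exists, of x] by (simp add: R_def)

lemma E_eqI: "(\<And>e. e \<in> E \<Longrightarrow> x \<bullet> e = y \<bullet> e) \<Longrightarrow> x = y"
  by (rule hilbert_basis_eqI[OF E_basis])

lemma bounded_linear_R: "bounded_linear R"
proof -
  obtain K where K: "\<forall>e\<in>E. lam e \<le> K" using lam_bounded by blast
  show ?thesis
  proof (rule bounded_linear_intro)
    fix x y :: 'h and r :: real
    show "R (x + y) = R x + R y"
      by (rule E_eqI) (simp add: R_inner inner_simps algebra_simps)
    show "R (r *\<^sub>R x) = r *\<^sub>R R x"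
      by (rule E_eqI) (simp add: R_inner inner_simps algebra_simps)
    have "(norm (R x))\<^sup>2 \<le> \<bar>K\<bar> * (norm x)\<^sup>2"
    proof (rule has_sum_mono[OF hilbert_basis_parseval[OF E_basis]
          has_sum_cmult_right[OF hilbert_basis_parseval[OF E_basis]]])
      fix e assume "e \<in> E"
      then show "(R x \<bullet> e)\<^sup>2 \<le> \<bar>K\<bar> * (x \<bullet> e)\<^sup>2"
        using K lam_nonneg[of e] by (auto simp: R_inner power_mult_distrib intro!: mult_right_mono)
    qed
    then have "norm (R x) \<le> sqrt (\<bar>K\<bar> * (norm x)\<^sup>2)"
      by (simp add: real_le_rsqrt)
    then show "norm (R x) \<le> norm x * sqrt \<bar>K\<bar>"
      by (simp add: real_sqrt_mult mult.commute)
  qed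
qed

lemma R_sa: "R x \<bullet> y = x \<bullet> R y"
proof -
  have "((\<lambda>e. (R x \<bullet> e) * (y \<bullet> e)) has_sum (R x \<bullet> y)) E"
    by (rule hilbert_basis_inner[OF E_basis])
  moreover have "((\<lambda>e. (R x \<bullet> e) * (y \<bullet> e)) has_sum (x \<bullet> R y)) E"
    using hilbert_basis_inner[OF E_basis, of x "R y"]
    by (rule has_sum_cong[THEN iffD1, rotated]) (simp add: R_inner)
  ultimately show ?thesis by (rule has_sum_unique)
qed

lemma R_pos: "0 \<le> R x \<bullet> x"
  using hilbert_basis_inner[OF E_basis, of "R x" x]
  by (rule has_sum_nonneg) (simp add: R_inner lam_nonneg mult.assoc)

lemma R_R: "R (R x) = Q x"
  by (rule E_eqI) (simp add: R_inner Q_inner lam_nonneg flip: mult.assoc)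

lemma op_sqrt_Q: "op_sqrt Q = R"
proof (rule op_sqrt_unique[OF bounded_linear_R])
  show "selfadjoint_op R" by (simp add: selfadjoint_op_def R_sa)
  show "positive_op R" unfolding positive_op_def using R_pos by blast
qed (simp add: fun_eq_iff R_R)

text \<open>Moves the trace from the given basis \<open>B\<close> to the eigenbasis:
  \<open>lam e\<close> is the squared norm of \<open>R e\<close>, expanded in \<open>B\<close> by
  Parseval, and for each \<open>b\<close> Bessel bounds the sum over \<open>J\<close> by
  \<open>Q b \<bullet> b\<close>. With \<open>J\<close> finite no double series has to be
  interchanged.\<close>

lemma lam_sum_bounded: "\<exists>\<tau>>0. \<forall>J. finite J \<and> J \<subseteq> E \<longrightarrow> sum lam J \<le> \<tau>"
proof -
  obtain B where B: "hilbert_basis B" and tr: "(\<lambda>e. Q e \<bullet> e) summable_on B"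
    using trace_summable by blast
  define T where "T = (\<Sum>\<^sub>\<infinity>b\<in>B. Q b \<bullet> b)"
  have T: "((\<lambda>b. Q b \<bullet> b) has_sum T) B"
    unfolding T_def using tr by (rule has_sum_infsum)
  have "T \<ge> 0"
    using T by (rule has_sum_nonneg) (use Q_pos in \<open>simp add: positive_op_def\<close>)
  have "sum lam J \<le> T" if J: "finite J" "J \<subseteq> E" for J
  proof (rule has_sum_mono[OF _ T])
    have "((\<lambda>b. \<Sum>e\<in>J. (R e \<bullet> b)\<^sup>2) has_sum (\<Sum>e\<in>J. (norm (R e))\<^sup>2)) B"
      by (rule has_sum_finite_sum[OF J(1) hilbert_basis_parseval[OF B]])
    moreover have "(norm (R e))\<^sup>2 = lam e" if "e \<in> E" for e
      using R_sa[of e "R e"] by (simp add: power2_norm_eq_inner R_R lam_def inner_commute)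
    moreover have "(R e \<bullet> b)\<^sup>2 = (R b \<bullet> e)\<^sup>2" for e b
      using R_sa[of e b] by (simp add: inner_commute)
    then have "(\<lambda>b. \<Sum>e\<in>J. (R e \<bullet> b)\<^sup>2) = (\<lambda>b. \<Sum>e\<in>J. (R b \<bullet> e)\<^sup>2)"
      by (intro ext sum.cong refl)
    ultimately show "((\<lambda>b. \<Sum>e\<in>J. (R b \<bullet> e)\<^sup>2) has_sum sum lam J) B"
      using J(2) by (simp add: subset_iff)
    fix b
    have "(\<Sum>e\<in>J. (R b \<bullet> e)\<^sup>2) \<le> (norm (R b))\<^sup>2"
      by (rule bessel_inequality[OF E_orthonormal J])
    also have "\<dots> = Q b \<bullet> b"
      using R_sa[of b "R b"] by (simp add: power2_norm_eq_inner R_R inner_commute)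
    finally show "(\<Sum>e\<in>J. (R b \<bullet> e)\<^sup>2) \<le> Q b \<bullet> b" .
  qed
  with \<open>T \<ge> 0\<close> show ?thesis
    by (intro exI[of _ "T + 1"]) force
qed

text \<open>A bound for the trace, strictly positive even for \<open>Q = 0\<close>, so that it can
  stand in denominators.\<close>

definition \<tau> :: real where
  "\<tau> = (SOME \<tau>. \<tau> > 0 \<and> (\<forall>J. finite J \<and> J \<subseteq> E \<longrightarrow> sum lam J \<le> \<tau>))"

lemma \<tau>_pos: "\<tau> > 0" and lam_sum_le: "finite J \<Longrightarrow> J \<subseteq> E \<Longrightarrow> sum lam J \<le> \<tau>"
  using someI_ex[OF lam_sum_bounded] by (auto simp: \<tau>_def)

lemma lam_summable: "lam summable_on E"
  by (rule nonneg_bdd_above_summable_on) (auto intro!: bdd_aboveI[of _ \<tau>] lam_sum_le simp: lam_nonneg)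

lemma lam_le: "e \<in> E \<Longrightarrow> lam e \<le> \<tau>"
  using lam_sum_le[of "{e}"] by simp

text \<open>A basis of the orthogonal complement of the kernel of \<open>R\<close>.\<close>

definition Ep :: "'h set" where "Ep = {e \<in> E. lam e > 0}"

lemma Ep_E: "e \<in> Ep \<Longrightarrow> e \<in> E" and Ep_subset: "Ep \<subseteq> E"
  by (auto simp: Ep_def)

lemma R_eq_0_iff: "R k = 0 \<longleftrightarrow> (\<forall>e\<in>Ep. k \<bullet> e = 0)"
proof
  assume "R k = 0"
  then show "\<forall>e\<in>Ep. k \<bullet> e = 0"
    using R_inner[of _ k] by (auto simp: Ep_def) (metis inner_zero_left mult_eq_0_iff real_sqrt_eq_zero_cancel_iff less_irrefl)
next
  assume *: "\<forall>e\<in>Ep. k \<bullet> e = 0"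
  show "R k = 0"
  proof (rule E_eqI)
    fix e assume e: "e \<in> E"
    then show "R k \<bullet> e = 0 \<bullet> e"
      using * lam_nonneg[of e] by (cases "lam e = 0") (auto simp: R_inner Ep_def)
  qed
qed

lemma orthogonal_kernel_iff:
  "(\<forall>k. R k = 0 \<longrightarrow> y \<bullet> k = 0) \<longleftrightarrow> (\<forall>e\<in>E - Ep. y \<bullet> e = 0)"
proof
  assume *: "\<forall>k. R k = 0 \<longrightarrow> y \<bullet> k = 0"
  show "\<forall>e\<in>E - Ep. y \<bullet> e = 0"
  proof
    fix e assume e: "e \<in> E - Ep"
    then have "R e = 0"
      unfolding R_eq_0_iff using E_inner Ep_subset by auto
    then show "y \<bullet> e = 0" using * by blast
  qed
next
  assume *: "\<forall>e\<in>E - Ep. y \<bullet> e = 0"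
  show "\<forall>k. R k = 0 \<longrightarrow> y \<bullet> k = 0"
  proof (intro allI impI)
    fix k assume "R k = 0"
    then have "(y \<bullet> e) * (k \<bullet> e) = 0" if "e \<in> E" for e
      using * that unfolding R_eq_0_iff by (cases "e \<in> Ep") auto
    then have "((\<lambda>e. (y \<bullet> e) * (k \<bullet> e)) has_sum 0) E"
      by (intro has_sum_0)
    with hilbert_basis_inner[OF E_basis, of y k] show "y \<bullet> k = 0"
      by (rule has_sum_unique)
  qed
qed

lemma pinv_eqI:
  assumes "R y = x" "\<And>e. e \<in> E - Ep \<Longrightarrow> y \<bullet> e = 0"
  shows "op_pinv R x = y"
  unfolding op_pinv_def orthogonal_kernel_iff
proof (rule the_equality)
  show "R y = x \<and> (\<forall>e\<in>E - Ep. y \<bullet> e = 0)" using assms by blast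
  fix z assume z: "R z = x \<and> (\<forall>e\<in>E - Ep. z \<bullet> e = 0)"
  have "R (z - y) = 0"
    using z assms linear_diff[OF bounded_linear.linear[OF bounded_linear_R]] by simp
  then show "z = y"
    unfolding R_eq_0_iff using z assms(2)
    by (intro E_eqI) (metis DiffI inner_diff_left right_minus_eq)
qed

text \<open>\<open>op_pinv R (R x)\<close> is \<open>x\<close> with its coordinates in the kernel
  deleted, which leaves the image under \<open>R\<close> unchanged and can only shorten the
  vector.\<close>

lemma pinv_R:
  shows R_pinv_R: "R (op_pinv R (R x)) = R x"
    and pinv_R_inner: "e \<in> E \<Longrightarrow> op_pinv R (R x) \<bullet> e = (if e \<in> Ep then x \<bullet> e else 0)"
    and norm_pinv_R: "norm (op_pinv R (R x)) \<le> norm x"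
proof -
  have "(\<lambda>e. (if e \<in> Ep then x \<bullet> e else 0)\<^sup>2) summable_on E"
    by (rule summable_on_comparison_test[OF bessel_summable[OF E_orthonormal, of x]]) auto
  from hilbert_basis_coords[OF E_basis this]
  obtain y where y: "\<forall>e\<in>E. y \<bullet> e = (if e \<in> Ep then x \<bullet> e else 0)" by blast
  have Ry: "R y = R x"
  proof (rule E_eqI)
    fix e assume "e \<in> E"
    then show "R y \<bullet> e = R x \<bullet> e"
      using y lam_nonneg[of e] by (auto simp: R_inner Ep_def)
  qed
  have p: "op_pinv R (R x) = y"
    by (rule pinv_eqI[OF Ry]) (use y in auto)
  show "R (op_pinv R (R x)) = R x" by (simp add: p Ry)
  show "e \<in> E \<Longrightarrow> op_pinv R (R x) \<bullet> e = (if e \<in> Ep then x \<bullet> e else 0)"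
    using y by (simp add: p)
  have "(norm y)\<^sup>2 \<le> (norm x)\<^sup>2"
    by (rule has_sum_mono[OF hilbert_basis_parseval[OF E_basis] hilbert_basis_parseval[OF E_basis]])
      (use y in auto)
  then show "norm (op_pinv R (R x)) \<le> norm x"
    unfolding p by (rule power2_le_imp_le) simp
qed

lemma H0_norm_eq: "H0_norm Q x = norm (op_pinv R x)"
  by (simp add: H0_norm_def H0_inner_def op_sqrt_Q norm_eq_sqrt_inner)

lemma H0_carrier_eq: "H0_carrier Q = range R"
  by (simp add: H0_carrier_def op_sqrt_Q)

lemma H0_norm_R_le: "H0_norm Q (R x) \<le> norm x"
  by (simp add: H0_norm_eq norm_pinv_R)

text \<open>Bessel for the preimage: a coordinate of \<open>x\<close> is \<open>sqrt (lam e)\<close>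
  times that of \<open>op_pinv R x\<close>, which produces the weights \<open>1 / lam e\<close> in
  the energies.\<close>

lemma H0_coords:
  assumes "x \<in> H0_carrier Q" "finite J" "J \<subseteq> Ep"
  shows "(\<Sum>e\<in>J. (x \<bullet> e)\<^sup>2 / lam e) \<le> (H0_norm Q x)\<^sup>2"
proof -
  obtain z where z: "x = R z" using assms(1) by (auto simp: H0_carrier_eq)
  have "(\<Sum>e\<in>J. (x \<bullet> e)\<^sup>2 / lam e) = (\<Sum>e\<in>J. (op_pinv R x \<bullet> e)\<^sup>2)"
  proof (rule sum.cong[OF refl])
    fix e assume "e \<in> J"
    then have e: "e \<in> Ep" "e \<in> E" "lam e > 0" using assms(3) by (auto simp: Ep_def)
    then show "(x \<bullet> e)\<^sup>2 / lam e = (op_pinv R x \<bullet> e)\<^sup>2"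
      by (simp add: z R_inner pinv_R_inner power_mult_distrib)
  qed
  also have "\<dots> \<le> (norm (op_pinv R x))\<^sup>2"
    using assms Ep_subset by (intro bessel_inequality[OF E_orthonormal]) auto
  finally show ?thesis by (simp add: H0_norm_eq)
qed

lemma H0_null_coord: "x \<in> H0_carrier Q \<Longrightarrow> e \<in> E - Ep \<Longrightarrow> x \<bullet> e = 0"
  using lam_nonneg[of e] by (auto simp: H0_carrier_eq R_inner Ep_def)

lemma H0_norm_bound: "\<exists>K. \<forall>x\<in>H0_carrier Q. norm x \<le> K * H0_norm Q x"
proof -
  obtain K where K: "\<And>x. norm (R x) \<le> norm x * K"
    using bounded_linear.bounded[OF bounded_linear_R] by blast
  have "norm x \<le> K * H0_norm Q x" if x: "x \<in> H0_carrier Q" for x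
  proof -
    obtain z where z: "x = R z" using x by (auto simp: H0_carrier_eq)
    show ?thesis
      using K[of "op_pinv R x"] R_pinv_R[of z] by (simp add: H0_norm_eq z mult.commute)
  qed
  then show ?thesis by blast
qed

lemma tail_lam: "d > 0 \<Longrightarrow> \<exists>J. finite J \<and> J \<subseteq> E \<and> (\<forall>G. finite G \<longrightarrow> G \<subseteq> E - J \<longrightarrow> sum lam G < d)"
  using summable_on_tail[OF lam_summable lam_nonneg] by metis

end

section \<open>Dyadic increments and Hoelder norms\<close>

definition dinc :: "(real \<Rightarrow> 'h::real_normed_vector) \<Rightarrow> nat \<Rightarrow> nat \<Rightarrow> 'h" where
  "dinc F m k = F (real (Suc k) / 2 ^ m) - F (real k / 2 ^ m)"

text \<open>\<open>(2 powr - \<alpha>) ^ m\<close> is the grid width of level \<open>m\<close> to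
  the power \<open>\<alpha>\<close>. From level 0 on this controls the whole Hoelder norm; from
  level \<open>n\<close> on it is the smallness of the modulus that defines the little Hoelder
  space. Only countably many increments occur, so it defines events.\<close>

definition dyadic_holder :: "real \<Rightarrow> nat \<Rightarrow> real \<Rightarrow> (real \<Rightarrow> 'h::real_normed_vector) \<Rightarrow> bool" where
  "dyadic_holder \<alpha> n \<eta> F \<longleftrightarrow> (\<forall>m\<ge>n. \<forall>k<2 ^ m. norm (dinc F m k) \<le> \<eta> * (2 powr - \<alpha>) ^ m)"

lemma dyadic_holderD:
  "dyadic_holder \<alpha> n \<eta> F \<Longrightarrow> n \<le> m \<Longrightarrow> k < 2 ^ m \<Longrightarrow> norm (dinc F m k) \<le> \<eta> * (2 powr - \<alpha>) ^ m"
  by (simp add: dyadic_holder_def)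

lemma dyadic_holder_nonneg: "dyadic_holder \<alpha> n \<eta> F \<Longrightarrow> 0 \<le> \<eta>"
proof -
  assume "dyadic_holder \<alpha> n \<eta> F"
  from dyadic_holderD[OF this order_refl, of 0] have "norm (dinc F n 0) \<le> \<eta> * (2 powr - \<alpha>) ^ n"
    by simp
  then have "0 \<le> \<eta> * (2 powr - \<alpha>) ^ n"
    using norm_ge_zero order_trans by blast
  then show ?thesis
    using mult_right_le_imp_le[of 0 "(2 powr - \<alpha>) ^ n" \<eta>] by simp
qed

lemma dyadic_holder_mono:
  assumes "dyadic_holder \<alpha> n \<eta> F" "n \<le> n'" "\<eta> \<le> \<eta>'"
  shows "dyadic_holder \<alpha> n' \<eta>' F"
  unfolding dyadic_holder_def
proof (intro allI impI)
  fix m k :: nat assume "n' \<le> m" "k < 2 ^ m"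
  then have "norm (dinc F m k) \<le> \<eta> * (2 powr - \<alpha>) ^ m"
    using assms by (intro dyadic_holderD[OF assms(1)]) auto
  also have "\<dots> \<le> \<eta>' * (2 powr - \<alpha>) ^ m"
    using assms by (intro mult_right_mono) auto
  finally show "norm (dinc F m k) \<le> \<eta>' * (2 powr - \<alpha>) ^ m" .
qed

lemma dinc_diff: "dinc (\<lambda>t. F t - G t) m k = dinc F m k - dinc G m k"
  by (simp add: dinc_def)

lemma dinc_scaleR: "dinc (\<lambda>t. c *\<^sub>R F t) m k = c *\<^sub>R dinc F m k"
  by (simp add: dinc_def scaleR_diff_right)

lemma dyadic_holder_diff:
  assumes "dyadic_holder \<alpha> n a F" "dyadic_holder \<alpha> n b G"
  shows "dyadic_holder \<alpha> n (a + b) (\<lambda>t. F t - G t)"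
  unfolding dyadic_holder_def
proof (intro allI impI)
  fix m k :: nat assume m: "n \<le> m" "k < 2 ^ m"
  show "norm (dinc (\<lambda>t. F t - G t) m k) \<le> (a + b) * (2 powr - \<alpha>) ^ m"
    using norm_triangle_ineq4[of "dinc F m k" "dinc G m k"]
      dyadic_holderD[OF assms(1) m] dyadic_holderD[OF assms(2) m]
    by (simp add: dinc_diff algebra_simps)
qed

lemma dyadic_mem: "k \<le> 2 ^ m \<Longrightarrow> real k / 2 ^ m \<in> {0..1}"
proof -
  assume "k \<le> 2 ^ m"
  then have "real k \<le> real (2 ^ m)" by (rule of_nat_mono)
  then show ?thesis by (simp add: divide_le_eq)
qed

lemma dinc_cong:
  assumes "\<And>t. t \<in> {0..1} \<Longrightarrow> F t = G t" "k < 2 ^ m"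
  shows "dinc F m k = dinc G m k"
  unfolding dinc_def using assms(1)[OF dyadic_mem[of k m]] assms(1)[OF dyadic_mem[of "Suc k" m]] assms(2) by simp

lemma dyadic_holder_cong:
  assumes "\<And>t. t \<in> {0..1} \<Longrightarrow> F t = G t"
  shows "dyadic_holder \<alpha> n \<eta> F \<longleftrightarrow> dyadic_holder \<alpha> n \<eta> G"
  unfolding dyadic_holder_def using dinc_cong[of F G, OF assms] by auto

definition dfloor :: "nat \<Rightarrow> real \<Rightarrow> nat" where "dfloor j s = nat \<lfloor>2 ^ j * s\<rfloor>"

lemma dfloor_bounds:
  assumes "s \<ge> 0"
  shows "real (dfloor j s) \<le> 2 ^ j * s" "2 ^ j * s < real (dfloor j s) + 1"
proof -
  have "0 \<le> \<lfloor>2 ^ j * s\<rfloor>" using assms by simp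
  then have "real (dfloor j s) = of_int \<lfloor>2 ^ j * s\<rfloor>" by (simp add: dfloor_def)
  then show "real (dfloor j s) \<le> 2 ^ j * s" "2 ^ j * s < real (dfloor j s) + 1" by linarith+
qed

lemma dfloor_le:
  assumes "s \<ge> 0" "s \<le> 1"
  shows "dfloor j s \<le> 2 ^ j"
proof -
  have "real (dfloor j s) \<le> 2 ^ j * 1"
    using dfloor_bounds(1)[OF assms(1), of j] assms(2)
    by (meson mult_left_mono order_trans zero_le_numeral zero_le_power)
  then have "real (dfloor j s) \<le> real (2 ^ j)" by simp
  then show ?thesis by (simp only: of_nat_le_iff)
qed

lemma dfloor_Suc:
  assumes "s \<ge> 0"
  shows "dfloor (Suc j) s = 2 * dfloor j s \<or> dfloor (Suc j) s = Suc (2 * dfloor j s)"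
proof -
  have "real (dfloor (Suc j) s) < 2 * real (dfloor j s) + 2" "2 * real (dfloor j s) < real (dfloor (Suc j) s) + 1"
    using dfloor_bounds[OF assms, of j] dfloor_bounds[OF assms, of "Suc j"] by (simp_all add: mult.assoc)
  then have "dfloor (Suc j) s < 2 * dfloor j s + 2" "2 * dfloor j s < dfloor (Suc j) s + 1" by linarith+
  then show ?thesis by linarith
qed

lemma dfloor_tendsto:
  assumes "s \<ge> 0"
  shows "(\<lambda>j. real (dfloor j s) / 2 ^ j) \<longlonglongrightarrow> s"
proof (rule LIM_zero_cancel, rule tendsto_rabs_zero_cancel)
  have "(\<lambda>j. (1 / 2 :: real) ^ j) \<longlonglongrightarrow> 0"
    by (rule LIMSEQ_power_zero) simp
  then show "(\<lambda>j. \<bar>real (dfloor j s) / 2 ^ j - s\<bar>) \<longlonglongrightarrow> 0"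
  proof (rule tendsto_null_sandwich)
    show "\<bar>real (dfloor j s) / 2 ^ j - s\<bar> \<le> (1 / 2) ^ j" for j
    proof -
      have "real (dfloor j s) / 2 ^ j \<le> s" "s < (real (dfloor j s) + 1) / 2 ^ j"
        using dfloor_bounds[OF assms, of j] by (simp_all add: field_simps)
      then show ?thesis by (simp add: power_one_over add_divide_distrib abs_le_iff)
    qed
  qed simp
qed

text \<open>With \<open>r = 2 powr - \<alpha>\<close>, the summand 1 is the step between the two
  grid points, \<open>2 * r / (1 - r)\<close> the geometric series from both end points, and
  \<open>2 powr \<alpha>\<close> the price of replacing the grid width by
  \<open>t - s\<close>.\<close>

definition chain_const :: "real \<Rightarrow> real" where
  "chain_const \<alpha> = 2 powr \<alpha> * (1 + 2 * (2 powr - \<alpha>) / (1 - 2 powr - \<alpha>))"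

lemma powr_minus_bounds:
  assumes "0 < \<alpha>"
  shows "0 < (2::real) powr - \<alpha>" "(2::real) powr - \<alpha> < 1"
  using assms by (simp_all add: powr_less_one)

lemma chain_const_pos: "0 < \<alpha> \<Longrightarrow> 0 < chain_const \<alpha>"
  using powr_minus_bounds[of \<alpha>] by (auto simp: chain_const_def intro!: mult_pos_pos add_pos_nonneg divide_nonneg_pos)

text \<open>Passing from one left dyadic approximation of \<open>s\<close> to the next either
  changes nothing or adds one dyadic increment of the finer level; the geometric series of these
  bounds reaches \<open>s\<close> by continuity.\<close>

lemma chain_to_point:
  fixes F :: "real \<Rightarrow> 'h::real_normed_vector"
  assumes \<alpha>: "0 < \<alpha>" and F: "continuous_on {0..1} F" and dy: "dyadic_holder \<alpha> n \<eta> F"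
    and m: "n \<le> m" and s: "0 \<le> s" "s \<le> 1"
  shows "norm (F s - F (real (dfloor m s) / 2 ^ m)) \<le>
    \<eta> * (2 powr - \<alpha>) ^ m * (2 powr - \<alpha> / (1 - 2 powr - \<alpha>))"
proof -
  define r :: real where "r = 2 powr - \<alpha>"
  have r: "0 < r" "r < 1" using powr_minus_bounds[OF \<alpha>] by (auto simp: r_def)
  have \<eta>: "0 \<le> \<eta>" by (rule dyadic_holder_nonneg[OF dy])
  define p where "p j = F (real (dfloor j s) / 2 ^ j)" for j
  have step: "norm (p (Suc j) - p j) \<le> \<eta> * r ^ Suc j" if j: "m \<le> j" for j
  proof (cases "dfloor (Suc j) s = 2 * dfloor j s")
    case True
    then show ?thesis using \<eta> r by (simp add: p_def)
  next
    case False
    then have eq: "dfloor (Suc j) s = Suc (2 * dfloor j s)" using dfloor_Suc[OF s(1)] by blast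
    then have "2 * dfloor j s < 2 ^ Suc j" using dfloor_le[OF s, of "Suc j"] by linarith
    moreover have "p (Suc j) - p j = dinc F (Suc j) (2 * dfloor j s)"
      unfolding dinc_def p_def eq by simp
    ultimately show ?thesis
      using dyadic_holderD[OF dy, of "Suc j" "2 * dfloor j s"] j m by (simp add: r_def)
  qed
  have sum: "norm (p (m + N) - p m) \<le> \<eta> * r ^ m * (r * (1 - r ^ N) / (1 - r))" for N
  proof (induction N)
    case (Suc N)
    have "norm (p (m + Suc N) - p m) \<le> norm (p (m + N) - p m) + norm (p (Suc (m + N)) - p (m + N))"
      using norm_triangle_ineq[of "p (m + N) - p m" "p (Suc (m + N)) - p (m + N)"] by simp
    also have "\<dots> \<le> \<eta> * r ^ m * (r * (1 - r ^ N) / (1 - r)) + \<eta> * r ^ Suc (m + N)"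
      by (intro add_mono Suc.IH step) simp
    also have "\<dots> = \<eta> * r ^ m * (r * (1 - r ^ Suc N) / (1 - r))"
      using r by (simp add: field_simps power_add)
    finally show ?case .
  qed simp
  have lim: "(\<lambda>N. norm (p (m + N) - p m)) \<longlonglongrightarrow> norm (F s - p m)"
  proof (intro tendsto_intros)
    have "(\<lambda>N. real (dfloor (m + N) s) / 2 ^ (m + N)) \<longlonglongrightarrow> s"
      using LIMSEQ_ignore_initial_segment[OF dfloor_tendsto[OF s(1)], of m] by (simp add: add.commute)
    then show "(\<lambda>N. p (m + N)) \<longlonglongrightarrow> F s"
      unfolding p_def
      by (rule continuous_on_tendsto_compose[OF F]) (use s dyadic_mem[OF dfloor_le[OF s]] in auto)
  qed
  have "norm (F s - p m) \<le> \<eta> * r ^ m * (r / (1 - r))"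
  proof (rule LIMSEQ_le_const2[OF lim], intro exI allI impI)
    fix N
    have "r * (1 - r ^ N) / (1 - r) \<le> r / (1 - r)"
      using r by (intro divide_right_mono) (auto simp: algebra_simps)
    then have "\<eta> * r ^ m * (r * (1 - r ^ N) / (1 - r)) \<le> \<eta> * r ^ m * (r / (1 - r))"
      using \<eta> r by (intro mult_left_mono) auto
    with sum[of N] show "norm (p (m + N) - p m) \<le> \<eta> * r ^ m * (r / (1 - r))" by linarith
  qed
  then show ?thesis by (simp add: p_def r_def)
qed

lemma dyadic_scale_exists:
  fixes d :: real
  assumes "0 < d" "d \<le> (1 / 2) ^ n"
  obtains m where "n \<le> m" "d \<le> (1 / 2) ^ m" "(1 / 2) ^ Suc m < d"
proof -
  define P where "P j \<longleftrightarrow> (1 / 2) ^ j < d" for j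
  have "\<exists>j. P j"
    unfolding P_def using real_arch_pow_inv[OF assms(1), of "1 / 2"] by simp
  then have L: "P (LEAST j. P j)" by (rule LeastI_ex)
  have "\<not> P j" if "j \<le> n" for j
  proof -
    have "(1 / 2 :: real) ^ n \<le> (1 / 2) ^ j" by (rule power_decreasing) (use that in auto)
    with assms(2) show ?thesis unfolding P_def by linarith
  qed
  then have n: "n < (LEAST j. P j)" using L by (metis not_less)
  then obtain m where m: "(LEAST j. P j) = Suc m" by (cases "LEAST j. P j") auto
  have "\<not> P m" by (rule not_less_Least) (simp add: m)
  have "n \<le> m" using n unfolding m by simp
  moreover have "(1 / 2) ^ Suc m < d" using L unfolding m unfolding P_def .
  moreover have "d \<le> (1 / 2) ^ m" using \<open>\<not> P m\<close> unfolding P_def by linarith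
  ultimately show thesis by (intro that)
qed

text \<open>At the level \<open>m\<close> with \<open>t - s\<close> between half the grid width and
  the grid width, the left approximations of \<open>s\<close> and \<open>t\<close> coincide or are
  neighbours. The lower bound on \<open>t - s\<close> turns the grid width back into
  \<open>(t - s) powr \<alpha>\<close>.\<close>

lemma chaining:
  fixes F :: "real \<Rightarrow> 'h::real_normed_vector"
  assumes \<alpha>: "0 < \<alpha>" and F: "continuous_on {0..1} F" and dy: "dyadic_holder \<alpha> n \<eta> F"
    and st: "0 \<le> s" "s < t" "t \<le> 1" "t - s \<le> (1 / 2) ^ n"
  shows "norm (F t - F s) \<le> chain_const \<alpha> * \<eta> * (t - s) powr \<alpha>"
proof -
  define r :: real where "r = 2 powr - \<alpha>"
  have r: "0 < r" "r < 1" using powr_minus_bounds[OF \<alpha>] by (auto simp: r_def)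
  have \<eta>: "0 \<le> \<eta>" by (rule dyadic_holder_nonneg[OF dy])
  obtain m where m: "n \<le> m" "t - s \<le> (1 / 2) ^ m" "(1 / 2) ^ Suc m < t - s"
    using dyadic_scale_exists[of "t - s" n] st by auto
  define a b where "a = dfloor m s" and "b = dfloor m t"
  have bt: "b \<le> 2 ^ m" unfolding b_def using st by (intro dfloor_le) auto
  have "2 ^ m * t \<le> 2 ^ m * s + 1"
    using m(2) by (simp add: field_simps power_one_over)
  moreover have "real a \<le> 2 ^ m * s" "2 ^ m * s < real a + 1" "real b \<le> 2 ^ m * t" "2 ^ m * t < real b + 1"
    using dfloor_bounds[of s m] dfloor_bounds[of t m] st by (auto simp: a_def b_def)
  moreover have "2 ^ m * s < 2 ^ m * t" using st by simp
  ultimately have "real b < real a + 2" "real a < real b + 1" by linarith+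
  then have "b = a \<or> b = Suc a" by linarith
  then have mid: "norm (F (real b / 2 ^ m) - F (real a / 2 ^ m)) \<le> \<eta> * r ^ m"
  proof
    assume "b = Suc a"
    with bt dyadic_holderD[OF dy m(1), of a] show ?thesis by (simp add: dinc_def r_def)
  qed (use \<eta> r in simp)
  have "norm (F t - F s) \<le> norm (F t - F (real b / 2 ^ m)) +
      (norm (F (real b / 2 ^ m) - F (real a / 2 ^ m)) + norm (F s - F (real a / 2 ^ m)))"
    using norm_triangle_ineq[of "F t - F (real b / 2 ^ m)" "F (real b / 2 ^ m) - F s"]
      norm_triangle_ineq4[of "F (real b / 2 ^ m) - F (real a / 2 ^ m)" "F s - F (real a / 2 ^ m)"]
    by simp
  also have "\<dots> \<le> \<eta> * r ^ m * (r / (1 - r)) + (\<eta> * r ^ m + \<eta> * r ^ m * (r / (1 - r)))"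
    unfolding a_def b_def r_def
    by (intro add_mono chain_to_point[OF \<alpha> F dy m(1)] mid[unfolded a_def b_def r_def]) (use st in auto)
  also have "\<dots> = \<eta> * (1 + 2 * r / (1 - r)) * r ^ m"
    by (simp add: field_simps)
  also have "\<dots> \<le> \<eta> * (1 + 2 * r / (1 - r)) * (2 powr \<alpha> * (t - s) powr \<alpha>)"
  proof (intro mult_left_mono)
    have "r ^ m = ((1 / 2) ^ m) powr \<alpha>"
      by (simp add: r_def powr_power powr_powr powr_minus_divide powr_divide mult.commute flip: powr_realpow)
    also have "\<dots> \<le> (2 * (t - s)) powr \<alpha>"
      using m(3) \<alpha> by (intro powr_mono2) auto
    also have "\<dots> = 2 powr \<alpha> * (t - s) powr \<alpha>"
      by (rule powr_mult)
    finally show "r ^ m \<le> 2 powr \<alpha> * (t - s) powr \<alpha>" .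
    show "0 \<le> \<eta> * (1 + 2 * r / (1 - r))" using \<eta> r by simp
  qed
  also have "\<dots> = chain_const \<alpha> * \<eta> * (t - s) powr \<alpha>"
    by (simp add: chain_const_def r_def)
  finally show ?thesis .
qed

lemma chaining_ratio:
  fixes F :: "real \<Rightarrow> 'h::real_normed_vector"
  assumes "0 < \<alpha>" "continuous_on {0..1} F" "dyadic_holder \<alpha> n \<eta> F"
    and "0 \<le> s" "s < t" "t \<le> 1" "t - s \<le> (1 / 2) ^ n"
  shows "norm (F t - F s) / \<bar>t - s\<bar> powr \<alpha> \<le> chain_const \<alpha> * \<eta>"
  using chaining[OF assms] assms(5) by (simp add: divide_le_eq)

lemma holder_norm_le:
  fixes F :: "real \<Rightarrow> 'h::real_normed_vector"
  assumes "0 < \<alpha>" "continuous_on {0..1} F" "dyadic_holder \<alpha> 0 \<eta> F"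
  shows "holder_norm \<alpha> F \<le> chain_const \<alpha> * \<eta>"
proof -
  have "(SUP (s, t) \<in> {(s, t). 0 \<le> s \<and> s < t \<and> t \<le> 1}. ennreal (norm (F t - F s) / \<bar>t - s\<bar> powr \<alpha>))
    \<le> ennreal (chain_const \<alpha> * \<eta>)"
    by (rule SUP_least) (auto intro!: ennreal_leI chaining_ratio[OF assms])
  moreover have "0 \<le> chain_const \<alpha> * \<eta>"
    using chain_const_pos[OF assms(1)] dyadic_holder_nonneg[OF assms(3)] by simp
  ultimately show ?thesis
    unfolding holder_norm_def by (rule enn2real_leI[rotated])
qed

lemma holder0_continuous:
  fixes F :: "real \<Rightarrow> 'h::real_normed_vector"
  assumes "0 < \<alpha>" and F: "F \<in> holder0 \<alpha>"
  shows "continuous_on {0..1} F"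
proof -
  obtain K where K: "\<And>s t. 0 \<le> s \<Longrightarrow> s < t \<Longrightarrow> t \<le> 1 \<Longrightarrow> norm (F t - F s) / \<bar>t - s\<bar> powr \<alpha> \<le> K"
    using holder0_bound[OF assms] by blast
  have le: "norm (F t - F s) \<le> K * \<bar>t - s\<bar> powr \<alpha>" if "s \<in> {0..1}" "t \<in> {0..1}" for s t
  proof (cases s t rule: linorder_cases)
    case less
    then show ?thesis using K[of s t] that by (simp add: divide_le_eq)
  next
    case greater
    then show ?thesis using K[of t s] that by (simp add: divide_le_eq norm_minus_commute abs_minus_commute)
  qed simp
  show ?thesis
    unfolding continuous_on_def
  proof
    fix s :: real assume s: "s \<in> {0..1}"
    show "(F \<longlongrightarrow> F s) (at s within {0..1})"
    proof (rule LIM_zero_cancel, rule Lim_null_comparison)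
      show "\<forall>\<^sub>F t in at s within {0..1}. norm (F t - F s) \<le> K * \<bar>t - s\<bar> powr \<alpha>"
        unfolding eventually_at using le[OF s] by (auto intro!: exI[of _ 1])
      have "((\<lambda>t. \<bar>t - s\<bar>) \<longlongrightarrow> \<bar>s - s\<bar>) (at s within {0..1})"
        by (intro tendsto_intros)
      then have "((\<lambda>t. \<bar>t - s\<bar> powr \<alpha>) \<longlongrightarrow> \<bar>s - s\<bar> powr \<alpha>) (at s within {0..1})"
        by (rule tendsto_powr2) (use \<open>0 < \<alpha>\<close> in auto)
      from tendsto_mult_left[OF this, of K]
      show "((\<lambda>t. K * \<bar>t - s\<bar> powr \<alpha>) \<longlongrightarrow> 0) (at s within {0..1})"
        using \<open>0 < \<alpha>\<close> by simp
    qed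
  qed
qed

lemma holder0_dyadic:
  fixes F :: "real \<Rightarrow> 'h::real_normed_vector"
  assumes F: "F \<in> holder0 \<alpha>" and \<eta>: "\<eta> > 0"
  shows "\<exists>n. dyadic_holder \<alpha> n \<eta> F"
proof -
  have "(holder_modulus \<alpha> F \<longlongrightarrow> 0) (at_right 0)"
    using F by (simp add: holder0_def)
  then have "\<forall>\<^sub>F \<delta> in at_right 0. holder_modulus \<alpha> F \<delta> < ennreal \<eta>"
    by (rule order_tendstoD) (use \<eta> in simp)
  then obtain b where b: "b > 0" "\<And>\<delta>. 0 < \<delta> \<Longrightarrow> \<delta> < b \<Longrightarrow> holder_modulus \<alpha> F \<delta> < ennreal \<eta>"
    by (auto simp: eventually_at_right_field)
  define d where "d = b / 2"
  have d: "d > 0" "holder_modulus \<alpha> F d < ennreal \<eta>"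
    using b by (auto simp: d_def)
  obtain n where n: "(1 / 2) ^ n < d"
    using real_arch_pow_inv[OF d(1), of "1 / 2"] by auto
  have "norm (dinc F m k) \<le> \<eta> * (2 powr - \<alpha>) ^ m" if m: "n \<le> m" "k < 2 ^ m" for m k
  proof -
    let ?s = "real k / 2 ^ m" and ?t = "real (Suc k) / 2 ^ m"
    have diff: "?t - ?s = (1 / 2) ^ m" by (simp add: diff_divide_distrib[symmetric] power_one_over)
    have "(1 / 2 :: real) ^ m \<le> (1 / 2) ^ n" using m by (intro power_decreasing) auto
    with n have small: "(1 / 2) ^ m < d" by linarith
    have "ennreal (norm (F ?t - F ?s) / \<bar>?t - ?s\<bar> powr \<alpha>) \<le> holder_modulus \<alpha> F d"
      unfolding holder_modulus_def
      by (rule SUP_upper2[where i = "(?s, ?t)"])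
        (use small diff dyadic_mem[of k m] dyadic_mem[of "Suc k" m] m in auto)
    also have "\<dots> \<le> ennreal \<eta>" using d by simp
    finally have "norm (dinc F m k) / ((1 / 2) ^ m) powr \<alpha> \<le> \<eta>"
      using \<eta> unfolding diff dinc_def by (simp add: ennreal_le_iff)
    moreover have "((1 / 2) ^ m) powr \<alpha> = (2 powr - \<alpha>) ^ m"
      by (simp add: powr_power powr_powr powr_minus_divide powr_divide mult.commute flip: powr_realpow)
    ultimately show ?thesis by (simp add: divide_le_eq)
  qed
  then show ?thesis unfolding dyadic_holder_def by blast
qed

text \<open>Together with \<open>holder0_dyadic\<close> this replaces the modulus, a supremum over
  uncountably many pairs, by dyadic conditions.\<close>

lemma holder0I:
  fixes F :: "real \<Rightarrow> 'h::real_normed_vector"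
  assumes \<alpha>: "0 < \<alpha>" and F: "F \<in> extensional {0..1}" "F 0 = 0" "continuous_on {0..1} F"
    and dy: "\<And>\<eta>. \<eta> > 0 \<Longrightarrow> \<exists>n. dyadic_holder \<alpha> n \<eta> F"
  shows "F \<in> holder0 \<alpha>"
proof -
  have "(holder_modulus \<alpha> F \<longlongrightarrow> 0) (at_right 0)"
  proof (rule order_tendstoI)
    fix a :: ennreal assume "0 < a"
    then obtain b where b: "0 < b" "b < a" using dense by blast
    define e where "e = enn2real b"
    have "b < top" using b(2) by (rule less_le_trans) simp
    then have e: "0 < e" "ennreal e < a"
      using b by (simp_all add: e_def enn2real_positive_iff)
    define \<eta> where "\<eta> = e / chain_const \<alpha>"
    have \<eta>: "\<eta> > 0" using e chain_const_pos[OF \<alpha>] by (simp add: \<eta>_def)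
    obtain n where n: "dyadic_holder \<alpha> n \<eta> F" using dy[OF \<eta>] by blast
    have ratio: "norm (F t - F s) / \<bar>t - s\<bar> powr \<alpha> \<le> e"
      if "s \<in> {0..1}" "t \<in> {0..1}" "s < t" "\<bar>t - s\<bar> < (1 / 2) ^ n" for s t
      using chaining_ratio[OF \<alpha> F(3) n, of s t] that chain_const_pos[OF \<alpha>] by (simp add: \<eta>_def)
    have "holder_modulus \<alpha> F \<delta> \<le> ennreal e" if "\<delta> < (1 / 2) ^ n" for \<delta>
      unfolding holder_modulus_def
    proof (rule SUP_least, clarify)
      fix s t :: real assume st: "s \<in> {0..1}" "t \<in> {0..1}" "t \<noteq> s" "\<bar>t - s\<bar> < \<delta>"
      have "norm (F t - F s) / \<bar>t - s\<bar> powr \<alpha> \<le> e"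
        using ratio[of s t] ratio[of t s] st that
        by (cases "s < t") (auto simp: norm_minus_commute abs_minus_commute)
      then show "ennreal (norm (F t - F s) / \<bar>t - s\<bar> powr \<alpha>) \<le> ennreal e"
        by (rule ennreal_leI)
    qed
    then have "\<forall>\<delta>>0. \<delta> < (1 / 2) ^ n \<longrightarrow> holder_modulus \<alpha> F \<delta> < a"
      using e(2) by (meson order.strict_trans1)
    then show "\<forall>\<^sub>F \<delta> in at_right 0. holder_modulus \<alpha> F \<delta> < a"
      unfolding eventually_at_right_field by (intro exI[of _ "(1 / 2) ^ n"]) auto
  qed simp
  with F show ?thesis by (simp add: holder0_def)
qed

lemma holder_dist_le:
  fixes F G :: "real \<Rightarrow> 'h::real_normed_vector"
  assumes "0 < \<alpha>" "F \<in> holder0 \<alpha>" "G \<in> holder0 \<alpha>" "dyadic_holder \<alpha> 0 \<eta> (\<lambda>t. F t - G t)"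
  shows "holder_dist \<alpha> F G \<le> chain_const \<alpha> * \<eta>"
  unfolding holder_dist_def using assms
  by (intro holder_norm_le continuous_intros holder0_continuous) auto

lemma sum_pairs: "(\<Sum>k<2 * (n::nat). f k) = (\<Sum>k<n. f (2 * k) + f (Suc (2 * k)))"
  for f :: "nat \<Rightarrow> 'a::comm_monoid_add"
  by (induction n) (simp_all add: add.assoc)

text \<open>Paths that vary little below scale \<open>2\<^sup>-\<^sup>n\<close> are controlled by their values at level \<open>n\<close>.\<close>

lemma dyadic_holder_bucket:
  assumes \<alpha>: "\<alpha> \<le> 1" and FG: "dyadic_holder \<alpha> n \<eta> F" "dyadic_holder \<alpha> n \<eta> G"
    and close: "\<And>k. k \<le> 2 ^ n \<Longrightarrow> norm (F (real k / 2 ^ n) - G (real k / 2 ^ n)) \<le> \<eta> * (1 / 2) ^ n"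
  shows "dyadic_holder \<alpha> 0 (2 * \<eta>) (\<lambda>t. F t - G t)"
  unfolding dyadic_holder_def
proof (intro allI impI)
  fix m k :: nat assume k: "k < 2 ^ m"
  have \<eta>: "0 \<le> \<eta>" by (rule dyadic_holder_nonneg[OF FG(1)])
  show "norm (dinc (\<lambda>t. F t - G t) m k) \<le> 2 * \<eta> * (2 powr - \<alpha>) ^ m"
  proof (cases "n \<le> m")
    case True
    with dyadic_holder_diff[OF FG] k show ?thesis
      by (simp add: dyadic_holder_def)
  next
    case False
    then have mn: "m \<le> n" by simp
    \<comment> \<open>A point of a coarser grid also belongs to the grid of level \<open>n\<close>,
      so each end point of the increment costs at most the grid tolerance.\<close>
    have pt: "norm (F (real j / 2 ^ m) - G (real j / 2 ^ m)) \<le> \<eta> * (1 / 2) ^ n" if "j \<le> 2 ^ m" for j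
    proof -
      have "real j / 2 ^ m = real (j * 2 ^ (n - m)) / 2 ^ n"
        using mn by (simp add: field_simps flip: power_add)
      moreover have "j * 2 ^ (n - m) \<le> 2 ^ m * 2 ^ (n - m)" using that by simp
      then have "j * 2 ^ (n - m) \<le> 2 ^ n" using mn by (simp flip: power_add)
      ultimately show ?thesis using close[of "j * 2 ^ (n - m)"] by simp
    qed
    have "norm (dinc (\<lambda>t. F t - G t) m k) \<le> \<eta> * (1 / 2) ^ n + \<eta> * (1 / 2) ^ n"
      unfolding dinc_def using k by (intro norm_triangle_le_diff add_mono pt) auto
    also have "\<dots> = 2 * \<eta> * (1 / 2) ^ n" by simp
    also have "\<dots> \<le> 2 * \<eta> * (2 powr - \<alpha>) ^ m"
    proof (intro mult_left_mono)
      have "(1 / 2 :: real) ^ n \<le> (1 / 2) ^ m" using mn by (intro power_decreasing) auto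
      also have "\<dots> \<le> (2 powr - \<alpha>) ^ m"
      proof (rule power_mono)
        have "(2::real) powr - 1 \<le> 2 powr - \<alpha>" using \<alpha> by (intro powr_mono) auto
        then show "1 / 2 \<le> (2::real) powr - \<alpha>" by (simp add: powr_minus_divide)
      qed simp
      finally show "(1 / 2 :: real) ^ n \<le> (2 powr - \<alpha>) ^ m" .
    qed (use \<eta> in simp)
    finally show ?thesis .
  qed
qed

section \<open>Polygonal interpolation and dyadic energies\<close>

definition clamp01 :: "real \<Rightarrow> real" where "clamp01 x = max 0 (min 1 x)"

text \<open>The polygon through the grid values, written as a sum of ramps: the \<open>k\<close>-th
  ramp rises on the \<open>k\<close>-th dyadic interval only. No case distinction over intervals
  enters, so continuity is immediate.\<close>

definition interp :: "nat \<Rightarrow> (real \<Rightarrow> 'h::real_normed_vector) \<Rightarrow> real \<Rightarrow> 'h" where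
  "interp n F t = F 0 + (\<Sum>k<2 ^ n. clamp01 (2 ^ n * t - real k) *\<^sub>R dinc F n k)"

lemma continuous_on_interp: "continuous_on S (interp n F)"
  unfolding interp_def clamp01_def by (intro continuous_intros)

lemma interp_dyadic:
  assumes "j \<le> 2 ^ n"
  shows "interp n F (real j / 2 ^ n) = F (real j / 2 ^ n)"
proof -
  have "(\<Sum>k<2 ^ n. clamp01 (2 ^ n * (real j / 2 ^ n) - real k) *\<^sub>R dinc F n k) = (\<Sum>k<j. dinc F n k)"
    using assms by (intro sum.mono_neutral_cong_right) (auto simp: clamp01_def)
  also have "\<dots> = F (real j / 2 ^ n) - F (real 0 / 2 ^ n)"
    unfolding dinc_def by (rule sum_lessThan_telescope)
  finally show ?thesis by (simp add: interp_def)
qed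

text \<open>A dyadic interval of level \<open>n + l\<close> lies in exactly one of level
  \<open>n\<close>; all other ramps are constant on it, and the active one climbs by
  \<open>1 / 2 ^ l\<close>.\<close>

lemma dinc_interp:
  assumes "j < 2 ^ n * 2 ^ l"
  shows "dinc (interp n F) (n + l) j = (1 / 2 ^ l) *\<^sub>R dinc F n (j div 2 ^ l)"
proof -
  define i where "i = j div 2 ^ l"
  have i: "i < 2 ^ n" using assms by (simp add: i_def less_mult_imp_div_less)
  have j: "i * 2 ^ l \<le> j" "Suc j \<le> Suc i * 2 ^ l"
    unfolding i_def by (simp_all add: Suc_le_eq dividend_less_div_times)
  have "real (i * 2 ^ l) \<le> real j" "real (Suc j) \<le> real (Suc i * 2 ^ l)"
    using j by (simp_all only: of_nat_le_iff)
  then have jr: "real i * 2 ^ l \<le> real j" "real j + 1 \<le> (real i + 1) * 2 ^ l"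
    by (simp_all add: algebra_simps)
  define a b where "a = real j / 2 ^ l" and "b = real (Suc j) / 2 ^ l"
  have ab: "real i \<le> a" "a \<le> b" "b \<le> real i + 1" "b - a = 1 / 2 ^ l"
    using jr by (simp_all add: a_def b_def field_simps divide_right_mono)
  have eq: "2 ^ n * (real (Suc j) / 2 ^ (n + l)) = b" "2 ^ n * (real j / 2 ^ (n + l)) = a"
    by (simp_all add: a_def b_def power_add)
  have "dinc (interp n F) (n + l) j = (\<Sum>k<2 ^ n. (clamp01 (b - real k) - clamp01 (a - real k)) *\<^sub>R dinc F n k)"
    unfolding dinc_def[of "interp n F"] interp_def eq by (simp add: sum_subtractf scaleR_diff_left)
  also have "\<dots> = (\<Sum>k\<in>{i}. (clamp01 (b - real k) - clamp01 (a - real k)) *\<^sub>R dinc F n k)"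
  proof (rule sum.mono_neutral_right)
    show "\<forall>k\<in>{..<2 ^ n} - {i}. (clamp01 (b - real k) - clamp01 (a - real k)) *\<^sub>R dinc F n k = 0"
    proof
      fix k assume "k \<in> {..<2 ^ n} - {i}"
      then consider "k + 1 \<le> i" | "i + 1 \<le> k" by force
      then show "(clamp01 (b - real k) - clamp01 (a - real k)) *\<^sub>R dinc F n k = 0"
      proof cases
        case 1
        then have "real k + 1 \<le> real i" by linarith
        with ab show ?thesis by (simp add: clamp01_def)
      next
        case 2
        then have "real i + 1 \<le> real k" by linarith
        with ab show ?thesis by (simp add: clamp01_def)
      qed
    qed
  qed (use i in auto)
  also have "\<dots> = (1 / 2 ^ l) *\<^sub>R dinc F n i"
  proof -
    have "clamp01 (b - real i) - clamp01 (a - real i) = 1 / 2 ^ l"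
      using ab by (simp add: clamp01_def)
    then show ?thesis by simp
  qed
  finally show ?thesis by (simp add: i_def)
qed

text \<open>Below level \<open>n\<close> the increments of the polygon halve at each level, while
  the tolerance shrinks only by \<open>2 powr - \<alpha>\<close>, which is at least
  \<open>1 / 2\<close>.\<close>

lemma dyadic_holder_interp:
  assumes \<alpha>: "\<alpha> \<le> 1" and F: "dyadic_holder \<alpha> n \<eta> F"
  shows "dyadic_holder \<alpha> n \<eta> (interp n F)"
  unfolding dyadic_holder_def
proof (intro allI impI)
  fix m k :: nat assume m: "n \<le> m" "k < 2 ^ m"
  then obtain l where l: "m = n + l" using le_Suc_ex by blast
  have k: "k < 2 ^ n * 2 ^ l" using m by (simp add: l power_add)
  have "norm (dinc (interp n F) m k) = (1 / 2) ^ l * norm (dinc F n (k div 2 ^ l))"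
    unfolding l dinc_interp[OF k] by (simp add: power_one_over)
  also have "\<dots> \<le> (2 powr - \<alpha>) ^ l * (\<eta> * (2 powr - \<alpha>) ^ n)"
  proof (intro mult_mono power_mono)
    have "(2::real) powr - 1 \<le> 2 powr - \<alpha>" using \<alpha> by (intro powr_mono) auto
    then show "1 / 2 \<le> (2::real) powr - \<alpha>" by (simp add: powr_minus_divide)
    show "norm (dinc F n (k div 2 ^ l)) \<le> \<eta> * (2 powr - \<alpha>) ^ n"
      using k by (intro dyadic_holderD[OF F]) (auto simp: less_mult_imp_div_less)
  qed auto
  also have "\<dots> = \<eta> * (2 powr - \<alpha>) ^ m" by (simp add: l power_add)
  finally show "norm (dinc (interp n F) m k) \<le> \<eta> * (2 powr - \<alpha>) ^ m" .
qed

lemma dinc_linear: "linear L \<Longrightarrow> dinc (\<lambda>t. L (F t)) m k = L (dinc F m k)"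
  by (simp add: dinc_def linear_diff)

lemma dyadic_holder_contraction:
  assumes "linear L" "\<And>x. norm (L x) \<le> norm x" "dyadic_holder \<alpha> n \<eta> F"
  shows "dyadic_holder \<alpha> n \<eta> (\<lambda>t. L (F t))"
  unfolding dyadic_holder_def dinc_linear[OF assms(1)]
  using dyadic_holderD[OF assms(3)] order_trans[OF assms(2)] by blast

context trace_operator
begin

text \<open>Half the energy is the rate of the polygonal interpolation at level \<open>n\<close> of the projection
  of \<open>F\<close> to the span of \<open>J\<close>.\<close>

definition energy :: "nat \<Rightarrow> 'h set \<Rightarrow> (real \<Rightarrow> 'h) \<Rightarrow> real" where
  "energy n J F = 2 ^ n * (\<Sum>k<2 ^ n. \<Sum>e\<in>J. (dinc F n k \<bullet> e)\<^sup>2 / lam e)"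

lemma energy_nonneg: "0 \<le> energy n J F"
  unfolding energy_def by (intro mult_nonneg_nonneg sum_nonneg divide_nonneg_nonneg lam_nonneg) auto

lemma dinc_Suc: "dinc F n k = dinc F (Suc n) (2 * k) + dinc F (Suc n) (Suc (2 * k))"
proof -
  have "real (Suc (Suc (2 * k))) / 2 ^ Suc n = real (Suc k) / 2 ^ n" "real (2 * k) / 2 ^ Suc n = real k / 2 ^ n"
    by (simp_all add: field_simps)
  then show ?thesis by (simp add: dinc_def del: of_nat_Suc power_Suc)
qed

text \<open>An increment is the sum of two finer ones, and the factor 2 in
  \<open>(a + b)\<^sup>2 \<le> 2 * (a\<^sup>2 + b\<^sup>2)\<close> is the one by which the prefactor
  \<open>2 ^ n\<close> grows.\<close>

lemma energy_Suc: "energy n J F \<le> energy (Suc n) J F"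
proof -
  have "(dinc F n k \<bullet> e)\<^sup>2 / lam e \<le>
      2 * ((dinc F (Suc n) (2 * k) \<bullet> e)\<^sup>2 / lam e + (dinc F (Suc n) (Suc (2 * k)) \<bullet> e)\<^sup>2 / lam e)" for k e
  proof -
    define a b where "a = dinc F (Suc n) (2 * k) \<bullet> e" and "b = dinc F (Suc n) (Suc (2 * k)) \<bullet> e"
    have "(a + b)\<^sup>2 \<le> 2 * (a\<^sup>2 + b\<^sup>2)"
      using sum_squares_bound[of a b] by (simp add: power2_sum)
    then have "(a + b)\<^sup>2 / lam e \<le> 2 * (a\<^sup>2 + b\<^sup>2) / lam e"
      by (rule divide_right_mono[OF _ lam_nonneg])
    then show ?thesis
      by (subst dinc_Suc) (simp add: a_def b_def inner_add_left add_divide_distrib)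
  qed
  then have "energy n J F \<le> 2 ^ n * (\<Sum>k<2 ^ n. \<Sum>e\<in>J.
      2 * ((dinc F (Suc n) (2 * k) \<bullet> e)\<^sup>2 / lam e + (dinc F (Suc n) (Suc (2 * k)) \<bullet> e)\<^sup>2 / lam e))"
    unfolding energy_def by (intro mult_left_mono sum_mono) auto
  also have "\<dots> = energy (Suc n) J F"
    unfolding energy_def power_Suc sum_pairs
    by (simp add: sum.distrib sum_distrib_left algebra_simps)
  finally show ?thesis .
qed

lemma energy_mono: "n \<le> m \<Longrightarrow> energy n J F \<le> energy m J F"
  by (rule lift_Suc_mono_le[of "\<lambda>n. energy n J F"]) (rule energy_Suc)

lemma energy_mono_set:
  assumes "finite J'" "J \<subseteq> J'"
  shows "energy n J F \<le> energy n J' F"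
  unfolding energy_def
  by (intro mult_left_mono sum_mono sum_mono2 assms divide_nonneg_nonneg lam_nonneg) auto

text \<open>Refinement replaces each increment by \<open>2 ^ l\<close> equal parts: the squares lose
  \<open>2 ^ (2 * l)\<close>, the number of parts and the prefactor each regain
  \<open>2 ^ l\<close>.\<close>

lemma energy_interp: "energy (n + l) J (interp n F) = energy n J F"
proof -
  have "energy (n + l) J (interp n F) = 2 ^ n * (\<Sum>k<2 ^ n * 2 ^ l. 2 ^ l * (\<Sum>e\<in>J. ((1 / 2 ^ l) * (dinc F n (k div 2 ^ l) \<bullet> e))\<^sup>2 / lam e))"
    unfolding energy_def power_add
    by (simp add: dinc_interp sum_distrib_left mult_ac)
  also have "\<dots> = 2 ^ n * (\<Sum>k<2 ^ n * 2 ^ l. (1 / 2 ^ l) * (\<Sum>e\<in>J. (dinc F n (k div 2 ^ l) \<bullet> e)\<^sup>2 / lam e))"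
    by (simp add: sum_distrib_left power_mult_distrib power2_eq_square)
  also have "(\<Sum>k<2 ^ n * 2 ^ l. (1 / 2 ^ l) * (\<Sum>e\<in>J. (dinc F n (k div 2 ^ l) \<bullet> e)\<^sup>2 / lam e)) =
      (\<Sum>i<2 ^ n. \<Sum>e\<in>J. (dinc F n i \<bullet> e)\<^sup>2 / lam e)"
    (is "(\<Sum>k<2 ^ n * 2 ^ l. ?c * ?g (k div 2 ^ l)) = _")
  proof -
    have "(\<Sum>k<N * 2 ^ l. ?c * ?g (k div 2 ^ l)) = (\<Sum>i<N. ?g i)" for N :: nat
    proof (induction N)
      case (Suc N)
      have "(\<Sum>k<Suc N * 2 ^ l. ?c * ?g (k div 2 ^ l)) =
          (\<Sum>k<N * 2 ^ l. ?c * ?g (k div 2 ^ l)) + (\<Sum>k\<in>{N * 2 ^ l..<Suc N * 2 ^ l}. ?c * ?g (k div 2 ^ l))"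
        by (subst sum.union_disjoint[symmetric]) (auto intro!: sum.cong)
      also have "(\<Sum>k\<in>{N * 2 ^ l..<Suc N * 2 ^ l}. ?c * ?g (k div 2 ^ l)) =
          (\<Sum>k\<in>{N * 2 ^ l..<Suc N * 2 ^ l}. ?c * ?g N)"
        proof (rule sum.cong[OF refl])
          fix k assume "k \<in> {N * 2 ^ l..<Suc N * 2 ^ l}"
          then have "k div 2 ^ l = N" by (intro div_nat_eqI) (auto simp: mult.commute)
          then show "?c * ?g (k div 2 ^ l) = ?c * ?g N" by simp
        qed
      also have "\<dots> = ?g N" by simp
      finally show ?case using Suc.IH by simp
    qed simp
    then show ?thesis .
  qed
  finally show ?thesis by (simp add: energy_def)
qed

definition approx :: "nat \<Rightarrow> 'h set \<Rightarrow> (real \<Rightarrow> 'h) \<Rightarrow> real \<Rightarrow> 'h" where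
  "approx n J F t = oproj J (interp n F t)"

text \<open>One energy of \<open>F\<close> controls all energies of its approximation: monotonicity
  lifts the level \<open>m\<close> to \<open>n + m\<close>, where the energy of a polygon no longer
  grows.\<close>

lemma energy_approx:
  assumes "finite J" "J \<subseteq> E" "finite J'" "J' \<subseteq> E"
  shows "energy m J' (approx n J F) \<le> energy n J F"
proof -
  have "dinc (approx n J F) m k \<bullet> e = (if e \<in> J then dinc (interp n F) m k \<bullet> e else 0)" if "e \<in> J'" for m k e
    unfolding approx_def dinc_linear[OF bounded_linear.linear[OF bounded_linear_oproj]]
    using assms that by (subst oproj_inner[OF E_orthonormal]) auto
  then have "energy m J' (approx n J F) = 2 ^ m * (\<Sum>k<2 ^ m. \<Sum>e\<in>J' \<inter> J. (dinc (interp n F) m k \<bullet> e)\<^sup>2 / lam e)"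
    unfolding energy_def using assms
    by (intro arg_cong[where f="(*) _"] sum.cong refl sum.mono_neutral_cong_right) auto
  also have "\<dots> = energy m (J' \<inter> J) (interp n F)" by (simp add: energy_def)
  also have "\<dots> \<le> energy m J (interp n F)" using assms by (intro energy_mono_set) auto
  also have "\<dots> \<le> energy (n + m) J (interp n F)" by (intro energy_mono) simp
  also have "\<dots> = energy n J F" by (rule energy_interp)
  finally show ?thesis .
qed

lemma dyadic_holder_approx:
  assumes J: "finite J" "J \<subseteq> E" and \<alpha>: "\<alpha> \<le> 1" and F: "dyadic_holder \<alpha> n \<eta> F"
    and close: "\<And>k. k \<le> 2 ^ n \<Longrightarrow> norm (F (real k / 2 ^ n) - oproj J (F (real k / 2 ^ n))) \<le> \<eta> * (1 / 2) ^ n"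
  shows "dyadic_holder \<alpha> 0 (2 * \<eta>) (\<lambda>t. F t - approx n J F t)"
proof (rule dyadic_holder_bucket[OF \<alpha> F])
  show "dyadic_holder \<alpha> n \<eta> (approx n J F)"
    unfolding approx_def[abs_def]
    by (rule dyadic_holder_contraction[OF bounded_linear.linear[OF bounded_linear_oproj]
          norm_oproj_le[OF E_orthonormal J] dyadic_holder_interp[OF \<alpha> F]])
  show "norm (F (real k / 2 ^ n) - approx n J F (real k / 2 ^ n)) \<le> \<eta> * (1 / 2) ^ n" if "k \<le> 2 ^ n" for k
    using close[OF that] by (simp add: approx_def interp_dyadic[OF that])
qed

end

section \<open>Paths with square integrable derivative in the reproducing space\<close>

abbreviation unit_lebesgue :: "real measure" where
  "unit_lebesgue \<equiv> restrict_space lborel {0..1}"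

lemma prob_space_unit_lebesgue: "prob_space unit_lebesgue"
  by (rule prob_spaceI) (simp add: space_restrict_space emeasure_restrict_space)

lemma nn_integral_unit: "(\<integral>\<^sup>+s. f s \<partial>unit_lebesgue) = (\<integral>\<^sup>+s\<in>{0..1}. f s \<partial>lborel)"
  by (simp add: nn_integral_restrict_space)

lemma nn_integral_fatou_bound:
  fixes f :: "nat \<Rightarrow> 'a \<Rightarrow> ennreal"
  assumes f: "\<And>j. f j \<in> borel_measurable M" and lim: "AE x in M. (\<lambda>j. f j x) \<longlonglongrightarrow> g x"
    and le: "\<And>j. j \<ge> N \<Longrightarrow> (\<integral>\<^sup>+x. f j x \<partial>M) \<le> C"
  shows "(\<integral>\<^sup>+x. g x \<partial>M) \<le> C"
proof -
  have "(\<integral>\<^sup>+x. g x \<partial>M) = (\<integral>\<^sup>+x. liminf (\<lambda>j. f j x) \<partial>M)"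
    by (rule nn_integral_cong_AE)
      (use lim in \<open>auto elim!: eventually_mono simp: lim_imp_Liminf\<close>)
  also have "\<dots> \<le> liminf (\<lambda>j. \<integral>\<^sup>+x. f j x \<partial>M)"
    by (rule nn_integral_liminf) (rule f)
  also have "\<dots> \<le> C"
    by (rule Liminf_le) (use le in \<open>auto simp: eventually_sequentially\<close>)
  finally show ?thesis .
qed

text \<open>Integrate \<open>norm (f x) \<le> c + 1 / c * (norm (f x))\<^sup>2\<close>. The two
  terms explain the factor 2 in place of the optimal constant 1.\<close>

lemma (in prob_space) nn_integral_norm_le_square:
  fixes f :: "'a \<Rightarrow> 'b::real_normed_vector"
  assumes f: "f \<in> borel_measurable M" and c: "c > 0"
    and le: "(\<integral>\<^sup>+x. ennreal ((norm (f x))\<^sup>2) \<partial>M) \<le> ennreal (c\<^sup>2)"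
  shows "(\<integral>\<^sup>+x. ennreal (norm (f x)) \<partial>M) \<le> ennreal (2 * c)"
proof -
  have "(\<integral>\<^sup>+x. ennreal (norm (f x)) \<partial>M) \<le> (\<integral>\<^sup>+x. (ennreal c + ennreal (1 / c) * ennreal ((norm (f x))\<^sup>2)) \<partial>M)"
  proof (rule nn_integral_mono)
    fix x
    have "norm (f x) \<le> c + 1 / c * (norm (f x))\<^sup>2"
    proof (cases "norm (f x) \<le> c")
      case True
      have "0 \<le> 1 / c * (norm (f x))\<^sup>2" using c by simp
      with True show ?thesis by linarith
    next
      case False
      then have "c * norm (f x) \<le> norm (f x) * norm (f x)" by (intro mult_right_mono) auto
      then have "norm (f x) \<le> 1 / c * (norm (f x))\<^sup>2" using c by (simp add: field_simps power2_eq_square)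
      with c show ?thesis by linarith
    qed
    then show "ennreal (norm (f x)) \<le> ennreal c + ennreal (1 / c) * ennreal ((norm (f x))\<^sup>2)"
      using c by (simp add: ennreal_leI flip: ennreal_mult ennreal_plus)
  qed
  also have "\<dots> = ennreal c + ennreal (1 / c) * (\<integral>\<^sup>+x. ennreal ((norm (f x))\<^sup>2) \<partial>M)"
    using f by (subst nn_integral_add) (auto simp: nn_integral_cmult emeasure_space_1)
  also have "\<dots> \<le> ennreal c + ennreal (1 / c) * ennreal (c\<^sup>2)"
    by (intro add_mono mult_left_mono le) auto
  also have "\<dots> = ennreal (2 * c)"
    using c by (simp add: power2_eq_square flip: ennreal_mult ennreal_plus)
  finally show ?thesis .
qed

text \<open>The geometric rate makes the mean distances of neighbours summable, so the sequence
  converges almost everywhere; Fatou transfers both bounds to the limit. An \<open>L\<^sup>1\<close>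
  distance in the conclusion is what the convergence of integrals calls for.\<close>

lemma (in prob_space) L2_complete:
  fixes V :: "nat \<Rightarrow> 'a \<Rightarrow> 'b::{banach,second_countable_topology}"
  assumes V: "\<And>i. V i \<in> borel_measurable M"
    and cauchy: "\<And>i j. i \<le> j \<Longrightarrow> (\<integral>\<^sup>+x. ennreal ((norm (V j x - V i x))\<^sup>2) \<partial>M) \<le> ennreal (((1 / 2) ^ i)\<^sup>2)"
    and bound: "\<And>i. (\<integral>\<^sup>+x. ennreal ((norm (V i x))\<^sup>2) \<partial>M) \<le> K"
  obtains W where "W \<in> borel_measurable M" "(\<integral>\<^sup>+x. ennreal ((norm (W x))\<^sup>2) \<partial>M) \<le> K"
    "\<And>i. (\<integral>\<^sup>+x. ennreal (norm (W x - V i x)) \<partial>M) \<le> ennreal (2 * (1 / 2) ^ i)"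
proof -
  note V[measurable]
  have L1: "(\<integral>\<^sup>+x. ennreal (norm (V j x - V i x)) \<partial>M) \<le> ennreal (2 * (1 / 2) ^ i)" if "i \<le> j" for i j
    by (rule nn_integral_norm_le_square) (use cauchy[OF that] in auto)
  \<comment> \<open>Where the sequence diverges \<open>lim\<close> is an unspecified value; this
    happens on a null set only, and \<open>W\<close> is measurable in any case.\<close>
  define W where "W x = lim (\<lambda>i. V i x)" for x
  have W[measurable]: "W \<in> borel_measurable M"
    unfolding W_def by measurable
  have "(\<integral>\<^sup>+x. (\<Sum>i. ennreal (norm (V (Suc i) x - V i x))) \<partial>M) = (\<Sum>i. \<integral>\<^sup>+x. ennreal (norm (V (Suc i) x - V i x)) \<partial>M)"
    by (rule nn_integral_suminf) simp
  also have "\<dots> \<le> (\<Sum>i. ennreal (2 * (1 / 2) ^ i))"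
    by (intro suminf_le L1) auto
  also have "\<dots> < \<infinity>"
  proof -
    have "summable (\<lambda>i. 2 * (1 / 2 :: real) ^ i)"
      by (intro summable_mult summable_geometric) simp
    then have "(\<Sum>i. ennreal (2 * (1 / 2) ^ i)) \<noteq> top"
      by (rule ennreal_suminf_neq_top) simp
    then show ?thesis
      by (simp only: infinity_ennreal_def less_top)
  qed
  finally have "AE x in M. (\<Sum>i. ennreal (norm (V (Suc i) x - V i x))) \<noteq> \<infinity>"
    by (intro nn_integral_PInf_AE) auto
  then have lim: "AE x in M. (\<lambda>i. V i x) \<longlonglongrightarrow> W x"
  proof (rule eventually_mono)
    fix x assume "(\<Sum>i. ennreal (norm (V (Suc i) x - V i x))) \<noteq> \<infinity>"
    then have "summable (\<lambda>i. norm (V (Suc i) x - V i x))"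
      by (intro summable_suminf_not_top) auto
    then have "summable (\<lambda>i. V (Suc i) x - V i x)"
      by (rule summable_norm_cancel)
    then have "(\<lambda>n. \<Sum>i<n. V (Suc i) x - V i x) \<longlonglongrightarrow> (\<Sum>i. V (Suc i) x - V i x)"
      by (rule summable_LIMSEQ)
    then have "(\<lambda>n. V n x - V 0 x) \<longlonglongrightarrow> (\<Sum>i. V (Suc i) x - V i x)"
      unfolding sum_lessThan_telescope[of "\<lambda>i. V i x"] .
    from tendsto_add[OF this tendsto_const[of "V 0 x"]] have "convergent (\<lambda>n. V n x)"
      by (auto simp: convergent_def)
    then show "(\<lambda>i. V i x) \<longlonglongrightarrow> W x"
      by (simp add: W_def convergent_LIMSEQ_iff)
  qed
  show thesis
  proof (rule that[OF W])
    show "(\<integral>\<^sup>+x. ennreal ((norm (W x))\<^sup>2) \<partial>M) \<le> K"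
      by (rule nn_integral_fatou_bound[where f = "\<lambda>j x. ennreal ((norm (V j x))\<^sup>2)" and N = 0])
        (use lim bound in \<open>auto elim!: eventually_mono intro!: tendsto_intros\<close>)
    show "(\<integral>\<^sup>+x. ennreal (norm (W x - V i x)) \<partial>M) \<le> ennreal (2 * (1 / 2) ^ i)" for i
      by (rule nn_integral_fatou_bound[where f = "\<lambda>j x. ennreal (norm (V j x - V i x))" and N = i])
        (use lim L1 in \<open>auto elim!: eventually_mono intro!: tendsto_intros\<close>)
  qed
qed

section \<open>Dyadic step functions and their integrals\<close>

definition dstep :: "nat \<Rightarrow> (nat \<Rightarrow> 'a::real_vector) \<Rightarrow> real \<Rightarrow> 'a" where
  "dstep n c s = (if 0 \<le> s \<and> s < 1 then c (dfloor n s) else 0)"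

lemma dfloor_eq_iff: "s \<ge> 0 \<Longrightarrow> dfloor n s = k \<longleftrightarrow> s \<in> {real k / 2 ^ n..<real (Suc k) / 2 ^ n}"
proof
  assume s: "s \<ge> 0" and "dfloor n s = k"
  with dfloor_bounds[OF s, of n] show "s \<in> {real k / 2 ^ n..<real (Suc k) / 2 ^ n}"
    by (simp add: field_simps)
next
  assume s: "s \<ge> 0" and "s \<in> {real k / 2 ^ n..<real (Suc k) / 2 ^ n}"
  then have "real k \<le> 2 ^ n * s" "2 ^ n * s < real k + 1"
    by (simp_all add: field_simps)
  then have "\<lfloor>2 ^ n * s\<rfloor> = int k" by linarith
  then show "dfloor n s = k" by (simp add: dfloor_def)
qed

lemma dfloor_less: "0 \<le> s \<Longrightarrow> s < 1 \<Longrightarrow> dfloor n s < 2 ^ n"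
proof -
  assume s: "0 \<le> s" "s < 1"
  have "real (dfloor n s) \<le> 2 ^ n * s" using dfloor_bounds(1)[OF s(1)] .
  also have "\<dots> < real (2 ^ n)" using s by simp
  finally show ?thesis by (simp only: of_nat_less_iff)
qed

lemma dfloor_div: "0 \<le> s \<Longrightarrow> dfloor (n + l) s div 2 ^ l = dfloor n s"
proof (induction l)
  case (Suc l)
  have "dfloor (n + Suc l) s div 2 ^ Suc l = dfloor (Suc (n + l)) s div 2 div 2 ^ l"
    by (simp add: div_mult2_eq)
  also have "dfloor (Suc (n + l)) s div 2 = dfloor (n + l) s"
    using dfloor_Suc[OF Suc.prems, of "n + l"] by auto
  finally show ?case using Suc by simp
qed simp

lemma dstep_eq_sum:
  "dstep n c s = (\<Sum>k<2 ^ n. indicat_real {real k / 2 ^ n..<real (Suc k) / 2 ^ n} s *\<^sub>R c k)"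
proof (cases "0 \<le> s \<and> s < 1")
  case True
  then have "(\<Sum>k<2 ^ n. indicat_real {real k / 2 ^ n..<real (Suc k) / 2 ^ n} s *\<^sub>R c k) =
      (\<Sum>k<2 ^ n. if k = dfloor n s then c k else 0)"
    unfolding indicator_def dfloor_eq_iff[OF conjunct1[OF True], symmetric]
    by (intro sum.cong refl) auto
  with True show ?thesis by (simp add: dstep_def dfloor_less)
next
  case False
  have "indicat_real {real k / 2 ^ n..<real (Suc k) / 2 ^ n} s = 0" if "k < 2 ^ n" for k
  proof -
    have "0 \<le> real k / 2 ^ n" "real (Suc k) / 2 ^ n \<le> 1"
      using dyadic_mem[of k n] dyadic_mem[of "Suc k" n] that by auto
    with False have "\<not> (real k / 2 ^ n \<le> s \<and> s < real (Suc k) / 2 ^ n)" by linarith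
    then show ?thesis by (simp del: of_nat_Suc)
  qed
  then have "(\<Sum>k<2 ^ n. indicat_real {real k / 2 ^ n..<real (Suc k) / 2 ^ n} s *\<^sub>R c k) = 0"
    by (intro sum.neutral) (simp del: of_nat_Suc)
  moreover have "dstep n c s = 0" using False by (auto simp: dstep_def)
  ultimately show ?thesis by (simp only:)
qed

lemma measurable_dstep[measurable]:
  fixes c :: "nat \<Rightarrow> 'a::{real_normed_vector,second_countable_topology}"
  shows "dstep n c \<in> borel_measurable lborel"
  unfolding dstep_eq_sum by measurable

lemma nn_integral_dstep:
  fixes c :: "nat \<Rightarrow> real"
  assumes c: "\<And>k. 0 \<le> c k"
  shows "(\<integral>\<^sup>+s. ennreal (dstep n c s) \<partial>unit_lebesgue) = ennreal ((\<Sum>k<2 ^ n. c k) / 2 ^ n)"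
proof -
  have "(\<integral>\<^sup>+s. ennreal (dstep n c s) \<partial>unit_lebesgue) = (\<integral>\<^sup>+s. ennreal (dstep n c s) \<partial>lborel)"
    unfolding nn_integral_unit by (intro nn_integral_cong) (auto simp: dstep_def indicator_def)
  also have "\<dots> = (\<integral>\<^sup>+s. (\<Sum>k<2 ^ n. ennreal (c k) * indicator {real k / 2 ^ n..<real (Suc k) / 2 ^ n} s) \<partial>lborel)"
    unfolding dstep_eq_sum
    by (intro nn_integral_cong) (auto simp: c indicator_def sum_ennreal[symmetric] simp del: sum_ennreal intro!: sum.cong)
  also have "\<dots> = (\<Sum>k<2 ^ n. ennreal (c k) * ennreal (1 / 2 ^ n))"
  proof -
    have "emeasure lborel {real k / 2 ^ n..<real (Suc k) / 2 ^ n} = ennreal (1 / 2 ^ n)" for k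
      by (simp add: divide_right_mono diff_divide_distrib[symmetric])
    then show ?thesis
      by (subst nn_integral_sum) (auto simp: nn_integral_cmult_indicator simp del: of_nat_Suc)
  qed
  also have "\<dots> = ennreal ((\<Sum>k<2 ^ n. c k) / 2 ^ n)"
    using c by (simp add: sum_divide_distrib flip: ennreal_mult)
  finally show ?thesis .
qed

lemma set_integral_dstep:
  fixes c :: "nat \<Rightarrow> real"
  assumes j: "j \<le> 2 ^ n"
  shows "(LINT s:{0..real j / 2 ^ n}|lborel. dstep n c s) = (\<Sum>k<j. c k / 2 ^ n)"
proof -
  let ?I = "\<lambda>k. {real k / 2 ^ n..<real (Suc k) / 2 ^ n}" and ?T = "{0..real j / 2 ^ n}"
  have fin: "emeasure lborel (?I k \<inter> ?T) < \<infinity>" for k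
    by (rule le_less_trans[OF emeasure_mono[of _ "?I k"]]) (auto simp: divide_right_mono)
  have "(LINT s:?T|lborel. dstep n c s) = (LINT s|lborel. (\<Sum>k<2 ^ n. indicat_real (?I k \<inter> ?T) s * c k))"
    unfolding set_lebesgue_integral_def dstep_eq_sum
    by (intro Bochner_Integration.integral_cong refl) (simp only: real_scaleR_def sum_distrib_left indicator_inter_arith mult_ac)
  also have "\<dots> = (\<Sum>k<2 ^ n. measure lborel (?I k \<inter> ?T) * c k)"
    using fin by (subst Bochner_Integration.integral_sum) auto
  also have "\<dots> = (\<Sum>k<j. c k / 2 ^ n)"
  proof (rule sum.mono_neutral_cong_right)
    show "\<forall>k\<in>{..<2 ^ n} - {..<j}. measure lborel (?I k \<inter> ?T) * c k = 0"
    proof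
      fix k assume "k \<in> {..<2 ^ n} - {..<j}"
      then have "real j \<le> real k" by simp
      then have "real j / 2 ^ n \<le> real k / 2 ^ n" by (simp add: divide_right_mono)
      then have "?I k \<inter> ?T \<subseteq> {real j / 2 ^ n}" by auto
      then have "emeasure lborel (?I k \<inter> ?T) \<le> emeasure lborel {real j / 2 ^ n}"
        by (rule emeasure_mono) simp
      then show "measure lborel (?I k \<inter> ?T) * c k = 0" by (simp add: measure_def)
    qed
    fix k assume "k \<in> {..<j}"
    then have "real (Suc k) \<le> real j" by simp
    then have "real (Suc k) / 2 ^ n \<le> real j / 2 ^ n" by (rule divide_right_mono) simp
    then have "?I k \<inter> ?T = ?I k" by (auto simp: le_less_trans) (meson divide_nonneg_nonneg of_nat_0_le_iff order_trans zero_le_numeral zero_le_power)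
    moreover have "measure lborel (?I k) = 1 / 2 ^ n"
      by (simp add: divide_right_mono diff_divide_distrib[symmetric])
    ultimately show "measure lborel (?I k \<inter> ?T) * c k = c k / 2 ^ n" by simp
  qed (use j in auto)
  finally show ?thesis .
qed

lemma sum_blocks:
  fixes h :: "nat \<Rightarrow> nat \<Rightarrow> 'a::comm_monoid_add"
  shows "(\<Sum>j<N * 2 ^ l. h j (j div 2 ^ l)) = (\<Sum>i<N. \<Sum>j\<in>{i * 2 ^ l..<i * 2 ^ l + 2 ^ l}. h j i)"
  unfolding sum.nat_group[symmetric]
proof (intro sum.cong refl)
  fix i j :: nat assume "j \<in> {i * 2 ^ l..<i * 2 ^ l + 2 ^ l}"
  then have "j div 2 ^ l = i" by (intro div_nat_eqI) (auto simp: mult.commute)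
  then show "h j (j div 2 ^ l) = h j i" by simp
qed

lemma dinc_block: "(\<Sum>j\<in>{i * 2 ^ l..<i * 2 ^ l + 2 ^ l}. dinc F (n + l) j) = dinc F n i"
proof -
  have "(\<Sum>j\<in>{i * 2 ^ l..<i * 2 ^ l + 2 ^ l}. dinc F (n + l) j) =
      F (real (i * 2 ^ l + 2 ^ l) / 2 ^ (n + l)) - F (real (i * 2 ^ l) / 2 ^ (n + l))"
    unfolding dinc_def by (rule sum_Suc_diff') simp
  moreover have "real (i * 2 ^ l + 2 ^ l) / 2 ^ (n + l) = real (Suc i) / 2 ^ n"
      "real (i * 2 ^ l) / 2 ^ (n + l) = real i / 2 ^ n"
    by (simp_all add: power_add field_simps)
  ultimately show ?thesis by (simp add: dinc_def)
qed

lemma continuous_dyadic_eqI: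
  fixes f g :: "real \<Rightarrow> 'a::t2_space"
  assumes "continuous_on {0..1} f" "continuous_on {0..1} g"
    and eq: "\<And>n k. k \<le> 2 ^ n \<Longrightarrow> f (real k / 2 ^ n) = g (real k / 2 ^ n)" and t: "t \<in> {0..1}"
  shows "f t = g t"
proof -
  have t': "0 \<le> t" "t \<le> 1" using t by auto
  have mem: "eventually (\<lambda>j. real (dfloor j t) / 2 ^ j \<in> {0..1}) sequentially"
    using dyadic_mem[OF dfloor_le[OF t']] by simp
  have "(\<lambda>j. f (real (dfloor j t) / 2 ^ j)) \<longlonglongrightarrow> f t" "(\<lambda>j. g (real (dfloor j t) / 2 ^ j)) \<longlonglongrightarrow> g t"
    using continuous_on_tendsto_compose[OF assms(1) dfloor_tendsto[OF t'(1)] t mem]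
      continuous_on_tendsto_compose[OF assms(2) dfloor_tendsto[OF t'(1)] t mem] by auto
  moreover have "f (real (dfloor j t) / 2 ^ j) = g (real (dfloor j t) / 2 ^ j)" for j
    using dfloor_le[OF t'] by (rule eq)
  ultimately show ?thesis by (simp add: LIMSEQ_unique)
qed

text \<open>The integral of the squared deviation of \<open>f\<close> from its mean \<open>c\<close>
  is nonnegative.\<close>

lemma set_integral_cauchy_schwarz:
  fixes f :: "real \<Rightarrow> real"
  assumes ab: "a < b" and f: "set_integrable lborel {a<..b} f" and f2: "set_integrable lborel {a<..b} (\<lambda>s. (f s)\<^sup>2)"
  shows "(LINT s:{a<..b}|lborel. f s)\<^sup>2 \<le> (b - a) * (LINT s:{a<..b}|lborel. (f s)\<^sup>2)"
proof -
  define I where "I = (LINT s:{a<..b}|lborel. f s)"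
  define c where "c = I / (b - a)"
  have const: "set_integrable lborel {a<..b} (\<lambda>s. x :: real)" for x
    using ab by (simp add: set_integrable_def)
  have intc: "(LINT s:{a<..b}|lborel. x) = x * (b - a)" for x :: real
    using ab by (simp add: set_lebesgue_integral_def)
  have "0 \<le> (LINT s:{a<..b}|lborel. (f s - c)\<^sup>2)"
    unfolding set_lebesgue_integral_def by (rule integral_nonneg_AE) (simp add: indicator_def)
  also have "\<dots> = (LINT s:{a<..b}|lborel. (f s)\<^sup>2 - (2 * c) * f s + c\<^sup>2)"
    by (simp add: power2_diff algebra_simps)
  also have "\<dots> = (LINT s:{a<..b}|lborel. (f s)\<^sup>2) - 2 * c * I + c\<^sup>2 * (b - a)"
    using f f2 const by (simp add: set_integral_add set_integral_diff set_integrable_mult_right intc I_def)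
  also have "\<dots> = (LINT s:{a<..b}|lborel. (f s)\<^sup>2) - I\<^sup>2 / (b - a)"
  proof -
    have "c * (b - a) = I" using ab by (simp add: c_def)
    then have "c\<^sup>2 * (b - a) = c * I" by (simp add: power2_eq_square mult.assoc)
    moreover have "c * I = I\<^sup>2 / (b - a)" by (simp add: c_def power2_eq_square)
    ultimately show ?thesis by simp
  qed
  finally show ?thesis
    using ab by (simp add: I_def field_simps)
qed

lemma set_integral_Ioc:
  fixes f :: "real \<Rightarrow> 'a::{banach,second_countable_topology}"
  assumes f: "set_integrable lborel {0..1} f" and ab: "0 \<le> a" "a \<le> b" "b \<le> 1"
  shows "(LINT s:{0..b}|lborel. f s) - (LINT s:{0..a}|lborel. f s) = (LINT s:{a<..b}|lborel. f s)"
proof -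
  have "{0..b} = {0..a} \<union> {a<..b}" using ab by auto
  then have "(LINT s:{0..b}|lborel. f s) = (LINT s:{0..a}|lborel. f s) + (LINT s:{a<..b}|lborel. f s)"
    using ab by (simp only:) (intro set_integral_Un set_integrable_subset[OF f]; auto)
  then show ?thesis by simp
qed

lemma space_borel_of: "space (borel_of X) = topspace X"
  by (simp add: borel_of_def space_measure_of_conv)

lemma sets_borel_of: "sets (borel_of X) = sigma_sets (topspace X) {U. openin X U}"
  unfolding borel_of_def using openin_subset by (subst sets_measure_of) auto

lemma openin_borel_of: "openin X U \<Longrightarrow> U \<in> sets (borel_of X)"
  by (simp add: sets_borel_of)

lemma measurable_borel_ofI:
  assumes "\<And>x. x \<in> space M \<Longrightarrow> f x \<in> topspace X"
    and "\<And>U. openin X U \<Longrightarrow> f -` U \<inter> space M \<in> sets M"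
  shows "f \<in> measurable M (borel_of X)"
  unfolding borel_of_def
  by (rule measurable_measure_of) (use assms in \<open>auto dest: openin_subset[THEN subsetD]\<close>)

section \<open>The reproducing space, and energies of indefinite integrals\<close>

context trace_operator
begin

lemma H0_carrier_diff: "x \<in> H0_carrier Q \<Longrightarrow> y \<in> H0_carrier Q \<Longrightarrow> x - y \<in> H0_carrier Q"
  unfolding H0_carrier_eq
  by (metis (no_types, lifting) bounded_linear.linear[OF bounded_linear_R] linear_diff rangeE rangeI)

lemma pinv_diff:
  assumes "x \<in> H0_carrier Q" "y \<in> H0_carrier Q"
  shows "op_pinv R (x - y) = op_pinv R x - op_pinv R y"
proof -
  obtain a b where ab: "x = R a" "y = R b" using assms by (auto simp: H0_carrier_eq)
  have "x - y = R (a - b)" by (simp add: ab linear_diff[OF bounded_linear.linear[OF bounded_linear_R]])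
  then show ?thesis
    by (intro E_eqI) (simp add: ab pinv_R_inner inner_diff_left)
qed

text \<open>Outside the carrier both sides are the same junk value, so symmetry needs no hypothesis.\<close>

lemma H0_norm_minus: "H0_norm Q (- x) = H0_norm Q x"
proof (cases "x \<in> H0_carrier Q")
  case True
  then obtain z where z: "x = R z" by (auto simp: H0_carrier_eq)
  have "- x = R (- z)" by (simp add: z linear_neg[OF bounded_linear.linear[OF bounded_linear_R]])
  then have "op_pinv R (- x) = - op_pinv R x"
    by (intro E_eqI) (simp add: z pinv_R_inner)
  then show ?thesis by (simp add: H0_norm_eq)
next
  case False
  have "R y \<noteq> x \<and> R y \<noteq> - x" for y
  proof
    show "R y \<noteq> x" using False by (auto simp: H0_carrier_eq)
    show "R y \<noteq> - x"
    proof
      assume "R y = - x"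
      then have "x = R (- y)" by (simp add: linear_neg[OF bounded_linear.linear[OF bounded_linear_R]])
      with False show False by (simp add: H0_carrier_eq)
    qed
  qed
  then have "op_pinv R (- x) = op_pinv R x" by (simp add: op_pinv_def)
  then show ?thesis by (simp add: H0_norm_eq)
qed

lemma H0_metric: "Metric_space (H0_carrier Q) (\<lambda>x y. H0_norm Q (x - y))"
proof
  fix x y z
  show "0 \<le> H0_norm Q (x - y)" by (simp add: H0_norm_eq)
  show "H0_norm Q (x - y) = H0_norm Q (y - x)"
    using H0_norm_minus[of "x - y"] by simp
  show "H0_norm Q (x - z) \<le> H0_norm Q (x - y) + H0_norm Q (y - z)"
    if "x \<in> H0_carrier Q" "y \<in> H0_carrier Q" "z \<in> H0_carrier Q"
    using that norm_triangle_ineq[of "op_pinv R x - op_pinv R y" "op_pinv R y - op_pinv R z"]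
    by (simp add: H0_norm_eq pinv_diff)
  show "H0_norm Q (x - y) = 0 \<longleftrightarrow> x = y" if xy: "x \<in> H0_carrier Q" "y \<in> H0_carrier Q"
  proof
    assume "H0_norm Q (x - y) = 0"
    then have "op_pinv R x = op_pinv R y" using xy by (simp add: H0_norm_eq pinv_diff)
    then show "x = y" using xy R_pinv_R by (auto simp: H0_carrier_eq) metis
  qed (use pinv_diff[OF xy(1) xy(1)] in \<open>simp add: H0_norm_eq\<close>)
qed

lemma topspace_H0: "topspace (H0_topology Q) = H0_carrier Q"
  by (simp add: H0_topology_def Metric_space.topspace_mtopology[OF H0_metric])

lemma openin_H0_iff:
  "openin (H0_topology Q) O' \<longleftrightarrow>
    O' \<subseteq> H0_carrier Q \<and> (\<forall>x\<in>O'. \<exists>r>0. \<forall>y\<in>H0_carrier Q. H0_norm Q (x - y) < r \<longrightarrow> y \<in> O')"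
  unfolding H0_topology_def Metric_space.openin_mtopology[OF H0_metric]
    subset_iff Metric_space.in_mball[OF H0_metric] by blast

text \<open>Members of \<open>L2_H0\<close> are measurable for the topology of the reproducing
  space, whereas the Bochner integral lives in the ambient space. The embedding and
  \<open>H0_norm Q\<close> are both Lipschitz, so one lemma covers both.\<close>

lemma measurable_H0_lipschitz:
  fixes g :: "'h \<Rightarrow> 'b::metric_space"
  assumes U: "U \<in> measurable M (borel_of (H0_topology Q))"
    and g: "\<And>x y. x \<in> H0_carrier Q \<Longrightarrow> y \<in> H0_carrier Q \<Longrightarrow> dist (g x) (g y) \<le> K * H0_norm Q (x - y)"
  shows "(\<lambda>s. g (U s)) \<in> borel_measurable M"
proof (rule borel_measurableI)
  fix S :: "'b set" assume S: "open S"
  \<comment> \<open>A strictly positive constant is wanted, since the radius of the ball below is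
    \<open>e\<close> divided by it.\<close>
  have K: "dist (g x) (g y) \<le> (\<bar>K\<bar> + 1) * H0_norm Q (x - y)" if "x \<in> H0_carrier Q" "y \<in> H0_carrier Q" for x y
    using g[OF that] by (rule order_trans) (auto simp: H0_norm_eq intro!: mult_right_mono)
  have "openin (H0_topology Q) {x \<in> H0_carrier Q. g x \<in> S}"
    unfolding openin_H0_iff
  proof (intro conjI ballI)
    fix x assume x: "x \<in> {x \<in> H0_carrier Q. g x \<in> S}"
    then obtain e where e: "e > 0" "\<And>z. dist z (g x) < e \<Longrightarrow> z \<in> S"
      using S unfolding open_dist by blast
    show "\<exists>r>0. \<forall>y\<in>H0_carrier Q. H0_norm Q (x - y) < r \<longrightarrow> y \<in> {x \<in> H0_carrier Q. g x \<in> S}"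
    proof (intro exI[of _ "e / (\<bar>K\<bar> + 1)"] conjI ballI impI)
      fix y assume y: "y \<in> H0_carrier Q" "H0_norm Q (x - y) < e / (\<bar>K\<bar> + 1)"
      have "dist (g y) (g x) \<le> (\<bar>K\<bar> + 1) * H0_norm Q (x - y)"
        using K[of x y] x y by (simp add: dist_commute)
      also have "\<dots> < e" using y(2) by (simp add: pos_less_divide_eq mult.commute add_nonneg_pos)
      finally show "y \<in> {x \<in> H0_carrier Q. g x \<in> S}" using y e by simp
    qed (use e in \<open>simp add: add_nonneg_pos\<close>)
  qed auto
  then have "{x \<in> H0_carrier Q. g x \<in> S} \<in> sets (borel_of (H0_topology Q))"
    by (rule openin_borel_of)
  from measurable_sets[OF U this]
  have "U -` {x \<in> H0_carrier Q. g x \<in> S} \<inter> space M \<in> sets M" .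
  moreover have "U -` {x \<in> H0_carrier Q. g x \<in> S} \<inter> space M = (\<lambda>s. g (U s)) -` S \<inter> space M"
    using measurable_space[OF U] by (auto simp: space_borel_of topspace_H0)
  ultimately show "(\<lambda>s. g (U s)) -` S \<inter> space M \<in> sets M" by simp
qed

lemma L2_H0D:
  assumes "U \<in> L2_H0 Q"
  shows L2_H0_carrier: "\<And>s. s \<in> {0..1} \<Longrightarrow> U s \<in> H0_carrier Q"
    and L2_H0_integrable: "set_integrable lborel {0..1} U"
    and L2_H0_square: "e \<in> E \<Longrightarrow> set_integrable lborel {0..1} (\<lambda>s. (U s \<bullet> e)\<^sup>2)"
proof -
  have U: "U \<in> measurable unit_lebesgue (borel_of (H0_topology Q))"
    and fin: "(\<integral>\<^sup>+s. ennreal ((H0_norm Q (U s))\<^sup>2) \<partial>unit_lebesgue) < \<infinity>"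
    using assms by (auto simp: L2_H0_def nn_integral_unit)
  interpret prob_space unit_lebesgue by (rule prob_space_unit_lebesgue)
  show car: "\<And>s. s \<in> {0..1} \<Longrightarrow> U s \<in> H0_carrier Q"
    using measurable_space[OF U] by (simp add: space_borel_of topspace_H0 space_restrict_space)
  obtain K where K: "\<And>x. x \<in> H0_carrier Q \<Longrightarrow> norm x \<le> K * H0_norm Q x"
    using H0_norm_bound by blast
  have Um[measurable]: "U \<in> borel_measurable unit_lebesgue"
    by (rule measurable_H0_lipschitz[OF U, of "\<lambda>x. x" K]) (use K H0_carrier_diff in \<open>auto simp: dist_norm\<close>)
  have Nm[measurable]: "(\<lambda>s. H0_norm Q (U s)) \<in> borel_measurable unit_lebesgue"
  proof (rule measurable_H0_lipschitz[OF U, of _ 1])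
    fix x y assume "x \<in> H0_carrier Q" "y \<in> H0_carrier Q"
    then show "dist (H0_norm Q x) (H0_norm Q y) \<le> 1 * H0_norm Q (x - y)"
      by (simp add: H0_norm_eq pinv_diff dist_real_def norm_triangle_ineq3)
  qed
  have "(\<integral>\<^sup>+s. ennreal ((norm (U s))\<^sup>2) \<partial>unit_lebesgue) \<le> (\<integral>\<^sup>+s. ennreal (K\<^sup>2) * ennreal ((H0_norm Q (U s))\<^sup>2) \<partial>unit_lebesgue)"
  proof (rule nn_integral_mono)
    fix s assume "s \<in> space unit_lebesgue"
    then have "norm (U s) \<le> K * H0_norm Q (U s)" by (intro K car) (simp add: space_restrict_space)
    then have "(norm (U s))\<^sup>2 \<le> (K * H0_norm Q (U s))\<^sup>2" by (rule power_mono) simp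
    then show "ennreal ((norm (U s))\<^sup>2) \<le> ennreal (K\<^sup>2) * ennreal ((H0_norm Q (U s))\<^sup>2)"
      by (simp add: power_mult_distrib ennreal_leI flip: ennreal_mult)
  qed
  also have "\<dots> = ennreal (K\<^sup>2) * (\<integral>\<^sup>+s. ennreal ((H0_norm Q (U s))\<^sup>2) \<partial>unit_lebesgue)"
    by (rule nn_integral_cmult) simp
  also have "\<dots> < \<infinity>" using fin by (simp add: ennreal_mult_less_top)
  finally have sq: "(\<integral>\<^sup>+s. ennreal ((norm (U s))\<^sup>2) \<partial>unit_lebesgue) < \<infinity>" .
  define T where "T = enn2real (\<integral>\<^sup>+s. ennreal ((norm (U s))\<^sup>2) \<partial>unit_lebesgue)"
  have T: "(\<integral>\<^sup>+s. ennreal ((norm (U s))\<^sup>2) \<partial>unit_lebesgue) = ennreal T"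
    using sq by (simp add: T_def)
  have "0 \<le> T" by (simp add: T_def)
  \<comment> \<open>\<open>sqrt T\<close> may be 0, and \<open>nn_integral_norm_le_square\<close>
    asks for a positive root.\<close>
  then have "T \<le> (sqrt T + 1)\<^sup>2" by (simp add: power2_sum)
  then have "(\<integral>\<^sup>+s. ennreal (norm (U s)) \<partial>unit_lebesgue) \<le> ennreal (2 * (sqrt T + 1))"
    using \<open>0 \<le> T\<close> by (intro nn_integral_norm_le_square) (auto simp: T intro!: ennreal_leI add_nonneg_pos)
  then have "(\<integral>\<^sup>+s. ennreal (norm (U s)) \<partial>unit_lebesgue) < \<infinity>"
    by (rule le_less_trans) simp
  then have "integrable unit_lebesgue U"
    by (intro integrableI_bounded) auto
  then show "set_integrable lborel {0..1} U"
    by (simp add: integrable_restrict_space set_integrable_def)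
  show "set_integrable lborel {0..1} (\<lambda>s. (U s \<bullet> e)\<^sup>2)" if e: "e \<in> E"
  proof -
    have "(\<integral>\<^sup>+s. ennreal (norm ((U s \<bullet> e)\<^sup>2)) \<partial>unit_lebesgue) \<le> (\<integral>\<^sup>+s. ennreal ((norm (U s))\<^sup>2) \<partial>unit_lebesgue)"
    proof (intro nn_integral_mono ennreal_leI)
      fix s
      have "\<bar>U s \<bullet> e\<bar> \<le> norm (U s)"
        using Cauchy_Schwarz_ineq2[of "U s" e] E_norm[OF e] by simp
      then show "norm ((U s \<bullet> e)\<^sup>2) \<le> (norm (U s))\<^sup>2"
        using power_mono[of "\<bar>U s \<bullet> e\<bar>" "norm (U s)" 2] by simp
    qed
    also note sq
    finally have "integrable unit_lebesgue (\<lambda>s. (U s \<bullet> e)\<^sup>2)"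
      by (intro integrableI_bounded) auto
    then show ?thesis by (simp add: integrable_restrict_space set_integrable_def)
  qed
qed

lemma set_integrable_inner: "set_integrable M A U \<Longrightarrow> set_integrable M A (\<lambda>s. U s \<bullet> (e::'h))"
proof -
  assume "set_integrable M A U"
  then have "integrable M (\<lambda>s. (indicat_real A s *\<^sub>R U s) \<bullet> e)"
    unfolding set_integrable_def by (rule integrable_inner_left)
  then show ?thesis by (simp add: set_integrable_def)
qed

lemma set_integral_inner: "set_integrable M A U \<Longrightarrow> (LINT s:A|M. U s \<bullet> (e::'h)) = (LINT s:A|M. U s) \<bullet> e"
  unfolding set_integrable_def set_lebesgue_integral_def
  by (subst integral_inner_left[symmetric]) auto

text \<open>Cauchy-Schwarz on each dyadic interval costs its length \<open>1 / 2 ^ n\<close>, which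
  cancels the prefactor of the energy; the integrals \<open>p e\<close> of the squared coordinates
  then telescope over the grid, and \<open>H0_coords\<close> bounds the integrand pointwise.\<close>

lemma energy_le_integral:
  assumes U: "U \<in> L2_H0 Q" and F: "\<And>t. t \<in> {0..1} \<Longrightarrow> F t = (LINT s:{0..t}|lborel. U s)"
    and J: "finite J" "J \<subseteq> Ep"
  shows "ennreal (energy n J F) \<le> (\<integral>\<^sup>+s\<in>{0..1}. ennreal ((H0_norm Q (U s))\<^sup>2) \<partial>lborel)"
proof -
  note int = L2_H0_integrable[OF U]
  have JE: "e \<in> J \<Longrightarrow> e \<in> E" for e using J Ep_subset by auto
  define q where "q e = (LINT s:{0..1}|lborel. (U s \<bullet> e)\<^sup>2)" for e
  define p where "p e t = (LINT s:{0..t}|lborel. (U s \<bullet> e)\<^sup>2)" for e t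
  have step: "(dinc F n k \<bullet> e)\<^sup>2 \<le> (1 / 2 ^ n) * (p e (real (Suc k) / 2 ^ n) - p e (real k / 2 ^ n))"
    if e: "e \<in> J" and k: "k < 2 ^ n" for e k
  proof -
    define a b where "a = real k / 2 ^ n" and "b = real (Suc k) / 2 ^ n"
    have ab: "0 \<le> a" "a < b" "b \<le> 1" "b - a = 1 / 2 ^ n"
      using dyadic_mem[of k n] dyadic_mem[of "Suc k" n] k
      by (auto simp: a_def b_def divide_strict_right_mono diff_divide_distrib[symmetric])
    have intab: "set_integrable lborel {a<..b} (\<lambda>s. U s \<bullet> e)" "set_integrable lborel {a<..b} (\<lambda>s. (U s \<bullet> e)\<^sup>2)"
      using ab by (auto intro!: set_integrable_subset[OF set_integrable_inner[OF int]]
          set_integrable_subset[OF L2_H0_square[OF U JE[OF e]]])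
    have "F b \<bullet> e - F a \<bullet> e = (LINT s:{a<..b}|lborel. U s \<bullet> e)"
    proof -
      have "F t \<bullet> e = (LINT s:{0..t}|lborel. U s \<bullet> e)" if "t \<in> {0..1}" for t
        using that by (simp add: F set_integral_inner set_integrable_subset[OF int])
      then show ?thesis
        using ab set_integral_Ioc[OF set_integrable_inner[OF int], of a b e] by simp
    qed
    then have "(dinc F n k \<bullet> e)\<^sup>2 = (LINT s:{a<..b}|lborel. U s \<bullet> e)\<^sup>2"
      by (simp add: dinc_def inner_diff_left a_def b_def del: of_nat_Suc)
    also have "\<dots> \<le> (b - a) * (LINT s:{a<..b}|lborel. (U s \<bullet> e)\<^sup>2)"
      by (rule set_integral_cauchy_schwarz[OF ab(2) intab])
    also have "(LINT s:{a<..b}|lborel. (U s \<bullet> e)\<^sup>2) = p e b - p e a"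
      unfolding p_def using ab by (intro set_integral_Ioc[symmetric] L2_H0_square[OF U JE[OF e]]) auto
    finally show ?thesis using ab(4) by (simp add: a_def b_def del: of_nat_Suc)
  qed
  have p0: "0 \<le> p e t" for e t
    unfolding p_def set_lebesgue_integral_def by (rule integral_nonneg_AE) (simp add: indicator_def)
  have "energy n J F = 2 ^ n * (\<Sum>e\<in>J. \<Sum>k<2 ^ n. (dinc F n k \<bullet> e)\<^sup>2 / lam e)"
    unfolding energy_def by (subst sum.swap) (rule refl)
  also have "\<dots> \<le> 2 ^ n * (\<Sum>e\<in>J. \<Sum>k<2 ^ n. (1 / 2 ^ n) * (p e (real (Suc k) / 2 ^ n) - p e (real k / 2 ^ n)) / lam e)"
    by (intro mult_left_mono sum_mono divide_right_mono step lam_nonneg) auto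
  also have "\<dots> = (\<Sum>e\<in>J. (\<Sum>k<2 ^ n. p e (real (Suc k) / 2 ^ n) - p e (real k / 2 ^ n)) / lam e)"
    by (simp add: sum_distrib_left sum_divide_distrib del: of_nat_Suc)
  also have "\<dots> = (\<Sum>e\<in>J. (p e 1 - p e 0) / lam e)"
    by (subst sum_lessThan_telescope) simp
  also have "\<dots> \<le> (\<Sum>e\<in>J. p e 1 / lam e)"
    using p0 by (intro sum_mono divide_right_mono lam_nonneg) auto
  also have "\<dots> = (LINT s|unit_lebesgue. (\<Sum>e\<in>J. (U s \<bullet> e)\<^sup>2 / lam e))"
    using L2_H0_square[OF U JE]
    by (subst Bochner_Integration.integral_sum)
      (auto simp: p_def set_lebesgue_integral_def integral_restrict_space integrable_restrict_space set_integrable_def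
        simp flip: times_divide_eq_right)
  finally have "ennreal (energy n J F) \<le> ennreal (LINT s|unit_lebesgue. (\<Sum>e\<in>J. (U s \<bullet> e)\<^sup>2 / lam e))"
    by (rule ennreal_leI)
  also have "\<dots> = (\<integral>\<^sup>+s. ennreal (\<Sum>e\<in>J. (U s \<bullet> e)\<^sup>2 / lam e) \<partial>unit_lebesgue)"
  proof (rule nn_integral_eq_integral[symmetric])
    show "integrable unit_lebesgue (\<lambda>s. \<Sum>e\<in>J. (U s \<bullet> e)\<^sup>2 / lam e)"
      using L2_H0_square[OF U JE]
      by (intro Bochner_Integration.integrable_sum)
        (auto simp: integrable_restrict_space set_integrable_def simp flip: times_divide_eq_right)
  qed (auto intro!: sum_nonneg divide_nonneg_nonneg lam_nonneg)
  also have "\<dots> \<le> (\<integral>\<^sup>+s. ennreal ((H0_norm Q (U s))\<^sup>2) \<partial>unit_lebesgue)"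
    by (intro nn_integral_mono ennreal_leI H0_coords L2_H0_carrier[OF U] J) (simp add: space_restrict_space)
  finally show ?thesis by (simp add: nn_integral_unit)
qed

lemma null_coord_integral:
  assumes U: "U \<in> L2_H0 Q" and e: "e \<in> E - Ep" and t: "t \<in> {0..1}"
  shows "(LINT s:{0..t}|lborel. U s) \<bullet> e = 0"
proof -
  have "(LINT s:{0..t}|lborel. U s) \<bullet> e = (LINT s:{0..t}|lborel. U s \<bullet> e)"
    using t by (intro set_integral_inner[symmetric] set_integrable_subset[OF L2_H0_integrable[OF U]]) auto
  also have "\<dots> = (LINT s:{0..t}|lborel. 0)"
    using t H0_null_coord[OF L2_H0_carrier[OF U] e] by (intro set_lebesgue_integral_cong) auto
  finally show ?thesis by (simp add: set_lebesgue_integral_def)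
qed

text \<open>The energy bound holds for every competitor and so for the infimum. The vanishing of the
  kernel coordinates follows from the existence of one competitor, which a finite rate
  guarantees.\<close>

lemma schilder_rateD:
  assumes "schilder_rate Q F \<le> ennreal C" "C \<ge> 0"
  shows "\<And>n J. finite J \<Longrightarrow> J \<subseteq> Ep \<Longrightarrow> energy n J F \<le> 2 * C"
    and "\<And>t e. t \<in> {0..1} \<Longrightarrow> e \<in> E - Ep \<Longrightarrow> F t \<bullet> e = 0"
proof -
  let ?S = "{U \<in> L2_H0 Q. \<forall>t\<in>{0..1}. F t = (LINT s:{0..t}|lborel. U s)}"
  show "energy n J F \<le> 2 * C" if J: "finite J" "J \<subseteq> Ep" for n J
  proof -
    have "(1 / 2) * ennreal (energy n J F) \<le> schilder_rate Q F"
      unfolding schilder_rate_def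
      by (intro INF_greatest mult_left_mono energy_le_integral J) auto
    also note assms(1)
    finally have "(1 / 2) * ennreal (energy n J F) \<le> ennreal C" .
    moreover have "(1 / 2 :: ennreal) = ennreal (1 / 2)"
      by (metis divide_ennreal ennreal_1 ennreal_numeral zero_le_one zero_less_numeral)
    moreover have "ennreal (1 / 2) * ennreal (energy n J F) = ennreal (1 / 2 * energy n J F)"
      by (rule ennreal_mult[symmetric]) (simp_all add: energy_nonneg)
    ultimately have "ennreal (1 / 2 * energy n J F) \<le> ennreal C"
      by (simp only:)
    then have "1 / 2 * energy n J F \<le> C"
      by (simp only: ennreal_le_iff[OF assms(2)])
    then show ?thesis by simp
  qed
  have "?S \<noteq> {}"
  proof
    assume "?S = {}"
    then have "schilder_rate Q F = top" unfolding schilder_rate_def by (simp only: image_empty Inf_empty)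
    then show False using assms by (simp add: top_unique)
  qed
  then obtain U where U: "U \<in> L2_H0 Q" "\<And>t. t \<in> {0..1} \<Longrightarrow> F t = (LINT s:{0..t}|lborel. U s)" by blast
  show "F t \<bullet> e = 0" if "t \<in> {0..1}" "e \<in> E - Ep" for t e
    using null_coord_integral[OF U(1) that(2,1)] U(2)[OF that(1)] by simp
qed

end

section \<open>Recovering a density from bounded energies\<close>

context trace_operator
begin

text \<open>Finite sets exhausting \<open>Ep\<close>. Using the dyadic level as index refines time
  and coordinates along a single sequence.\<close>

definition Jn :: "nat \<Rightarrow> 'h set" where "Jn n = {e \<in> Ep. to_nat_on Ep e < n}"

lemma countable_Ep: "countable Ep"
  using countable_E Ep_subset by (rule countable_subset[rotated])

lemma finite_Jn: "finite (Jn n)"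
proof (rule inj_on_finite[of "to_nat_on Ep" _ "{..<n}"])
  show "inj_on (to_nat_on Ep) (Jn n)"
    using inj_on_to_nat_on[OF countable_Ep] by (rule inj_on_subset) (auto simp: Jn_def)
qed (auto simp: Jn_def)

lemma Jn_subset: "Jn n \<subseteq> Ep" and Jn_E: "Jn n \<subseteq> E" and Jn_mono: "n \<le> m \<Longrightarrow> Jn n \<subseteq> Jn m"
  by (auto simp: Jn_def Ep_def)

lemma Jn_cover: "e \<in> Ep \<Longrightarrow> e \<in> Jn (Suc (to_nat_on Ep e))"
  by (simp add: Jn_def)

text \<open>The difference quotient on the \<open>k\<close>-th interval pulled back by the square
  root \<open>R\<close>. Its norm in the ambient space is the \<open>H0_norm\<close> of the
  projected quotient, so the limit can be taken in an ordinary \<open>L\<^sup>2\<close>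
  space.\<close>

definition dslope :: "(real \<Rightarrow> 'h) \<Rightarrow> nat \<Rightarrow> nat \<Rightarrow> 'h" where
  "dslope F n k = (\<Sum>e\<in>Jn n. (2 ^ n * (dinc F n k \<bullet> e) / sqrt (lam e)) *\<^sub>R e)"

lemma dslope_inner:
  "e \<in> E \<Longrightarrow> dslope F n k \<bullet> e = (if e \<in> Jn n then 2 ^ n * (dinc F n k \<bullet> e) / sqrt (lam e) else 0)"
  unfolding dslope_def by (rule orthonormal_sum_inner[OF E_orthonormal finite_Jn Jn_E])

lemma dslope_dslope:
  assumes "n \<le> m"
  shows "dslope F m j \<bullet> dslope F n i = (\<Sum>e\<in>Jn n. 2 ^ m * 2 ^ n * ((dinc F m j \<bullet> e) * (dinc F n i \<bullet> e) / lam e))"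
  unfolding dslope_def[of F n i] inner_sum_right
proof (rule sum.cong[OF refl])
  fix e assume e: "e \<in> Jn n"
  then have "e \<in> Ep" "e \<in> Jn m" using Jn_mono[OF assms] Jn_subset by blast+
  then have e': "e \<in> E" "e \<in> Jn m" "lam e > 0" by (auto simp: Ep_def)
  then have "lam e = sqrt (lam e) * sqrt (lam e)" by simp
  with e' show "dslope F m j \<bullet> ((2 ^ n * (dinc F n i \<bullet> e) / sqrt (lam e)) *\<^sub>R e) =
      2 ^ m * 2 ^ n * ((dinc F m j \<bullet> e) * (dinc F n i \<bullet> e) / lam e)"
    by (simp add: dslope_inner)
qed

lemma sum_dslope: "(\<Sum>k<2 ^ n. (norm (dslope F n k))\<^sup>2) / 2 ^ n = energy n (Jn n) F"
proof -
  have "(norm (dslope F n k))\<^sup>2 = 2 ^ n * (2 ^ n * (\<Sum>e\<in>Jn n. (dinc F n k \<bullet> e)\<^sup>2 / lam e))" for k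
    unfolding power2_norm_eq_inner dslope_dslope[OF order_refl]
    by (simp add: sum_distrib_left power2_eq_square mult.assoc)
  then show ?thesis
    by (simp add: energy_def sum_distrib_left[symmetric])
qed

text \<open>The slopes form a martingale in the level, so their increments are orthogonal.\<close>

lemma sum_dslope_diff:
  "(\<Sum>j<2 ^ (n + l). (norm (dslope F (n + l) j - dslope F n (j div 2 ^ l)))\<^sup>2) / 2 ^ (n + l)
    = energy (n + l) (Jn (n + l)) F - energy n (Jn n) F"
proof -
  let ?B = "\<lambda>i. {i * 2 ^ l..<i * 2 ^ l + 2 ^ l :: nat}"
  have block: "(\<Sum>j\<in>?B i. (norm (dslope F (n + l) j - dslope F n i))\<^sup>2) =
      (\<Sum>j\<in>?B i. (norm (dslope F (n + l) j))\<^sup>2) - 2 ^ l * (norm (dslope F n i))\<^sup>2" for i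
  proof -
    have "(\<Sum>j\<in>?B i. dslope F (n + l) j \<bullet> dslope F n i) =
        (\<Sum>e\<in>Jn n. 2 ^ (n + l) * 2 ^ n * (((\<Sum>j\<in>?B i. dinc F (n + l) j) \<bullet> e) * (dinc F n i \<bullet> e) / lam e))"
      by (subst dslope_dslope, simp, subst sum.swap)
        (simp add: sum_distrib_left sum_distrib_right sum_divide_distrib inner_sum_left)
    also have "\<dots> = 2 ^ l * (\<Sum>e\<in>Jn n. 2 ^ n * 2 ^ n * ((dinc F n i \<bullet> e) * (dinc F n i \<bullet> e) / lam e))"
      unfolding dinc_block by (simp add: sum_distrib_left power_add mult_ac)
    also have "\<dots> = 2 ^ l * (norm (dslope F n i))\<^sup>2"
      by (simp add: power2_norm_eq_inner dslope_dslope)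
    finally have cross: "(\<Sum>j\<in>?B i. dslope F (n + l) j \<bullet> dslope F n i) = 2 ^ l * (norm (dslope F n i))\<^sup>2" .
    have "(norm (dslope F (n + l) j - dslope F n i))\<^sup>2 =
        (norm (dslope F (n + l) j))\<^sup>2 - 2 * (dslope F (n + l) j \<bullet> dslope F n i) + (norm (dslope F n i))\<^sup>2" for j
      by (simp add: power2_norm_eq_inner inner_diff_left inner_diff_right inner_commute)
    then have "(\<Sum>j\<in>?B i. (norm (dslope F (n + l) j - dslope F n i))\<^sup>2) =
        (\<Sum>j\<in>?B i. (norm (dslope F (n + l) j))\<^sup>2) - 2 * (\<Sum>j\<in>?B i. dslope F (n + l) j \<bullet> dslope F n i)
        + 2 ^ l * (norm (dslope F n i))\<^sup>2"
      by (simp add: sum.distrib sum_subtractf sum_distrib_left)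
    then show ?thesis by (simp add: cross)
  qed
  have "(\<Sum>j<2 ^ (n + l). (norm (dslope F (n + l) j - dslope F n (j div 2 ^ l)))\<^sup>2) =
      (\<Sum>i<2 ^ n. \<Sum>j\<in>?B i. (norm (dslope F (n + l) j - dslope F n i))\<^sup>2)"
    unfolding power_add by (rule sum_blocks)
  also have "\<dots> = (\<Sum>i<2 ^ n. \<Sum>j\<in>?B i. (norm (dslope F (n + l) j))\<^sup>2) - 2 ^ l * (\<Sum>i<2 ^ n. (norm (dslope F n i))\<^sup>2)"
    by (simp add: block sum_subtractf sum_distrib_left)
  also have "(\<Sum>i<2 ^ n. \<Sum>j\<in>?B i. (norm (dslope F (n + l) j))\<^sup>2) = (\<Sum>j<2 ^ (n + l). (norm (dslope F (n + l) j))\<^sup>2)"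
    unfolding power_add by (rule sum.nat_group)
  finally show ?thesis
    unfolding sum_dslope[symmetric] by (simp add: diff_divide_distrib power_add)
qed

text \<open>The energies increase and are bounded, so by \<open>sum_dslope_diff\<close> the step
  functions made of the slopes form an \<open>L\<^sup>2\<close> Cauchy sequence. Its limit
  \<open>W\<close> satisfies the same square bound, and \<open>U = R (W s)\<close> is the density:
  both sides of the integral identity agree in every coordinate at dyadic times and are
  continuous.\<close>

lemma schilder_rateI:
  assumes F: "continuous_on {0..1} F" "F 0 = 0"
    and null: "\<And>t e. t \<in> {0..1} \<Longrightarrow> e \<in> E - Ep \<Longrightarrow> F t \<bullet> e = 0"
    and K: "\<And>n J. finite J \<Longrightarrow> J \<subseteq> Ep \<Longrightarrow> energy n J F \<le> 2 * C"
  shows "schilder_rate Q F \<le> ennreal C"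
proof -
  interpret prob_space unit_lebesgue by (rule prob_space_unit_lebesgue)
  define a where "a n = energy n (Jn n) F" for n
  have mono: "a n \<le> a m" if "n \<le> m" for n m
    unfolding a_def using energy_mono_set[OF finite_Jn Jn_mono[OF that]] energy_mono[OF that] order_trans by blast
  have aC: "a n \<le> 2 * C" for n unfolding a_def by (intro K finite_Jn Jn_subset)
  define A where "A = (SUP n. a n)"
  have bdd: "bdd_above (range a)" using aC by (auto intro!: bdd_aboveI[of _ "2 * C"])
  have aA: "a n \<le> A" for n unfolding A_def by (rule cSUP_upper[OF _ bdd]) simp
  have "\<exists>N. \<forall>n\<ge>N. A - a n \<le> ((1 / 2) ^ i)\<^sup>2" for i
  proof -
    have "A - ((1 / 2) ^ i)\<^sup>2 < (SUP n. a n)" by (simp add: A_def)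
    then obtain N where "A - ((1 / 2) ^ i)\<^sup>2 < a N" using less_cSUP_iff[OF _ bdd] by auto
    then have "\<forall>n\<ge>N. A - a n \<le> ((1 / 2) ^ i)\<^sup>2" using mono by (smt (verit))
    then show ?thesis by blast
  qed
  then obtain N where N: "\<And>i n. N i \<le> n \<Longrightarrow> A - a n \<le> ((1 / 2) ^ i)\<^sup>2" by metis
  \<comment> \<open>Levels that are monotone, dominate \<open>N i\<close> to give the geometric rate
    of \<open>L2_complete\<close>, and dominate \<open>i\<close> so that every coordinate and every
    dyadic point is eventually reached.\<close>
  define r where "r i = i + (\<Sum>j\<le>i. N j)" for i
  have rN: "N i \<le> r i" and ri: "i \<le> r i" for i
    unfolding r_def by (simp_all add: member_le_sum trans_le_add2)
  have rmono: "r i \<le> r j" if "i \<le> j" for i j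
    unfolding r_def using that by (intro add_mono sum_mono2) auto
  define V where "V i = dstep (r i) (dslope F (r i))" for i
  have Vm[measurable]: "V i \<in> borel_measurable unit_lebesgue" for i
    unfolding V_def by (rule measurable_restrict_space1) measurable
  have V2: "(\<integral>\<^sup>+s. ennreal ((norm (V i s))\<^sup>2) \<partial>unit_lebesgue) \<le> ennreal (2 * C)" for i
  proof -
    have "(norm (V i s))\<^sup>2 = dstep (r i) (\<lambda>k. (norm (dslope F (r i) k))\<^sup>2) s" for s
      by (simp add: V_def dstep_def)
    then have "(\<integral>\<^sup>+s. ennreal ((norm (V i s))\<^sup>2) \<partial>unit_lebesgue) = ennreal (a (r i))"
      by (simp add: nn_integral_dstep sum_dslope a_def)
    also have "\<dots> \<le> ennreal (2 * C)" by (intro ennreal_leI aC)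
    finally show ?thesis .
  qed
  have cauchy: "(\<integral>\<^sup>+s. ennreal ((norm (V j s - V i s))\<^sup>2) \<partial>unit_lebesgue) \<le> ennreal (((1 / 2) ^ i)\<^sup>2)" if ij: "i \<le> j" for i j
  proof -
    obtain l where l: "r j = r i + l" using rmono[OF ij] le_Suc_ex by blast
    have "(norm (V j s - V i s))\<^sup>2 =
        dstep (r i + l) (\<lambda>k. (norm (dslope F (r i + l) k - dslope F (r i) (k div 2 ^ l)))\<^sup>2) s" for s
      by (simp add: V_def dstep_def l dfloor_div)
    then have "(\<integral>\<^sup>+s. ennreal ((norm (V j s - V i s))\<^sup>2) \<partial>unit_lebesgue) = ennreal (a (r i + l) - a (r i))"
      by (simp add: nn_integral_dstep sum_dslope_diff a_def)
    also have "\<dots> \<le> ennreal (((1 / 2) ^ i)\<^sup>2)"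
      using aA[of "r i + l"] N[OF rN[of i]] by (intro ennreal_leI) linarith
    finally show ?thesis .
  qed
  obtain W where W[measurable]: "W \<in> borel_measurable unit_lebesgue"
    and W2: "(\<integral>\<^sup>+s. ennreal ((norm (W s))\<^sup>2) \<partial>unit_lebesgue) \<le> ennreal (2 * C)"
    and WV: "\<And>i. (\<integral>\<^sup>+s. ennreal (norm (W s - V i s)) \<partial>unit_lebesgue) \<le> ennreal (2 * (1 / 2) ^ i)"
    using L2_complete[OF Vm cauchy V2] by blast
  have integrableI: "integrable unit_lebesgue f"
    if f[measurable]: "f \<in> borel_measurable unit_lebesgue" and le: "(\<integral>\<^sup>+s. ennreal ((norm (f s))\<^sup>2) \<partial>unit_lebesgue) \<le> ennreal (2 * C)"
    for f :: "real \<Rightarrow> 'h"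
  proof (rule integrableI_bounded)
    have "(sqrt \<bar>2 * C\<bar> + 1)\<^sup>2 = \<bar>2 * C\<bar> + 1 + 2 * sqrt \<bar>2 * C\<bar>" by (simp add: power2_sum)
    moreover have "0 \<le> sqrt \<bar>2 * C\<bar>" "2 * C \<le> \<bar>2 * C\<bar>" by simp_all
    ultimately have "2 * C \<le> (sqrt \<bar>2 * C\<bar> + 1)\<^sup>2" by linarith
    then have "(\<integral>\<^sup>+s. ennreal (norm (f s)) \<partial>unit_lebesgue) \<le> ennreal (2 * (sqrt \<bar>2 * C\<bar> + 1))"
      by (intro nn_integral_norm_le_square f order_trans[OF le] ennreal_leI) (auto intro: add_nonneg_pos)
    then show "(\<integral>\<^sup>+s. ennreal (norm (f s)) \<partial>unit_lebesgue) < \<infinity>"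
      by (rule le_less_trans) simp
  qed simp
  have Wint: "set_integrable lborel {0..1} W"
    using integrableI[OF W W2] by (simp add: integrable_restrict_space set_integrable_def)
  have Vint: "set_integrable lborel {0..1} (V i)" for i
    using integrableI[OF Vm V2] by (simp add: integrable_restrict_space set_integrable_def)
  have close: "\<bar>(LINT s:{0..t}|lborel. W s \<bullet> e) - (LINT s:{0..t}|lborel. V i s \<bullet> e)\<bar> \<le> 2 * (1 / 2) ^ i"
    if e: "e \<in> E" and t: "t \<in> {0..1}" for e t i
  proof -
    have sub: "set_integrable lborel {0..t} (\<lambda>s. W s \<bullet> e)" "set_integrable lborel {0..t} (\<lambda>s. V i s \<bullet> e)"
      using t by (auto intro!: set_integrable_subset[OF set_integrable_inner[OF Wint]] set_integrable_subset[OF set_integrable_inner[OF Vint]])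
    have "ennreal (norm (LINT s:{0..t}|lborel. W s \<bullet> e - V i s \<bullet> e)) \<le>
        (\<integral>\<^sup>+s. ennreal (norm (indicator {0..t} s *\<^sub>R (W s \<bullet> e - V i s \<bullet> e))) \<partial>lborel)"
      unfolding set_lebesgue_integral_def
      by (rule integral_norm_bound_ennreal) (use set_integral_diff(1)[OF sub] in \<open>simp add: set_integrable_def\<close>)
    also have "\<dots> \<le> (\<integral>\<^sup>+s. ennreal (norm (W s - V i s)) * indicator {0..1} s \<partial>lborel)"
    proof (rule nn_integral_mono)
      fix s
      have "\<bar>W s \<bullet> e - V i s \<bullet> e\<bar> \<le> norm (W s - V i s)"
        using Cauchy_Schwarz_ineq2[of "W s - V i s" e] E_norm[OF e] by (simp add: inner_diff_left)
      then show "ennreal (norm (indicator {0..t} s *\<^sub>R (W s \<bullet> e - V i s \<bullet> e))) \<le> ennreal (norm (W s - V i s)) * indicator {0..1} s"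
        using t by (auto simp: indicator_def intro!: ennreal_leI)
    qed
    also have "\<dots> \<le> ennreal (2 * (1 / 2) ^ i)" using WV[of i] by (simp only: nn_integral_unit)
    finally have "norm (LINT s:{0..t}|lborel. W s \<bullet> e - V i s \<bullet> e) \<le> 2 * (1 / 2) ^ i"
      by (subst (asm) ennreal_le_iff) auto
    then show ?thesis by (simp add: set_integral_diff(2)[OF sub])
  qed
  \<comment> \<open>Up to a grid point of a coarser level the integral of the slopes telescopes
    exactly, so the only error in \<open>Wval\<close> is the distance from \<open>V i\<close> to
    \<open>W\<close>.\<close>
  have Vval: "(LINT s:{0..real j / 2 ^ n}|lborel. V i s \<bullet> e) = F (real j / 2 ^ n) \<bullet> e / sqrt (lam e)"
    if j: "j \<le> 2 ^ n" and n: "n \<le> r i" and e: "e \<in> Jn (r i)" for j n i e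
  proof -
    have e': "e \<in> E" using e Jn_E by blast
    obtain l where l: "r i = n + l" using n le_Suc_ex by blast
    have t: "real j / 2 ^ n = real (j * 2 ^ l) / 2 ^ r i" by (simp add: l power_add)
    have "V i s \<bullet> e = dstep (r i) (\<lambda>k. 2 ^ r i * (dinc F (r i) k \<bullet> e) / sqrt (lam e)) s" for s
      using e by (simp add: V_def dstep_def dslope_inner[OF e'])
    then have "(LINT s:{0..real j / 2 ^ n}|lborel. V i s \<bullet> e) =
        (\<Sum>k<j * 2 ^ l. 2 ^ r i * (dinc F (r i) k \<bullet> e) / sqrt (lam e) / 2 ^ r i)"
      unfolding t using j by (simp only:) (rule set_integral_dstep, simp add: l power_add)
    also have "\<dots> = (\<Sum>k<j * 2 ^ l. dinc F (r i) k) \<bullet> e / sqrt (lam e)"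
      by (simp add: inner_sum_left sum_divide_distrib)
    also have "(\<Sum>k<j * 2 ^ l. dinc F (r i) k) = F (real j / 2 ^ n)"
      unfolding dinc_def t by (subst sum_lessThan_telescope) (simp add: F(2))
    finally show ?thesis .
  qed
  have Wval: "(LINT s:{0..real j / 2 ^ n}|lborel. W s \<bullet> e) = F (real j / 2 ^ n) \<bullet> e / sqrt (lam e)"
    if j: "j \<le> 2 ^ n" and e: "e \<in> Ep" for j n e
  proof -
    let ?d = "\<bar>(LINT s:{0..real j / 2 ^ n}|lborel. W s \<bullet> e) - F (real j / 2 ^ n) \<bullet> e / sqrt (lam e)\<bar>"
    have le: "?d \<le> 2 * (1 / 2) ^ i" if i: "i \<ge> max n (Suc (to_nat_on Ep e))" for i
    proof -
      have "n \<le> r i" "Suc (to_nat_on Ep e) \<le> r i" using i ri[of i] by auto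
      then have "e \<in> Jn (r i)" using Jn_cover[OF e] Jn_mono by blast
      from close[OF Ep_E[OF e] dyadic_mem[OF j], of i] Vval[OF j \<open>n \<le> r i\<close> this] show ?thesis by simp
    qed
    have "(\<lambda>i. 2 * (1 / 2 :: real) ^ i) \<longlonglongrightarrow> 0"
      by (intro tendsto_mult_right_zero LIMSEQ_power_zero) simp
    then have "?d \<le> 0"
      by (rule LIMSEQ_le_const) (use le in blast)
    then show ?thesis by simp
  qed
  define U where "U s = R (W s)" for s
  have Ucoord: "U s \<bullet> e = sqrt (lam e) * (W s \<bullet> e)" if "e \<in> E" for s e
    using that by (simp add: U_def R_inner)
  have Uint: "set_integrable lborel {0..1} U"
    using integrable_bounded_linear[OF bounded_linear_R Wint[unfolded set_integrable_def]]
    by (simp add: U_def set_integrable_def linear_cmul[OF bounded_linear.linear[OF bounded_linear_R]])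
  have Udyadic: "(LINT s:{0..real j / 2 ^ n}|lborel. U s \<bullet> e) = F (real j / 2 ^ n) \<bullet> e"
    if j: "j \<le> 2 ^ n" and e: "e \<in> E" for j n e
  proof (cases "e \<in> Ep")
    case True
    then have "lam e > 0" by (simp add: Ep_def)
    then show ?thesis using Wval[OF j True] by (simp add: Ucoord[OF e])
  next
    case False
    then have "lam e = 0" using e lam_nonneg[of e] by (auto simp: Ep_def)
    then show ?thesis using null[OF dyadic_mem[OF j]] False e by (simp add: Ucoord[OF e])
  qed
  have FU: "F t = (LINT s:{0..t}|lborel. U s)" if t: "t \<in> {0..1}" for t
  proof (rule E_eqI)
    fix e assume e: "e \<in> E"
    have int: "set_integrable lborel {0..t} (\<lambda>s. U s \<bullet> e)" if "t \<in> {0..1}" for t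
      using that by (intro set_integrable_subset[OF set_integrable_inner[OF Uint]]) auto
    have "continuous_on {0..1} (\<lambda>t. integral {0..t} (\<lambda>s. U s \<bullet> e))"
      by (rule indefinite_integral_continuous_1) (rule set_borel_integral_eq_integral(1)[OF int], simp)
    then have cont: "continuous_on {0..1} (\<lambda>t. LINT s:{0..t}|lborel. U s \<bullet> e)"
      by (rule continuous_on_eq) (simp add: set_borel_integral_eq_integral(2)[OF int])
    have "F t \<bullet> e = (LINT s:{0..t}|lborel. U s \<bullet> e)"
      by (rule continuous_dyadic_eqI[OF _ cont _ t])
        (auto intro!: continuous_intros F(1) simp: Udyadic[OF _ e])
    also have "\<dots> = (LINT s:{0..t}|lborel. U s) \<bullet> e"
      using t by (intro set_integral_inner set_integrable_subset[OF Uint]) auto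
    finally show "F t \<bullet> e = (LINT s:{0..t}|lborel. U s) \<bullet> e" .
  qed
  \<comment> \<open>\<open>R\<close> is a contraction from the ambient space into the reproducing
    space by \<open>H0_norm_R_le\<close>, so preimages of its open sets are open.\<close>
  have Umeas: "U \<in> measurable unit_lebesgue (borel_of (H0_topology Q))"
  proof (rule measurable_borel_ofI)
    show "U s \<in> topspace (H0_topology Q)" for s by (simp add: topspace_H0 U_def H0_carrier_eq)
    fix O' assume O': "openin (H0_topology Q) O'"
    have "open {v. R v \<in> O'}"
      unfolding open_dist
    proof
      fix v assume "v \<in> {v. R v \<in> O'}"
      then obtain d where d: "d > 0" "\<And>y. y \<in> H0_carrier Q \<Longrightarrow> H0_norm Q (R v - y) < d \<Longrightarrow> y \<in> O'"
        using O' unfolding openin_H0_iff by blast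
      show "\<exists>d>0. \<forall>w. dist w v < d \<longrightarrow> w \<in> {v. R v \<in> O'}"
      proof (intro exI[of _ d] conjI allI impI d(1))
        fix w assume "dist w v < d"
        moreover have "R v - R w = R (v - w)"
          by (simp add: linear_diff[OF bounded_linear.linear[OF bounded_linear_R]])
        ultimately have "H0_norm Q (R v - R w) < d"
          using H0_norm_R_le[of "v - w"] by (simp add: dist_norm norm_minus_commute)
        then show "w \<in> {v. R v \<in> O'}" using d(2) by (simp add: H0_carrier_eq)
      qed
    qed
    then have "W -` {v. R v \<in> O'} \<inter> space unit_lebesgue \<in> sets unit_lebesgue"
      by (intro measurable_sets[OF W]) auto
    then show "U -` O' \<inter> space unit_lebesgue \<in> sets unit_lebesgue"
      by (simp add: U_def vimage_def)
  qed
  have U2: "(\<integral>\<^sup>+s\<in>{0..1}. ennreal ((H0_norm Q (U s))\<^sup>2) \<partial>lborel) \<le> ennreal (2 * C)"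
  proof -
    have "(\<integral>\<^sup>+s. ennreal ((H0_norm Q (U s))\<^sup>2) \<partial>unit_lebesgue) \<le> (\<integral>\<^sup>+s. ennreal ((norm (W s))\<^sup>2) \<partial>unit_lebesgue)"
      unfolding U_def by (intro nn_integral_mono ennreal_leI power_mono H0_norm_R_le) (simp add: H0_norm_eq)
    with W2 show ?thesis by (simp add: nn_integral_unit)
  qed
  have "U \<in> L2_H0 Q"
    using Umeas le_less_trans[OF U2] by (simp add: L2_H0_def)
  then have "schilder_rate Q F \<le> (1 / 2) * (\<integral>\<^sup>+s\<in>{0..1}. ennreal ((H0_norm Q (U s))\<^sup>2) \<partial>lborel)"
    unfolding schilder_rate_def using FU by (intro INF_lower) auto
  also have "\<dots> \<le> (1 / 2) * ennreal (2 * C)"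
    by (intro mult_left_mono U2) simp
  also have "\<dots> = ennreal C"
  proof -
    have "(1 / 2 :: ennreal) = ennreal (1 / 2)"
      by (metis divide_ennreal ennreal_1 ennreal_numeral zero_le_one zero_less_numeral)
    then have "(1 / 2) * ennreal (2 * C) = ennreal (1 / 2) * ennreal (2 * C)" by (simp only:)
    also have "\<dots> = ennreal (1 / 2 * (2 * C))" by (rule ennreal_mult'[symmetric]) simp
    finally show ?thesis by simp
  qed
  finally show ?thesis .
qed

end

section \<open>Compactness of the level sets\<close>

text \<open>Turns a classification of \<open>S\<close> into finitely many classes into a finite set
  of centres inside \<open>S\<close>, as the definition of total boundedness demands.\<close>

lemma finite_representatives:
  assumes "finite (b ` S)"
  obtains K where "finite K" "K \<subseteq> S" "\<And>x. x \<in> S \<Longrightarrow> \<exists>y\<in>K. b x = b y"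
proof (rule that[of "inv_into S b ` b ` S"])
  show "inv_into S b ` b ` S \<subseteq> S" by (auto intro: inv_into_into)
  show "\<exists>y\<in>inv_into S b ` b ` S. b x = b y" if "x \<in> S" for x
    using that by (intro bexI[of _ "inv_into S b (b x)"]) (auto simp: f_inv_into_f)
qed (use assms in auto)

lemma countable_representatives:
  fixes b :: "'a \<Rightarrow> 'b::countable"
  obtains K where "countable K" "K \<subseteq> S" "\<And>x. x \<in> S \<Longrightarrow> \<exists>y\<in>K. b x = b y"
proof (rule that[of "inv_into S b ` b ` S"])
  show "inv_into S b ` b ` S \<subseteq> S" by (auto intro: inv_into_into)
  show "\<exists>y\<in>inv_into S b ` b ` S. b x = b y" if "x \<in> S" for x
    using that by (intro bexI[of _ "inv_into S b (b x)"]) (auto simp: f_inv_into_f)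
qed auto

lemma dyadic_holder_limit:
  fixes G :: "real \<Rightarrow> 'h::real_normed_vector"
  assumes lim: "\<And>t. t \<in> {0..1} \<Longrightarrow> (\<lambda>m. H m t) \<longlonglongrightarrow> G t"
    and dy: "\<forall>\<^sub>F m in sequentially. dyadic_holder \<alpha> n \<eta> (H m)"
  shows "dyadic_holder \<alpha> n \<eta> G"
  unfolding dyadic_holder_def
proof (intro allI impI)
  fix m k :: nat assume m: "n \<le> m" "k < 2 ^ m"
  have "(\<lambda>i. norm (dinc (H i) m k)) \<longlonglongrightarrow> norm (dinc G m k)"
    unfolding dinc_def using m by (intro tendsto_intros lim dyadic_mem) auto
  moreover have "\<forall>\<^sub>F i in sequentially. norm (dinc (H i) m k) \<le> \<eta> * (2 powr - \<alpha>) ^ m"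
    using dy by (rule eventually_mono) (rule dyadic_holderD[OF _ m])
  ultimately show "norm (dinc G m k) \<le> \<eta> * (2 powr - \<alpha>) ^ m"
    by (rule tendsto_upperbound) simp
qed

text \<open>\<open>enn2real\<close> would send an infinite supremum to 0, so the supremum has to be
  finite before its real value bounds any quotient.\<close>

lemma holder_dist_lower:
  fixes F G :: "real \<Rightarrow> 'h::real_normed_vector"
  assumes \<alpha>: "0 < \<alpha>" and FG: "F \<in> holder0 \<alpha>" "G \<in> holder0 \<alpha>" and st: "0 \<le> s" "s < t" "t \<le> 1"
  shows "norm ((F t - G t) - (F s - G s)) \<le> holder_dist \<alpha> F G * (t - s) powr \<alpha>"
proof -
  obtain K L where K: "\<And>s t. 0 \<le> s \<Longrightarrow> s < t \<Longrightarrow> t \<le> 1 \<Longrightarrow> norm (F t - F s) / \<bar>t - s\<bar> powr \<alpha> \<le> K"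
    and L: "\<And>s t. 0 \<le> s \<Longrightarrow> s < t \<Longrightarrow> t \<le> 1 \<Longrightarrow> norm (G t - G s) / \<bar>t - s\<bar> powr \<alpha> \<le> L"
    using holder0_bound[OF \<alpha> FG(1)] holder0_bound[OF \<alpha> FG(2)] by metis
  define S where "S = (SUP (s, t) \<in> {(s, t). 0 \<le> s \<and> s < t \<and> t \<le> 1}.
       ennreal (norm ((F t - G t) - (F s - G s)) / \<bar>t - s\<bar> powr \<alpha>))"
  have "S \<le> ennreal (K + L)"
    unfolding S_def
  proof (rule SUP_least, clarify)
    fix s t :: real assume st: "0 \<le> s" "s < t" "t \<le> 1"
    have "norm ((F t - G t) - (F s - G s)) \<le> norm (F t - F s) + norm (G t - G s)"
      using norm_triangle_ineq4[of "F t - F s" "G t - G s"] by (simp add: algebra_simps)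
    then have "norm ((F t - G t) - (F s - G s)) / \<bar>t - s\<bar> powr \<alpha> \<le>
        norm (F t - F s) / \<bar>t - s\<bar> powr \<alpha> + norm (G t - G s) / \<bar>t - s\<bar> powr \<alpha>"
      by (simp add: add_divide_distrib[symmetric] divide_right_mono)
    also have "\<dots> \<le> K + L" by (intro add_mono K L st)
    finally show "ennreal (norm ((F t - G t) - (F s - G s)) / \<bar>t - s\<bar> powr \<alpha>) \<le> ennreal (K + L)"
      by (rule ennreal_leI)
  qed
  then have "S < top" by (rule le_less_trans) simp
  then have S: "S = ennreal (holder_dist \<alpha> F G)"
    unfolding holder_dist_def holder_norm_def S_def[symmetric] by simp
  have "ennreal (norm ((F t - G t) - (F s - G s)) / \<bar>t - s\<bar> powr \<alpha>) \<le> S"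
    unfolding S_def by (rule SUP_upper2[of "(s, t)"]) (use st in auto)
  then have "norm ((F t - G t) - (F s - G s)) / \<bar>t - s\<bar> powr \<alpha> \<le> holder_dist \<alpha> F G"
    unfolding S by (subst (asm) ennreal_le_iff) (simp_all add: holder_dist_def holder_norm_def)
  then show ?thesis using st by (simp add: divide_le_eq)
qed

lemma half_power_powr: "((1 / 2 :: real) ^ m) powr \<alpha> = (2 powr - \<alpha>) ^ m"
  by (simp add: powr_power powr_powr powr_minus_divide powr_divide mult.commute flip: powr_realpow)

lemma holder_dist_dyadic:
  fixes F G :: "real \<Rightarrow> 'h::real_normed_vector"
  assumes \<alpha>: "0 < \<alpha>" and FG: "F \<in> holder0 \<alpha>" "G \<in> holder0 \<alpha>"
  shows "dyadic_holder \<alpha> 0 (holder_dist \<alpha> F G) (\<lambda>t. F t - G t)"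
  unfolding dyadic_holder_def
proof (intro allI impI)
  fix m k :: nat assume "k < 2 ^ m"
  then have mem: "real k / 2 ^ m \<in> {0..1}" "real (Suc k) / 2 ^ m \<in> {0..1}" by (rule_tac dyadic_mem, simp)+
  have "real (Suc k) / 2 ^ m - real k / 2 ^ m = (1 / 2) ^ m"
    by (simp add: diff_divide_distrib[symmetric] power_one_over)
  moreover have "real k / 2 ^ m < real (Suc k) / 2 ^ m" by (simp add: divide_strict_right_mono)
  ultimately show "norm (dinc (\<lambda>t. F t - G t) m k) \<le> holder_dist \<alpha> F G * (2 powr - \<alpha>) ^ m"
    using holder_dist_lower[OF \<alpha> FG, of "real k / 2 ^ m" "real (Suc k) / 2 ^ m"] mem
    by (simp add: dinc_def half_power_powr del: of_nat_Suc)
qed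

lemma holder_dist_sup:
  fixes F G :: "real \<Rightarrow> 'h::real_normed_vector"
  assumes \<alpha>: "0 < \<alpha>" and FG: "F \<in> holder0 \<alpha>" "G \<in> holder0 \<alpha>" and t: "t \<in> {0..1}"
  shows "norm (F t - G t) \<le> holder_dist \<alpha> F G"
proof (cases "t = 0")
  case True
  then show ?thesis using FG by (simp add: holder0_def holder_dist_def holder_norm_def)
next
  case False
  with t have t': "0 < t" "t \<le> 1" by auto
  have "norm (F t - G t) \<le> holder_dist \<alpha> F G * t powr \<alpha>"
    using holder_dist_lower[OF \<alpha> FG, of 0 t] t' FG by (simp add: holder0_def)
  also have "\<dots> \<le> holder_dist \<alpha> F G * 1"
    using t' \<alpha> by (intro mult_left_mono powr_le1) (auto simp: holder_dist_def holder_norm_def)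
  finally show ?thesis by simp
qed

lemma topspace_holder:
  "0 < \<alpha> \<Longrightarrow> topspace (holder_topology \<alpha> :: (real \<Rightarrow> 'h::real_normed_vector) topology) = holder0 \<alpha>"
  by (simp add: holder_topology_def Metric_space.topspace_mtopology[OF Metric_space_holder0])

section \<open>Open sets and separability of the Hoelder space\<close>

lemma openin_holder_dyadic:
  fixes O' :: "(real \<Rightarrow> 'h::real_normed_vector) set"
  assumes \<alpha>: "0 < \<alpha>" and O': "openin (holder_topology \<alpha>) O'" and F: "F \<in> O'"
  obtains \<eta> where "\<eta> > 0" "\<And>G. G \<in> holder0 \<alpha> \<Longrightarrow> dyadic_holder \<alpha> 0 \<eta> (\<lambda>t. G t - F t) \<Longrightarrow> G \<in> O'"
proof -
  interpret Metric_space "holder0 \<alpha> :: (real \<Rightarrow> 'h) set" "holder_dist \<alpha>"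
    by (rule Metric_space_holder0[OF \<alpha>])
  obtain r where r: "r > 0" "mball F r \<subseteq> O'" and F0: "F \<in> holder0 \<alpha>"
    using O' F unfolding holder_topology_def openin_mtopology by blast
  define \<eta> where "\<eta> = r / (2 * chain_const \<alpha>)"
  have c: "chain_const \<alpha> > 0" by (rule chain_const_pos[OF \<alpha>])
  show thesis
  proof (rule that[of \<eta>])
    show "\<eta> > 0" using r c by (simp add: \<eta>_def)
    fix G :: "real \<Rightarrow> 'h" assume G: "G \<in> holder0 \<alpha>" "dyadic_holder \<alpha> 0 \<eta> (\<lambda>t. G t - F t)"
    have "holder_dist \<alpha> F G = holder_dist \<alpha> G F" by (rule commute)
    also have "\<dots> \<le> chain_const \<alpha> * \<eta>" by (rule holder_dist_le[OF \<alpha> G(1) F0 G(2)])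
    also have "\<dots> < r" using r c by (simp add: \<eta>_def)
    finally show "G \<in> O'" using r(2) F0 G(1) by (auto simp: subset_iff)
  qed
qed

text \<open>Classify \<open>F\<close> by a level at which it is \<open>\<eta>\<close>-regular
  together with its grid values rounded to a countable dense set. There are countably many classes,
  and by \<open>dyadic_holder_bucket\<close> members of one class are
  \<open>2 * \<eta>\<close>-close. Representatives for \<open>\<eta> = 1 / real (Suc i)\<close> form
  the dense set.\<close>

lemma holder0_separable:
  assumes \<alpha>: "0 < \<alpha>" "\<alpha> \<le> 1"
  obtains D :: "(real \<Rightarrow> 'h::{real_normed_vector,second_countable_topology}) set"
  where "countable D" "D \<subseteq> holder0 \<alpha>"
    "\<And>F \<eta>. F \<in> holder0 \<alpha> \<Longrightarrow> \<eta> > 0 \<Longrightarrow> \<exists>G\<in>D. dyadic_holder \<alpha> 0 \<eta> (\<lambda>t. F t - G t)"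
proof -
  obtain C :: "'h set" where C: "countable C" "\<And>X. open X \<Longrightarrow> X \<noteq> {} \<Longrightarrow> \<exists>d\<in>C. d \<in> X"
    using countable_dense_setE by blast
  have dense: "\<exists>c\<in>C. dist x c < e" if "e > 0" for x e
    using C(2)[of "ball x e"] that by auto
  define lev where "lev \<eta> F = (SOME n. dyadic_holder \<alpha> n \<eta> F)" for \<eta> and F :: "real \<Rightarrow> 'h"
  have lev: "dyadic_holder \<alpha> (lev \<eta> F) \<eta> F" if "F \<in> holder0 \<alpha>" "\<eta> > 0" for \<eta> F
    unfolding lev_def by (rule someI_ex[OF holder0_dyadic[OF that]])
  define near where "near e x = (SOME c. c \<in> C \<and> dist x c < e)" for e x
  have near: "near e x \<in> C \<and> dist x (near e x) < e" if "e > 0" for e x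
    unfolding near_def by (rule someI_ex) (use dense[OF that] in blast)
  define b where "b \<eta> F = (lev \<eta> F,
      map (\<lambda>k. to_nat_on C (near (\<eta> * (1 / 2) ^ lev \<eta> F / 2) (F (real k / 2 ^ lev \<eta> F)))) [0..<Suc (2 ^ lev \<eta> F)])"
    for \<eta> F
  have close: "dyadic_holder \<alpha> 0 (2 * \<eta>) (\<lambda>t. F t - G t)"
    if FG: "F \<in> holder0 \<alpha>" "G \<in> holder0 \<alpha>" and \<eta>: "\<eta> > 0" and eq: "b \<eta> F = b \<eta> G" for F G \<eta>
  proof -
    define n where "n = lev \<eta> F"
    \<comment> \<open>Half the grid tolerance, since two values with the same code differ by up to
      two rounding errors.\<close>
    define e where "e = \<eta> * (1 / 2) ^ n / 2"
    have e: "e > 0" using \<eta> by (simp add: e_def)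
    have n: "lev \<eta> G = n" using eq by (simp add: b_def n_def)
    show ?thesis
    proof (rule dyadic_holder_bucket[OF \<alpha>(2)])
      show "dyadic_holder \<alpha> n \<eta> F" "dyadic_holder \<alpha> n \<eta> G"
        using lev[OF FG(1) \<eta>] lev[OF FG(2) \<eta>] by (simp_all add: n n_def[symmetric])
      fix k :: nat assume k: "k \<le> 2 ^ n"
      let ?x = "F (real k / 2 ^ n)" and ?y = "G (real k / 2 ^ n)"
      have "map (\<lambda>k. to_nat_on C (near e (F (real k / 2 ^ n)))) [0..<Suc (2 ^ n)] =
          map (\<lambda>k. to_nat_on C (near e (G (real k / 2 ^ n)))) [0..<Suc (2 ^ n)]"
        using eq unfolding b_def n n_def[symmetric] e_def by simp
      then have "to_nat_on C (near e ?x) = to_nat_on C (near e ?y)"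
        using k by (auto simp: less_Suc_eq_le)
      then have "near e ?x = near e ?y"
        using near[OF e] inj_on_to_nat_on[OF C(1)] by (auto dest: inj_onD)
      then have "dist ?x ?y < e + e"
        using near[OF e, of ?x] near[OF e, of ?y] dist_triangle2[of ?x ?y "near e ?x"] by simp
      then show "norm (?x - ?y) \<le> \<eta> * (1 / 2) ^ n" by (simp add: dist_norm e_def)
    qed
  qed
  have "\<exists>K. countable K \<and> K \<subseteq> holder0 \<alpha> \<and> (\<forall>F\<in>holder0 \<alpha>. \<exists>G\<in>K. b \<eta> F = b \<eta> G)" for \<eta>
    by (rule countable_representatives[of "holder0 \<alpha>" "b \<eta>"]) blast
  then obtain K where K: "\<And>\<eta>. countable (K \<eta>)" "\<And>\<eta>. K \<eta> \<subseteq> holder0 \<alpha>"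
      "\<And>\<eta> F. F \<in> holder0 \<alpha> \<Longrightarrow> \<exists>G\<in>K \<eta>. b \<eta> F = b \<eta> G" by metis
  show thesis
  proof (rule that[of "\<Union>i::nat. K (1 / real (Suc i))"])
    fix F :: "real \<Rightarrow> 'h" and \<eta> :: real assume F: "F \<in> holder0 \<alpha>" and \<eta>: "\<eta> > 0"
    obtain i where i: "1 / real (Suc i) < \<eta> / 2" using nat_approx_posE[of "\<eta> / 2"] \<eta> by auto
    obtain G where G: "G \<in> K (1 / real (Suc i))" "b (1 / real (Suc i)) F = b (1 / real (Suc i)) G"
      using K(3)[OF F] by blast
    have "dyadic_holder \<alpha> 0 (2 * (1 / real (Suc i))) (\<lambda>t. F t - G t)"
      using G K(2) by (intro close F) auto
    then have "dyadic_holder \<alpha> 0 \<eta> (\<lambda>t. F t - G t)"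
      by (rule dyadic_holder_mono) (use i in auto)
    with G show "\<exists>G\<in>\<Union>i::nat. K (1 / real (Suc i)). dyadic_holder \<alpha> 0 \<eta> (\<lambda>t. F t - G t)" by blast
  qed (use K in auto)
qed

text \<open>Needed for Borel measurability of the path map: the sets in the union are given by
  countably many dyadic increments, so their preimages are events.\<close>

lemma holder_open_countable_union:
  fixes O' :: "(real \<Rightarrow> 'h::{real_normed_vector,second_countable_topology}) set"
  assumes \<alpha>: "0 < \<alpha>" "\<alpha> \<le> 1" and O': "openin (holder_topology \<alpha>) O'"
  obtains P :: "((real \<Rightarrow> 'h) \<times> real) set"
  where "countable P" "O' = (\<Union>(G, q)\<in>P. {F \<in> holder0 \<alpha>. dyadic_holder \<alpha> 0 q (\<lambda>t. F t - G t)})"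
proof -
  obtain D :: "(real \<Rightarrow> 'h) set" where D: "countable D" "D \<subseteq> holder0 \<alpha>"
    "\<And>F \<eta>. F \<in> holder0 \<alpha> \<Longrightarrow> \<eta> > 0 \<Longrightarrow> \<exists>G\<in>D. dyadic_holder \<alpha> 0 \<eta> (\<lambda>t. F t - G t)"
    using holder0_separable[OF \<alpha>] by blast
  let ?B = "\<lambda>G q. {F \<in> holder0 \<alpha>. dyadic_holder \<alpha> 0 q (\<lambda>t. F t - G t)}"
  define P where "P = {(G, q) \<in> D \<times> range (\<lambda>i. 1 / real (Suc i)). ?B G q \<subseteq> O'}"
  show thesis
  proof (rule that[of P])
    show "countable P"
      by (rule countable_subset[of _ "D \<times> range (\<lambda>i. 1 / real (Suc i))"]) (use D(1) in \<open>auto simp: P_def\<close>)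
    show "O' = (\<Union>(G, q)\<in>P. ?B G q)"
    proof
      show "(\<Union>(G, q)\<in>P. ?B G q) \<subseteq> O'" by (auto simp: P_def)
      show "O' \<subseteq> (\<Union>(G, q)\<in>P. ?B G q)"
      proof
        fix F assume F: "F \<in> O'"
        obtain \<eta> where \<eta>: "\<eta> > 0" "\<And>G. G \<in> holder0 \<alpha> \<Longrightarrow> dyadic_holder \<alpha> 0 \<eta> (\<lambda>t. G t - F t) \<Longrightarrow> G \<in> O'"
          using openin_holder_dyadic[OF \<alpha>(1) O' F] by blast
        have F0: "F \<in> holder0 \<alpha>"
          using openin_subset[OF O'] F by (auto simp: topspace_holder[OF \<alpha>(1)])
        obtain i where i: "1 / real (Suc i) < \<eta> / 2" using nat_approx_posE[of "\<eta> / 2"] \<eta>(1) by auto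
        obtain G where G: "G \<in> D" "dyadic_holder \<alpha> 0 (1 / real (Suc i)) (\<lambda>t. F t - G t)"
          using D(3)[OF F0, of "1 / real (Suc i)"] by auto
        have "?B G (1 / real (Suc i)) \<subseteq> O'"
        proof
          fix F' assume F': "F' \<in> ?B G (1 / real (Suc i))"
          have "dyadic_holder \<alpha> 0 (1 / real (Suc i) + 1 / real (Suc i)) (\<lambda>t. (F' t - G t) - (F t - G t))"
            using F' G(2) by (intro dyadic_holder_diff) auto
          then have "dyadic_holder \<alpha> 0 \<eta> (\<lambda>t. (F' t - G t) - (F t - G t))"
            by (rule dyadic_holder_mono) (use i in auto)
          then show "F' \<in> O'" using F' by (intro \<eta>(2)) auto
        qed
        with G F0 show "F \<in> (\<Union>(G, q)\<in>P. ?B G q)"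
          by (intro UN_I[of "(G, 1 / real (Suc i))"]) (auto simp: P_def)
      qed
    qed
  qed
qed

section \<open>Total boundedness and completeness of the level sets\<close>

context trace_operator
begin

text \<open>One increment contributes at most \<open>K / 2 ^ m\<close> to the weighted square sum,
  and \<open>lam e \<le> \<tau>\<close> removes the weights.\<close>

lemma energy_norm_dinc:
  assumes en: "\<And>J. finite J \<Longrightarrow> J \<subseteq> Ep \<Longrightarrow> energy m J F \<le> K"
    and null: "\<And>t e. t \<in> {0..1} \<Longrightarrow> e \<in> E - Ep \<Longrightarrow> F t \<bullet> e = 0" and k: "k < 2 ^ m"
  shows "(norm (dinc F m k))\<^sup>2 \<le> \<tau> * K / 2 ^ m"
proof (rule has_sum_le_finite_sums[OF hilbert_basis_parseval[OF E_basis]])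
  fix G assume G: "finite G" "G \<subseteq> E"
  have "(\<Sum>e\<in>G. (dinc F m k \<bullet> e)\<^sup>2) = (\<Sum>e\<in>G \<inter> Ep. (dinc F m k \<bullet> e)\<^sup>2)"
  proof (rule sum.mono_neutral_right)
    have "F (real k / 2 ^ m) \<bullet> e = 0" "F (real (Suc k) / 2 ^ m) \<bullet> e = 0" if "e \<in> E - Ep" for e
      by (rule null[OF dyadic_mem that]; use k in simp)+
    then have "dinc F m k \<bullet> e = 0" if "e \<in> E - Ep" for e
      using that by (simp add: dinc_def inner_diff_left)
    then show "\<forall>e\<in>G - G \<inter> Ep. (dinc F m k \<bullet> e)\<^sup>2 = 0"
      using G(2) by auto
  qed (use G in auto)
  also have "\<dots> \<le> (\<Sum>e\<in>G \<inter> Ep. \<tau> * ((dinc F m k \<bullet> e)\<^sup>2 / lam e))"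
  proof (rule sum_mono)
    fix e assume "e \<in> G \<inter> Ep"
    then have "0 < lam e" "lam e \<le> \<tau>" by (auto simp: Ep_def lam_le)
    then show "(dinc F m k \<bullet> e)\<^sup>2 \<le> \<tau> * ((dinc F m k \<bullet> e)\<^sup>2 / lam e)"
      by (simp add: field_simps mult_right_mono)
  qed
  also have "\<dots> = \<tau> * (\<Sum>e\<in>G \<inter> Ep. (dinc F m k \<bullet> e)\<^sup>2 / lam e)"
    by (simp add: sum_distrib_left)
  also have "\<dots> \<le> \<tau> * (\<Sum>k<2 ^ m. \<Sum>e\<in>G \<inter> Ep. (dinc F m k \<bullet> e)\<^sup>2 / lam e)"
    using k \<tau>_pos by (intro mult_left_mono member_le_sum[of k _ "\<lambda>k. \<Sum>e\<in>G \<inter> Ep. (dinc F m k \<bullet> e)\<^sup>2 / lam e"])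
      (auto intro!: sum_nonneg divide_nonneg_nonneg lam_nonneg)
  also have "\<dots> = \<tau> * energy m (G \<inter> Ep) F / 2 ^ m"
    by (simp add: energy_def)
  also have "\<dots> \<le> \<tau> * K / 2 ^ m"
    using \<tau>_pos G by (intro divide_right_mono mult_left_mono en) auto
  finally show "(\<Sum>e\<in>G. (dinc F m k \<bullet> e)\<^sup>2) \<le> \<tau> * K / 2 ^ m" .
qed

text \<open>The increments have order \<open>2 powr (- m / 2)\<close>. Splitting off
  \<open>(2 powr - \<alpha>) ^ m\<close> leaves a surplus factor that decays with the level when
  \<open>\<alpha> < 1 / 2\<close>.\<close>

lemma energy_dyadic_holder:
  assumes \<alpha>: "\<alpha> \<le> 1 / 2" and en: "\<And>m J. finite J \<Longrightarrow> J \<subseteq> Ep \<Longrightarrow> energy m J F \<le> K"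
    and null: "\<And>t e. t \<in> {0..1} \<Longrightarrow> e \<in> E - Ep \<Longrightarrow> F t \<bullet> e = 0"
  shows "dyadic_holder \<alpha> n (sqrt (\<tau> * K) * (2 powr - (1 / 2 - \<alpha>)) ^ n) F"
  unfolding dyadic_holder_def
proof (intro allI impI)
  fix m k :: nat assume m: "n \<le> m" "k < 2 ^ m"
  have "norm (dinc F m k) \<le> sqrt (\<tau> * K / 2 ^ m)"
    using energy_norm_dinc[OF en null m(2)] by (rule real_le_rsqrt)
  also have "\<dots> = sqrt (\<tau> * K) * (2 powr - (1 / 2)) ^ m"
    by (simp add: real_sqrt_divide real_sqrt_power powr_minus_divide powr_half_sqrt power_divide)
  also have "(2 powr - (1 / 2)) ^ m = (2 powr - (1 / 2 - \<alpha>)) ^ m * (2 powr - \<alpha> :: real) ^ m"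
    by (simp add: power_mult_distrib[symmetric] powr_add[symmetric])
  also have "sqrt (\<tau> * K) * ((2 powr - (1 / 2 - \<alpha>)) ^ m * (2 powr - \<alpha>) ^ m) \<le>
      sqrt (\<tau> * K) * ((2 powr - (1 / 2 - \<alpha>)) ^ n * (2 powr - \<alpha>) ^ m)"
  proof (intro mult_left_mono mult_right_mono power_decreasing m(1))
    show "(2 :: real) powr - (1 / 2 - \<alpha>) \<le> 1"
      using \<alpha> powr_mono[of "- (1 / 2 - \<alpha>)" 0 "2 :: real"] by simp
    have "0 \<le> energy 0 {} F" by (rule energy_nonneg)
    also have "\<dots> \<le> K" by (rule en) auto
    finally show "0 \<le> sqrt (\<tau> * K)" using \<tau>_pos by simp
  qed auto
  finally show "norm (dinc F m k) \<le> sqrt (\<tau> * K) * (2 powr - (1 / 2 - \<alpha>)) ^ n * (2 powr - \<alpha>) ^ m"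
    by (simp add: mult.assoc)
qed

text \<open>A grid value is a sum of at most \<open>2 ^ n\<close> increments, so discrete
  Cauchy-Schwarz costs exactly the prefactor of the energy. Thus all grid values lie in one ball of
  the reproducing space.\<close>

lemma energy_coord_bound:
  assumes F0: "F 0 = 0" and k: "k \<le> 2 ^ n" and J: "finite J"
  shows "(\<Sum>e\<in>J. (F (real k / 2 ^ n) \<bullet> e)\<^sup>2 / lam e) \<le> energy n J F"
proof -
  have "(F (real k / 2 ^ n) \<bullet> e)\<^sup>2 \<le> 2 ^ n * (\<Sum>j<2 ^ n. (dinc F n j \<bullet> e)\<^sup>2)" for e
  proof -
    have "F (real k / 2 ^ n) = (\<Sum>j<k. dinc F n j)"
      unfolding dinc_def by (subst sum_lessThan_telescope) (simp add: F0)
    then have "(F (real k / 2 ^ n) \<bullet> e)\<^sup>2 = (\<Sum>j<k. dinc F n j \<bullet> e)\<^sup>2"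
      by (simp add: inner_sum_left)
    also have "\<dots> \<le> (\<Sum>j<k. (dinc F n j \<bullet> e)\<^sup>2) * card {..<k}"
      by (rule sum_squared_le_sum_of_squares)
    also have "\<dots> \<le> (\<Sum>j<2 ^ n. (dinc F n j \<bullet> e)\<^sup>2) * real (2 ^ n)"
      using k by (intro mult_mono sum_mono2) (auto intro: sum_nonneg simp flip: of_nat_power)
    finally show ?thesis by (simp add: mult.commute)
  qed
  then have "(\<Sum>e\<in>J. (F (real k / 2 ^ n) \<bullet> e)\<^sup>2 / lam e) \<le> (\<Sum>e\<in>J. 2 ^ n * (\<Sum>j<2 ^ n. (dinc F n j \<bullet> e)\<^sup>2) / lam e)"
    by (intro sum_mono divide_right_mono lam_nonneg)
  also have "\<dots> = energy n J F"
    unfolding energy_def by (subst sum.swap) (simp add: sum_distrib_left sum_divide_distrib)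
  finally show ?thesis .
qed

text \<open>On this ball \<open>(x \<bullet> e)\<^sup>2\<close> is dominated by
  \<open>\<bar>K\<bar> * lam e\<close>, a summable bound uniform in \<open>x\<close>, so finite
  projections approximate uniformly.\<close>

lemma energy_ball_totally_bounded:
  assumes d: "d > 0"
  shows "\<exists>k. finite k \<and>
    {x. (\<forall>J. finite J \<and> J \<subseteq> Ep \<longrightarrow> (\<Sum>e\<in>J. (x \<bullet> e)\<^sup>2 / lam e) \<le> K) \<and> (\<forall>e\<in>E - Ep. x \<bullet> e = 0)} \<subseteq> (\<Union>x\<in>k. ball x d)"
    (is "\<exists>k. finite k \<and> ?S \<subseteq> _")
proof -
  have coord: "(x \<bullet> e)\<^sup>2 \<le> \<bar>K\<bar> * lam e" if x: "x \<in> ?S" and e: "e \<in> E" for x e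
  proof (cases "e \<in> Ep")
    case True
    then have l: "lam e > 0" by (simp add: Ep_def)
    have "(\<Sum>e\<in>{e}. (x \<bullet> e)\<^sup>2 / lam e) \<le> K" using x True by blast
    then have "(x \<bullet> e)\<^sup>2 \<le> K * lam e" using l by (simp add: field_simps)
    also have "\<dots> \<le> \<bar>K\<bar> * lam e" using l by (intro mult_right_mono) auto
    finally show ?thesis .
  next
    case False
    then show ?thesis using x e lam_nonneg[of e] by simp
  qed
  have sums: "(\<Sum>e\<in>G. (x \<bullet> e)\<^sup>2) \<le> \<bar>K\<bar> * sum lam G" if "x \<in> ?S" "G \<subseteq> E" for x G
    unfolding sum_distrib_left using that by (intro sum_mono coord) auto
  show ?thesis
  proof (rule totally_bounded_oproj[OF E_orthonormal, of _ "sqrt (\<bar>K\<bar> * \<tau>)"])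
    fix x assume x: "x \<in> ?S"
    have "(norm x)\<^sup>2 \<le> \<bar>K\<bar> * \<tau>"
    proof (rule has_sum_le_finite_sums[OF hilbert_basis_parseval[OF E_basis]])
      fix G assume G: "finite G" "G \<subseteq> E"
      have "(\<Sum>e\<in>G. (x \<bullet> e)\<^sup>2) \<le> \<bar>K\<bar> * sum lam G" by (rule sums[OF x G(2)])
      also have "\<dots> \<le> \<bar>K\<bar> * \<tau>" by (intro mult_left_mono lam_sum_le G) simp
      finally show "(\<Sum>e\<in>G. (x \<bullet> e)\<^sup>2) \<le> \<bar>K\<bar> * \<tau>" .
    qed
    then show "norm x \<le> sqrt (\<bar>K\<bar> * \<tau>)" by (rule real_le_rsqrt)
  next
    fix d :: real assume d: "d > 0"
    define c where "c = (d / 2)\<^sup>2 / (\<bar>K\<bar> + 1)"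
    have c: "c > 0" using d by (simp add: c_def add_nonneg_pos)
    obtain J where J: "finite J" "J \<subseteq> E" "\<And>G. finite G \<Longrightarrow> G \<subseteq> E - J \<Longrightarrow> sum lam G < c"
      using tail_lam[OF c] by blast
    have "norm (x - oproj J x) < d" if x: "x \<in> ?S" for x
    proof -
      have "(norm (x - oproj J x))\<^sup>2 \<le> (d / 2)\<^sup>2"
      proof (rule norm_diff_oproj_le[OF E_basis J(1,2)])
        fix G assume G: "finite G" "G \<subseteq> E - J"
        have "(\<Sum>e\<in>G. (x \<bullet> e)\<^sup>2) \<le> \<bar>K\<bar> * sum lam G" using G by (intro sums x) auto
        also have "\<dots> \<le> (\<bar>K\<bar> + 1) * c"
          using J(3)[OF G] c by (intro mult_mono) (auto intro!: sum_nonneg lam_nonneg)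
        also have "\<dots> = (d / 2)\<^sup>2" by (simp add: c_def add_nonneg_pos less_imp_neq[symmetric])
        finally show "(\<Sum>e\<in>G. (x \<bullet> e)\<^sup>2) \<le> (d / 2)\<^sup>2" .
      qed
      then have "norm (x - oproj J x) \<le> d / 2"
        by (rule power2_le_imp_le) (use d in simp)
      with d show ?thesis by simp
    qed
    with J(1,2) show "\<exists>J. finite J \<and> J \<subseteq> E \<and> (\<forall>x\<in>?S. norm (x - oproj J x) < d)" by blast
  qed (rule d)
qed

lemma energy_tendsto:
  assumes "\<And>t. t \<in> {0..1} \<Longrightarrow> (\<lambda>i. H i t) \<longlonglongrightarrow> F t"
  shows "(\<lambda>i. energy n J (H i)) \<longlonglongrightarrow> energy n J F"
proof -
  have "(\<lambda>i. dinc (H i) n k) \<longlonglongrightarrow> dinc F n k" if "k < 2 ^ n" for k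
    unfolding dinc_def using that by (intro tendsto_intros assms dyadic_mem) auto
  then show ?thesis
    unfolding energy_def divide_inverse by (intro tendsto_intros) auto
qed

text \<open>Total boundedness: on the level set the regularity is uniform, so a fixed grid suffices,
  and the grid values range over a totally bounded set; rounding them yields finitely many classes
  of close paths. Completeness: a Cauchy sequence converges uniformly and its limit inherits the
  energy bounds.\<close>

lemma schilder_rate_compact:
  assumes \<alpha>: "0 < \<alpha>" "\<alpha> < 1 / 2" and C: "C \<ge> 0"
  shows "compactin (holder_topology \<alpha>) {F \<in> topspace (holder_topology \<alpha>). schilder_rate Q F \<le> ennreal C}"
    (is "compactin _ ?L")
proof -
  interpret Metric_space "holder0 \<alpha> :: (real \<Rightarrow> 'h) set" "holder_dist \<alpha>"
    by (rule Metric_space_holder0[OF \<alpha>(1)])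
  note [simp] = topspace_holder[OF \<alpha>(1)]
  define L where "L = {F \<in> holder0 \<alpha>. schilder_rate Q F \<le> ennreal C}"
  have L: "?L = L" by (simp add: L_def)
  have L_rate: "schilder_rate Q F \<le> ennreal C" if "F \<in> L" for F using that by (simp add: L_def)
  have L_holder [simp]: "F \<in> L \<Longrightarrow> F \<in> holder0 \<alpha>" for F by (simp add: L_def)
  have en: "energy n J F \<le> 2 * C" if "F \<in> L" "finite J" "J \<subseteq> Ep" for F n J
    by (rule schilder_rateD(1)[OF L_rate[OF that(1)] C that(2,3)])
  have null: "F t \<bullet> e = 0" if "F \<in> L" "t \<in> {0..1}" "e \<in> E - Ep" for F t e
    by (rule schilder_rateD(2)[OF L_rate[OF that(1)] C that(2,3)])
  define \<beta> where "\<beta> n = sqrt (\<tau> * (2 * C)) * (2 powr - (1 / 2 - \<alpha>)) ^ n" for n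
  have \<beta>: "\<beta> \<longlonglongrightarrow> 0"
    unfolding \<beta>_def using \<alpha> powr_minus_bounds[of "1 / 2 - \<alpha>"]
    by (intro tendsto_mult_right_zero LIMSEQ_power_zero) auto
  have dy: "dyadic_holder \<alpha> n (\<beta> n) F" if "F \<in> L" for F n
    unfolding \<beta>_def using \<alpha> en[OF that] null[OF that] by (intro energy_dyadic_holder) auto
  have tb: "mtotally_bounded L"
    unfolding mtotally_bounded_def
  proof (intro allI impI)
    fix \<epsilon> :: real assume \<epsilon>: "\<epsilon> > 0"
    define \<eta> where "\<eta> = \<epsilon> / (4 * chain_const \<alpha>)"
    have c: "chain_const \<alpha> > 0" by (rule chain_const_pos[OF \<alpha>(1)])
    then have \<eta>: "\<eta> > 0" using \<epsilon> by (simp add: \<eta>_def)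
    obtain n where n: "\<beta> n < \<eta>"
      using order_tendstoD(2)[OF \<beta> \<eta>] by (auto simp: eventually_sequentially)
    define e where "e = \<eta> * (1 / 2) ^ n / 2"
    have e: "e > 0" using \<eta> by (simp add: e_def)
    define S where "S = {x. (\<forall>J. finite J \<and> J \<subseteq> Ep \<longrightarrow> (\<Sum>e\<in>J. (x \<bullet> e)\<^sup>2 / lam e) \<le> 2 * C) \<and> (\<forall>e\<in>E - Ep. x \<bullet> e = 0)}"
    obtain k where k: "finite k" "S \<subseteq> (\<Union>x\<in>k. ball x e)"
      using energy_ball_totally_bounded[OF e, of "2 * C"] unfolding S_def[symmetric] by blast
    have val: "\<exists>c\<in>k. dist c (F (real i / 2 ^ n)) < e" if F: "F \<in> L" and i: "i \<le> 2 ^ n" for F i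
    proof -
      have F0: "F 0 = 0" using L_holder[OF F] by (simp add: holder0_def)
      have "F (real i / 2 ^ n) \<in> S"
        unfolding S_def mem_Collect_eq
      proof (intro conjI allI impI ballI)
        fix J assume "finite J \<and> J \<subseteq> Ep"
        then show "(\<Sum>e\<in>J. (F (real i / 2 ^ n) \<bullet> e)\<^sup>2 / lam e) \<le> 2 * C"
          using order_trans[OF energy_coord_bound[where F = F and k = i and n = n, OF F0 i] en[OF F]] by blast
      qed (rule null[OF F dyadic_mem[OF i]])
      with k(2) obtain c where "c \<in> k" "F (real i / 2 ^ n) \<in> ball c e" by blast
      then show ?thesis by (intro bexI[of _ c]) simp_all
    qed
    \<comment> \<open>Restricting the rounding map to the grid indices makes its values extensional,
      so they lie in a finite function space.\<close>
    define b where "b F = (\<lambda>i\<in>{..2 ^ n :: nat}. SOME c. c \<in> k \<and> dist c (F (real i / 2 ^ n)) < e)" for F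
    have b: "b F i \<in> k \<and> dist (b F i) (F (real i / 2 ^ n)) < e" if "F \<in> L" "i \<le> 2 ^ n" for F i
    proof -
      have "(SOME c. c \<in> k \<and> dist c (F (real i / 2 ^ n)) < e) \<in> k \<and>
          dist (SOME c. c \<in> k \<and> dist c (F (real i / 2 ^ n)) < e) (F (real i / 2 ^ n)) < e"
        by (rule someI_ex) (use val[OF that] in blast)
      then show ?thesis using that(2) by (simp add: b_def)
    qed
    have "b F \<in> PiE {..2 ^ n} (\<lambda>_. k)" if "F \<in> L" for F
      using b[OF that] by (intro PiE_I) (auto simp: b_def)
    then have "b ` L \<subseteq> PiE {..2 ^ n} (\<lambda>_. k)" by blast
    then have "finite (b ` L)"
      by (rule finite_subset) (use k(1) in \<open>auto intro: finite_PiE\<close>)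
    then obtain K where K: "finite K" "K \<subseteq> L" "\<And>F. F \<in> L \<Longrightarrow> \<exists>G\<in>K. b F = b G"
      by (rule finite_representatives) blast
    have "L \<subseteq> (\<Union>x\<in>K. mball x \<epsilon>)"
    proof
      fix F assume F: "F \<in> L"
      then obtain G where G: "G \<in> K" "b F = b G" using K(3) by blast
      have GL: "G \<in> L" using G K by blast
      have "dyadic_holder \<alpha> 0 (2 * \<eta>) (\<lambda>t. G t - F t)"
      proof (rule dyadic_holder_bucket)
        show "dyadic_holder \<alpha> n \<eta> G" "dyadic_holder \<alpha> n \<eta> F"
          using dyadic_holder_mono[OF dy[OF GL, of n] order_refl] dyadic_holder_mono[OF dy[OF F, of n] order_refl] n by auto
        fix i :: nat assume i: "i \<le> 2 ^ n"
        have "dist (G (real i / 2 ^ n)) (F (real i / 2 ^ n)) < e + e"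
          using b[OF F i] b[OF GL i] G(2) dist_triangle3[of "G (real i / 2 ^ n)" "F (real i / 2 ^ n)" "b G i"] by simp
        then show "norm (G (real i / 2 ^ n) - F (real i / 2 ^ n)) \<le> \<eta> * (1 / 2) ^ n"
          by (simp add: dist_norm e_def)
      qed (use \<alpha> in simp)
      then have "holder_dist \<alpha> G F \<le> chain_const \<alpha> * (2 * \<eta>)"
        using GL F by (intro holder_dist_le \<alpha>) auto
      also have "\<dots> < \<epsilon>" using c \<epsilon> by (simp add: \<eta>_def)
      finally have "F \<in> mball G \<epsilon>" using GL F by simp
      with G(1) show "F \<in> (\<Union>x\<in>K. mball x \<epsilon>)" by blast
    qed
    with K show "\<exists>K. finite K \<and> K \<subseteq> L \<and> L \<subseteq> (\<Union>x\<in>K. mball x \<epsilon>)" by blast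
  qed
  have lim: "\<exists>F\<in>L. limitin mtopology H F sequentially" if H: "range H \<subseteq> L" and cau: "MCauchy H" for H
  proof -
    have HL: "H i \<in> L" "H i \<in> holder0 \<alpha>" for i using H by (auto simp: image_subset_iff)
    have pc: "\<exists>N. \<forall>i\<ge>N. \<forall>j\<ge>N. holder_dist \<alpha> (H i) (H j) < \<epsilon>" if "\<epsilon> > 0" for \<epsilon>
      using cau[unfolded MCauchy_def, THEN conjunct2, rule_format, OF that] by blast
    have "\<exists>x. (\<lambda>i. H i t) \<longlonglongrightarrow> x" if t: "t \<in> {0..1}" for t
    proof -
      have "Cauchy (\<lambda>i. H i t)"
      proof (rule metric_CauchyI)
        fix \<epsilon> :: real assume "0 < \<epsilon>"
        then obtain N where N: "\<forall>i\<ge>N. \<forall>j\<ge>N. holder_dist \<alpha> (H i) (H j) < \<epsilon>" using pc by blast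
        have "dist (H i t) (H j t) < \<epsilon>" if "i \<ge> N" "j \<ge> N" for i j
          using holder_dist_sup[OF \<alpha>(1) HL(2) HL(2) t, of i j] N that by (auto simp: dist_norm intro: le_less_trans)
        then show "\<exists>M. \<forall>m\<ge>M. \<forall>n\<ge>M. dist (H m t) (H n t) < \<epsilon>" by blast
      qed
      then show ?thesis by (simp add: Cauchy_convergent_iff convergent_def)
    qed
    then obtain f where f: "\<And>t. t \<in> {0..1} \<Longrightarrow> (\<lambda>i. H i t) \<longlonglongrightarrow> f t" by metis
    define F where "F = restrict f {0..1}"
    have F: "(\<lambda>i. H i t) \<longlonglongrightarrow> F t" if "t \<in> {0..1}" for t using f[OF that] that by (simp add: F_def)
    have F0: "F 0 = 0"
    proof -
      have "H i 0 = 0" for i using HL(2)[of i] by (simp add: holder0_def)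
      then show ?thesis using F[of 0] by (simp add: LIMSEQ_const_iff)
    qed
    \<comment> \<open>Lower semicontinuity of the rate: each energy depends continuously on finitely
      many values, and the rate is at most \<open>C\<close> as soon as all of them are at most
      \<open>2 * C\<close>.\<close>
    have enF: "energy n J F \<le> 2 * C" if "finite J" "J \<subseteq> Ep" for n J
      by (rule LIMSEQ_le_const2[OF energy_tendsto[OF F]]) (use en[OF HL(1) that] in auto)
    have nullF: "F t \<bullet> e = 0" if "t \<in> {0..1}" "e \<in> E - Ep" for t e
    proof -
      have "(\<lambda>i. H i t \<bullet> e) \<longlonglongrightarrow> F t \<bullet> e" by (intro tendsto_intros F that)
      then show ?thesis using null[OF HL(1) that] by (simp add: LIMSEQ_const_iff)
    qed
    have "uniform_limit {0..1} H F sequentially"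
    proof (rule uniform_limitI)
      fix \<epsilon> :: real assume \<epsilon>: "0 < \<epsilon>"
      then obtain N where N: "\<forall>i\<ge>N. \<forall>j\<ge>N. holder_dist \<alpha> (H i) (H j) < \<epsilon> / 2" using pc[of "\<epsilon> / 2"] by auto
      have "dist (H i t) (F t) < \<epsilon>" if i: "i \<ge> N" and t: "t \<in> {0..1}" for i t
      proof -
        have "(\<lambda>j. dist (H i t) (H j t)) \<longlonglongrightarrow> dist (H i t) (F t)" by (intro tendsto_intros F t)
        moreover have "dist (H i t) (H j t) \<le> \<epsilon> / 2" if "j \<ge> N" for j
        proof -
          have "holder_dist \<alpha> (H i) (H j) < \<epsilon> / 2" using N i that by blast
          then show ?thesis using holder_dist_sup[OF \<alpha>(1) HL(2) HL(2) t, of i j] by (simp add: dist_norm)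
        qed
        ultimately have "dist (H i t) (F t) \<le> \<epsilon> / 2" by (intro LIMSEQ_le_const2) auto
        with \<epsilon> show ?thesis by simp
      qed
      then show "\<forall>\<^sub>F n in sequentially. \<forall>x\<in>{0..1}. dist (H n x) (F x) < \<epsilon>"
        unfolding eventually_sequentially by blast
    qed
    then have cont: "continuous_on {0..1} F"
      by (rule uniform_limit_theorem[rotated]) (simp, intro always_eventually allI holder0_continuous[OF \<alpha>(1) HL(2)])
    have "F \<in> holder0 \<alpha>"
    proof (rule holder0I[OF \<alpha>(1) _ F0 cont])
      show "F \<in> extensional {0..1}" by (simp add: F_def)
      fix \<eta> :: real assume "\<eta> > 0"
      then obtain n where n: "\<beta> n < \<eta>"
        using order_tendstoD(2)[OF \<beta>] by (auto simp: eventually_sequentially)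
      have "dyadic_holder \<alpha> n (\<beta> n) F"
        unfolding \<beta>_def using \<alpha> enF nullF by (intro energy_dyadic_holder) auto
      then show "\<exists>n. dyadic_holder \<alpha> n \<eta> F" using n by (blast intro: dyadic_holder_mono less_imp_le)
    qed
    moreover have "schilder_rate Q F \<le> ennreal C"
      by (rule schilder_rateI[OF cont F0 nullF enF])
    ultimately have FL: "F \<in> L" unfolding L_def by blast
    have "limitin mtopology H F sequentially"
      unfolding limitin_metric
    proof (intro conjI allI impI)
      show "F \<in> holder0 \<alpha>" by fact
      fix \<epsilon> :: real assume \<epsilon>: "\<epsilon> > 0"
      define \<eta> where "\<eta> = \<epsilon> / (2 * chain_const \<alpha>)"
      have c: "chain_const \<alpha> > 0" by (rule chain_const_pos[OF \<alpha>(1)])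
      have "\<eta> > 0" using \<epsilon> c by (simp add: \<eta>_def)
      then obtain N where N: "\<forall>i\<ge>N. \<forall>j\<ge>N. holder_dist \<alpha> (H i) (H j) < \<eta>" using pc by blast
      have "H i \<in> holder0 \<alpha> \<and> holder_dist \<alpha> (H i) F < \<epsilon>" if i: "i \<ge> N" for i
      proof
        have "dyadic_holder \<alpha> 0 \<eta> (\<lambda>t. H i t - F t)"
        proof (rule dyadic_holder_limit[where H = "\<lambda>j t. H i t - H j t"])
          show "(\<lambda>j. H i t - H j t) \<longlonglongrightarrow> H i t - F t" if "t \<in> {0..1}" for t
            by (intro tendsto_intros F that)
          have "dyadic_holder \<alpha> 0 \<eta> (\<lambda>t. H i t - H j t)" if "j \<ge> N" for j
            using dyadic_holder_mono[OF holder_dist_dyadic[OF \<alpha>(1) HL(2) HL(2), of i j] order_refl] N i that by (auto intro: less_imp_le)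
          then show "\<forall>\<^sub>F j in sequentially. dyadic_holder \<alpha> 0 \<eta> (\<lambda>t. H i t - H j t)"
            by (auto simp: eventually_sequentially)
        qed
        then have "holder_dist \<alpha> (H i) F \<le> chain_const \<alpha> * \<eta>"
          using FL by (intro holder_dist_le \<alpha> HL(2)) auto
        also have "\<dots> < \<epsilon>" using c \<epsilon> by (simp add: \<eta>_def)
        finally show "holder_dist \<alpha> (H i) F < \<epsilon>" .
      qed (rule HL(2))
      then show "\<forall>\<^sub>F x in sequentially. H x \<in> holder0 \<alpha> \<and> holder_dist \<alpha> (H x) F < \<epsilon>"
        by (auto simp: eventually_sequentially)
    qed
    with FL show ?thesis by blast
  qed
  have "compactin mtopology L"
    unfolding compactin_sequentially
  proof (intro conjI allI impI)
    show "L \<subseteq> holder0 \<alpha>" unfolding L_def by blast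
    fix \<sigma> :: "nat \<Rightarrow> real \<Rightarrow> 'h"
    assume \<sigma>: "range \<sigma> \<subseteq> L"
    then obtain r where r: "strict_mono r" "MCauchy (\<sigma> \<circ> r)"
      using tb unfolding mtotally_bounded_sequentially by blast
    have "range (\<sigma> \<circ> r) \<subseteq> L" using \<sigma> by (auto simp: image_subset_iff)
    from lim[OF this r(2)] r(1)
    show "\<exists>l r. l \<in> L \<and> strict_mono r \<and> limitin mtopology (\<sigma> \<circ> r) l sequentially" by blast
  qed
  then show ?thesis unfolding L by (simp add: holder_topology_def)
qed

lemma Hausdorff_holder: "0 < \<alpha> \<Longrightarrow> Hausdorff_space (holder_topology \<alpha> :: (real \<Rightarrow> 'h) topology)"
  unfolding holder_topology_def by (rule Metric_space.Hausdorff_space_mtopology[OF Metric_space_holder0])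

lemma schilder_rate_good:
  assumes "0 < \<alpha>" "\<alpha> < 1 / 2"
  shows "good_rate_function (holder_topology \<alpha>) (schilder_rate Q)"
  unfolding good_rate_function_def rate_function_def
  using schilder_rate_compact[OF assms] compactin_imp_closedin[OF Hausdorff_holder[OF assms(1)]] by blast

end

section \<open>Gaussian product measures\<close>

lemma prob_space_gauss: "prob_space std_normal_distribution"
  using real_dist_normal_dist by (simp add: real_distribution_def)

lemma sets_gauss [measurable_cong]: "sets std_normal_distribution = sets borel"
  by simp

text \<open>Normalising \<open>g\<close> to a density gives a second probability measure; the
  assumption on characteristic functions says that \<open>X\<close> is standard normal under it, and
  Levy's uniqueness theorem on the line applies.\<close>

lemma (in prob_space) gauss_density:
  fixes g X :: "'a \<Rightarrow> real"
  assumes g[measurable]: "g \<in> borel_measurable M" and g0: "\<And>x. 0 \<le> g x" and gC: "\<And>x. g x \<le> C"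
    and X[measurable]: "X \<in> borel_measurable M" and c: "expectation g > 0"
    and chr: "\<And>t. (LINT x|M. complex_of_real (g x) * iexp (t * X x)) = complex_of_real (expectation g) * complex_of_real (exp (- t\<^sup>2 / 2))"
    and B[measurable]: "B \<in> sets borel"
  shows "expectation (\<lambda>x. g x * indicator B (X x)) = expectation g * measure std_normal_distribution B"
proof -
  define c where "c = expectation g"
  have c0: "c > 0" using c by (simp add: c_def)
  define N where "N = density M (\<lambda>x. ennreal (g x / c))"
  have int: "integrable M g"
    by (rule integrable_const_bound[of _ C]) (use g0 gC in auto)
  have "emeasure N (space N) = (\<integral>\<^sup>+x. ennreal (g x / c) \<partial>M)"
    unfolding N_def by (subst emeasure_density) (auto intro!: nn_integral_cong)
  also have "\<dots> = ennreal (LINT x|M. g x / c)"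
    using int g0 c0 by (intro nn_integral_eq_integral) auto
  also have "\<dots> = 1" using c0 by (simp add: c_def[symmetric])
  finally interpret N: prob_space N by (rule prob_spaceI)
  have XN[measurable]: "X \<in> borel_measurable N" by (simp add: N_def)
  have dN: "(LINT x|N. h x) = (LINT x|M. (g x / c) *\<^sub>R h x)" if "h \<in> borel_measurable M"
    for h :: "'a \<Rightarrow> 'b::{banach,second_countable_topology}"
    unfolding N_def using that g0 c0 by (intro integral_density) auto
  have "char (distr N borel X) t = complex_of_real (exp (- t\<^sup>2 / 2))" for t
  proof -
    have "char (distr N borel X) t = (LINT x|N. iexp (t * X x))"
      unfolding char_def by (subst integral_distr) auto
    also have "\<dots> = (LINT x|M. (g x / c) *\<^sub>R iexp (t * X x))" by (rule dN) simp
    also have "\<dots> = (LINT x|M. complex_of_real (1 / c) * (complex_of_real (g x) * iexp (t * X x)))"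
      by (intro Bochner_Integration.integral_cong refl) (simp add: scaleR_conv_of_real)
    also have "\<dots> = complex_of_real (1 / c) * (LINT x|M. complex_of_real (g x) * iexp (t * X x))"
      by (rule integral_mult_right_zero)
    also have "\<dots> = complex_of_real (exp (- t\<^sup>2 / 2))"
      unfolding chr using c0 by (simp add: c_def[symmetric])
    finally show ?thesis .
  qed
  then have "distr N borel X = std_normal_distribution"
    by (intro Levy_uniqueness N.real_distribution_distr XN real_dist_normal_dist)
      (simp add: char_std_normal_distribution fun_eq_iff)
  then have "measure std_normal_distribution B = measure (distr N borel X) B" by simp
  also have "\<dots> = measure N (X -` B \<inter> space N)" by (simp add: measure_distr)
  also have "\<dots> = (LINT x|N. indicator (X -` B \<inter> space N) x)" by simp
  also have "\<dots> = (LINT x|N. indicator B (X x))"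
    by (intro Bochner_Integration.integral_cong refl) (simp add: indicator_def)
  also have "\<dots> = (LINT x|M. (g x / c) *\<^sub>R indicator B (X x))" by (rule dN) simp
  also have "\<dots> = expectation (\<lambda>x. g x * indicator B (X x) / c)" by simp
  also have "\<dots> = expectation (\<lambda>x. g x * indicator B (X x)) / c" by (rule integral_divide_zero)
  finally show ?thesis using c0 by (simp add: c_def[symmetric] field_simps)
qed

text \<open>A signed weight is no density, but \<open>2 + f\<close> lies between 1 and 3. Apply
  \<open>gauss_density\<close> to it and to the constant weight 1, then subtract.\<close>

lemma (in prob_space) gauss_weight_real:
  fixes f X :: "'a \<Rightarrow> real"
  assumes f[measurable]: "f \<in> borel_measurable M" and f1: "\<And>x. \<bar>f x\<bar> \<le> 1"
    and X[measurable]: "X \<in> borel_measurable M"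
    and one: "\<And>t. (LINT x|M. iexp (t * X x)) = complex_of_real (exp (- t\<^sup>2 / 2))"
    and wt: "\<And>t. (LINT x|M. complex_of_real (f x) * iexp (t * X x)) = complex_of_real (expectation f) * complex_of_real (exp (- t\<^sup>2 / 2))"
    and B[measurable]: "B \<in> sets borel"
  shows "expectation (\<lambda>x. f x * indicator B (X x)) = expectation f * measure std_normal_distribution B"
proof -
  have intf: "integrable M f" by (rule integrable_const_bound[of _ 1]) (use f1 in auto)
  have f1': "- 1 \<le> f x" "f x \<le> 1" for x using f1[of x] by (simp_all add: abs_le_iff)
  have E2: "expectation (\<lambda>x. 2 + f x) = 2 + expectation f"
    using intf by (simp add: prob_space)
  have "- 1 \<le> expectation f"
    using integral_mono[of M "\<lambda>_. - 1" f] intf f1' by (simp add: prob_space)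
  then have pos: "expectation (\<lambda>x. 2 + f x) > 0" unfolding E2 by simp
  have inti: "integrable M (\<lambda>x. iexp (t * X x))" "integrable M (\<lambda>x. complex_of_real (f x) * iexp (t * X x))" for t
    using f1 by (auto intro!: integrable_const_bound[of _ 1] simp: norm_mult)
  have "expectation (\<lambda>x. 1 * indicator B (X x)) = expectation (\<lambda>x. 1) * measure std_normal_distribution B"
    by (rule gauss_density[of "\<lambda>_. 1" 1]) (use one in \<open>auto simp: prob_space\<close>)
  then have 1: "expectation (\<lambda>x. indicator B (X x)) = measure std_normal_distribution B"
    by (simp add: prob_space)
  have "expectation (\<lambda>x. (2 + f x) * indicator B (X x)) = expectation (\<lambda>x. 2 + f x) * measure std_normal_distribution B"
  proof (rule gauss_density[of _ 3])
    fix t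
    have "(LINT x|M. complex_of_real (2 + f x) * iexp (t * X x)) =
        (LINT x|M. 2 * iexp (t * X x) + complex_of_real (f x) * iexp (t * X x))"
      by (simp add: algebra_simps)
    also have "\<dots> = 2 * (LINT x|M. iexp (t * X x)) + (LINT x|M. complex_of_real (f x) * iexp (t * X x))"
      using inti by simp
    also have "\<dots> = complex_of_real (expectation (\<lambda>x. 2 + f x)) * complex_of_real (exp (- t\<^sup>2 / 2))"
      unfolding one wt E2 by (simp add: algebra_simps)
    finally show "(LINT x|M. complex_of_real (2 + f x) * iexp (t * X x)) =
        complex_of_real (expectation (\<lambda>x. 2 + f x)) * complex_of_real (exp (- t\<^sup>2 / 2))" .
    show "0 \<le> 2 + f x" "2 + f x \<le> 3" for x using f1'[of x] by simp_all
  qed (use pos in auto)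
  moreover have "expectation (\<lambda>x. (2 + f x) * indicator B (X x)) =
      2 * expectation (\<lambda>x. indicator B (X x)) + expectation (\<lambda>x. f x * indicator B (X x))"
  proof -
    have "integrable M (\<lambda>x. indicat_real B (X x))" "integrable M (\<lambda>x. f x * indicat_real B (X x))"
      using f1 by (auto intro!: integrable_const_bound[of _ 1] simp: abs_mult indicator_def)
    then show ?thesis by (simp add: distrib_right)
  qed
  ultimately show ?thesis unfolding 1 E2 by (simp add: algebra_simps)
qed

text \<open>Real and imaginary parts are combinations of \<open>f\<close> and its conjugate, and the
  hypothesis for the conjugate is the conjugate of the hypothesis at \<open>- t\<close>.\<close>

lemma (in prob_space) gauss_weight_complex:
  fixes f :: "'a \<Rightarrow> complex" and X :: "'a \<Rightarrow> real"
  assumes f[measurable]: "f \<in> borel_measurable M" and f1: "\<And>x. norm (f x) \<le> 1"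
    and X[measurable]: "X \<in> borel_measurable M"
    and one: "\<And>t. (LINT x|M. iexp (t * X x)) = complex_of_real (exp (- t\<^sup>2 / 2))"
    and wt: "\<And>t. (LINT x|M. f x * iexp (t * X x)) = (LINT x|M. f x) * complex_of_real (exp (- t\<^sup>2 / 2))"
    and B[measurable]: "B \<in> sets borel"
  shows "(LINT x|M. f x * complex_of_real (indicator B (X x))) = (LINT x|M. f x) * complex_of_real (measure std_normal_distribution B)"
proof -
  have intf: "integrable M f" by (rule integrable_const_bound[of _ 1]) (use f1 in auto)
  have [measurable]: "(\<lambda>x. cnj (f x)) \<in> borel_measurable M"
    by (rule measurable_compose[OF f borel_measurable_continuous_onI]) (intro continuous_intros)
  have inti: "integrable M (\<lambda>x. f x * iexp (t * X x))" "integrable M (\<lambda>x. cnj (f x) * iexp (t * X x))" for t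
    using f1 by (auto intro!: integrable_const_bound[of _ 1] simp: norm_mult)
  have cn: "(LINT x|M. cnj (f x) * iexp (t * X x)) = cnj (LINT x|M. f x) * complex_of_real (exp (- t\<^sup>2 / 2))" for t
  proof -
    have "(LINT x|M. cnj (f x) * iexp (t * X x)) = (LINT x|M. cnj (f x * iexp ((- t) * X x)))"
      by (intro Bochner_Integration.integral_cong refl) (simp add: exp_cnj)
    also have "\<dots> = cnj (LINT x|M. f x * iexp ((- t) * X x))" by (rule Bochner_Integration.integral_cnj)
    also have "\<dots> = cnj (LINT x|M. f x) * complex_of_real (exp (- t\<^sup>2 / 2))"
      unfolding wt by simp
    finally show ?thesis .
  qed
  have Re: "expectation (\<lambda>x. Re (f x)) = Re (LINT x|M. f x)" and Im: "expectation (\<lambda>x. Im (f x)) = Im (LINT x|M. f x)"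
    using intf by simp_all
  have re: "expectation (\<lambda>x. Re (f x) * indicator B (X x)) = expectation (\<lambda>x. Re (f x)) * measure std_normal_distribution B"
  proof (rule gauss_weight_real[OF _ _ X one _ B])
    fix t
    have "(LINT x|M. complex_of_real (Re (f x)) * iexp (t * X x)) =
        (LINT x|M. (1 / 2) * (f x * iexp (t * X x) + cnj (f x) * iexp (t * X x)))"
      by (intro Bochner_Integration.integral_cong refl) (simp add: distrib_right[symmetric] complex_add_cnj)
    also have "\<dots> = (1 / 2) * ((LINT x|M. f x * iexp (t * X x)) + (LINT x|M. cnj (f x) * iexp (t * X x)))"
      using inti by (simp only: integral_mult_right_zero Bochner_Integration.integral_add)
    also have "\<dots> = (1 / 2) * ((LINT x|M. f x) + cnj (LINT x|M. f x)) * complex_of_real (exp (- t\<^sup>2 / 2))"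
      unfolding wt cn by (simp add: algebra_simps)
    also have "\<dots> = complex_of_real (expectation (\<lambda>x. Re (f x))) * complex_of_real (exp (- t\<^sup>2 / 2))"
      unfolding Re complex_add_cnj by simp
    finally show "(LINT x|M. complex_of_real (Re (f x)) * iexp (t * X x)) =
        complex_of_real (expectation (\<lambda>x. Re (f x))) * complex_of_real (exp (- t\<^sup>2 / 2))" .
    show "\<bar>Re (f x)\<bar> \<le> 1" for x using abs_Re_le_cmod[of "f x"] f1[of x] by linarith
  qed simp
  have im: "expectation (\<lambda>x. Im (f x) * indicator B (X x)) = expectation (\<lambda>x. Im (f x)) * measure std_normal_distribution B"
  proof (rule gauss_weight_real[OF _ _ X one _ B])
    fix t
    have imc: "complex_of_real (Im z) = - (\<i> / 2) * (z - cnj z)" for z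
      by (simp add: complex_eq_iff)
    have "(LINT x|M. complex_of_real (Im (f x)) * iexp (t * X x)) =
        (LINT x|M. - (\<i> / 2) * (f x * iexp (t * X x) - cnj (f x) * iexp (t * X x)))"
      by (intro Bochner_Integration.integral_cong refl) (simp add: imc left_diff_distrib mult.assoc)
    also have "\<dots> = - (\<i> / 2) * ((LINT x|M. f x * iexp (t * X x)) - (LINT x|M. cnj (f x) * iexp (t * X x)))"
      using inti by (simp only: integral_mult_right_zero Bochner_Integration.integral_diff)
    also have "\<dots> = - (\<i> / 2) * ((LINT x|M. f x) - cnj (LINT x|M. f x)) * complex_of_real (exp (- t\<^sup>2 / 2))"
      unfolding wt cn by (simp add: algebra_simps)
    also have "\<dots> = complex_of_real (expectation (\<lambda>x. Im (f x))) * complex_of_real (exp (- t\<^sup>2 / 2))"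
      unfolding Im imc ..
    finally show "(LINT x|M. complex_of_real (Im (f x)) * iexp (t * X x)) =
        complex_of_real (expectation (\<lambda>x. Im (f x))) * complex_of_real (exp (- t\<^sup>2 / 2))" .
    show "\<bar>Im (f x)\<bar> \<le> 1" for x using abs_Im_le_cmod[of "f x"] f1[of x] by linarith
  qed simp
  have intB: "integrable M (\<lambda>x. f x * complex_of_real (indicator B (X x)))"
    using f1 by (auto intro!: integrable_const_bound[of _ 1] simp: norm_mult indicator_def)
  show ?thesis
  proof (rule complex_eqI)
    show "Re (LINT x|M. f x * complex_of_real (indicator B (X x))) = Re ((LINT x|M. f x) * complex_of_real (measure std_normal_distribution B))"
      using re by (simp add: integral_Re[OF intB, symmetric] Re)
    show "Im (LINT x|M. f x * complex_of_real (indicator B (X x))) = Im ((LINT x|M. f x) * complex_of_real (measure std_normal_distribution B))"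
      using im by (simp add: integral_Im[OF intB, symmetric] Im)
  qed
qed

text \<open>Derives independence from the joint characteristic function using the one-dimensional
  uniqueness theorem only. The induction replaces one exponential at a time by an indicator, and the
  weight \<open>f\<close> carries the indicators already obtained.\<close>

lemma (in prob_space) gauss_rectangle:
  fixes f :: "'a \<Rightarrow> complex" and X :: "'i \<Rightarrow> 'a \<Rightarrow> real"
  assumes "finite T" and X[measurable]: "\<And>i. X i \<in> borel_measurable M"
    and one: "\<And>i t. i \<in> T \<Longrightarrow> (LINT x|M. iexp (t * X i x)) = complex_of_real (exp (- t\<^sup>2 / 2))"
    and B[measurable]: "\<And>i. B i \<in> sets borel"
    and "f \<in> borel_measurable M" "\<And>x. norm (f x) \<le> 1"
    and "\<And>a. (LINT x|M. f x * iexp (\<Sum>i\<in>T. a i * X i x)) = (LINT x|M. f x) * complex_of_real (\<Prod>i\<in>T. exp (- (a i)\<^sup>2 / 2))"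
  shows "(LINT x|M. f x * complex_of_real (\<Prod>i\<in>T. indicator (B i) (X i x))) =
    (LINT x|M. f x) * complex_of_real (\<Prod>i\<in>T. measure std_normal_distribution (B i))"
  using assms(1,3,5-7)
proof (induction T arbitrary: f rule: finite_induct)
  case (insert j T)
  note f[measurable] = insert.prems(2) and f1 = insert.prems(3) and chr = insert.prems(4)
  have oneT: "\<And>i t. i \<in> T \<Longrightarrow> (LINT x|M. iexp (t * X i x)) = complex_of_real (exp (- t\<^sup>2 / 2))"
    by (rule insert.prems(1)) simp
  have onej: "\<And>t. (LINT x|M. iexp (t * X j x)) = complex_of_real (exp (- t\<^sup>2 / 2))"
    by (rule insert.prems(1)) simp
  \<comment> \<open>The exponentials of the remaining variables are absorbed into the weight, so
    that \<open>X j\<close> can be treated alone for every \<open>a\<close>.\<close>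
  define g where "g a x = f x * iexp (\<Sum>i\<in>T. a i * X i x)" for a x
  have g[measurable]: "g a \<in> borel_measurable M" for a unfolding g_def by measurable
  have g1: "norm (g a x) \<le> 1" for a x using f1[of x] by (simp add: g_def norm_mult)
  have split: "(LINT x|M. g a x * iexp (t * X j x)) =
      (LINT x|M. f x) * complex_of_real (\<Prod>i\<in>T. exp (- (a i)\<^sup>2 / 2)) * complex_of_real (exp (- t\<^sup>2 / 2))" for a t
  proof -
    have "(\<Sum>i\<in>insert j T. (a(j := t)) i * X i x) = t * X j x + (\<Sum>i\<in>T. a i * X i x)" for x
      using insert.hyps by (simp, intro sum.cong) auto
    then have "(LINT x|M. g a x * iexp (t * X j x)) = (LINT x|M. f x * iexp (\<Sum>i\<in>insert j T. (a(j := t)) i * X i x))"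
      by (intro Bochner_Integration.integral_cong refl) (simp add: g_def exp_add[symmetric] algebra_simps)
    also have "\<dots> = (LINT x|M. f x) * complex_of_real (\<Prod>i\<in>insert j T. exp (- ((a(j := t)) i)\<^sup>2 / 2))"
      by (rule chr)
    also have "(\<Prod>i\<in>insert j T. exp (- ((a(j := t)) i)\<^sup>2 / 2)) = exp (- t\<^sup>2 / 2) * (\<Prod>i\<in>T. exp (- (a i)\<^sup>2 / 2))"
      using insert.hyps by (simp, intro prod.cong) auto
    finally show ?thesis by (simp add: mult_ac)
  qed
  have gint: "(LINT x|M. g a x) = (LINT x|M. f x) * complex_of_real (\<Prod>i\<in>T. exp (- (a i)\<^sup>2 / 2))" for a
    using split[of a 0] by simp
  have gB: "(LINT x|M. g a x * complex_of_real (indicator (B j) (X j x))) =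
      (LINT x|M. g a x) * complex_of_real (measure std_normal_distribution (B j))" for a
    by (rule gauss_weight_complex[OF g g1 X onej _ B]) (simp only: split gint)
  define f' where "f' x = f x * complex_of_real (indicator (B j) (X j x))" for x
  have f'int: "(LINT x|M. f' x) = (LINT x|M. f x) * complex_of_real (measure std_normal_distribution (B j))"
    using gB[of "\<lambda>_. 0"] gint[of "\<lambda>_. 0"] by (simp add: g_def f'_def)
  have "(LINT x|M. f' x * complex_of_real (\<Prod>i\<in>T. indicator (B i) (X i x))) =
    (LINT x|M. f' x) * complex_of_real (\<Prod>i\<in>T. measure std_normal_distribution (B i))"
  proof (rule insert.IH[OF oneT])
    show "f' \<in> borel_measurable M" unfolding f'_def by measurable
    show "norm (f' x) \<le> 1" for x using f1[of x] by (simp add: f'_def norm_mult indicator_def)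
    fix a
    have "(LINT x|M. f' x * iexp (\<Sum>i\<in>T. a i * X i x)) = (LINT x|M. g a x * complex_of_real (indicator (B j) (X j x)))"
      by (intro Bochner_Integration.integral_cong refl) (simp add: f'_def g_def)
    also have "\<dots> = (LINT x|M. f' x) * complex_of_real (\<Prod>i\<in>T. exp (- (a i)\<^sup>2 / 2))"
      unfolding gB gint f'int by (simp add: mult_ac)
    finally show "(LINT x|M. f' x * iexp (\<Sum>i\<in>T. a i * X i x)) = (LINT x|M. f' x) * complex_of_real (\<Prod>i\<in>T. exp (- (a i)\<^sup>2 / 2))" .
  qed
  then show ?case
    using insert.hyps by (simp add: f'_def f'int[unfolded f'_def] mult.assoc)
qed simp

lemma (in prob_space) iid_gauss:
  fixes X :: "'i \<Rightarrow> 'a \<Rightarrow> real"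
  assumes I: "finite I" and X[measurable]: "\<And>i. X i \<in> borel_measurable M"
    and chr: "\<And>a. (LINT x|M. iexp (\<Sum>i\<in>I. a i * X i x)) = complex_of_real (exp (- (\<Sum>i\<in>I. (a i)\<^sup>2) / 2))"
  shows "distr M (PiM I (\<lambda>_. std_normal_distribution)) (\<lambda>x. \<lambda>i\<in>I. X i x) = PiM I (\<lambda>_. std_normal_distribution)"
proof -
  interpret G: prob_space std_normal_distribution by (rule prob_space_gauss)
  interpret P: product_sigma_finite "\<lambda>_::'i. std_normal_distribution" ..
  have one: "(LINT x|M. iexp (t * X i x)) = complex_of_real (exp (- t\<^sup>2 / 2))" if "i \<in> I" for i t
  proof -
    have "(\<Sum>k\<in>I. (if k = i then t else 0) * X k x) = t * X i x" for x
      using that I by (simp add: if_distrib[where f = "\<lambda>z. z * _"] cong: if_cong)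
    moreover have "(\<Sum>k\<in>I. (if k = i then t else 0)\<^sup>2) = t\<^sup>2"
      using that I by (simp add: if_distrib[where f = "\<lambda>z. z\<^sup>2"] cong: if_cong)
    ultimately show ?thesis using chr[of "\<lambda>k. if k = i then t else 0"] by simp
  qed
  have Xm[measurable]: "(\<lambda>x. \<lambda>i\<in>I. X i x) \<in> measurable M (PiM I (\<lambda>_. std_normal_distribution))"
    by (rule measurable_restrict) simp
  show ?thesis
  proof (rule P.PiM_eqI[OF I])
    fix A assume A: "\<And>i. i \<in> I \<Longrightarrow> A i \<in> sets std_normal_distribution"
    define B where "B i = (if i \<in> I then A i else UNIV)" for i
    have B[measurable]: "B i \<in> sets borel" for i using A by (simp add: B_def)
    have AB: "PiE I A = PiE I B" by (intro PiE_cong) (simp add: B_def)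
    have Bs: "PiE I B \<in> sets (PiM I (\<lambda>_. std_normal_distribution))"
      using B by (intro sets_PiM_I_finite I) simp
    have "(LINT x|M. (1 :: complex) * complex_of_real (\<Prod>i\<in>I. indicator (B i) (X i x))) =
        (LINT x|M. (1 :: complex)) * complex_of_real (\<Prod>i\<in>I. measure std_normal_distribution (B i))"
    proof (rule gauss_rectangle[OF I X one B])
      fix a :: "'i \<Rightarrow> real"
      have "(\<Prod>i\<in>I. exp (- (a i)\<^sup>2 / 2)) = exp (- (\<Sum>i\<in>I. (a i)\<^sup>2) / 2)"
        by (simp add: exp_sum[OF I, symmetric] sum_negf sum_divide_distrib)
      then show "(LINT x|M. (1 :: complex) * iexp (\<Sum>i\<in>I. a i * X i x)) =
          (LINT x|M. (1 :: complex)) * complex_of_real (\<Prod>i\<in>I. exp (- (a i)\<^sup>2 / 2))"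
        by (simp only: mult_1_left chr) (simp add: prob_space)
    qed auto
    then have "complex_of_real (LINT x|M. (\<Prod>i\<in>I. indicator (B i) (X i x))) = complex_of_real (\<Prod>i\<in>I. measure std_normal_distribution (B i))"
      by (simp add: prob_space integral_complex_of_real del: of_real_prod)
    then have eq: "(LINT x|M. (\<Prod>i\<in>I. indicator (B i) (X i x))) = (\<Prod>i\<in>I. measure std_normal_distribution (B i))"
      by (simp only: of_real_eq_iff)
    have "(\<lambda>x. \<lambda>i\<in>I. X i x) -` PiE I B \<inter> space M = {x \<in> space M. \<forall>i\<in>I. X i x \<in> B i}"
      by (auto simp: PiE_iff)
    then have "emeasure (distr M (PiM I (\<lambda>_. std_normal_distribution)) (\<lambda>x. \<lambda>i\<in>I. X i x)) (PiE I B) =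
        emeasure M {x \<in> space M. \<forall>i\<in>I. X i x \<in> B i}"
      using Bs by (simp add: emeasure_distr)
    also have "\<dots> = ennreal (measure M {x \<in> space M. \<forall>i\<in>I. X i x \<in> B i})"
      by (rule emeasure_eq_measure)
    also have "measure M {x \<in> space M. \<forall>i\<in>I. X i x \<in> B i} = (LINT x|M. indicator {x \<in> space M. \<forall>i\<in>I. X i x \<in> B i} x)"
      using I by simp
    also have "\<dots> = (LINT x|M. (\<Prod>i\<in>I. indicator (B i) (X i x)))"
    proof (intro Bochner_Integration.integral_cong refl)
      fix x assume "x \<in> space M"
      then show "indicat_real {x \<in> space M. \<forall>i\<in>I. X i x \<in> B i} x = (\<Prod>i\<in>I. indicator (B i) (X i x))"
        using I by (auto simp: indicator_def prod_zero_iff intro: prod.neutral[symmetric])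
    qed
    also note eq
    also have "ennreal (\<Prod>i\<in>I. measure std_normal_distribution (B i)) = (\<Prod>i\<in>I. emeasure std_normal_distribution (B i))"
      by (simp add: G.emeasure_eq_measure prod_ennreal)
    also have "\<dots> = (\<Prod>i\<in>I. emeasure std_normal_distribution (A i))"
      by (intro prod.cong) (auto simp: B_def)
    finally show "emeasure (distr M (PiM I (\<lambda>_. std_normal_distribution)) (\<lambda>x. \<lambda>i\<in>I. X i x)) (PiE I A) =
        (\<Prod>i\<in>I. emeasure std_normal_distribution (A i))"
      unfolding AB .
  qed simp
qed

section \<open>Exponential moments, shifts and reflections of Gaussian products\<close>

lemma nn_integral_gauss:
  assumes [measurable]: "f \<in> borel_measurable borel"
  shows "(\<integral>\<^sup>+x. f x \<partial>std_normal_distribution) = (\<integral>\<^sup>+x. ennreal (std_normal_density x) * f x \<partial>lborel)"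
  by (subst nn_integral_density) auto

text \<open>The integrand is \<open>s\<close> times a centred normal density with variance
  \<open>s\<^sup>2 = 1 / (1 - a)\<close>.\<close>

lemma gauss_exp_square:
  assumes a: "a < 1"
  shows "(\<integral>\<^sup>+x. ennreal (exp (a / 2 * x\<^sup>2)) \<partial>std_normal_distribution) = ennreal (1 / sqrt (1 - a))"
proof -
  define s where "s = 1 / sqrt (1 - a)"
  have s: "s > 0" "s\<^sup>2 = 1 / (1 - a)" using a by (simp_all add: s_def power_divide)
  have "std_normal_density x * exp (a / 2 * x\<^sup>2) = s * normal_density 0 s x" for x
  proof -
    have "exp (- x\<^sup>2 / 2) * exp (a / 2 * x\<^sup>2) = exp (- x\<^sup>2 / (2 * s\<^sup>2))"
      unfolding s(2) exp_add[symmetric] using a by (simp add: field_simps)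
    moreover have "sqrt (2 * pi * s\<^sup>2) = s * sqrt (2 * pi)"
      using s(1) by (simp add: real_sqrt_mult)
    ultimately show ?thesis
      using s(1) by (simp add: normal_density_def field_simps)
  qed
  then have "ennreal (std_normal_density x) * ennreal (exp (a / 2 * x\<^sup>2)) = ennreal s * ennreal (normal_density 0 s x)" for x
    using s by (simp flip: ennreal_mult)
  then have "(\<integral>\<^sup>+x. ennreal (exp (a / 2 * x\<^sup>2)) \<partial>std_normal_distribution) = ennreal s * (\<integral>\<^sup>+x. ennreal (normal_density 0 s x) \<partial>lborel)"
    by (simp add: nn_integral_gauss nn_integral_cmult)
  also have "(\<integral>\<^sup>+x. ennreal (normal_density 0 s x) \<partial>lborel) = 1"
    using prob_space.emeasure_space_1[OF prob_space_normal_density[OF s(1), of 0]] by (simp add: emeasure_density)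
  finally show ?thesis by (simp add: s_def)
qed

lemma gauss_shift:
  assumes A[measurable]: "A \<in> sets borel"
  shows "emeasure std_normal_distribution {y. y - m \<in> A} =
    (\<integral>\<^sup>+y. ennreal (exp (- m * y - m\<^sup>2 / 2)) * indicator A y \<partial>std_normal_distribution)"
proof -
  have [measurable]: "{y. y - m \<in> A} \<in> sets borel"
    by (rule pred_Collect_borel) measurable
  have "emeasure std_normal_distribution {y. y - m \<in> A} =
      (\<integral>\<^sup>+x. ennreal (std_normal_density x) * indicator {y. y - m \<in> A} x \<partial>lborel)"
    by (subst emeasure_density) auto
  also have "\<dots> = (\<integral>\<^sup>+x. ennreal (std_normal_density (m + 1 * x)) * indicator {y. y - m \<in> A} (m + 1 * x) \<partial>lborel)"
    by (subst nn_integral_real_affine[where c = 1 and t = m]) auto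
  also have "\<dots> = (\<integral>\<^sup>+x. ennreal (std_normal_density x) * (ennreal (exp (- m * x - m\<^sup>2 / 2)) * indicator A x) \<partial>lborel)"
  proof (rule nn_integral_cong)
    fix x
    have "exp (- (m + x)\<^sup>2 / 2) = exp (- x\<^sup>2 / 2) * exp (- m * x - m\<^sup>2 / 2)"
      unfolding exp_add[symmetric] by (simp add: power2_eq_square field_simps)
    then have "std_normal_density (m + x) = std_normal_density x * exp (- m * x - m\<^sup>2 / 2)"
      by (simp add: std_normal_density_def)
    then show "ennreal (std_normal_density (m + 1 * x)) * indicator {y. y - m \<in> A} (m + 1 * x) =
        ennreal (std_normal_density x) * (ennreal (exp (- m * x - m\<^sup>2 / 2)) * indicator A x)"
      by (simp add: ennreal_mult indicator_def)
  qed
  also have "\<dots> = (\<integral>\<^sup>+y. ennreal (exp (- m * y - m\<^sup>2 / 2)) * indicator A y \<partial>std_normal_distribution)"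
    by (subst nn_integral_gauss) auto
  finally show ?thesis .
qed

lemma gauss_reflect:
  assumes A[measurable]: "A \<in> sets borel"
  shows "emeasure std_normal_distribution {y. - y \<in> A} = emeasure std_normal_distribution A"
proof -
  have [measurable]: "{y. - y \<in> A} \<in> sets borel"
    by (rule pred_Collect_borel) measurable
  have "emeasure std_normal_distribution A = (\<integral>\<^sup>+x. ennreal (std_normal_density x) * indicator A x \<partial>lborel)"
    by (subst emeasure_density) auto
  also have "\<dots> = (\<integral>\<^sup>+x. ennreal (std_normal_density (0 + (- 1) * x)) * indicator A (0 + (- 1) * x) \<partial>lborel)"
    by (subst nn_integral_real_affine[where c = "- 1" and t = 0]) auto
  also have "\<dots> = (\<integral>\<^sup>+x. ennreal (std_normal_density x) * indicator {y. - y \<in> A} x \<partial>lborel)"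
    by (intro nn_integral_cong) (simp add: std_normal_density_def indicator_def)
  also have "\<dots> = emeasure std_normal_distribution {y. - y \<in> A}"
    by (subst emeasure_density) auto
  finally show ?thesis by simp
qed

abbreviation gauss_PiM :: "'i set \<Rightarrow> ('i \<Rightarrow> real) measure" where
  "gauss_PiM I \<equiv> PiM I (\<lambda>_. std_normal_distribution)"

lemma product_sigma_finite_gauss: "product_sigma_finite (\<lambda>_::'i. std_normal_distribution)"
proof -
  interpret prob_space std_normal_distribution by (rule prob_space_gauss)
  show ?thesis by standard
qed

lemma gauss_PiM_exp_square:
  assumes I: "finite I" and a: "a < 1"
  shows "(\<integral>\<^sup>+y. ennreal (exp (a / 2 * (\<Sum>i\<in>I. (y i)\<^sup>2))) \<partial>gauss_PiM I) = ennreal ((1 / sqrt (1 - a)) ^ card I)"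
proof -
  interpret P: product_sigma_finite "\<lambda>_::'a. std_normal_distribution" by (rule product_sigma_finite_gauss)
  have "(\<integral>\<^sup>+y. ennreal (exp (a / 2 * (\<Sum>i\<in>I. (y i)\<^sup>2))) \<partial>gauss_PiM I) =
      (\<integral>\<^sup>+y. (\<Prod>i\<in>I. ennreal (exp (a / 2 * (y i)\<^sup>2))) \<partial>gauss_PiM I)"
    by (intro nn_integral_cong) (simp add: sum_distrib_left exp_sum[OF I] prod_ennreal)
  also have "\<dots> = (\<Prod>i\<in>I. \<integral>\<^sup>+y. ennreal (exp (a / 2 * y\<^sup>2)) \<partial>std_normal_distribution)"
    by (rule P.product_nn_integral_prod[OF I]) measurable
  also have "\<dots> = ennreal ((1 / sqrt (1 - a)) ^ card I)"
    unfolding gauss_exp_square[OF a] prod_constant using a by (simp add: ennreal_power)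
  finally show ?thesis .
qed

text \<open>Both sides are compared on rectangles with the product \<open>\<nu>\<close> of the
  shifted factors, where \<open>gauss_shift\<close> gives the density of each coordinate.\<close>

lemma gauss_PiM_shift:
  assumes I: "finite I"
  shows "distr (gauss_PiM I) (gauss_PiM I) (\<lambda>y. \<lambda>i\<in>I. y i - m i) =
    density (gauss_PiM I) (\<lambda>y. ennreal (exp (- (\<Sum>i\<in>I. m i * y i) - (\<Sum>i\<in>I. (m i)\<^sup>2) / 2)))"
    (is "?D1 = ?D2")
proof -
  interpret P: product_sigma_finite "\<lambda>_::'a. std_normal_distribution" by (rule product_sigma_finite_gauss)
  define \<nu> where "\<nu> i = distr std_normal_distribution borel (\<lambda>y. y - m i)" for i
  have \<nu>: "emeasure (\<nu> i) A = emeasure std_normal_distribution {y. y - m i \<in> A}" if "A \<in> sets borel" for i A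
    unfolding \<nu>_def using that by (subst emeasure_distr) (auto simp: vimage_def)
  have \<nu>p: "prob_space (\<nu> i)" for i
    unfolding \<nu>_def by (rule prob_space.prob_space_distr[OF prob_space_gauss]) simp
  interpret N: product_sigma_finite \<nu>
    unfolding product_sigma_finite_def using \<nu>p by (auto intro: prob_space_imp_sigma_finite)
  have sets: "sets (gauss_PiM I) = sets (PiM I \<nu>)"
    by (intro sets_PiM_cong) (auto simp: \<nu>_def)
  have shift[measurable]: "(\<lambda>y. \<lambda>i\<in>I. y i - m i) \<in> measurable (gauss_PiM I) (gauss_PiM I)"
    by (rule measurable_restrict) measurable
  have "?D1 = PiM I \<nu>"
  proof (rule N.PiM_eqI[OF I])
    fix A assume A: "\<And>i. i \<in> I \<Longrightarrow> A i \<in> sets (\<nu> i)"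
    then have Ab: "\<And>i. i \<in> I \<Longrightarrow> A i \<in> sets borel" by (simp add: \<nu>_def)
    have "(\<lambda>y. \<lambda>i\<in>I. y i - m i) -` PiE I A \<inter> space (gauss_PiM I) = PiE I (\<lambda>i. {y. y - m i \<in> A i})"
      by (auto simp: space_PiM PiE_iff)
    moreover have "{y. y - m i \<in> A i} \<in> sets borel" if "i \<in> I" for i
      using measurable_sets[of "\<lambda>y. y - m i" borel borel, OF _ Ab[OF that]] by (simp add: vimage_def)
    moreover have "PiE I A \<in> sets (gauss_PiM I)" using Ab I by (intro sets_PiM_I_finite) auto
    ultimately show "emeasure ?D1 (PiE I A) = (\<Prod>i\<in>I. emeasure (\<nu> i) (A i))"
      using I by (simp add: emeasure_distr P.emeasure_PiM \<nu> Ab)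
  qed (simp add: sets)
  also have "PiM I \<nu> = ?D2"
  proof (rule N.PiM_eqI[OF I, symmetric])
    fix A assume A: "\<And>i. i \<in> I \<Longrightarrow> A i \<in> sets (\<nu> i)"
    then have Ab: "\<And>i. i \<in> I \<Longrightarrow> A i \<in> sets borel" by (simp add: \<nu>_def)
    have AP: "PiE I A \<in> sets (gauss_PiM I)" using Ab I by (intro sets_PiM_I_finite) auto
    have "emeasure ?D2 (PiE I A) = (\<integral>\<^sup>+y. ennreal (exp (- (\<Sum>i\<in>I. m i * y i) - (\<Sum>i\<in>I. (m i)\<^sup>2) / 2)) * indicator (PiE I A) y \<partial>gauss_PiM I)"
      by (rule emeasure_density) (use AP in measurable)
    also have "\<dots> = (\<integral>\<^sup>+y. (\<Prod>i\<in>I. ennreal (exp (- m i * y i - (m i)\<^sup>2 / 2)) * indicator (A i) (y i)) \<partial>gauss_PiM I)"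
    proof (rule nn_integral_cong)
      fix y assume "y \<in> space (gauss_PiM I)"
      then have y: "y \<in> extensional I" by (simp add: space_PiM PiE_iff)
      have "- (\<Sum>i\<in>I. m i * y i) - (\<Sum>i\<in>I. (m i)\<^sup>2) / 2 = (\<Sum>i\<in>I. - m i * y i - (m i)\<^sup>2 / 2)"
        by (simp add: sum_subtractf sum_negf sum_divide_distrib)
      then have "ennreal (exp (- (\<Sum>i\<in>I. m i * y i) - (\<Sum>i\<in>I. (m i)\<^sup>2) / 2)) = (\<Prod>i\<in>I. ennreal (exp (- m i * y i - (m i)\<^sup>2 / 2)))"
        by (simp only: exp_sum[OF I]) (simp add: prod_ennreal)
      moreover have "indicator (PiE I A) y = (\<Prod>i\<in>I. indicator (A i) (y i) :: ennreal)"
        using I y by (auto simp: indicator_def PiE_iff prod_zero_iff intro: prod.neutral[symmetric])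
      ultimately show "ennreal (exp (- (\<Sum>i\<in>I. m i * y i) - (\<Sum>i\<in>I. (m i)\<^sup>2) / 2)) * indicator (PiE I A) y =
          (\<Prod>i\<in>I. ennreal (exp (- m i * y i - (m i)\<^sup>2 / 2)) * indicator (A i) (y i))"
        by (simp add: prod.distrib)
    qed
    also have "\<dots> = (\<Prod>i\<in>I. \<integral>\<^sup>+y. ennreal (exp (- m i * y - (m i)\<^sup>2 / 2)) * indicator (A i) y \<partial>std_normal_distribution)"
      by (rule P.product_nn_integral_prod[OF I]) (use Ab in measurable)
    also have "\<dots> = (\<Prod>i\<in>I. emeasure (\<nu> i) (A i))"
      using Ab by (intro prod.cong refl) (simp add: \<nu> gauss_shift)
    finally show "emeasure ?D2 (PiE I A) = (\<Prod>i\<in>I. emeasure (\<nu> i) (A i))" .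
  qed (simp add: sets)
  finally show ?thesis .
qed

lemma gauss_PiM_reflect:
  assumes I: "finite I"
  shows "distr (gauss_PiM I) (gauss_PiM I) (\<lambda>y. \<lambda>i\<in>I. - y i) = gauss_PiM I" (is "?D = _")
proof -
  interpret P: product_sigma_finite "\<lambda>_::'a. std_normal_distribution" by (rule product_sigma_finite_gauss)
  have refl[measurable]: "(\<lambda>y. \<lambda>i\<in>I. - y i) \<in> measurable (gauss_PiM I) (gauss_PiM I)"
    by (rule measurable_restrict) measurable
  show ?thesis
  proof (rule P.PiM_eqI[OF I])
    fix A assume "\<And>i. i \<in> I \<Longrightarrow> A i \<in> sets std_normal_distribution"
    then have Ab: "\<And>i. i \<in> I \<Longrightarrow> A i \<in> sets borel" by simp
    have "(\<lambda>y. \<lambda>i\<in>I. - y i) -` PiE I A \<inter> space (gauss_PiM I) = PiE I (\<lambda>i. {y. - y \<in> A i})"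
      by (auto simp: space_PiM PiE_iff)
    moreover have "{y. - y \<in> A i} \<in> sets borel" if "i \<in> I" for i
      using measurable_sets[of "uminus" borel borel, OF _ Ab[OF that]] by (simp add: vimage_def)
    moreover have "PiE I A \<in> sets (gauss_PiM I)" using Ab I by (intro sets_PiM_I_finite) auto
    ultimately show "emeasure ?D (PiE I A) = (\<Prod>i\<in>I. emeasure std_normal_distribution (A i))"
      using I by (simp add: emeasure_distr P.emeasure_PiM gauss_reflect Ab)
  qed simp
qed

text \<open>Averaging the Cameron--Martin density over \<open>y\<close> and \<open>-y\<close> turns its exponential factor into a
  hyperbolic cosine, which is at least \<open>1\<close>; hence the bound has no error term.\<close>

lemma gauss_PiM_symmetric_shift:
  assumes I: "finite I" and B[measurable]: "B \<in> sets (gauss_PiM I)"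
    and sym: "\<And>y. y \<in> B \<Longrightarrow> (\<lambda>i\<in>I. - y i) \<in> B"
  shows "ennreal (exp (- (\<Sum>i\<in>I. (m i)\<^sup>2) / 2)) * emeasure (gauss_PiM I) B \<le>
    emeasure (gauss_PiM I) {y \<in> space (gauss_PiM I). (\<lambda>i\<in>I. y i - m i) \<in> B}"
proof -
  define c where "c = (\<Sum>i\<in>I. (m i)\<^sup>2) / 2"
  define q where "q y = exp (- (\<Sum>i\<in>I. m i * y i) - c)" for y :: "'a \<Rightarrow> real"
  define q' where "q' y = exp ((\<Sum>i\<in>I. m i * y i) - c)" for y :: "'a \<Rightarrow> real"
  have [measurable]: "q \<in> borel_measurable (gauss_PiM I)" "q' \<in> borel_measurable (gauss_PiM I)"
    unfolding q_def q'_def by measurable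
  have shift[measurable]: "(\<lambda>y. \<lambda>i\<in>I. y i - m i) \<in> measurable (gauss_PiM I) (gauss_PiM I)"
    by (rule measurable_restrict) measurable
  have refl[measurable]: "(\<lambda>y. \<lambda>i\<in>I. - y i) \<in> measurable (gauss_PiM I) (gauss_PiM I)"
    by (rule measurable_restrict) measurable
  define S where "S = emeasure (gauss_PiM I) {y \<in> space (gauss_PiM I). (\<lambda>i\<in>I. y i - m i) \<in> B}"
  have "S = emeasure (distr (gauss_PiM I) (gauss_PiM I) (\<lambda>y. \<lambda>i\<in>I. y i - m i)) B"
    unfolding S_def by (subst emeasure_distr) (auto intro!: arg_cong2[where f = emeasure])
  also have "\<dots> = (\<integral>\<^sup>+y. ennreal (q y) * indicator B y \<partial>gauss_PiM I)"
    unfolding gauss_PiM_shift[OF I] c_def[symmetric] q_def[symmetric] by (rule emeasure_density) measurable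
  finally have S1: "S = (\<integral>\<^sup>+y. ennreal (q y) * indicator B y \<partial>gauss_PiM I)" .
  also have "\<dots> = (\<integral>\<^sup>+y. ennreal (q y) * indicator B y \<partial>distr (gauss_PiM I) (gauss_PiM I) (\<lambda>y. \<lambda>i\<in>I. - y i))"
    unfolding gauss_PiM_reflect[OF I] ..
  also have "\<dots> = (\<integral>\<^sup>+y. ennreal (q (\<lambda>i\<in>I. - y i)) * indicator B (\<lambda>i\<in>I. - y i) \<partial>gauss_PiM I)"
    by (rule nn_integral_distr) measurable
  also have "\<dots> = (\<integral>\<^sup>+y. ennreal (q' y) * indicator B y \<partial>gauss_PiM I)"
  proof (rule nn_integral_cong)
    fix y assume "y \<in> space (gauss_PiM I)"
    then have y: "(\<lambda>i\<in>I. - (\<lambda>i\<in>I. - y i) i) = y"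
      by (auto simp: space_PiM PiE_iff extensional_def fun_eq_iff)
    have "(\<lambda>i\<in>I. - y i) \<in> B \<longleftrightarrow> y \<in> B"
      using sym[of y] sym[of "\<lambda>i\<in>I. - y i"] unfolding y by blast
    moreover have "q (\<lambda>i\<in>I. - y i) = q' y"
      by (simp add: q_def q'_def sum_negf)
    ultimately show "ennreal (q (\<lambda>i\<in>I. - y i)) * indicator B (\<lambda>i\<in>I. - y i) = ennreal (q' y) * indicator B y"
      by (simp add: indicator_def)
  qed
  finally have S2: "S = (\<integral>\<^sup>+y. ennreal (q' y) * indicator B y \<partial>gauss_PiM I)" .
  have "2 * (ennreal (exp (- c)) * emeasure (gauss_PiM I) B) = (\<integral>\<^sup>+y. ennreal (2 * exp (- c)) * indicator B y \<partial>gauss_PiM I)"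
    by (subst nn_integral_cmult_indicator) (simp_all add: ennreal_mult mult.assoc)
  also have "\<dots> \<le> (\<integral>\<^sup>+y. (ennreal (q y) * indicator B y + ennreal (q' y) * indicator B y) \<partial>gauss_PiM I)"
  proof (rule nn_integral_mono)
    fix y
    define z where "z = (\<Sum>i\<in>I. m i * y i)"
    have "exp (- c) * 2 \<le> exp (- c) * (exp (- z) + exp z)"
      using arith_geo_mean_sqrt[of "exp z" "exp (- z)"] by (simp add: exp_minus field_simps)
    then have "2 * exp (- c) \<le> q y + q' y"
      by (simp add: q_def q'_def z_def[symmetric] exp_diff exp_minus field_simps)
    then have "ennreal (2 * exp (- c)) \<le> ennreal (q y) + ennreal (q' y)"
      by (simp add: q_def q'_def ennreal_leI flip: ennreal_plus)
    then show "ennreal (2 * exp (- c)) * indicator B y \<le> ennreal (q y) * indicator B y + ennreal (q' y) * indicator B y"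
      by (auto simp: indicator_def)
  qed
  also have "\<dots> = S + S"
    by (subst nn_integral_add) (simp_all add: S1[symmetric] S2[symmetric])
  also have "\<dots> = 2 * S" by (simp add: mult_2)
  finally have "ennreal (exp (- c)) * emeasure (gauss_PiM I) B \<le> S"
    by (subst (asm) ennreal_mult_le_mult_iff) auto
  then show ?thesis by (simp add: S_def c_def)
qed

section \<open>Wiener processes\<close>

text \<open>The missing mass \<open>1 - sum p I\<close> is placed at 0, where the exponential is 1;
  the tangent at the mean \<open>m\<close> gives the inequality.\<close>

lemma exp_jensen:
  fixes p y :: "'i \<Rightarrow> real"
  assumes p: "\<And>i. i \<in> I \<Longrightarrow> 0 \<le> p i" and P: "sum p I \<le> 1"
  shows "exp (\<Sum>i\<in>I. p i * y i) \<le> (1 - sum p I) + (\<Sum>i\<in>I. p i * exp (y i))"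
proof -
  define m where "m = (\<Sum>i\<in>I. p i * y i)"
  have tangent: "exp m * (1 + z - m) \<le> exp z" for z
    using exp_ge_add_one_self[of "z - m"] by (simp add: exp_diff field_simps)
  have "exp m = (1 - sum p I) * (exp m * (1 + 0 - m)) + (\<Sum>i\<in>I. p i * (exp m * (1 + y i - m)))"
  proof -
    have "(\<Sum>i\<in>I. p i * (c * (1 + y i - d))) = c * ((1 - d) * sum p I + (\<Sum>i\<in>I. p i * y i))" for c d
      by (simp add: sum_distrib_left sum.distrib sum_subtractf algebra_simps)
    from this[of "exp m" m] have "(\<Sum>i\<in>I. p i * (exp m * (1 + y i - m))) = exp m * ((1 - m) * sum p I + m)"
      by (simp only: m_def)
    then show ?thesis by (simp add: algebra_simps)
  qed
  also have "\<dots> \<le> (1 - sum p I) * exp 0 + (\<Sum>i\<in>I. p i * exp (y i))"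
    using P by (intro add_mono mult_left_mono sum_mono tangent p) auto
  finally show ?thesis by (simp add: m_def)
qed

text \<open>Consecutive terms have the ratio
  \<open>2 * exp (- (b * (\<rho> - 1) * \<rho> ^ m))\<close>, at most \<open>1 / 2\<close> once the
  exponent reaches \<open>ln 4\<close>.\<close>

lemma summable_double_exponential:
  fixes b \<rho> :: real
  assumes b: "b > 0" and \<rho>: "\<rho> > 1"
  shows "summable (\<lambda>m::nat. 2 ^ m * exp (- b * \<rho> ^ m))"
proof -
  have "filterlim (\<lambda>m::nat. (b * (\<rho> - 1)) * \<rho> ^ m) at_top sequentially"
  proof (rule filterlim_tendsto_pos_mult_at_top[OF tendsto_const])
    show "filterlim (\<lambda>m. \<rho> ^ m) at_top sequentially"
      using \<rho> by (intro filterlim_at_infinity_imp_filterlim_at_top filterlim_realpow_sequentially_gt1) auto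
  qed (use b \<rho> in simp)
  then have "\<forall>\<^sub>F m in sequentially. ln 4 \<le> b * (\<rho> - 1) * \<rho> ^ m"
    by (simp add: filterlim_at_top)
  then obtain N where N: "\<And>m. m \<ge> N \<Longrightarrow> ln 4 \<le> b * (\<rho> - 1) * \<rho> ^ m"
    by (auto simp: eventually_sequentially)
  show ?thesis
  proof (rule summable_ratio_test[of "1 / 2" N])
    fix m :: nat assume "N \<le> m"
    then have "exp (- (b * (\<rho> - 1) * \<rho> ^ m)) \<le> exp (- ln 4)" using N by simp
    also have "\<dots> = 1 / 4" by (simp add: exp_minus)
    finally have le: "exp (- (b * (\<rho> - 1) * \<rho> ^ m)) \<le> 1 / 4" .
    have "norm (2 ^ Suc m * exp (- b * \<rho> ^ Suc m)) = 2 * (2 ^ m * exp (- b * \<rho> ^ m)) * exp (- (b * (\<rho> - 1) * \<rho> ^ m))"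
      by (simp add: exp_add[symmetric] algebra_simps)
    also have "\<dots> \<le> 2 * (2 ^ m * exp (- b * \<rho> ^ m)) * (1 / 4)"
      by (intro mult_left_mono le) auto
    finally show "norm (2 ^ Suc m * exp (- b * \<rho> ^ Suc m)) \<le> 1 / 2 * norm (2 ^ m * exp (- b * \<rho> ^ m))"
      by simp
  qed simp
qed

section \<open>Gaussian coordinates and tails of the increments\<close>

locale wiener = trace_operator Q for Q :: "'h::{real_inner,banach,polish_space} \<Rightarrow> 'h" +
  fixes M :: "'w measure" and W :: "real \<Rightarrow> 'w \<Rightarrow> 'h" and \<alpha> :: real
  assumes W: "Q_Wiener_process M Q W" and \<alpha>_pos: "0 < \<alpha>" and \<alpha>_half: "\<alpha> < 1 / 2"
begin

sublocale prob_space M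
  using W by (simp add: Q_Wiener_process_def)

lemma W_measurable [measurable (raw)]: "t \<in> {0..1} \<Longrightarrow> W t \<in> borel_measurable M"
  and W_0: "\<omega> \<in> space M \<Longrightarrow> W 0 \<omega> = 0"
  and W_cont: "\<omega> \<in> space M \<Longrightarrow> continuous_on {0..1} (\<lambda>t. W t \<omega>)"
  using W by (auto simp: Q_Wiener_process_def)

lemma W_char:
  assumes "0 \<le> s" "s \<le> t" "t \<le> 1"
  shows "(LINT \<omega>|M. iexp (h \<bullet> (W t \<omega> - W s \<omega>))) = complex_of_real (exp (- ((t - s) * (Q h \<bullet> h) / 2)))"
proof -
  have "gaussian_rv M 0 (\<lambda>x. (t - s) *\<^sub>R Q x) (\<lambda>\<omega>. W t \<omega> - W s \<omega>)"
    using W assms unfolding Q_Wiener_process_def by blast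
  then have "(LINT \<omega>|M. iexp (h \<bullet> (W t \<omega> - W s \<omega>))) = exp (\<i> * complex_of_real (h \<bullet> 0) - complex_of_real (((t - s) *\<^sub>R Q h) \<bullet> h / 2))"
    unfolding gaussian_rv_def by blast
  also have "\<dots> = exp (complex_of_real (- ((t - s) * (Q h \<bullet> h) / 2)))" by simp
  also have "\<dots> = complex_of_real (exp (- ((t - s) * (Q h \<bullet> h) / 2)))" by (rule exp_of_real)
  finally show ?thesis .
qed

abbreviation Wpath :: "'w \<Rightarrow> real \<Rightarrow> 'h" where "Wpath \<omega> \<equiv> (\<lambda>t. W t \<omega>)"

lemma dinc_W_measurable: "k < 2 ^ n \<Longrightarrow> (\<lambda>\<omega>. dinc (Wpath \<omega>) n k) \<in> borel_measurable M"
  unfolding dinc_def by (intro borel_measurable_diff W_measurable dyadic_mem) auto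

lemma dinc_W_indep: "indep_vars (\<lambda>_. borel) (\<lambda>k \<omega>. dinc (Wpath \<omega>) n k) {..<2 ^ n}"
proof -
  have "independent_increments M W" using W by (simp add: Q_Wiener_process_def)
  have "0 \<le> real 0 / 2 ^ n \<and> (\<forall>i<2 ^ n. real i / 2 ^ n < real (Suc i) / 2 ^ n) \<and> real (2 ^ n) / 2 ^ n \<le> 1"
    by (simp add: divide_strict_right_mono)
  from \<open>independent_increments M W\<close>[unfolded independent_increments_def, THEN spec[of _ "2 ^ n"],
      THEN spec[of _ "\<lambda>i. real i / 2 ^ n"], THEN mp, OF this]
  have "indep_vars (\<lambda>_. borel) (\<lambda>i \<omega>. W (real (Suc i) / 2 ^ n) \<omega> - W (real i / 2 ^ n) \<omega>) {..<2 ^ n}" .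
  then show ?thesis by (simp add: dinc_def)
qed

lemma R_E: "e \<in> E \<Longrightarrow> R e = sqrt (lam e) *\<^sub>R e"
  by (rule E_eqI) (simp add: R_inner E_inner)

text \<open>The coordinate of a level \<open>n\<close> increment along \<open>e\<close> has variance
  \<open>lam e / 2 ^ n\<close>, so this scaling is standard normal for \<open>e\<close> in
  \<open>Ep\<close>. The default 0 makes the variable measurable for every index, as
  \<open>iid_gauss\<close> asks.\<close>

definition xi :: "nat \<Rightarrow> nat \<times> 'h \<Rightarrow> 'w \<Rightarrow> real" where
  "xi n i \<omega> = (if fst i < 2 ^ n then sqrt (2 ^ n) * (dinc (Wpath \<omega>) n (fst i) \<bullet> snd i) / sqrt (lam (snd i)) else 0)"

lemma xi_measurable [measurable]: "xi n i \<in> borel_measurable M"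
proof (cases "fst i < 2 ^ n")
  case True
  note [measurable] = dinc_W_measurable[OF True]
  show ?thesis unfolding xi_def using True by simp
qed (simp add: xi_def[abs_def])

text \<open>For each interval \<open>k\<close>, the vector \<open>h k\<close> collects the
  coefficients so that a linear combination of the \<open>xi\<close> becomes a sum of inner products
  with independent increments. \<open>R\<close> turns \<open>h k\<close> into an orthonormal
  combination, which yields the exponent \<open>Qh\<close>.\<close>

lemma xi_iid:
  assumes J: "finite J" "J \<subseteq> Ep"
  shows "distr M (gauss_PiM ({..<2 ^ n} \<times> J)) (\<lambda>\<omega>. \<lambda>i\<in>{..<2 ^ n} \<times> J. xi n i \<omega>) = gauss_PiM ({..<2 ^ n} \<times> J)"
proof (rule iid_gauss)
  fix a :: "nat \<times> 'h \<Rightarrow> real"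
  have JE: "J \<subseteq> E" using J Ep_subset by blast
  define h where "h k = (\<Sum>e\<in>J. (a (k, e) * sqrt (2 ^ n) / sqrt (lam e)) *\<^sub>R e)" for k
  have Qh: "Q (h k) \<bullet> h k = 2 ^ n * (\<Sum>e\<in>J. (a (k, e))\<^sup>2)" for k
  proof -
    have "R (h k) = (\<Sum>e\<in>J. (a (k, e) * sqrt (2 ^ n)) *\<^sub>R e)"
      unfolding h_def linear_sum[OF bounded_linear.linear[OF bounded_linear_R]]
      using J JE by (intro sum.cong refl) (auto simp: linear_cmul[OF bounded_linear.linear[OF bounded_linear_R]] R_E Ep_def subset_iff)
    then have "(norm (R (h k)))\<^sup>2 = (\<Sum>e\<in>J. (a (k, e) * sqrt (2 ^ n))\<^sup>2)"
      by (simp only: orthonormal_norm_sum[OF E_orthonormal J(1) JE])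
    moreover have "Q (h k) \<bullet> h k = (norm (R (h k)))\<^sup>2"
      using R_sa[of "R (h k)" "h k"] by (simp add: R_R power2_norm_eq_inner)
    ultimately show ?thesis by (simp add: power_mult_distrib sum_distrib_left mult.commute)
  qed
  have "(\<Sum>i\<in>{..<2 ^ n} \<times> J. a i * xi n i \<omega>) = (\<Sum>k<2 ^ n. h k \<bullet> dinc (Wpath \<omega>) n k)" for \<omega>
    unfolding sum.cartesian_product[symmetric] h_def inner_sum_left sum.cartesian_product'
    by (intro sum.cong refl) (auto simp: xi_def inner_commute)
  then have "(LINT \<omega>|M. iexp (\<Sum>i\<in>{..<2 ^ n} \<times> J. a i * xi n i \<omega>)) =
      (LINT \<omega>|M. (\<Prod>k<2 ^ n. iexp (h k \<bullet> dinc (Wpath \<omega>) n k)))"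
    by (intro Bochner_Integration.integral_cong refl) (simp add: exp_sum[symmetric] sum_distrib_left)
  also have "\<dots> = (\<Prod>k<2 ^ n. LINT \<omega>|M. iexp (h k \<bullet> dinc (Wpath \<omega>) n k))"
  proof (rule indep_vars_lebesgue_integral)
    show "indep_vars (\<lambda>_. borel) (\<lambda>k \<omega>. iexp (h k \<bullet> dinc (Wpath \<omega>) n k)) {..<2 ^ n}"
      by (rule indep_vars_compose2[OF dinc_W_indep]) measurable
    show "integrable M (\<lambda>\<omega>. iexp (h k \<bullet> dinc (Wpath \<omega>) n k))" if "k \<in> {..<2 ^ n}" for k
    proof -
      have [measurable]: "(\<lambda>\<omega>. dinc (Wpath \<omega>) n k) \<in> borel_measurable M"
        using that by (intro dinc_W_measurable) simp
      show ?thesis by (rule integrable_const_bound[of _ 1]) auto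
    qed
  qed simp
  also have "\<dots> = (\<Prod>k<2 ^ n. complex_of_real (exp (- (\<Sum>e\<in>J. (a (k, e))\<^sup>2) / 2)))"
  proof (rule prod.cong[OF refl])
    fix k :: nat assume "k \<in> {..<2 ^ n}"
    then have k: "k \<le> 2 ^ n" "Suc k \<le> 2 ^ n" by auto
    have "(LINT \<omega>|M. iexp (h k \<bullet> dinc (Wpath \<omega>) n k)) =
        complex_of_real (exp (- ((real (Suc k) / 2 ^ n - real k / 2 ^ n) * (Q (h k) \<bullet> h k) / 2)))"
      unfolding dinc_def using dyadic_mem[OF k(1)] dyadic_mem[OF k(2)]
      by (intro W_char) (auto simp: divide_right_mono)
    also have "real (Suc k) / 2 ^ n - real k / 2 ^ n = 1 / 2 ^ n"
      by (simp add: diff_divide_distrib[symmetric])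
    finally show "(LINT \<omega>|M. iexp (h k \<bullet> dinc (Wpath \<omega>) n k)) = complex_of_real (exp (- (\<Sum>e\<in>J. (a (k, e))\<^sup>2) / 2))"
      by (simp add: Qh)
  qed
  also have "\<dots> = complex_of_real (exp (\<Sum>k<2 ^ n. - (\<Sum>e\<in>J. (a (k, e))\<^sup>2) / 2))"
    by (simp add: exp_sum)
  also have "(\<Sum>k<2 ^ n. - (\<Sum>e\<in>J. (a (k, e))\<^sup>2) / 2) = - (\<Sum>i\<in>{..<2 ^ n} \<times> J. (a i)\<^sup>2) / 2"
    unfolding sum.cartesian_product' by (simp add: sum_negf sum_divide_distrib)
  finally show "(LINT \<omega>|M. iexp (\<Sum>i\<in>{..<2 ^ n} \<times> J. a i * xi n i \<omega>)) =
      complex_of_real (exp (- (\<Sum>i\<in>{..<2 ^ n} \<times> J. (a i)\<^sup>2) / 2))" .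
qed (use J in auto)

text \<open>Stating the law as an image of the standard normal law, and not through a density,
  includes \<open>lam e = 0\<close>, where it is a point mass.\<close>

lemma coord_distr:
  assumes st: "0 \<le> s" "s \<le> t" "t \<le> 1" and e: "e \<in> E"
  shows "distr M borel (\<lambda>\<omega>. (W t \<omega> - W s \<omega>) \<bullet> e) = distr std_normal_distribution borel (\<lambda>x. sqrt ((t - s) * lam e) * x)"
proof -
  have [measurable]: "W t \<in> borel_measurable M" "W s \<in> borel_measurable M" using st by (auto intro: W_measurable)
  interpret G: prob_space std_normal_distribution by (rule prob_space_gauss)
  have m[measurable]: "(\<lambda>x. sqrt ((t - s) * lam e) * x) \<in> borel_measurable std_normal_distribution" by measurable
  have v: "0 \<le> (t - s) * lam e" using st lam_nonneg by simp
  show ?thesis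
  proof (rule Levy_uniqueness)
    show "real_distribution (distr M borel (\<lambda>\<omega>. (W t \<omega> - W s \<omega>) \<bullet> e))"
      by (rule real_distribution_distr) simp
    show "real_distribution (distr std_normal_distribution borel (\<lambda>x. sqrt ((t - s) * lam e) * x))"
      by (rule G.real_distribution_distr) (rule m)
    have "char (distr M borel (\<lambda>\<omega>. (W t \<omega> - W s \<omega>) \<bullet> e)) u = char (distr std_normal_distribution borel (\<lambda>x. sqrt ((t - s) * lam e) * x)) u" for u
    proof -
      have "char (distr M borel (\<lambda>\<omega>. (W t \<omega> - W s \<omega>) \<bullet> e)) u = (LINT \<omega>|M. iexp (u * ((W t \<omega> - W s \<omega>) \<bullet> e)))"
        unfolding char_def by (subst integral_distr) auto
      also have "\<dots> = (LINT \<omega>|M. iexp ((u *\<^sub>R e) \<bullet> (W t \<omega> - W s \<omega>)))"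
        by (simp add: inner_commute)
      also have "\<dots> = complex_of_real (exp (- ((t - s) * (Q (u *\<^sub>R e) \<bullet> (u *\<^sub>R e)) / 2)))"
        by (rule W_char[OF st])
      also have "Q (u *\<^sub>R e) \<bullet> (u *\<^sub>R e) = u\<^sup>2 * lam e"
        by (simp add: linear_cmul[OF bounded_linear.linear[OF bounded_linear_Q]] lam_def power2_eq_square)
      also have "complex_of_real (exp (- ((t - s) * (u\<^sup>2 * lam e) / 2))) = char std_normal_distribution (u * sqrt ((t - s) * lam e))"
      proof -
        have "(u * sqrt ((t - s) * lam e))\<^sup>2 = (t - s) * (u\<^sup>2 * lam e)"
          using v by (simp add: power_mult_distrib mult_ac)
        then show ?thesis unfolding char_std_normal_distribution by simp
      qed
      also have "\<dots> = char (distr std_normal_distribution borel (\<lambda>x. sqrt ((t - s) * lam e) * x)) u"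
        unfolding char_def by (subst integral_distr) (auto simp: mult_ac)
      finally show ?thesis .
    qed
    then show "char (distr M borel (\<lambda>\<omega>. (W t \<omega> - W s \<omega>) \<bullet> e)) = char (distr std_normal_distribution borel (\<lambda>x. sqrt ((t - s) * lam e) * x))"
      by (rule ext)
  qed
qed

lemma coord_nn_integral:
  assumes st: "0 \<le> s" "s \<le> t" "t \<le> 1" and e: "e \<in> E" and f[measurable]: "f \<in> borel_measurable borel"
  shows "(\<integral>\<^sup>+\<omega>. f ((W t \<omega> - W s \<omega>) \<bullet> e) \<partial>M) = (\<integral>\<^sup>+x. f (sqrt ((t - s) * lam e) * x) \<partial>std_normal_distribution)"
proof -
  have [measurable]: "W t \<in> borel_measurable M" "W s \<in> borel_measurable M" using st by (auto intro: W_measurable)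
  have "(\<integral>\<^sup>+\<omega>. f ((W t \<omega> - W s \<omega>) \<bullet> e) \<partial>M) = (\<integral>\<^sup>+x. f x \<partial>distr M borel (\<lambda>\<omega>. (W t \<omega> - W s \<omega>) \<bullet> e))"
    by (subst nn_integral_distr) auto
  also have "\<dots> = (\<integral>\<^sup>+x. f (sqrt ((t - s) * lam e) * x) \<partial>std_normal_distribution)"
    unfolding coord_distr[OF st e] by (subst nn_integral_distr) auto
  finally show ?thesis .
qed

lemma coord_null:
  assumes st: "0 \<le> s" "s \<le> t" "t \<le> 1" and e: "e \<in> E - Ep"
  shows "AE \<omega> in M. (W t \<omega> - W s \<omega>) \<bullet> e = 0"
proof -
  have [measurable]: "W t \<in> borel_measurable M" "W s \<in> borel_measurable M" using st by (auto intro: W_measurable)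
  have "lam e = 0" using e lam_nonneg[of e] by (auto simp: Ep_def)
  then have "(\<integral>\<^sup>+\<omega>. ennreal (((W t \<omega> - W s \<omega>) \<bullet> e)\<^sup>2) \<partial>M) = 0"
    using e coord_nn_integral[OF st, of e "\<lambda>x. ennreal (x\<^sup>2)"] by simp
  then have "AE \<omega> in M. ennreal (((W t \<omega> - W s \<omega>) \<bullet> e)\<^sup>2) = 0"
    by (subst (asm) nn_integral_0_iff_AE) auto
  then show ?thesis by (rule eventually_mono) (simp add: ennreal_eq_0_iff)
qed

text \<open>Convexity with weights \<open>lam e / T\<close> reduces the exponential of the sum to
  single coordinates, so the bound does not grow with the number of coordinates. For one coordinate
  the constant 4 leaves the expectation of \<open>exp (x\<^sup>2 / 4)\<close>, which is
  \<open>sqrt 2\<close>.\<close>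

lemma coord_exp_moment:
  assumes st: "0 \<le> s" "s < t" "t \<le> 1" and T: "T > 0" and G: "finite G" "G \<subseteq> E" "sum lam G \<le> T"
  shows "(\<integral>\<^sup>+\<omega>. ennreal (exp ((\<Sum>e\<in>G. ((W t \<omega> - W s \<omega>) \<bullet> e)\<^sup>2) / (4 * (t - s) * T))) \<partial>M) \<le> ennreal (sqrt 2)"
proof -
  have [measurable]: "W t \<in> borel_measurable M" "W s \<in> borel_measurable M" using st by (auto intro: W_measurable)
  define G' where "G' = G \<inter> Ep"
  have G': "finite G'" "G' \<subseteq> E" "\<And>e. e \<in> G' \<Longrightarrow> lam e > 0" using G by (auto simp: G'_def Ep_def)
  define p where "p e = lam e / T" for e
  define y where "y e \<omega> = ((W t \<omega> - W s \<omega>) \<bullet> e)\<^sup>2 / (4 * (t - s) * lam e)" for e \<omega>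
  have ym[measurable]: "y e \<in> borel_measurable M" for e unfolding y_def by measurable
  have p0: "0 \<le> p e" for e using T lam_nonneg[of e] by (simp add: p_def)
  have "sum lam G' \<le> sum lam G" unfolding G'_def using G lam_nonneg by (intro sum_mono2) auto
  then have P: "sum p G' \<le> 1" using G T unfolding p_def by (simp add: sum_divide_distrib[symmetric] divide_le_eq)
  have y2: "(\<integral>\<^sup>+\<omega>. ennreal (exp (y e \<omega>)) \<partial>M) = ennreal (sqrt 2)" if e: "e \<in> G'" for e
  proof -
    have "(\<integral>\<^sup>+\<omega>. ennreal (exp (y e \<omega>)) \<partial>M) =
        (\<integral>\<^sup>+x. ennreal (exp ((sqrt ((t - s) * lam e) * x)\<^sup>2 / (4 * (t - s) * lam e))) \<partial>std_normal_distribution)"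
      unfolding y_def using st G'(2) e by (intro coord_nn_integral[where f = "\<lambda>x. ennreal (exp (x\<^sup>2 / (4 * (t - s) * lam e)))"]) auto
    also have "\<dots> = (\<integral>\<^sup>+x. ennreal (exp ((1 / 2) / 2 * x\<^sup>2)) \<partial>std_normal_distribution)"
    proof (intro nn_integral_cong)
      fix x :: real
      have "(sqrt ((t - s) * lam e) * x)\<^sup>2 / (4 * (t - s) * lam e) = (1 / 2) / 2 * x\<^sup>2"
      proof -
        define q where "q = (t - s) * lam e"
        have q: "q > 0" "4 * (t - s) * lam e = 4 * q" using st G'(3)[OF e] by (simp_all add: q_def)
        have "(sqrt q * x)\<^sup>2 / (4 * q) = (1 / 2) / 2 * x\<^sup>2"
          using q(1) by (simp add: power_mult_distrib)
        then show ?thesis unfolding q(2) by (simp only: q_def)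
      qed
      then show "ennreal (exp ((sqrt ((t - s) * lam e) * x)\<^sup>2 / (4 * (t - s) * lam e))) = ennreal (exp ((1 / 2) / 2 * x\<^sup>2))"
        by (simp only:)
    qed
    also have "\<dots> = ennreal (1 / sqrt (1 - 1 / 2))" by (rule gauss_exp_square) simp
    also have "1 / sqrt (1 - 1 / 2) = sqrt 2" by (simp add: real_sqrt_divide)
    finally show ?thesis .
  qed
  have null: "AE \<omega> in M. \<forall>e\<in>G - Ep. (W t \<omega> - W s \<omega>) \<bullet> e = 0"
    using G by (intro AE_finite_allI) (auto intro!: coord_null st less_imp_le)
  have "(\<integral>\<^sup>+\<omega>. ennreal (exp ((\<Sum>e\<in>G. ((W t \<omega> - W s \<omega>) \<bullet> e)\<^sup>2) / (4 * (t - s) * T))) \<partial>M) \<le>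
      (\<integral>\<^sup>+\<omega>. (ennreal (1 - sum p G') + (\<Sum>e\<in>G'. ennreal (p e) * ennreal (exp (y e \<omega>)))) \<partial>M)"
  proof (rule nn_integral_mono_AE, use null in eventually_elim)
    fix \<omega> assume z: "\<forall>e\<in>G - Ep. (W t \<omega> - W s \<omega>) \<bullet> e = 0"
    have "(\<Sum>e\<in>G. ((W t \<omega> - W s \<omega>) \<bullet> e)\<^sup>2) / (4 * (t - s) * T) = (\<Sum>e\<in>G'. ((W t \<omega> - W s \<omega>) \<bullet> e)\<^sup>2) / (4 * (t - s) * T)"
      unfolding G'_def using G z by (intro arg_cong2[where f = "(/)"] sum.mono_neutral_right refl) auto
    also have "\<dots> = (\<Sum>e\<in>G'. p e * y e \<omega>)"
      unfolding sum_divide_distrib using G'(3) T st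
      by (intro sum.cong refl) (force simp: p_def y_def field_simps)
    finally have "exp ((\<Sum>e\<in>G. ((W t \<omega> - W s \<omega>) \<bullet> e)\<^sup>2) / (4 * (t - s) * T)) \<le>
        (1 - sum p G') + (\<Sum>e\<in>G'. p e * exp (y e \<omega>))"
      using exp_jensen[of G' p "\<lambda>e. y e \<omega>", OF p0 P] by simp
    then have "ennreal (exp ((\<Sum>e\<in>G. ((W t \<omega> - W s \<omega>) \<bullet> e)\<^sup>2) / (4 * (t - s) * T))) \<le>
        ennreal ((1 - sum p G') + (\<Sum>e\<in>G'. p e * exp (y e \<omega>)))"
      by (rule ennreal_leI)
    also have "\<dots> = ennreal (1 - sum p G') + (\<Sum>e\<in>G'. ennreal (p e) * ennreal (exp (y e \<omega>)))"
      using P p0 by (simp add: ennreal_plus sum_nonneg ennreal_mult[symmetric] sum_ennreal)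
    finally show "ennreal (exp ((\<Sum>e\<in>G. ((W t \<omega> - W s \<omega>) \<bullet> e)\<^sup>2) / (4 * (t - s) * T))) \<le>
        ennreal (1 - sum p G') + (\<Sum>e\<in>G'. ennreal (p e) * ennreal (exp (y e \<omega>)))" .
  qed
  also have "\<dots> = ennreal (1 - sum p G') + (\<Sum>e\<in>G'. ennreal (p e) * ennreal (sqrt 2))"
    by (simp add: nn_integral_add nn_integral_sum nn_integral_cmult y2 emeasure_space_1)
  also have "\<dots> = ennreal ((1 - sum p G') + sum p G' * sqrt 2)"
    using P p0 by (simp add: ennreal_plus sum_nonneg ennreal_mult[symmetric] sum_ennreal sum_distrib_right)
  also have "\<dots> \<le> ennreal (sqrt 2)"
  proof (rule ennreal_leI)
    have "(1 - sum p G') * 1 \<le> (1 - sum p G') * sqrt 2" using P by (intro mult_left_mono) auto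
    then show "(1 - sum p G') + sum p G' * sqrt 2 \<le> sqrt 2" by (simp add: algebra_simps)
  qed
  finally show ?thesis .
qed

text \<open>Exponential Markov inequality on finite coordinate sets outside \<open>J\<close>,
  followed by a monotone limit. With \<open>J\<close> empty and \<open>T = \<tau>\<close> it bounds
  the whole increment; with \<open>J\<close> large it makes the projection error negligible through
  a small \<open>T\<close>.\<close>

lemma increment_tail:
  assumes st: "0 \<le> s" "s < t" "t \<le> 1" and T: "T > 0" and J: "finite J" "J \<subseteq> E"
    and lamT: "\<And>G. finite G \<Longrightarrow> G \<subseteq> E - J \<Longrightarrow> sum lam G \<le> T" and r: "r \<ge> 0"
  shows "emeasure M {\<omega> \<in> space M. r < norm ((W t \<omega> - W s \<omega>) - oproj J (W t \<omega> - W s \<omega>))} \<le>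
    ennreal (sqrt 2 * exp (- r\<^sup>2 / (4 * (t - s) * T)))"
proof -
  have [measurable]: "W t \<in> borel_measurable M" "W s \<in> borel_measurable M" using st by (auto intro: W_measurable)
  define c where "c = 4 * (t - s) * T"
  have c: "c > 0" using st T by (simp add: c_def)
  \<comment> \<open>An increasing sequence of finite sets exhausting \<open>E - J\<close>, so that
    the events \<open>A i\<close> increase.\<close>
  define G where "G i = {e \<in> E - J. to_nat_on E e < i}" for i
  have G: "finite (G i)" "G i \<subseteq> E - J" for i
  proof -
    show "finite (G i)"
    proof (rule inj_on_finite[of "to_nat_on E" _ "{..<i}"])
      show "inj_on (to_nat_on E) (G i)"
        using inj_on_to_nat_on[OF countable_E] by (rule inj_on_subset) (auto simp: G_def)
    qed (auto simp: G_def)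
  qed (auto simp: G_def)
  define A where "A i = {\<omega> \<in> space M. r\<^sup>2 < (\<Sum>e\<in>G i. ((W t \<omega> - W s \<omega>) \<bullet> e)\<^sup>2)}" for i
  have Am: "A i \<in> sets M" for i unfolding A_def by measurable
  have Gmono: "G i \<subseteq> G j" if "i \<le> j" for i j using that by (auto simp: G_def)
  have inc: "incseq A"
  proof (rule incseq_SucI, rule subsetI)
    fix i \<omega> assume "\<omega> \<in> A i"
    moreover have "(\<Sum>e\<in>G i. ((W t \<omega> - W s \<omega>) \<bullet> e)\<^sup>2) \<le> (\<Sum>e\<in>G (Suc i). ((W t \<omega> - W s \<omega>) \<bullet> e)\<^sup>2)"
      by (rule sum_mono2[OF G(1) Gmono]) auto
    ultimately show "\<omega> \<in> A (Suc i)" by (auto simp: A_def)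
  qed
  have Ai: "emeasure M (A i) \<le> ennreal (sqrt 2 * exp (- r\<^sup>2 / c))" for i
  proof -
    have "emeasure M (A i) = (\<integral>\<^sup>+\<omega>. indicator (A i) \<omega> \<partial>M)" by (simp add: Am)
    also have "\<dots> \<le> (\<integral>\<^sup>+\<omega>. ennreal (exp (- r\<^sup>2 / c)) * ennreal (exp ((\<Sum>e\<in>G i. ((W t \<omega> - W s \<omega>) \<bullet> e)\<^sup>2) / c)) \<partial>M)"
    proof (rule nn_integral_mono)
      fix \<omega>
      show "indicator (A i) \<omega> \<le> ennreal (exp (- r\<^sup>2 / c)) * ennreal (exp ((\<Sum>e\<in>G i. ((W t \<omega> - W s \<omega>) \<bullet> e)\<^sup>2) / c))"
      proof (cases "\<omega> \<in> A i")
        case True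
        then have "0 \<le> ((\<Sum>e\<in>G i. ((W t \<omega> - W s \<omega>) \<bullet> e)\<^sup>2) - r\<^sup>2) / c" using c by (simp add: A_def)
        then have "1 \<le> exp (- r\<^sup>2 / c + (\<Sum>e\<in>G i. ((W t \<omega> - W s \<omega>) \<bullet> e)\<^sup>2) / c)"
          by (simp add: diff_divide_distrib)
        then have "(1 :: ennreal) \<le> ennreal (exp (- r\<^sup>2 / c + (\<Sum>e\<in>G i. ((W t \<omega> - W s \<omega>) \<bullet> e)\<^sup>2) / c))"
          using ennreal_leI by fastforce
        also have "\<dots> = ennreal (exp (- r\<^sup>2 / c)) * ennreal (exp ((\<Sum>e\<in>G i. ((W t \<omega> - W s \<omega>) \<bullet> e)\<^sup>2) / c))"
          unfolding exp_add by (rule ennreal_mult) auto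
        finally show ?thesis using True by simp
      qed simp
    qed
    also have "\<dots> = ennreal (exp (- r\<^sup>2 / c)) * (\<integral>\<^sup>+\<omega>. ennreal (exp ((\<Sum>e\<in>G i. ((W t \<omega> - W s \<omega>) \<bullet> e)\<^sup>2) / c)) \<partial>M)"
      by (rule nn_integral_cmult) measurable
    also have "\<dots> \<le> ennreal (exp (- r\<^sup>2 / c)) * ennreal (sqrt 2)"
      unfolding c_def using G lamT[OF G] by (intro mult_left_mono coord_exp_moment st T) auto
    also have "\<dots> = ennreal (sqrt 2 * exp (- r\<^sup>2 / c))" by (simp add: ennreal_mult[symmetric] mult.commute)
    finally show ?thesis .
  qed
  have "{\<omega> \<in> space M. r < norm ((W t \<omega> - W s \<omega>) - oproj J (W t \<omega> - W s \<omega>))} \<subseteq> (\<Union>i. A i)"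
  proof
    fix \<omega> assume \<omega>: "\<omega> \<in> {\<omega> \<in> space M. r < norm ((W t \<omega> - W s \<omega>) - oproj J (W t \<omega> - W s \<omega>))}"
    show "\<omega> \<in> (\<Union>i. A i)"
    proof (rule ccontr)
      assume "\<omega> \<notin> (\<Union>i. A i)"
      then have le: "(\<Sum>e\<in>G i. ((W t \<omega> - W s \<omega>) \<bullet> e)\<^sup>2) \<le> r\<^sup>2" for i using \<omega> by (force simp: A_def not_less)
      have "(norm ((W t \<omega> - W s \<omega>) - oproj J (W t \<omega> - W s \<omega>)))\<^sup>2 \<le> r\<^sup>2"
      proof (rule norm_diff_oproj_le[OF E_basis J])
        fix F assume F: "finite F" "F \<subseteq> E - J"
        have "F \<subseteq> G (Suc (Max (insert 0 (to_nat_on E ` F))))"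
          using F by (auto simp: G_def less_Suc_eq_le intro: Max_ge)
        then have "(\<Sum>e\<in>F. ((W t \<omega> - W s \<omega>) \<bullet> e)\<^sup>2) \<le> (\<Sum>e\<in>G (Suc (Max (insert 0 (to_nat_on E ` F)))). ((W t \<omega> - W s \<omega>) \<bullet> e)\<^sup>2)"
          by (intro sum_mono2 G) auto
        also have "\<dots> \<le> r\<^sup>2" by (rule le)
        finally show "(\<Sum>e\<in>F. ((W t \<omega> - W s \<omega>) \<bullet> e)\<^sup>2) \<le> r\<^sup>2" .
      qed
      then have "norm ((W t \<omega> - W s \<omega>) - oproj J (W t \<omega> - W s \<omega>)) \<le> r" using r by (rule power2_le_imp_le)
      with \<omega> show False by simp
    qed
  qed
  then have "emeasure M {\<omega> \<in> space M. r < norm ((W t \<omega> - W s \<omega>) - oproj J (W t \<omega> - W s \<omega>))} \<le> emeasure M (\<Union>i. A i)"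
    using Am by (intro emeasure_mono) auto
  also have "\<dots> = (SUP i. emeasure M (A i))"
    using Am inc by (intro SUP_emeasure_incseq[symmetric]) auto
  also have "\<dots> \<le> ennreal (sqrt 2 * exp (- r\<^sup>2 / c))" by (intro SUP_least Ai)
  finally show ?thesis by (simp add: c_def)
qed

end

lemma suminf_tail_tendsto_0:
  fixes f :: "nat \<Rightarrow> real"
  assumes f: "summable f"
  shows "(\<lambda>n. \<Sum>m. f (m + n)) \<longlonglongrightarrow> 0"
proof -
  have "(\<lambda>n. suminf f - (\<Sum>i<n. f i)) \<longlonglongrightarrow> suminf f - suminf f"
    by (intro tendsto_diff tendsto_const summable_LIMSEQ f)
  then show ?thesis by (simp add: suminf_minus_initial_segment[OF f])
qed

section \<open>Dyadic regularity of the Wiener process\<close>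

context wiener
begin

text \<open>Growth per level of the squared tolerance \<open>(2 powr - \<alpha>) ^ (2 * m)\<close>
  relative to the variance scale \<open>1 / 2 ^ m\<close>.\<close>

definition \<rho> :: real where "\<rho> = 2 * (2 powr - \<alpha>)\<^sup>2"

lemma \<rho>_gt_1: "\<rho> > 1"
proof -
  have "\<rho> = 2 powr (1 - 2 * \<alpha>)"
    by (simp add: \<rho>_def power2_eq_square powr_add[symmetric] powr_diff powr_minus field_simps)
  then show ?thesis using \<alpha>_half by simp
qed

text \<open>Union bound for the \<open>2 ^ m\<close> increments of level \<open>m\<close>; the
  factor \<open>sqrt 2\<close> is that of \<open>increment_tail\<close>.\<close>

definition tail_term :: "real \<Rightarrow> nat \<Rightarrow> real" where
  "tail_term b m = sqrt 2 * (2 ^ m * exp (- b * \<rho> ^ m))"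

lemma summable_tail_term: "b > 0 \<Longrightarrow> summable (tail_term b)"
  unfolding tail_term_def by (intro summable_mult summable_double_exponential \<rho>_gt_1)

lemma tail_term_nonneg: "0 \<le> tail_term b m"
  by (simp add: tail_term_def)

lemma \<alpha>_le_1: "\<alpha> \<le> 1"
  using \<alpha>_half by simp

lemma dyadic_holder_measurable:
  fixes G :: "real \<Rightarrow> 'h"
  shows "{\<omega> \<in> space M. dyadic_holder \<alpha> n \<eta> (\<lambda>t. c *\<^sub>R W t \<omega> - G t)} \<in> sets M"
proof -
  have "Measurable.pred M (\<lambda>\<omega>. \<forall>m. n \<le> m \<longrightarrow> (\<forall>k. k < 2 ^ m \<longrightarrow>
      norm (c *\<^sub>R dinc (Wpath \<omega>) m k - dinc G m k) \<le> \<eta> * (2 powr - \<alpha>) ^ m))"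
  proof (intro pred_intros_countable(1) pred_intros_imp')
    fix m k :: nat assume "k < 2 ^ m"
    note [measurable] = dinc_W_measurable[OF this]
    show "Measurable.pred M (\<lambda>\<omega>. norm (c *\<^sub>R dinc (Wpath \<omega>) m k - dinc G m k) \<le> \<eta> * (2 powr - \<alpha>) ^ m)"
      by measurable
  qed
  then show ?thesis
    unfolding dyadic_holder_def dinc_diff dinc_scaleR by (simp only: pred_def)
qed

lemma not_dyadic_holder_le:
  assumes \<eta>: "\<eta> \<ge> 0"
  shows "emeasure M {\<omega> \<in> space M. \<not> dyadic_holder \<alpha> n \<eta> (Wpath \<omega>)} \<le> (\<Sum>m. ennreal (tail_term (\<eta>\<^sup>2 / (4 * \<tau>)) (m + n)))"
proof -
  define bad where "bad m k = {\<omega> \<in> space M. \<eta> * (2 powr - \<alpha>) ^ m < norm (dinc (Wpath \<omega>) m k)}" for m k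
  have bad_sets: "bad m k \<in> sets M" if "k < 2 ^ m" for m k
  proof -
    note [measurable] = dinc_W_measurable[OF that]
    show ?thesis unfolding bad_def by measurable
  qed
  have bad_le: "emeasure M (bad m k) \<le> ennreal (sqrt 2 * exp (- (\<eta>\<^sup>2 / (4 * \<tau>)) * \<rho> ^ m))" if k: "k < 2 ^ m" for m k
  proof -
    let ?s = "real k / 2 ^ m" and ?t = "real (Suc k) / 2 ^ m"
    have ts: "?t - ?s = 1 / 2 ^ m" by (simp add: diff_divide_distrib[symmetric])
    have "emeasure M {\<omega> \<in> space M. \<eta> * (2 powr - \<alpha>) ^ m < norm ((W ?t \<omega> - W ?s \<omega>) - oproj {} (W ?t \<omega> - W ?s \<omega>))} \<le>
        ennreal (sqrt 2 * exp (- (\<eta> * (2 powr - \<alpha>) ^ m)\<^sup>2 / (4 * (?t - ?s) * \<tau>)))"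
      using dyadic_mem[of k m] dyadic_mem[of "Suc k" m] k \<eta>
      by (intro increment_tail \<tau>_pos lam_sum_le) (auto simp: divide_strict_right_mono)
    also have "- (\<eta> * (2 powr - \<alpha>) ^ m)\<^sup>2 / (4 * (?t - ?s) * \<tau>) = - (\<eta>\<^sup>2 / (4 * \<tau>)) * \<rho> ^ m"
      unfolding ts \<rho>_def using \<tau>_pos by (simp add: power_mult_distrib power2_eq_square field_simps)
    finally show ?thesis by (simp add: bad_def dinc_def oproj_def)
  qed
  have "{\<omega> \<in> space M. \<not> dyadic_holder \<alpha> n \<eta> (Wpath \<omega>)} \<subseteq> (\<Union>m. \<Union>k\<in>{..<2 ^ (m + n)}. bad (m + n) k)"
  proof
    fix \<omega> assume "\<omega> \<in> {\<omega> \<in> space M. \<not> dyadic_holder \<alpha> n \<eta> (Wpath \<omega>)}"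
    then obtain m k where mk: "n \<le> m" "k < 2 ^ m" "\<omega> \<in> bad m k" by (auto simp: dyadic_holder_def bad_def not_le)
    then show "\<omega> \<in> (\<Union>m. \<Union>k\<in>{..<2 ^ (m + n)}. bad (m + n) k)"
      by (intro UN_I[of "m - n"] UN_I[of k]) auto
  qed
  then have "emeasure M {\<omega> \<in> space M. \<not> dyadic_holder \<alpha> n \<eta> (Wpath \<omega>)} \<le> emeasure M (\<Union>m. \<Union>k\<in>{..<2 ^ (m + n)}. bad (m + n) k)"
    using bad_sets by (intro emeasure_mono) auto
  also have "\<dots> \<le> (\<Sum>m. emeasure M (\<Union>k\<in>{..<2 ^ (m + n)}. bad (m + n) k))"
    by (rule emeasure_subadditive_countably) (use bad_sets in auto)
  also have "\<dots> \<le> (\<Sum>m. ennreal (tail_term (\<eta>\<^sup>2 / (4 * \<tau>)) (m + n)))"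
  proof (rule suminf_le)
    fix m
    have "emeasure M (\<Union>k\<in>{..<2 ^ (m + n)}. bad (m + n) k) \<le> (\<Sum>k<2 ^ (m + n). emeasure M (bad (m + n) k))"
      using bad_sets by (intro emeasure_subadditive_finite) auto
    also have "\<dots> \<le> (\<Sum>k<(2::nat) ^ (m + n). ennreal (sqrt 2 * exp (- (\<eta>\<^sup>2 / (4 * \<tau>)) * \<rho> ^ (m + n))))"
      by (intro sum_mono bad_le) simp
    also have "\<dots> = ennreal (\<Sum>k<(2::nat) ^ (m + n). sqrt 2 * exp (- (\<eta>\<^sup>2 / (4 * \<tau>)) * \<rho> ^ (m + n)))"
      by (rule sum_ennreal) simp
    also have "(\<Sum>k<(2::nat) ^ (m + n). sqrt 2 * exp (- (\<eta>\<^sup>2 / (4 * \<tau>)) * \<rho> ^ (m + n))) = tail_term (\<eta>\<^sup>2 / (4 * \<tau>)) (m + n)"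
      by (simp add: tail_term_def)
    finally show "emeasure M (\<Union>k\<in>{..<2 ^ (m + n)}. bad (m + n) k) \<le> ennreal (tail_term (\<eta>\<^sup>2 / (4 * \<tau>)) (m + n))" .
  qed auto
  finally show ?thesis .
qed

lemma prob_not_dyadic_holder_le:
  assumes \<eta>: "\<eta> > 0"
  shows "prob {\<omega> \<in> space M. \<not> dyadic_holder \<alpha> n \<eta> (Wpath \<omega>)} \<le> (\<Sum>m. tail_term (\<eta>\<^sup>2 / (4 * \<tau>)) (m + n))"
proof -
  have b: "\<eta>\<^sup>2 / (4 * \<tau>) > 0" using \<eta> \<tau>_pos by simp
  have s: "summable (\<lambda>m. tail_term (\<eta>\<^sup>2 / (4 * \<tau>)) (m + n))"
    using summable_tail_term[OF b] by (rule summable_ignore_initial_segment)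
  have "ennreal (prob {\<omega> \<in> space M. \<not> dyadic_holder \<alpha> n \<eta> (Wpath \<omega>)}) \<le> (\<Sum>m. ennreal (tail_term (\<eta>\<^sup>2 / (4 * \<tau>)) (m + n)))"
    using not_dyadic_holder_le[of \<eta> n] \<eta> by (simp add: emeasure_eq_measure)
  also have "\<dots> = ennreal (\<Sum>m. tail_term (\<eta>\<^sup>2 / (4 * \<tau>)) (m + n))"
    using s by (intro suminf_ennreal2) (auto simp: tail_term_nonneg)
  finally show ?thesis
    by (subst (asm) ennreal_le_iff) (auto intro!: suminf_nonneg s tail_term_nonneg)
qed

text \<open>Scaling the path replaces \<open>b\<close> by \<open>b / \<epsilon>\<close>. As
  \<open>L \<le> b * \<rho> ^ m\<close> for all \<open>m \<ge> n\<close>, every term gains at least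
  the factor \<open>exp (L - L / \<epsilon>)\<close>, and a summable series independent of
  \<open>\<epsilon>\<close> remains.\<close>

lemma prob_not_dyadic_holder_scaled:
  assumes \<eta>: "\<eta> > 0" and L: "0 \<le> L" "L \<le> \<eta>\<^sup>2 / (4 * \<tau>) * \<rho> ^ n"
  obtains K where "K > 0" "\<And>\<epsilon>. 0 < \<epsilon> \<Longrightarrow> \<epsilon> \<le> 1 \<Longrightarrow>
    prob {\<omega> \<in> space M. \<not> dyadic_holder \<alpha> n (\<eta> / sqrt \<epsilon>) (Wpath \<omega>)} \<le> K * exp (- L / \<epsilon>)"
proof -
  define b where "b = \<eta>\<^sup>2 / (4 * \<tau>)"
  have b: "b > 0" using \<eta> \<tau>_pos by (simp add: b_def)
  have sum: "summable (\<lambda>m. tail_term b (m + n))" if "b > 0" for b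
    using summable_tail_term[OF that] by (rule summable_ignore_initial_segment)
  define K where "K = exp L * (\<Sum>m. tail_term b (m + n))"
  have "0 < tail_term b (0 + n)" by (simp add: tail_term_def)
  then have "0 < (\<Sum>m. tail_term b (m + n))"
    using suminf_pos2[OF sum[OF b], of 0] tail_term_nonneg by auto
  then have K: "K > 0" by (simp add: K_def)
  show thesis
  proof (rule that[OF K])
    fix \<epsilon> :: real assume \<epsilon>: "0 < \<epsilon>" "\<epsilon> \<le> 1"
    have be: "(\<eta> / sqrt \<epsilon>)\<^sup>2 / (4 * \<tau>) = b / \<epsilon>" using \<epsilon> by (simp add: b_def power_divide)
    have le: "tail_term (b / \<epsilon>) (m + n) \<le> exp (L - L / \<epsilon>) * tail_term b (m + n)" for m
    proof -
      have "L \<le> b * \<rho> ^ n" using L by (simp add: b_def)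
      also have "\<dots> \<le> b * \<rho> ^ (m + n)" using b \<rho>_gt_1 by (intro mult_left_mono power_increasing) auto
      \<comment> \<open>Expanding this product is the comparison of exponents;
        \<open>\<epsilon> \<le> 1\<close> makes the second factor nonnegative.\<close>
      finally have "0 \<le> (b * \<rho> ^ (m + n) - L) * (1 / \<epsilon> - 1)"
        using \<epsilon> by (intro mult_nonneg_nonneg) (auto simp: field_simps)
      then have "- (b / \<epsilon>) * \<rho> ^ (m + n) \<le> (L - L / \<epsilon>) + - b * \<rho> ^ (m + n)"
        by (simp add: algebra_simps)
      then have "exp (- (b / \<epsilon>) * \<rho> ^ (m + n)) \<le> exp (L - L / \<epsilon>) * exp (- b * \<rho> ^ (m + n))"
        by (simp add: exp_add[symmetric])
      then have "sqrt 2 * 2 ^ (m + n) * exp (- (b / \<epsilon>) * \<rho> ^ (m + n)) \<le> sqrt 2 * 2 ^ (m + n) * (exp (L - L / \<epsilon>) * exp (- b * \<rho> ^ (m + n)))"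
        by (intro mult_left_mono) auto
      then show ?thesis by (simp add: tail_term_def mult_ac)
    qed
    have "prob {\<omega> \<in> space M. \<not> dyadic_holder \<alpha> n (\<eta> / sqrt \<epsilon>) (Wpath \<omega>)} \<le> (\<Sum>m. tail_term (b / \<epsilon>) (m + n))"
      using prob_not_dyadic_holder_le[of "\<eta> / sqrt \<epsilon>" n] \<eta> \<epsilon> unfolding be by simp
    also have "\<dots> \<le> (\<Sum>m. exp (L - L / \<epsilon>) * tail_term b (m + n))"
      using b \<epsilon> by (intro suminf_le le summable_mult sum) auto
    also have "\<dots> = exp (L - L / \<epsilon>) * (\<Sum>m. tail_term b (m + n))"
      by (rule suminf_mult[OF sum[OF b]])
    also have "\<dots> = K * exp (- L / \<epsilon>)"
      by (simp add: K_def exp_diff exp_minus field_simps)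
    finally show "prob {\<omega> \<in> space M. \<not> dyadic_holder \<alpha> n (\<eta> / sqrt \<epsilon>) (Wpath \<omega>)} \<le> K * exp (- L / \<epsilon>)" .
  qed
qed

lemma AE_dyadic_holder: "AE \<omega> in M. \<forall>j::nat. \<exists>n. dyadic_holder \<alpha> n (1 / real (Suc j)) (Wpath \<omega>)"
proof (rule AE_all_countable[THEN iffD2], rule allI)
  fix j :: nat
  define \<eta> where "\<eta> = 1 / real (Suc j)"
  have \<eta>: "\<eta> > 0" by (simp add: \<eta>_def)
  have sets: "{\<omega> \<in> space M. \<not> dyadic_holder \<alpha> n \<eta> (Wpath \<omega>)} \<in> sets M" for n
    using sets.Diff[OF sets.top dyadic_holder_measurable[of n \<eta> 1 "\<lambda>_. 0"]]
    by (rule back_subst[of "\<lambda>A. A \<in> sets M"]) auto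
  define B where "B = (\<Inter>n. {\<omega> \<in> space M. \<not> dyadic_holder \<alpha> n \<eta> (Wpath \<omega>)})"
  have B: "B \<in> sets M" unfolding B_def using sets by auto
  have "prob B \<le> (\<Sum>m. tail_term (\<eta>\<^sup>2 / (4 * \<tau>)) (m + n))" for n
  proof -
    have "prob B \<le> prob {\<omega> \<in> space M. \<not> dyadic_holder \<alpha> n \<eta> (Wpath \<omega>)}"
      by (rule finite_measure_mono) (use sets in \<open>auto simp: B_def\<close>)
    also note prob_not_dyadic_holder_le[OF \<eta>]
    finally show ?thesis .
  qed
  moreover have "(\<lambda>n. \<Sum>m. tail_term (\<eta>\<^sup>2 / (4 * \<tau>)) (m + n)) \<longlonglongrightarrow> 0"
    using \<eta> \<tau>_pos by (intro suminf_tail_tendsto_0 summable_tail_term) simp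
  ultimately have "prob B \<le> 0" by (intro LIMSEQ_le_const) auto
  then have "emeasure M B = 0" by (simp add: emeasure_eq_measure measure_le_0_iff)
  then have "AE \<omega> in M. \<omega> \<notin> B" using B by (intro AE_not_in) auto
  with AE_space show "AE \<omega> in M. \<exists>n. dyadic_holder \<alpha> n (1 / real (Suc j)) (Wpath \<omega>)"
    by eventually_elim (auto simp: B_def \<eta>_def)
qed

section \<open>The law of the scaled path on the Hoelder space\<close>

definition spath :: "real \<Rightarrow> 'w \<Rightarrow> real \<Rightarrow> 'h" where
  "spath c \<omega> = (\<lambda>t\<in>{0..1}. c *\<^sub>R W t \<omega>)"

lemma spath_dyadic: "dyadic_holder \<alpha> n \<eta> (\<lambda>t. spath c \<omega> t - G t) \<longleftrightarrow> dyadic_holder \<alpha> n \<eta> (\<lambda>t. c *\<^sub>R W t \<omega> - G t)"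
  by (rule dyadic_holder_cong) (simp add: spath_def)

lemma dyadic_holder_scaled:
  assumes "c > 0"
  shows "dyadic_holder \<alpha> n \<eta> (\<lambda>t. c *\<^sub>R F t) \<longleftrightarrow> dyadic_holder \<alpha> n (\<eta> / c) F"
  using assms unfolding dyadic_holder_def dinc_scaleR by (simp add: field_simps)

text \<open>A countable description of membership, from which it becomes an event. The term
  \<open>- 0\<close> matches \<open>dyadic_holder_measurable\<close> for the zero path.\<close>

lemma spath_holder0_iff:
  assumes \<omega>: "\<omega> \<in> space M"
  shows "spath c \<omega> \<in> holder0 \<alpha> \<longleftrightarrow> (\<forall>j::nat. \<exists>n. dyadic_holder \<alpha> n (1 / real (Suc j)) (\<lambda>t. c *\<^sub>R W t \<omega> - 0))"
proof
  assume h: "spath c \<omega> \<in> holder0 \<alpha>"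
  show "\<forall>j::nat. \<exists>n. dyadic_holder \<alpha> n (1 / real (Suc j)) (\<lambda>t. c *\<^sub>R W t \<omega> - 0)"
  proof
    fix j :: nat
    obtain n where "dyadic_holder \<alpha> n (1 / real (Suc j)) (spath c \<omega>)"
      using holder0_dyadic[OF h, of "1 / real (Suc j)"] by auto
    then show "\<exists>n. dyadic_holder \<alpha> n (1 / real (Suc j)) (\<lambda>t. c *\<^sub>R W t \<omega> - 0)"
      using spath_dyadic[of n _ c \<omega> "\<lambda>_. 0"] by auto
  qed
next
  assume *: "\<forall>j::nat. \<exists>n. dyadic_holder \<alpha> n (1 / real (Suc j)) (\<lambda>t. c *\<^sub>R W t \<omega> - 0)"
  show "spath c \<omega> \<in> holder0 \<alpha>"
  proof (rule holder0I[OF \<alpha>_pos])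
    show "spath c \<omega> \<in> extensional {0..1}" "spath c \<omega> 0 = 0" using W_0[OF \<omega>] by (auto simp: spath_def)
    have "continuous_on {0..1} (\<lambda>t. c *\<^sub>R W t \<omega>)" by (intro continuous_intros W_cont \<omega>)
    then show "continuous_on {0..1} (spath c \<omega>)"
      by (rule continuous_on_eq) (simp add: spath_def)
    fix \<eta> :: real assume "\<eta> > 0"
    then obtain j where j: "1 / real (Suc j) < \<eta>" using nat_approx_posE by blast
    obtain n where "dyadic_holder \<alpha> n (1 / real (Suc j)) (\<lambda>t. c *\<^sub>R W t \<omega> - 0)" using * by blast
    then have "dyadic_holder \<alpha> n \<eta> (\<lambda>t. c *\<^sub>R W t \<omega> - 0)" by (rule dyadic_holder_mono) (use j in auto)
    then show "\<exists>n. dyadic_holder \<alpha> n \<eta> (spath c \<omega>)"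
      using spath_dyadic[of n \<eta> c \<omega> "\<lambda>_. 0"] by auto
  qed
qed

lemma spath_holder0_sets: "{\<omega> \<in> space M. spath c \<omega> \<in> holder0 \<alpha>} \<in> sets M"
proof -
  have "{\<omega> \<in> space M. spath c \<omega> \<in> holder0 \<alpha>} =
      {\<omega> \<in> space M. \<forall>j::nat. \<exists>n. dyadic_holder \<alpha> n (1 / real (Suc j)) (\<lambda>t. c *\<^sub>R W t \<omega> - 0)}"
    using spath_holder0_iff by auto
  also have "\<dots> \<in> sets M"
    by (intro sets.sets_Collect_countable_All sets.sets_Collect_countable_Ex dyadic_holder_measurable[of _ _ _ "\<lambda>_. 0"])
  finally show ?thesis .
qed

lemma AE_spath_holder0:
  assumes c: "c > 0"
  shows "AE \<omega> in M. spath c \<omega> \<in> holder0 \<alpha>"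
  using AE_dyadic_holder AE_space
proof eventually_elim
  fix \<omega> assume *: "\<forall>j::nat. \<exists>n. dyadic_holder \<alpha> n (1 / real (Suc j)) (Wpath \<omega>)" and \<omega>: "\<omega> \<in> space M"
  show "spath c \<omega> \<in> holder0 \<alpha>"
    unfolding spath_holder0_iff[OF \<omega>]
  proof
    fix j :: nat
    have "1 / real (Suc j) / c > 0" using c by simp
    then obtain i where i: "1 / real (Suc i) < 1 / real (Suc j) / c" using nat_approx_posE by blast
    obtain n where "dyadic_holder \<alpha> n (1 / real (Suc i)) (Wpath \<omega>)" using * by blast
    then have "dyadic_holder \<alpha> n (1 / real (Suc j) / c) (Wpath \<omega>)" by (rule dyadic_holder_mono) (use i in auto)
    then show "\<exists>n. dyadic_holder \<alpha> n (1 / real (Suc j)) (\<lambda>t. c *\<^sub>R W t \<omega> - 0)"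
      using dyadic_holder_scaled[OF c, of n "1 / real (Suc j)" "Wpath \<omega>"] by auto
  qed
qed

lemma zero_holder0: "(\<lambda>t\<in>{0..1}. 0 :: 'h) \<in> holder0 \<alpha>"
proof (rule holder0I[OF \<alpha>_pos])
  show "continuous_on {0..1} (\<lambda>t\<in>{0..1}. 0 :: 'h)"
    by (rule continuous_on_eq[of _ "\<lambda>_. 0"]) auto
  fix \<eta> :: real assume "\<eta> > 0"
  then have "dyadic_holder \<alpha> 0 \<eta> (\<lambda>_. 0 :: 'h)" by (simp add: dyadic_holder_def dinc_def)
  then show "\<exists>n. dyadic_holder \<alpha> n \<eta> (\<lambda>t\<in>{0..1}. 0 :: 'h)"
    using dyadic_holder_cong[of "\<lambda>t\<in>{0..1}. 0 :: 'h" "\<lambda>_. 0" \<alpha> 0 \<eta>] by auto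
qed auto

text \<open>A modification of \<open>spath\<close> that takes all its values in the Hoelder space,
  so that it is a measurable map; for \<open>c > 0\<close> it differs from \<open>spath\<close> on a
  null set only.\<close>

definition mpath :: "real \<Rightarrow> 'w \<Rightarrow> real \<Rightarrow> 'h" where
  "mpath c \<omega> = (if spath c \<omega> \<in> holder0 \<alpha> then spath c \<omega> else (\<lambda>t\<in>{0..1}. 0))"

lemma mpath_measurable: "mpath c \<in> measurable M (borel_of (holder_topology \<alpha>))"
proof (rule measurable_borel_ofI)
  show "mpath c \<omega> \<in> topspace (holder_topology \<alpha>)" for \<omega>
    using zero_holder0 by (simp add: mpath_def topspace_holder[OF \<alpha>_pos])
  fix O' :: "(real \<Rightarrow> 'h) set" assume O': "openin (holder_topology \<alpha>) O'"
  obtain P :: "((real \<Rightarrow> 'h) \<times> real) set" where P: "countable P"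
    "O' = (\<Union>(G, q)\<in>P. {F \<in> holder0 \<alpha>. dyadic_holder \<alpha> 0 q (\<lambda>t. F t - G t)})"
    by (rule holder_open_countable_union[OF \<alpha>_pos \<alpha>_le_1 O'])
  let ?H = "{\<omega> \<in> space M. spath c \<omega> \<in> holder0 \<alpha>}"
  have "{\<omega> \<in> space M. spath c \<omega> \<in> O'} =
      (\<Union>p\<in>P. ?H \<inter> {\<omega> \<in> space M. dyadic_holder \<alpha> 0 (snd p) (\<lambda>t. c *\<^sub>R W t \<omega> - fst p t)})"
    unfolding P(2) by (force simp: spath_dyadic)
  also have "\<dots> \<in> sets M"
    using P(1) spath_holder0_sets dyadic_holder_measurable by (intro sets.countable_UN' sets.Int) auto
  finally have 1: "{\<omega> \<in> space M. spath c \<omega> \<in> O'} \<in> sets M" .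
  have "mpath c -` O' \<inter> space M = (?H \<inter> {\<omega> \<in> space M. spath c \<omega> \<in> O'}) \<union>
      (if (\<lambda>t\<in>{0..1}. 0) \<in> O' then space M - ?H else {})"
    by (auto simp: mpath_def split: if_splits)
  also have "\<dots> \<in> sets M" using 1 spath_holder0_sets by auto
  finally show "mpath c -` O' \<inter> space M \<in> sets M" .
qed

lemma spath_sets:
  assumes "A \<in> sets (borel_of (holder_topology \<alpha>))"
  shows "{\<omega> \<in> space M. spath c \<omega> \<in> A} \<in> sets M"
proof -
  have "A \<subseteq> holder0 \<alpha>"
    using sets.sets_into_space[OF assms] by (simp add: space_borel_of topspace_holder[OF \<alpha>_pos])
  then have "{\<omega> \<in> space M. spath c \<omega> \<in> A} = {\<omega> \<in> space M. spath c \<omega> \<in> holder0 \<alpha>} \<inter> (mpath c -` A \<inter> space M)"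
    by (auto simp: mpath_def)
  then show ?thesis
    using spath_holder0_sets measurable_sets[OF mpath_measurable assms] by auto
qed

text \<open>Preimages of a Borel set under \<open>spath\<close> and \<open>mpath\<close> are events
  that agree up to a null set, so the two maps assign the same measure to it.\<close>

lemma scaled_law_eq:
  assumes \<epsilon>: "\<epsilon> > 0"
  shows "scaled_law \<alpha> M W \<epsilon> = distr M (borel_of (holder_topology \<alpha>)) (mpath (sqrt \<epsilon>))"
proof -
  let ?N = "borel_of (holder_topology \<alpha>) :: (real \<Rightarrow> 'h) measure"
  have "emeasure M (spath (sqrt \<epsilon>) -` A \<inter> space M) = emeasure M (mpath (sqrt \<epsilon>) -` A \<inter> space M)" if A: "A \<in> sets ?N" for A
  proof (rule emeasure_eq_AE)
    show "AE \<omega> in M. \<omega> \<in> spath (sqrt \<epsilon>) -` A \<inter> space M \<longleftrightarrow> \<omega> \<in> mpath (sqrt \<epsilon>) -` A \<inter> space M"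
      using AE_spath_holder0[of "sqrt \<epsilon>"] \<epsilon> by (auto elim!: eventually_mono simp: mpath_def)
    show "spath (sqrt \<epsilon>) -` A \<inter> space M \<in> sets M"
      using spath_sets[OF A, of "sqrt \<epsilon>"] by (rule back_subst[of "\<lambda>A. A \<in> sets M"]) auto
    show "mpath (sqrt \<epsilon>) -` A \<inter> space M \<in> sets M" by (rule measurable_sets[OF mpath_measurable A])
  qed
  then have "distr M ?N (spath (sqrt \<epsilon>)) = distr M ?N (mpath (sqrt \<epsilon>))"
    \<comment> \<open>\<open>distr\<close> is a \<open>measure_of\<close> whose last argument is the
      measure of preimages, and the result depends only on the values of that argument on the
      sigma-algebra.\<close>
    unfolding distr_def by (intro measure_of_eq sets.space_closed) (simp add: sets.sigma_sets_eq)
  then show ?thesis by (simp add: scaled_law_def spath_def[abs_def])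
qed

lemma scaled_law_prob:
  assumes \<epsilon>: "\<epsilon> > 0"
  shows "prob_space (scaled_law \<alpha> M W \<epsilon>)" "sets (scaled_law \<alpha> M W \<epsilon>) = sets (borel_of (holder_topology \<alpha>))"
  unfolding scaled_law_eq[OF \<epsilon>] by (auto intro: prob_space_distr mpath_measurable)

lemma scaled_law_measure:
  assumes \<epsilon>: "\<epsilon> > 0" and A: "A \<in> sets (borel_of (holder_topology \<alpha>))"
  shows "measure (scaled_law \<alpha> M W \<epsilon>) A = prob {\<omega> \<in> space M. spath (sqrt \<epsilon>) \<omega> \<in> A}"
proof -
  have "measure (scaled_law \<alpha> M W \<epsilon>) A = prob (mpath (sqrt \<epsilon>) -` A \<inter> space M)"
    unfolding scaled_law_eq[OF \<epsilon>] by (rule measure_distr[OF mpath_measurable A])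
  also have "\<dots> = prob {\<omega> \<in> space M. spath (sqrt \<epsilon>) \<omega> \<in> A}"
  proof (rule measure_eq_AE)
    show "AE \<omega> in M. \<omega> \<in> mpath (sqrt \<epsilon>) -` A \<inter> space M \<longleftrightarrow> \<omega> \<in> {\<omega> \<in> space M. spath (sqrt \<epsilon>) \<omega> \<in> A}"
      using AE_spath_holder0[of "sqrt \<epsilon>"] \<epsilon> by (auto elim!: eventually_mono simp: mpath_def)
  qed (use spath_sets[OF A] measurable_sets[OF mpath_measurable A] in auto)
  finally show ?thesis .
qed

end

section \<open>Large deviation bounds\<close>

text \<open>Without a gap there are points of \<open>A\<close> and \<open>L\<close> at dyadic
  distance tending to 0; a limit \<open>l\<close> of the points of \<open>L\<close> has an open
  neighbourhood missing \<open>A\<close>, which these points of \<open>A\<close> eventually enter.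
  The dyadic form of the gap fits the estimate of \<open>dyadic_holder_approx\<close>.\<close>

lemma compact_closed_dyadic_gap:
  fixes A L :: "(real \<Rightarrow> 'h::real_normed_vector) set"
  assumes \<alpha>: "0 < \<alpha>" and L: "compactin (holder_topology \<alpha>) L" and A: "closedin (holder_topology \<alpha>) A"
    and disj: "L \<inter> A = {}"
  obtains \<delta> where "\<delta> > 0" "\<And>z y. z \<in> A \<Longrightarrow> y \<in> L \<Longrightarrow> \<not> dyadic_holder \<alpha> 0 \<delta> (\<lambda>t. z t - y t)"
proof -
  interpret Metric_space "holder0 \<alpha> :: (real \<Rightarrow> 'h) set" "holder_dist \<alpha>"
    by (rule Metric_space_holder0[OF \<alpha>])
  note top = topspace_holder[OF \<alpha>, where 'h = 'h]
  have A': "A \<subseteq> holder0 \<alpha>" using closedin_subset[OF A] by (simp add: top)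
  have op: "openin (holder_topology \<alpha>) (holder0 \<alpha> - A)"
    using openin_diff[OF openin_topspace A] by (simp add: top)
  show thesis
  proof (rule ccontr)
    assume neg: "\<not> thesis"
    have "\<exists>z y. z \<in> A \<and> y \<in> L \<and> dyadic_holder \<alpha> 0 (1 / real (Suc i)) (\<lambda>t. z t - y t)" for i
      using that[of "1 / real (Suc i)"] neg by auto
    then obtain z y where zy: "\<And>i. z i \<in> A" "\<And>i. y i \<in> L"
      "\<And>i. dyadic_holder \<alpha> 0 (1 / real (Suc i)) (\<lambda>t. z i t - y i t)" by metis
    have "range y \<subseteq> L" using zy(2) by auto
    then obtain l r where l: "l \<in> L" "strict_mono r" "limitin mtopology (y \<circ> r) l sequentially"
      using L[unfolded holder_topology_def compactin_sequentially] by blast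
    have lh: "l \<in> holder0 \<alpha>" "l \<in> holder0 \<alpha> - A"
      using l(1) compactin_subset_topspace[OF L] disj by (auto simp: top)
    obtain \<eta> where \<eta>: "\<eta> > 0" "\<And>G. G \<in> holder0 \<alpha> \<Longrightarrow> dyadic_holder \<alpha> 0 \<eta> (\<lambda>t. G t - l t) \<Longrightarrow> G \<in> holder0 \<alpha> - A"
      by (rule openin_holder_dyadic[OF \<alpha> op lh(2)]) blast
    have "\<forall>\<^sub>F i in sequentially. (y \<circ> r) i \<in> holder0 \<alpha> \<and> holder_dist \<alpha> ((y \<circ> r) i) l < \<eta> / 2"
      using l(3) \<eta>(1) unfolding limitin_metric by (meson half_gt_zero)
    moreover have "\<forall>\<^sub>F i in sequentially. 1 / real (Suc i) < \<eta> / 2"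
      using \<eta>(1) LIMSEQ_inverse_real_of_nat
      by (intro order_tendstoD(2)[of _ 0]) (simp_all add: inverse_eq_divide)
    ultimately have "\<forall>\<^sub>F i in sequentially. (y (r i) \<in> holder0 \<alpha> \<and> holder_dist \<alpha> (y (r i)) l < \<eta> / 2) \<and> 1 / real (Suc i) < \<eta> / 2"
      by (simp add: eventually_conj_iff)
    then obtain i where i: "y (r i) \<in> holder0 \<alpha>" "holder_dist \<alpha> (y (r i)) l < \<eta> / 2" "1 / real (Suc i) < \<eta> / 2"
      using eventually_sequentially by auto
    have "1 / real (Suc (r i)) \<le> 1 / real (Suc i)"
      using seq_suble[OF l(2), of i] by (intro divide_left_mono) auto
    then have 1: "dyadic_holder \<alpha> 0 (\<eta> / 2) (\<lambda>t. z (r i) t - y (r i) t)"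
      using dyadic_holder_mono[OF zy(3)[of "r i"] order_refl] i(3) by simp
    have 2: "dyadic_holder \<alpha> 0 (\<eta> / 2) (\<lambda>t. l t - y (r i) t)"
      using dyadic_holder_mono[OF holder_dist_dyadic[OF \<alpha> lh(1) i(1)] order_refl, of "\<eta> / 2"] i(2) commute[of "y (r i)" l]
      by simp
    have "dyadic_holder \<alpha> 0 \<eta> (\<lambda>t. z (r i) t - l t)"
      using dyadic_holder_diff[OF 1 2] by simp
    then show False using \<eta>(2)[of "z (r i)"] zy(1)[of "r i"] A' by blast
  qed
qed

lemma Limsup_log_le:
  assumes K: "K > 0" and p: "\<And>\<epsilon>. 0 < \<epsilon> \<Longrightarrow> \<epsilon> \<le> 1 \<Longrightarrow> 0 \<le> p \<epsilon> \<and> p \<epsilon> \<le> K * exp (- l / \<epsilon>)"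
  shows "Limsup (at_right 0) (\<lambda>\<epsilon>. ereal \<epsilon> * log_ereal (p \<epsilon>)) \<le> - ereal l"
proof -
  have le: "ereal \<epsilon> * log_ereal (p \<epsilon>) \<le> ereal (\<epsilon> * ln K - l)" if \<epsilon>: "0 < \<epsilon>" "\<epsilon> < 1" for \<epsilon>
  proof (cases "p \<epsilon> = 0")
    case False
    then have "ln (p \<epsilon>) \<le> ln (K * exp (- l / \<epsilon>))" using p[of \<epsilon>] \<epsilon> by (subst ln_le_cancel_iff) (auto simp: K)
    also have "\<dots> = ln K - l / \<epsilon>" using K by (simp add: ln_mult)
    finally have "\<epsilon> * ln (p \<epsilon>) \<le> \<epsilon> * (ln K - l / \<epsilon>)" using \<epsilon> by (intro mult_left_mono) auto
    then show ?thesis using False \<epsilon> by (simp add: log_ereal_def right_diff_distrib)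
  qed (use \<epsilon> in \<open>simp add: log_ereal_def\<close>)
  have "Limsup (at_right 0) (\<lambda>\<epsilon>. ereal \<epsilon> * log_ereal (p \<epsilon>)) \<le> Limsup (at_right 0) (\<lambda>\<epsilon>. ereal (\<epsilon> * ln K - l))"
    by (rule Limsup_mono, rule eventually_at_rightI[of 0 1]) (use le in auto)
  also have "\<dots> = ereal (0 * ln K - l)"
    by (intro lim_imp_Limsup tendsto_intros) simp_all
  finally show ?thesis by simp
qed

lemma Liminf_log_ge:
  assumes c: "c > 0" and p: "\<forall>\<^sub>F \<epsilon> in at_right 0. c * exp (- C / \<epsilon>) \<le> p \<epsilon>"
  shows "- ereal C \<le> Liminf (at_right 0) (\<lambda>\<epsilon>. ereal \<epsilon> * log_ereal (p \<epsilon>))"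
proof -
  have "\<forall>\<^sub>F \<epsilon> in at_right 0. ereal (\<epsilon> * ln c - C) \<le> ereal \<epsilon> * log_ereal (p \<epsilon>)"
    using p eventually_at_right_less[of "0 :: real"]
  proof eventually_elim
    fix \<epsilon> :: real assume p: "c * exp (- C / \<epsilon>) \<le> p \<epsilon>" and \<epsilon>: "0 < \<epsilon>"
    have pos: "0 < c * exp (- C / \<epsilon>)" using c by simp
    have "ln c - C / \<epsilon> = ln (c * exp (- C / \<epsilon>))" using c by (simp add: ln_mult)
    also have "\<dots> \<le> ln (p \<epsilon>)" using p pos by (subst ln_le_cancel_iff) auto
    finally have "\<epsilon> * (ln c - C / \<epsilon>) \<le> \<epsilon> * ln (p \<epsilon>)" using \<epsilon> by (intro mult_left_mono) auto
    then show "ereal (\<epsilon> * ln c - C) \<le> ereal \<epsilon> * log_ereal (p \<epsilon>)"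
      using p pos \<epsilon> by (simp add: log_ereal_def right_diff_distrib)
  qed
  then have "Liminf (at_right 0) (\<lambda>\<epsilon>. ereal (\<epsilon> * ln c - C)) \<le> Liminf (at_right 0) (\<lambda>\<epsilon>. ereal \<epsilon> * log_ereal (p \<epsilon>))"
    by (rule Liminf_mono)
  moreover have "Liminf (at_right 0) (\<lambda>\<epsilon>. ereal (\<epsilon> * ln c - C)) = ereal (0 * ln c - C)"
    by (intro lim_imp_Liminf tendsto_intros) simp_all
  ultimately show ?thesis by simp
qed

context trace_operator
begin

lemma energy_scaleR: "energy n J (\<lambda>t. c *\<^sub>R F t) = c\<^sup>2 * energy n J F"
  by (simp add: energy_def dinc_scaleR power_mult_distrib sum_distrib_left mult_ac)

lemma energy_cong: "(\<And>t. t \<in> {0..1} \<Longrightarrow> F t = G t) \<Longrightarrow> energy n J F = energy n J G"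
  unfolding energy_def by (intro arg_cong[where f="(*) _"] sum.cong refl) (simp only: dinc_cong[of F G] lessThan_iff)

lemma finite_energy_level:
  assumes \<alpha>: "0 < \<alpha>" "\<alpha> < 1 / 2"
    and F: "F \<in> extensional {0..1}" "F 0 = 0" "continuous_on {0..1} F"
    and null: "\<And>t e. t \<in> {0..1} \<Longrightarrow> e \<in> E - Ep \<Longrightarrow> F t \<bullet> e = 0"
    and en: "\<And>m J. finite J \<Longrightarrow> J \<subseteq> Ep \<Longrightarrow> energy m J F \<le> 2 * C"
  shows "F \<in> {F \<in> topspace (holder_topology \<alpha>). schilder_rate Q F \<le> ennreal C}"
proof -
  have "F \<in> holder0 \<alpha>"
  proof (rule holder0I[OF \<alpha>(1) F])
    fix \<eta> :: real assume \<eta>: "\<eta> > 0"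
    let ?K = "sqrt (\<tau> * (2 * C))" and ?r = "2 powr - (1 / 2 - \<alpha>) :: real"
    have "(\<lambda>n. ?K * ?r ^ n) \<longlonglongrightarrow> ?K * 0"
      using \<alpha> by (intro tendsto_mult tendsto_const LIMSEQ_power_zero) (simp add: powr_less_one)
    then have "\<forall>\<^sub>F n in sequentially. ?K * ?r ^ n < \<eta>" by (rule order_tendstoD) (use \<eta> in simp)
    then obtain n where n: "?K * ?r ^ n < \<eta>" using eventually_sequentially by auto
    have "dyadic_holder \<alpha> n (?K * ?r ^ n) F"
      using \<alpha> by (intro energy_dyadic_holder en null) auto
    then have "dyadic_holder \<alpha> n \<eta> F" by (rule dyadic_holder_mono) (use n in auto)
    then show "\<exists>n. dyadic_holder \<alpha> n \<eta> F" ..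
  qed
  moreover have "schilder_rate Q F \<le> ennreal C"
    by (rule schilder_rateI[OF F(3,2) null en])
  ultimately show ?thesis by (simp add: topspace_holder[OF \<alpha>(1)])
qed

text \<open>By \<open>energy_approx\<close> all energies of the approximation are at most
  \<open>energy n J F\<close>, so one number read off at a single level decides membership in the
  level set.\<close>

lemma approx_restrict_level:
  assumes \<alpha>: "0 < \<alpha>" "\<alpha> < 1 / 2" and J: "finite J" "J \<subseteq> Ep" and F: "F 0 = 0" and en: "energy n J F \<le> 2 * C"
  shows "(\<lambda>t\<in>{0..1}. approx n J F t) \<in> {F \<in> topspace (holder_topology \<alpha>). schilder_rate Q F \<le> ennreal C}"
proof (rule finite_energy_level[OF \<alpha>])
  have JE: "J \<subseteq> E" using J Ep_subset by blast
  show "(\<lambda>t\<in>{0..1}. approx n J F t) 0 = 0"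
    using interp_dyadic[of 0 n F] F by (simp add: approx_def oproj_def)
  have "continuous_on {0..1} (approx n J F)"
    unfolding approx_def[abs_def]
    by (rule bounded_linear.continuous_on[OF bounded_linear_oproj continuous_on_interp])
  then show "continuous_on {0..1} (\<lambda>t\<in>{0..1}. approx n J F t)"
    by (rule continuous_on_eq) simp
  show "(\<lambda>t\<in>{0..1}. approx n J F t) t \<bullet> e = 0" if "t \<in> {0..1}" "e \<in> E - Ep" for t e
    using that J oproj_inner[OF E_orthonormal J(1) JE, of e] by (auto simp: approx_def)
  show "energy m J' (\<lambda>t\<in>{0..1}. approx n J F t) \<le> 2 * C" if "finite J'" "J' \<subseteq> Ep" for m J'
  proof -
    have "energy m J' (\<lambda>t\<in>{0..1}. approx n J F t) = energy m J' (approx n J F)"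
      by (rule energy_cong) simp
    also have "\<dots> \<le> energy n J F" using that Ep_subset by (intro energy_approx J JE) auto
    finally show ?thesis using en by simp
  qed
qed auto

end

section \<open>Exponential upper bound for closed sets\<close>

context wiener
begin

lemma sum_xi_square:
  assumes J: "finite J" "J \<subseteq> Ep"
  shows "(\<Sum>i\<in>{..<2 ^ n} \<times> J. (xi n i \<omega>)\<^sup>2) = energy n J (Wpath \<omega>)"
proof -
  have "(\<Sum>i\<in>{..<2 ^ n} \<times> J. (xi n i \<omega>)\<^sup>2) = (\<Sum>k<2 ^ n. \<Sum>e\<in>J. (xi n (k, e) \<omega>)\<^sup>2)"
    by (simp add: sum.cartesian_product)
  also have "\<dots> = (\<Sum>k<2 ^ n. \<Sum>e\<in>J. 2 ^ n * ((dinc (Wpath \<omega>) n k \<bullet> e)\<^sup>2 / lam e))"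
    by (intro sum.cong refl) (simp add: xi_def power_divide power_mult_distrib lam_nonneg)
  finally show ?thesis by (simp add: energy_def sum_distrib_left)
qed

lemma xi_PiM_measurable: "(\<lambda>\<omega>. \<lambda>i\<in>I. xi n i \<omega>) \<in> measurable M (gauss_PiM I)"
  by (rule measurable_restrict) (simp add: measurable_cong_sets[OF refl sets_density])

text \<open>The energy is a chi-square variable, its exponential moment of order
  \<open>a / 2\<close> is finite for \<open>a < 1\<close>, and Markov's inequality gives the tail.
  \<open>K\<close> depends on the dimension and on \<open>a\<close>, but not on the
  threshold.\<close>

lemma prob_energy_le:
  assumes J: "finite J" "J \<subseteq> Ep" and a: "0 \<le> a" "a < 1"
  obtains K where "K > 0" "\<And>u. prob {\<omega> \<in> space M. 2 * u < energy n J (Wpath \<omega>)} \<le> K * exp (- (a * u))"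
proof (rule that)
  let ?I = "{..<(2::nat) ^ n} \<times> J"
  define K where "K = (1 / sqrt (1 - a)) ^ card ?I"
  show "K > 0" using a by (simp add: K_def)
  fix u :: real
  have [measurable]: "(\<lambda>\<omega>. energy n J (Wpath \<omega>)) \<in> borel_measurable M"
    unfolding sum_xi_square[OF J, symmetric] by measurable
  have X: "(\<lambda>\<omega>. \<lambda>i\<in>?I. xi n i \<omega>) \<in> measurable M (gauss_PiM ?I)" by (rule xi_PiM_measurable)
  have "(\<integral>\<^sup>+\<omega>. ennreal (exp (a / 2 * energy n J (Wpath \<omega>))) \<partial>M) =
      (\<integral>\<^sup>+\<omega>. ennreal (exp (a / 2 * (\<Sum>i\<in>?I. ((\<lambda>i\<in>?I. xi n i \<omega>) i)\<^sup>2))) \<partial>M)"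
    unfolding sum_xi_square[OF J, symmetric] by simp
  also have "\<dots> = (\<integral>\<^sup>+y. ennreal (exp (a / 2 * (\<Sum>i\<in>?I. (y i)\<^sup>2))) \<partial>distr M (gauss_PiM ?I) (\<lambda>\<omega>. \<lambda>i\<in>?I. xi n i \<omega>))"
    by (rule nn_integral_distr[OF X, symmetric]) measurable
  also have "\<dots> = ennreal K"
    unfolding xi_iid[OF J] K_def using J a by (intro gauss_PiM_exp_square) auto
  finally have int: "(\<integral>\<^sup>+\<omega>. ennreal (exp (a / 2 * energy n J (Wpath \<omega>))) \<partial>M) = ennreal K" .
  have "emeasure M {\<omega> \<in> space M. 2 * u < energy n J (Wpath \<omega>)} =
      (\<integral>\<^sup>+\<omega>. indicator {\<omega> \<in> space M. 2 * u < energy n J (Wpath \<omega>)} \<omega> \<partial>M)"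
    by simp
  also have "\<dots> \<le> (\<integral>\<^sup>+\<omega>. ennreal (exp (- (a * u))) * ennreal (exp (a / 2 * energy n J (Wpath \<omega>))) \<partial>M)"
  proof (rule nn_integral_mono)
    fix \<omega>
    show "indicator {\<omega> \<in> space M. 2 * u < energy n J (Wpath \<omega>)} \<omega> \<le>
        ennreal (exp (- (a * u))) * ennreal (exp (a / 2 * energy n J (Wpath \<omega>)))"
    proof (cases "2 * u < energy n J (Wpath \<omega>)")
      case True
      have "a / 2 * (2 * u) \<le> a / 2 * energy n J (Wpath \<omega>)" using a True by (intro mult_left_mono) auto
      then have "1 \<le> exp (- (a * u) + a / 2 * energy n J (Wpath \<omega>))" by simp
      then have "ennreal 1 \<le> ennreal (exp (- (a * u)) * exp (a / 2 * energy n J (Wpath \<omega>)))"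
        unfolding exp_add by (rule ennreal_leI)
      then show ?thesis by (simp add: ennreal_mult' indicator_def)
    qed simp
  qed
  also have "\<dots> = ennreal (exp (- (a * u))) * ennreal K"
    unfolding int[symmetric] by (rule nn_integral_cmult) measurable
  also have "\<dots> = ennreal (K * exp (- (a * u)))" using \<open>K > 0\<close> by (simp add: ennreal_mult mult.commute)
  finally show "prob {\<omega> \<in> space M. 2 * u < energy n J (Wpath \<omega>)} \<le> K * exp (- (a * u))"
    using \<open>K > 0\<close> by (simp add: emeasure_eq_measure ennreal_le_iff)
qed

lemma prob_far_from_projection:
  assumes J: "finite J" "J \<subseteq> E" and T: "T > 0" and lamT: "\<And>G. finite G \<Longrightarrow> G \<subseteq> E - J \<Longrightarrow> sum lam G \<le> T"
    and r: "r \<ge> 0" and t: "t \<in> {0..1}"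
  shows "prob {\<omega> \<in> space M. r < norm (W t \<omega> - oproj J (W t \<omega>))} \<le> sqrt 2 * exp (- r\<^sup>2 / (4 * T))"
proof (cases "t = 0")
  case True
  then have "{\<omega> \<in> space M. r < norm (W t \<omega> - oproj J (W t \<omega>))} = {}"
    using r by (auto simp: W_0 oproj_def)
  then show ?thesis by (simp only: measure_empty) simp
next
  case False
  then have t: "0 < t" "t \<le> 1" using t by auto
  have "{\<omega> \<in> space M. r < norm (W t \<omega> - oproj J (W t \<omega>))} =
      {\<omega> \<in> space M. r < norm ((W t \<omega> - W 0 \<omega>) - oproj J (W t \<omega> - W 0 \<omega>))}"
    by (auto simp: W_0)
  then have "emeasure M {\<omega> \<in> space M. r < norm (W t \<omega> - oproj J (W t \<omega>))} \<le> ennreal (sqrt 2 * exp (- r\<^sup>2 / (4 * (t - 0) * T)))"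
    using increment_tail[OF order_refl t T J lamT r] by simp
  also have "\<dots> \<le> ennreal (sqrt 2 * exp (- r\<^sup>2 / (4 * T)))"
  proof (intro ennreal_leI mult_left_mono)
    have "r\<^sup>2 / (4 * T) \<le> r\<^sup>2 / (4 * (t - 0) * T)"
      using t T by (intro divide_left_mono) auto
    then show "exp (- r\<^sup>2 / (4 * (t - 0) * T)) \<le> exp (- r\<^sup>2 / (4 * T))" by simp
  qed simp
  finally show ?thesis by (simp add: emeasure_eq_measure ennreal_le_iff)
qed

text \<open>A path in \<open>A\<close> keeps a gap \<open>\<delta>\<close> from the level set
  \<open>L\<close> for \<open>l'\<close>. Outside three kinds of bad events (irregularity below
  level \<open>n\<close>, projection error at a grid point, large energy) its interpolation lies in
  \<open>L\<close> and is \<open>2 * \<eta>\<close>-close, a contradiction as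
  \<open>\<delta> = 2 * \<eta>\<close>.\<close>

lemma prob_closed_le:
  assumes A: "closedin (holder_topology \<alpha>) A" and l: "0 < l" "l < l'"
    and rate: "\<And>F. F \<in> A \<Longrightarrow> \<not> schilder_rate Q F \<le> ennreal l'"
  obtains K where "K > 0" "\<And>\<epsilon>. 0 < \<epsilon> \<Longrightarrow> \<epsilon> \<le> 1 \<Longrightarrow>
    prob {\<omega> \<in> space M. spath (sqrt \<epsilon>) \<omega> \<in> A} \<le> K * exp (- l / \<epsilon>)"
proof -
  define L where "L = {F \<in> topspace (holder_topology \<alpha>). schilder_rate Q F \<le> ennreal l'}"
  have "compactin (holder_topology \<alpha>) L"
    unfolding L_def using l by (intro schilder_rate_compact \<alpha>_pos \<alpha>_half) auto
  moreover have "L \<inter> A = {}" using rate by (auto simp: L_def)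
  ultimately obtain \<delta> where \<delta>: "\<delta> > 0" "\<And>z y. z \<in> A \<Longrightarrow> y \<in> L \<Longrightarrow> \<not> dyadic_holder \<alpha> 0 \<delta> (\<lambda>t. z t - y t)"
    using compact_closed_dyadic_gap[OF \<alpha>_pos _ A] by blast
  define \<eta> where "\<eta> = \<delta> / 2"
  have \<eta>: "\<eta> > 0" using \<delta>(1) by (simp add: \<eta>_def)
  have b: "\<eta>\<^sup>2 / (4 * \<tau>) > 0" using \<eta> \<tau>_pos by simp
  \<comment> \<open>From this level on, irregular paths have probability of order
    \<open>exp (- l' / \<epsilon>)\<close>.\<close>
  obtain n where "l' / (\<eta>\<^sup>2 / (4 * \<tau>)) < \<rho> ^ n" using real_arch_pow[OF \<rho>_gt_1] by blast
  then have n: "l' \<le> \<eta>\<^sup>2 / (4 * \<tau>) * \<rho> ^ n" using pos_divide_less_eq[OF b, of l' "\<rho> ^ n"] by (simp only: mult.commute[of "\<rho> ^ n"] less_imp_le)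
  have l'0: "0 \<le> l'" "0 < l'" using l by auto
  obtain K1 where K1: "K1 > 0" "\<And>\<epsilon>. 0 < \<epsilon> \<Longrightarrow> \<epsilon> \<le> 1 \<Longrightarrow>
      prob {\<omega> \<in> space M. \<not> dyadic_holder \<alpha> n (\<eta> / sqrt \<epsilon>) (Wpath \<omega>)} \<le> K1 * exp (- l' / \<epsilon>)"
    by (rule prob_not_dyadic_holder_scaled[OF \<eta> l'0(1) n]) blast
  \<comment> \<open>Chosen so that the tail exponent \<open>r\<^sup>2 / (4 * T)\<close> at the grid
    tolerance \<open>r\<close> equals \<open>l' / \<epsilon>\<close>.\<close>
  define T where "T = (\<eta> * (1 / 2) ^ n)\<^sup>2 / (4 * l')"
  have T: "T > 0" using \<eta> l'0 by (simp add: T_def)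
  obtain J0 where J0: "finite J0" "J0 \<subseteq> E" "\<And>G. finite G \<Longrightarrow> G \<subseteq> E - J0 \<Longrightarrow> sum lam G < T"
    using tail_lam[OF T] by blast
  \<comment> \<open>Energies divide by \<open>lam e\<close>, so eigenvectors in the kernel are
    removed; this changes no tail sum of eigenvalues.\<close>
  define J where "J = J0 \<inter> Ep"
  have J: "finite J" "J \<subseteq> Ep" "J \<subseteq> E" using J0 by (auto simp: J_def)
  have lamT: "sum lam G \<le> T" if G: "finite G" "G \<subseteq> E - J" for G
  proof -
    have "sum lam G = sum lam (G \<inter> Ep)"
    proof (rule sum.mono_neutral_right)
      show "\<forall>e\<in>G - G \<inter> Ep. lam e = 0"
      proof
        fix e assume "e \<in> G - G \<inter> Ep"
        then show "lam e = 0" using G lam_nonneg[of e] by (auto simp: Ep_def)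
      qed
    qed (use G in auto)
    also have "\<dots> \<le> T" using G J0(3)[of "G \<inter> Ep"] by (force simp: J_def)
    finally show ?thesis .
  qed
  \<comment> \<open>With this moment parameter the energy threshold \<open>l' / \<epsilon>\<close>
    yields the exponent \<open>l / \<epsilon>\<close>; this is why a strict gap between
    \<open>l\<close> and \<open>l'\<close> is assumed.\<close>
  have a: "0 \<le> l / l'" "l / l' < 1" using l by auto
  obtain K3 where K3: "K3 > 0" "\<And>u. prob {\<omega> \<in> space M. 2 * u < energy n J (Wpath \<omega>)} \<le> K3 * exp (- (l / l' * u))"
    by (rule prob_energy_le[OF J(1,2) a]) blast
  \<comment> \<open>There are \<open>2 ^ n + 1\<close> grid points, both end points
    included.\<close>
  define N where "N = real (Suc (2 ^ n)) * sqrt 2"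
  show thesis
  proof (rule that)
    show "K1 + N + K3 > 0" using K1 K3 by (simp add: N_def add_pos_pos)
    fix \<epsilon> :: real assume \<epsilon>: "0 < \<epsilon>" "\<epsilon> \<le> 1"
    define r where "r = \<eta> * (1 / 2) ^ n / sqrt \<epsilon>"
    define B1 where "B1 = {\<omega> \<in> space M. \<not> dyadic_holder \<alpha> n (\<eta> / sqrt \<epsilon>) (Wpath \<omega>)}"
    define B2 where "B2 k = {\<omega> \<in> space M. r < norm (W (real k / 2 ^ n) \<omega> - oproj J (W (real k / 2 ^ n) \<omega>))}" for k
    define B3 where "B3 = {\<omega> \<in> space M. 2 * (l' / \<epsilon>) < energy n J (Wpath \<omega>)}"
    have exp_le: "exp (- l' / \<epsilon>) \<le> exp (- l / \<epsilon>)" using l \<epsilon> by (simp add: divide_right_mono)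
    have r: "r \<ge> 0" "r\<^sup>2 / (4 * T) = l' / \<epsilon>" using \<eta> \<epsilon> l by (simp_all add: r_def T_def power_divide power_mult_distrib)
    have P1: "prob B1 \<le> K1 * exp (- l / \<epsilon>)"
      unfolding B1_def by (rule order_trans[OF K1(2)[OF \<epsilon>] mult_left_mono[OF exp_le less_imp_le[OF K1(1)]]])
    have P2k: "prob (B2 k) \<le> sqrt 2 * exp (- l / \<epsilon>)" if k: "k \<le> 2 ^ n" for k
    proof -
      have "prob (B2 k) \<le> sqrt 2 * exp (- r\<^sup>2 / (4 * T))"
        unfolding B2_def by (rule prob_far_from_projection[OF J(1,3) T lamT r(1) dyadic_mem[OF k]])
      also have "- r\<^sup>2 / (4 * T) = - l' / \<epsilon>" using r(2) by simp
      also have "sqrt 2 * exp (- l' / \<epsilon>) \<le> sqrt 2 * exp (- l / \<epsilon>)" by (intro mult_left_mono exp_le) simp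
      finally show ?thesis .
    qed
    have P3: "prob B3 \<le> K3 * exp (- l / \<epsilon>)"
      using K3(2)[of "l' / \<epsilon>"] l unfolding B3_def by simp
    have B1: "B1 \<in> sets M"
      using sets.Diff[OF sets.top dyadic_holder_measurable[of n "\<eta> / sqrt \<epsilon>" 1 "\<lambda>_. 0"]]
      by (rule back_subst[of "\<lambda>A. A \<in> sets M"]) (auto simp: B1_def)
    have B2: "B2 k \<in> sets M" if k: "k \<le> 2 ^ n" for k
    proof -
      note [measurable] = W_measurable[OF dyadic_mem[OF k]]
      show ?thesis unfolding B2_def oproj_def by measurable
    qed
    have B3: "B3 \<in> sets M"
      unfolding B3_def sum_xi_square[OF J(1,2), symmetric] by measurable
    have sub: "{\<omega> \<in> space M. spath (sqrt \<epsilon>) \<omega> \<in> A} \<subseteq> B1 \<union> (\<Union>k\<in>{..2 ^ n}. B2 k) \<union> B3"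
    proof
      fix \<omega> assume "\<omega> \<in> {\<omega> \<in> space M. spath (sqrt \<epsilon>) \<omega> \<in> A}"
      then have \<omega>: "\<omega> \<in> space M" "spath (sqrt \<epsilon>) \<omega> \<in> A" by auto
      show "\<omega> \<in> B1 \<union> (\<Union>k\<in>{..2 ^ n}. B2 k) \<union> B3"
      proof (rule ccontr)
        assume neg: "\<omega> \<notin> B1 \<union> (\<Union>k\<in>{..2 ^ n}. B2 k) \<union> B3"
        let ?F = "\<lambda>t. sqrt \<epsilon> *\<^sub>R W t \<omega>"
        have s: "sqrt \<epsilon> > 0" using \<epsilon> by simp
        have dy: "dyadic_holder \<alpha> n \<eta> ?F"
          using neg \<omega> dyadic_holder_scaled[OF s, of n \<eta> "Wpath \<omega>"] by (auto simp: B1_def)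
        have en: "energy n J (Wpath \<omega>) \<le> 2 * (l' / \<epsilon>)" using neg \<omega> by (auto simp: B3_def)
        have enF: "energy n J ?F \<le> 2 * l'"
          unfolding energy_scaleR using en \<epsilon> by (simp add: field_simps)
        have close: "norm (?F (real k / 2 ^ n) - oproj J (?F (real k / 2 ^ n))) \<le> \<eta> * (1 / 2) ^ n" if k: "k \<le> 2 ^ n" for k
        proof -
          let ?w = "W (real k / 2 ^ n) \<omega>"
          have "\<omega> \<notin> B2 k" using neg k by auto
          then have "norm (?w - oproj J ?w) \<le> r" using \<omega> by (simp add: B2_def not_less)
          then have "sqrt \<epsilon> * norm (?w - oproj J ?w) \<le> sqrt \<epsilon> * r" using s by (intro mult_left_mono) auto
          then show ?thesis using s by (simp add: oproj_scaleR r_def flip: scaleR_diff_right)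
        qed
        let ?Y = "\<lambda>t\<in>{0..1}. approx n J ?F t"
        have YL: "?Y \<in> L"
          unfolding L_def by (rule approx_restrict_level[OF \<alpha>_pos \<alpha>_half J(1,2) _ enF]) (simp add: W_0 \<omega>)
        have "dyadic_holder \<alpha> 0 (2 * \<eta>) (\<lambda>t. ?F t - approx n J ?F t)"
          by (rule dyadic_holder_approx[OF J(1,3) \<alpha>_le_1 dy close])
        moreover have "dyadic_holder \<alpha> 0 (2 * \<eta>) (\<lambda>t. spath (sqrt \<epsilon>) \<omega> t - ?Y t) \<longleftrightarrow>
            dyadic_holder \<alpha> 0 (2 * \<eta>) (\<lambda>t. ?F t - approx n J ?F t)"
          by (rule dyadic_holder_cong) (simp add: spath_def)
        ultimately have "dyadic_holder \<alpha> 0 \<delta> (\<lambda>t. spath (sqrt \<epsilon>) \<omega> t - ?Y t)" by (simp add: \<eta>_def)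
        then show False using \<delta>(2)[OF \<omega>(2) YL] by blast
      qed
    qed
    have "prob {\<omega> \<in> space M. spath (sqrt \<epsilon>) \<omega> \<in> A} \<le> prob (B1 \<union> (\<Union>k\<in>{..2 ^ n}. B2 k) \<union> B3)"
      by (rule finite_measure_mono[OF sub]) (use B1 B2 B3 in auto)
    also have "\<dots> \<le> prob (B1 \<union> (\<Union>k\<in>{..2 ^ n}. B2 k)) + prob B3"
      using B1 B2 B3 by (intro measure_Un_le) auto
    also have "\<dots> \<le> (prob B1 + prob (\<Union>k\<in>{..2 ^ n}. B2 k)) + prob B3"
      using B1 B2 by (intro add_right_mono measure_Un_le) auto
    also have "prob (\<Union>k\<in>{..2 ^ n}. B2 k) \<le> (\<Sum>k\<in>{..2 ^ n}. prob (B2 k))"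
      using B2 by (intro finite_measure_subadditive_finite) auto
    also have "\<dots> \<le> (\<Sum>k\<in>{..(2::nat) ^ n}. sqrt 2 * exp (- l / \<epsilon>))"
      by (intro sum_mono P2k) simp
    also have "\<dots> = N * exp (- l / \<epsilon>)" by (simp add: N_def)
    finally show "prob {\<omega> \<in> space M. spath (sqrt \<epsilon>) \<omega> \<in> A} \<le> (K1 + N + K3) * exp (- l / \<epsilon>)"
      using P1 P3 by (simp add: algebra_simps)
  qed
qed

end

section \<open>Lower bound for open sets\<close>

context trace_operator
begin

lemma Jn_cover_finite:
  assumes G: "finite G" "G \<subseteq> Ep"
  obtains N0 where "\<And>N. N \<ge> N0 \<Longrightarrow> G \<subseteq> Jn N"
proof (rule that)
  fix N assume N: "N \<ge> Suc (\<Sum>e\<in>G. to_nat_on Ep e)"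
  show "G \<subseteq> Jn N"
  proof
    fix e assume e: "e \<in> G"
    have "to_nat_on Ep e \<le> (\<Sum>e\<in>G. to_nat_on Ep e)" by (rule member_le_sum) (use e G in auto)
    then have "Suc (to_nat_on Ep e) \<le> N" using N by simp
    from Jn_mono[OF this] show "e \<in> Jn N" using Jn_cover[of e] e G by blast
  qed
qed

lemma norm_oproj_Jn_mono: "n \<le> m \<Longrightarrow> norm (oproj (Jn n) x) \<le> norm (oproj (Jn m) x)"
proof (rule power2_le_imp_le)
  assume "n \<le> m"
  then show "(norm (oproj (Jn n) x))\<^sup>2 \<le> (norm (oproj (Jn m) x))\<^sup>2"
    unfolding norm_oproj[OF E_orthonormal finite_Jn Jn_E]
    by (intro sum_mono2 finite_Jn Jn_mono) auto
qed simp

text \<open>Parseval along the exhaustion \<open>Jn\<close>. Only \<open>N \<ge> m\<close> is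
  assumed because a tube of level \<open>N\<close> says nothing about increments finer than
  \<open>N\<close>.\<close>

lemma norm_le_oproj_Jn:
  assumes c: "\<And>N. N \<ge> m \<Longrightarrow> norm (oproj (Jn N) x) \<le> c" and null: "\<And>e. e \<in> E - Ep \<Longrightarrow> x \<bullet> e = 0"
  shows "norm x \<le> c"
proof -
  have c0: "0 \<le> c" using c[of m] norm_ge_zero[of "oproj (Jn m) x"] by linarith
  have "(norm x)\<^sup>2 \<le> c\<^sup>2"
  proof (rule has_sum_le_finite_sums[OF hilbert_basis_parseval[OF E_basis]])
    fix G assume G: "finite G" "G \<subseteq> E"
    obtain N0 where N0: "\<And>N. N \<ge> N0 \<Longrightarrow> G \<inter> Ep \<subseteq> Jn N"
      by (rule Jn_cover_finite[of "G \<inter> Ep"]) (use G in auto)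
    define N where "N = max m N0"
    have "(\<Sum>e\<in>G. (x \<bullet> e)\<^sup>2) = (\<Sum>e\<in>G \<inter> Ep. (x \<bullet> e)\<^sup>2)"
      by (rule sum.mono_neutral_right) (use G null in auto)
    also have "\<dots> \<le> (\<Sum>e\<in>Jn N. (x \<bullet> e)\<^sup>2)"
      by (rule sum_mono2[OF finite_Jn N0]) (auto simp: N_def)
    also have "\<dots> = (norm (oproj (Jn N) x))\<^sup>2" by (rule norm_oproj[OF E_orthonormal finite_Jn Jn_E, symmetric])
    also have "\<dots> \<le> c\<^sup>2" by (intro power_mono c) (auto simp: N_def)
    finally show "(\<Sum>e\<in>G. (x \<bullet> e)\<^sup>2) \<le> c\<^sup>2" .
  qed
  then show ?thesis using c0 by (rule power2_le_imp_le)
qed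

text \<open>The increment at level \<open>m \<le> N\<close> of a path whose normalised increments at level \<open>N\<close>
  have coordinates \<open>y\<close>.\<close>

definition coarse :: "nat \<Rightarrow> nat \<Rightarrow> nat \<Rightarrow> (nat \<times> 'h \<Rightarrow> real) \<Rightarrow> 'h" where
  "coarse N m k y = (\<Sum>j\<in>{k * 2 ^ (N - m)..<k * 2 ^ (N - m) + 2 ^ (N - m)}.
     \<Sum>e\<in>Jn N. (sqrt (lam e) / sqrt (2 ^ N) * y (j, e)) *\<^sub>R e)"

lemma coarse_index:
  fixes m k j N :: nat
  assumes "m \<le> N" "k < 2 ^ m" "j < k * 2 ^ (N - m) + 2 ^ (N - m)"
  shows "j < 2 ^ N"
proof -
  have "Suc k * 2 ^ (N - m) \<le> 2 ^ m * 2 ^ (N - m)" using assms(2) by (intro mult_right_mono) auto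
  also have "\<dots> = (2::nat) ^ N" using assms(1) by (simp flip: power_add)
  finally show ?thesis using assms(3) by simp
qed

lemma coarse_cong:
  assumes "m \<le> N" "k < 2 ^ m" "\<And>i. i \<in> {..<2 ^ N} \<times> Jn N \<Longrightarrow> y i = z i"
  shows "coarse N m k y = coarse N m k z"
  unfolding coarse_def using assms(3) coarse_index[OF assms(1,2)] by (intro sum.cong refl) auto

lemma coarse_diff: "coarse N m k (\<lambda>i. y i - z i) = coarse N m k y - coarse N m k z"
  by (simp add: coarse_def sum_subtractf right_diff_distrib scaleR_diff_left)

lemma coarse_minus: "coarse N m k (\<lambda>i. - y i) = - coarse N m k y"
  by (simp add: coarse_def sum_negf)

text \<open>The factor \<open>c\<close> lets one computation cover the coordinates of the process
  and those of the shift.\<close>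

lemma coarse_coordinates:
  assumes m: "m \<le> N" and y: "\<And>j e. j < 2 ^ N \<Longrightarrow> e \<in> Jn N \<Longrightarrow> y (j, e) = c * (sqrt (2 ^ N) * (dinc F N j \<bullet> e) / sqrt (lam e))"
    and k: "k < 2 ^ m"
  shows "coarse N m k y = c *\<^sub>R oproj (Jn N) (dinc F m k)"
proof -
  let ?B = "{k * 2 ^ (N - m)..<k * 2 ^ (N - m) + 2 ^ (N - m)}"
  have "coarse N m k y = (\<Sum>j\<in>?B. \<Sum>e\<in>Jn N. c *\<^sub>R ((dinc F N j \<bullet> e) *\<^sub>R e))"
    unfolding coarse_def
  proof (intro sum.cong refl)
    fix j e assume j: "j \<in> ?B" and e: "e \<in> Jn N"
    have "lam e > 0" using e Jn_subset by (auto simp: Ep_def)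
    then show "(sqrt (lam e) / sqrt (2 ^ N) * y (j, e)) *\<^sub>R e = c *\<^sub>R ((dinc F N j \<bullet> e) *\<^sub>R e)"
      using y[OF coarse_index[OF m k] e, of j] j by simp
  qed
  also have "\<dots> = c *\<^sub>R oproj (Jn N) (\<Sum>j\<in>?B. dinc F N j)"
    unfolding linear_sum[OF bounded_linear.linear[OF bounded_linear_oproj]]
    by (simp add: oproj_def scaleR_sum_right)
  also have "(\<Sum>j\<in>?B. dinc F N j) = dinc F m k"
    using dinc_block[of F m "N - m" k] m by simp
  finally show ?thesis .
qed

end

context wiener
begin

text \<open>The dyadic Hoelder ball of radius \<open>\<delta>\<close> around \<open>F\<close>, cut
  down to levels up to \<open>N\<close> and coordinates in \<open>Jn N\<close>. It is an event about
  finitely many standard normal variables and decreases in \<open>N\<close>.\<close>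

definition tube :: "nat \<Rightarrow> real \<Rightarrow> real \<Rightarrow> (real \<Rightarrow> 'h) \<Rightarrow> 'w set" where
  "tube N c \<delta> F = {\<omega> \<in> space M. \<forall>m\<in>{..N}. \<forall>k\<in>{..<2 ^ m}.
     norm (oproj (Jn N) (c *\<^sub>R dinc (Wpath \<omega>) m k - dinc F m k)) \<le> \<delta> * (2 powr - \<alpha>) ^ m}"

lemma tube_measurable: "tube N c \<delta> F \<in> sets M"
  unfolding tube_def
proof (intro sets.sets_Collect_finite_All)
  fix m k assume "k \<in> {..<(2::nat) ^ m}"
  then have [measurable]: "(\<lambda>\<omega>. dinc (Wpath \<omega>) m k) \<in> borel_measurable M" by (intro dinc_W_measurable) auto
  show "{\<omega> \<in> space M. norm (oproj (Jn N) (c *\<^sub>R dinc (Wpath \<omega>) m k - dinc F m k)) \<le> \<delta> * (2 powr - \<alpha>) ^ m} \<in> sets M"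
    unfolding oproj_def by measurable
qed auto

lemma tube_antimono: "N \<le> N' \<Longrightarrow> tube N' c \<delta> F \<subseteq> tube N c \<delta> F"
proof
  fix \<omega> assume N: "N \<le> N'" and \<omega>: "\<omega> \<in> tube N' c \<delta> F"
  have "norm (oproj (Jn N) (c *\<^sub>R dinc (Wpath \<omega>) m k - dinc F m k)) \<le> \<delta> * (2 powr - \<alpha>) ^ m"
    if "m \<le> N" "k < 2 ^ m" for m k
    by (rule order_trans[OF norm_oproj_Jn_mono[OF N]]) (use that N \<omega> in \<open>auto simp: tube_def\<close>)
  then show "\<omega> \<in> tube N c \<delta> F" using \<omega> by (simp add: tube_def)
qed

text \<open>In the variables \<open>xi\<close> the tube around the zero path is a symmetric event
  \<open>B\<close>, the tube around \<open>F\<close> is its translate by \<open>h\<close>, and the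
  square sum of \<open>h\<close> is the energy of \<open>F\<close> divided by
  \<open>c\<^sup>2\<close>. So \<open>gauss_PiM_symmetric_shift\<close> applies.\<close>

lemma tube_prob_ge:
  assumes c: "c > 0" and en: "energy N (Jn N) F \<le> 2 * C"
  shows "exp (- C / c\<^sup>2) * prob (tube N c \<delta> (\<lambda>_. 0)) \<le> prob (tube N c \<delta> F)"
proof -
  let ?I = "{..<(2::nat) ^ N} \<times> Jn N"
  let ?G = "gauss_PiM ?I"
  define B where "B = {y \<in> space ?G. \<forall>m\<in>{..N}. \<forall>k\<in>{..<2 ^ m}. norm (c *\<^sub>R coarse N m k y) \<le> \<delta> * (2 powr - \<alpha>) ^ m}"
  define X where "X \<omega> = (\<lambda>i\<in>?I. xi N i \<omega>)" for \<omega>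
  define h where "h i = inverse c * (sqrt (2 ^ N) * (dinc F N (fst i) \<bullet> snd i) / sqrt (lam (snd i)))" for i
  have I: "finite ?I" by (simp add: finite_Jn)
  have Xm: "X \<in> measurable M ?G" unfolding X_def by (rule xi_PiM_measurable)
  have D: "distr M ?G X = ?G" unfolding X_def by (rule xi_iid[OF finite_Jn Jn_subset])
  have B: "B \<in> sets ?G"
    unfolding B_def
  proof (intro sets.sets_Collect_finite_All)
    fix m k assume mk: "m \<in> {..N}" "k \<in> {..<(2::nat) ^ m}"
    have "(\<lambda>y. coarse N m k y) \<in> borel_measurable ?G"
      unfolding coarse_def
    proof (intro borel_measurable_sum borel_measurable_scaleR borel_measurable_times borel_measurable_const)
      fix j e assume "j \<in> {k * 2 ^ (N - m)..<k * 2 ^ (N - m) + 2 ^ (N - m)}" "e \<in> Jn N"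
      then have "(j, e) \<in> ?I" using coarse_index[of m N k j] mk by auto
      then show "(\<lambda>y. y (j, e)) \<in> borel_measurable ?G"
        using measurable_component_singleton[of "(j, e)" ?I "\<lambda>_. std_normal_distribution"] by simp
    qed
    then have [measurable]: "(\<lambda>y. coarse N m k y) \<in> borel_measurable ?G" .
    show "{y \<in> space ?G. norm (c *\<^sub>R coarse N m k y) \<le> \<delta> * (2 powr - \<alpha>) ^ m} \<in> sets ?G"
      by measurable
  qed auto
  have sp: "(\<lambda>i\<in>?I. f i) \<in> space ?G" for f :: "nat \<times> 'h \<Rightarrow> real" by (simp add: space_PiM)
  have restr: "coarse N m k (\<lambda>i\<in>?I. f i) = coarse N m k f" if "m \<le> N" "k < 2 ^ m" for m k f
    by (rule coarse_cong[OF that]) auto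
  \<comment> \<open>The parameter \<open>s\<close> treats the tube around \<open>F\<close>
    (\<open>s = 1\<close>) and the centred one (\<open>s = 0\<close>) together.\<close>
  have hx: "c *\<^sub>R coarse N m k (\<lambda>i. X \<omega> i - s * h i) = oproj (Jn N) (c *\<^sub>R dinc (Wpath \<omega>) m k - s *\<^sub>R dinc F m k)"
    if mk: "m \<le> N" "k < 2 ^ m" for m k \<omega> s
  proof -
    have 1: "coarse N m k (X \<omega>) = 1 *\<^sub>R oproj (Jn N) (dinc (Wpath \<omega>) m k)"
      by (rule coarse_coordinates[OF mk(1) _ mk(2)]) (simp add: X_def xi_def)
    have 2: "coarse N m k (\<lambda>i. s * h i) = (s * inverse c) *\<^sub>R oproj (Jn N) (dinc F m k)"
      by (rule coarse_coordinates[OF mk(1) _ mk(2)]) (simp add: h_def)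
    show ?thesis
      unfolding coarse_diff 1 2 using c by (simp add: oproj_diff oproj_scaleR scaleR_diff_right)
  qed
  have Xsp: "X \<omega> \<in> space ?G" for \<omega> unfolding X_def by (rule sp)
  have tube_eq: "tube N c \<delta> (\<lambda>t. s *\<^sub>R F t) = X -` {y \<in> space ?G. (\<lambda>i\<in>?I. y i - s * h i) \<in> B} \<inter> space M" for s
    using Xsp by (auto simp: tube_def B_def sp restr hx dinc_scaleR simp del: norm_scaleR)
  have sym: "(\<lambda>i\<in>?I. - y i) \<in> B" if "y \<in> B" for y
    using that by (auto simp: B_def sp restr coarse_minus)
  have shm: "{y \<in> space ?G. (\<lambda>i\<in>?I. y i - s * h i) \<in> B} \<in> sets ?G" for s
  proof -
    have "(\<lambda>y. \<lambda>i\<in>?I. y i - s * h i) \<in> measurable ?G ?G"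
    proof (rule measurable_restrict)
      fix i assume "i \<in> ?I"
      then have "(\<lambda>y. y i) \<in> borel_measurable ?G"
        using measurable_component_singleton[of i ?I "\<lambda>_. std_normal_distribution"] by simp
      then show "(\<lambda>y. y i - s * h i) \<in> measurable ?G std_normal_distribution" by simp
    qed
    from measurable_sets[OF this B] show ?thesis
      by (rule back_subst[of "\<lambda>A. A \<in> sets ?G"]) auto
  qed
  have tube_em: "emeasure M (tube N c \<delta> (\<lambda>t. s *\<^sub>R F t)) = emeasure ?G {y \<in> space ?G. (\<lambda>i\<in>?I. y i - s * h i) \<in> B}" for s
    unfolding tube_eq using emeasure_distr[OF Xm shm[of s]] unfolding D by simp
  have B_eq: "{y \<in> space ?G. (\<lambda>i\<in>?I. y i - 0 * h i) \<in> B} = B"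
  proof -
    have "(\<lambda>i\<in>?I. y i - 0 * h i) = y" if "y \<in> space ?G" for y
      using that by (auto simp: space_PiM PiE_def extensional_restrict)
    moreover have "B \<subseteq> space ?G" by (auto simp: B_def)
    ultimately show ?thesis by auto
  qed
  have hsum: "(\<Sum>i\<in>?I. (h i)\<^sup>2) = energy N (Jn N) F / c\<^sup>2"
  proof -
    have "(\<Sum>i\<in>?I. (h i)\<^sup>2) = (\<Sum>k<2 ^ N. \<Sum>e\<in>Jn N. (h (k, e))\<^sup>2)"
      by (simp add: sum.cartesian_product)
    also have "\<dots> = (\<Sum>k<2 ^ N. \<Sum>e\<in>Jn N. 2 ^ N / c\<^sup>2 * ((dinc F N k \<bullet> e)\<^sup>2 / lam e))"
      by (intro sum.cong refl) (simp add: h_def power_divide power_mult_distrib lam_nonneg inverse_eq_divide)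
    finally show ?thesis by (simp add: energy_def sum_distrib_left sum_divide_distrib mult.commute)
  qed
  have "ennreal (exp (- C / c\<^sup>2)) * emeasure M (tube N c \<delta> (\<lambda>_. 0)) \<le> ennreal (exp (- (\<Sum>i\<in>?I. (h i)\<^sup>2) / 2)) * emeasure ?G B"
  proof (rule mult_mono)
    have "energy N (Jn N) F / c\<^sup>2 \<le> 2 * C / c\<^sup>2" using en by (intro divide_right_mono) auto
    then show "ennreal (exp (- C / c\<^sup>2)) \<le> ennreal (exp (- (\<Sum>i\<in>?I. (h i)\<^sup>2) / 2))"
      unfolding hsum by (intro ennreal_leI) simp
    show "emeasure M (tube N c \<delta> (\<lambda>_. 0)) \<le> emeasure ?G B"
      using tube_em[of 0] unfolding B_eq by simp
  qed auto
  also have "\<dots> \<le> emeasure ?G {y \<in> space ?G. (\<lambda>i\<in>?I. y i - h i) \<in> B}"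
    by (rule gauss_PiM_symmetric_shift[OF I B sym])
  also have "\<dots> = emeasure M (tube N c \<delta> F)"
    using tube_em[of 1] by simp
  finally show ?thesis
    by (simp add: emeasure_eq_measure ennreal_mult'[symmetric] ennreal_le_iff)
qed

text \<open>Projections are contractions, so the centred dyadic ball lies in every centred tube, and
  the bound of \<open>tube_prob_ge\<close> has the same factor for all \<open>N\<close>. As
  \<open>N\<close> grows the tubes around \<open>F\<close> decrease to the dyadic ball, up to a null
  set: the kernel coordinates of \<open>W\<close> vanish only almost surely.\<close>

lemma prob_tube_dyadic_holder_ge:
  assumes c: "c > 0" and en: "\<And>N. energy N (Jn N) F \<le> 2 * C"
    and null: "\<And>t e. t \<in> {0..1} \<Longrightarrow> e \<in> E - Ep \<Longrightarrow> F t \<bullet> e = 0"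
  shows "exp (- C / c\<^sup>2) * prob {\<omega> \<in> space M. dyadic_holder \<alpha> 0 (\<delta> / c) (Wpath \<omega>)} \<le>
    prob {\<omega> \<in> space M. dyadic_holder \<alpha> 0 \<delta> (\<lambda>t. c *\<^sub>R W t \<omega> - F t)}"
proof -
  let ?P = "{\<omega> \<in> space M. dyadic_holder \<alpha> 0 (\<delta> / c) (Wpath \<omega>)}"
  have sub: "?P \<subseteq> tube N c \<delta> (\<lambda>_. 0)" for N
  proof
    fix \<omega> assume "\<omega> \<in> ?P"
    then have \<omega>: "\<omega> \<in> space M" "dyadic_holder \<alpha> 0 \<delta> (\<lambda>t. c *\<^sub>R W t \<omega>)"
      using dyadic_holder_scaled[OF c, of 0 \<delta> "Wpath \<omega>"] by auto
    have "norm (oproj (Jn N) (c *\<^sub>R dinc (Wpath \<omega>) m k)) \<le> \<delta> * (2 powr - \<alpha>) ^ m" if "k < 2 ^ m" for m k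
      using norm_oproj_le[OF E_orthonormal finite_Jn Jn_E] dyadic_holderD[OF \<omega>(2) le0 that, unfolded dinc_scaleR]
      by (rule order_trans)
    then show "\<omega> \<in> tube N c \<delta> (\<lambda>_. 0)" using \<omega>(1) by (simp add: tube_def dinc_def)
  qed
  have "exp (- C / c\<^sup>2) * prob ?P \<le> prob (tube N c \<delta> F)" for N
  proof -
    have "exp (- C / c\<^sup>2) * prob ?P \<le> exp (- C / c\<^sup>2) * prob (tube N c \<delta> (\<lambda>_. 0))"
      by (intro mult_left_mono finite_measure_mono[OF sub] tube_measurable) simp
    also have "\<dots> \<le> prob (tube N c \<delta> F)" by (rule tube_prob_ge[OF c en])
    finally show ?thesis .
  qed
  moreover have "(\<lambda>N. prob (tube N c \<delta> F)) \<longlonglongrightarrow> prob (\<Inter>N. tube N c \<delta> F)"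
    using tube_measurable by (intro finite_Lim_measure_decseq) (auto simp: antimono_def tube_antimono)
  ultimately have "exp (- C / c\<^sup>2) * prob ?P \<le> prob (\<Inter>N. tube N c \<delta> F)"
    by (intro LIMSEQ_le_const) auto
  also have "\<dots> \<le> prob {\<omega> \<in> space M. dyadic_holder \<alpha> 0 \<delta> (\<lambda>t. c *\<^sub>R W t \<omega> - F t)}"
  proof (rule finite_measure_mono_AE[OF _ dyadic_holder_measurable])
    have "AE \<omega> in M. \<forall>m. \<forall>k. k < 2 ^ m \<longrightarrow> (\<forall>e\<in>E - Ep. dinc (Wpath \<omega>) m k \<bullet> e = 0)"
    proof (intro AE_all_countable[THEN iffD2] allI)
      fix m k :: nat
      have "AE \<omega> in M. \<forall>e\<in>E - Ep. dinc (Wpath \<omega>) m k \<bullet> e = 0" if k: "k < 2 ^ m"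
      proof (rule AE_ball_countable[THEN iffD2])
        show "countable (E - Ep)" using countable_E by simp
        show "\<forall>e\<in>E - Ep. AE \<omega> in M. dinc (Wpath \<omega>) m k \<bullet> e = 0"
          unfolding dinc_def using k dyadic_mem[of k m] dyadic_mem[of "Suc k" m]
          by (intro ballI coord_null) (auto intro: divide_right_mono)
      qed
      then show "AE \<omega> in M. k < 2 ^ m \<longrightarrow> (\<forall>e\<in>E - Ep. dinc (Wpath \<omega>) m k \<bullet> e = 0)"
        by (cases "k < 2 ^ m") auto
    qed
    then show "AE \<omega> in M. \<omega> \<in> (\<Inter>N. tube N c \<delta> F) \<longrightarrow>
        \<omega> \<in> {\<omega> \<in> space M. dyadic_holder \<alpha> 0 \<delta> (\<lambda>t. c *\<^sub>R W t \<omega> - F t)}"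
    proof (rule eventually_mono, intro impI)
      fix \<omega> assume z: "\<forall>m. \<forall>k. k < 2 ^ m \<longrightarrow> (\<forall>e\<in>E - Ep. dinc (Wpath \<omega>) m k \<bullet> e = 0)"
        and t: "\<omega> \<in> (\<Inter>N. tube N c \<delta> F)"
      have "norm (dinc (\<lambda>t. c *\<^sub>R W t \<omega> - F t) m k) \<le> \<delta> * (2 powr - \<alpha>) ^ m" if k: "k < 2 ^ m" for m k
        unfolding dinc_diff dinc_scaleR
      proof (rule norm_le_oproj_Jn)
        fix N assume "m \<le> N"
        moreover have "\<omega> \<in> tube N c \<delta> F" using t by blast
        ultimately show "norm (oproj (Jn N) (c *\<^sub>R dinc (Wpath \<omega>) m k - dinc F m k)) \<le> \<delta> * (2 powr - \<alpha>) ^ m"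
          using k by (auto simp: tube_def)
      next
        fix e assume e: "e \<in> E - Ep"
        have "dinc F m k \<bullet> e = 0"
          using null[OF dyadic_mem e, of k m] null[OF dyadic_mem e, of "Suc k" m] k by (simp add: dinc_def inner_diff_left)
        then show "(c *\<^sub>R dinc (Wpath \<omega>) m k - dinc F m k) \<bullet> e = 0"
          using z k e by (simp add: inner_diff_left)
      qed
      then show "\<omega> \<in> {\<omega> \<in> space M. dyadic_holder \<alpha> 0 \<delta> (\<lambda>t. c *\<^sub>R W t \<omega> - F t)}"
        using t by (auto simp: dyadic_holder_def tube_def)
    qed
  qed
  finally show ?thesis .
qed

text \<open>The centred ball has probability tending to 1, and \<open>1 / 2\<close> is all that is
  kept: a constant factor disappears on the logarithmic scale.\<close>

lemma prob_open_ge: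
  assumes O': "openin (holder_topology \<alpha>) O'" and F: "F \<in> O'" and rate: "schilder_rate Q F \<le> ennreal C" "0 \<le> C"
  shows "\<forall>\<^sub>F \<epsilon> in at_right 0. 1 / 2 * exp (- C / \<epsilon>) \<le> prob {\<omega> \<in> space M. spath (sqrt \<epsilon>) \<omega> \<in> O'}"
proof -
  obtain \<delta> where \<delta>: "\<delta> > 0" "\<And>G. G \<in> holder0 \<alpha> \<Longrightarrow> dyadic_holder \<alpha> 0 \<delta> (\<lambda>t. G t - F t) \<Longrightarrow> G \<in> O'"
    by (rule openin_holder_dyadic[OF \<alpha>_pos O' F]) blast
  define L where "L = \<delta>\<^sup>2 / (4 * \<tau>)"
  have L: "L > 0" using \<delta> \<tau>_pos by (simp add: L_def)
  have Ln: "0 \<le> L" "L \<le> \<delta>\<^sup>2 / (4 * \<tau>) * \<rho> ^ 0" using L by (simp_all add: L_def)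
  obtain K where K: "K > 0" "\<And>\<epsilon>. 0 < \<epsilon> \<Longrightarrow> \<epsilon> \<le> 1 \<Longrightarrow>
      prob {\<omega> \<in> space M. \<not> dyadic_holder \<alpha> 0 (\<delta> / sqrt \<epsilon>) (Wpath \<omega>)} \<le> K * exp (- L / \<epsilon>)"
    by (rule prob_not_dyadic_holder_scaled[OF \<delta>(1) Ln]) blast
  have O'_sets: "O' \<in> sets (borel_of (holder_topology \<alpha>))" by (rule openin_borel_of[OF O'])
  have main: "1 / 2 * exp (- C / \<epsilon>) \<le> prob {\<omega> \<in> space M. spath (sqrt \<epsilon>) \<omega> \<in> O'}"
    if \<epsilon>: "0 < \<epsilon>" "\<epsilon> < min 1 (L / (2 * K))" for \<epsilon>
  proof -
    let ?D = "{\<omega> \<in> space M. dyadic_holder \<alpha> 0 (\<delta> / sqrt \<epsilon>) (Wpath \<omega>)}"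
    have s: "sqrt \<epsilon> > 0" using \<epsilon> by simp
    \<comment> \<open>This elementary bound gives the explicit threshold \<open>L / (2 * K)\<close>
      for \<open>\<epsilon>\<close>.\<close>
    have "L / \<epsilon> \<le> exp (L / \<epsilon>)" using exp_ge_add_one_self[of "L / \<epsilon>"] by linarith
    then have "exp (- L / \<epsilon>) \<le> \<epsilon> / L" using L \<epsilon> by (simp add: exp_minus field_simps)
    then have "K * exp (- L / \<epsilon>) \<le> K * (\<epsilon> / L)" using K by (intro mult_left_mono) auto
    also have "\<dots> \<le> 1 / 2" using \<epsilon> K(1) L by (simp add: field_simps)
    finally have "prob {\<omega> \<in> space M. \<not> dyadic_holder \<alpha> 0 (\<delta> / sqrt \<epsilon>) (Wpath \<omega>)} \<le> 1 / 2"
      using K(2)[of \<epsilon>] \<epsilon> by simp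
    moreover have "?D \<in> sets M"
      using dyadic_holder_measurable[of 0 "\<delta> / sqrt \<epsilon>" 1 "\<lambda>_. 0"] by simp
    ultimately have half: "1 / 2 \<le> prob ?D" using prob_neg[of "\<lambda>\<omega>. dyadic_holder \<alpha> 0 (\<delta> / sqrt \<epsilon>) (Wpath \<omega>)"] by simp
    have "1 / 2 * exp (- C / \<epsilon>) \<le> exp (- C / (sqrt \<epsilon>)\<^sup>2) * prob ?D"
      using half \<epsilon> by simp
    also have "\<dots> \<le> prob {\<omega> \<in> space M. dyadic_holder \<alpha> 0 \<delta> (\<lambda>t. sqrt \<epsilon> *\<^sub>R W t \<omega> - F t)}"
      using schilder_rateD[OF rate] finite_Jn Jn_subset by (intro prob_tube_dyadic_holder_ge s) auto
    also have "\<dots> \<le> prob {\<omega> \<in> space M. spath (sqrt \<epsilon>) \<omega> \<in> O'}"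
    proof (rule finite_measure_mono_AE[OF _ spath_sets[OF O'_sets]])
      show "AE \<omega> in M. \<omega> \<in> {\<omega> \<in> space M. dyadic_holder \<alpha> 0 \<delta> (\<lambda>t. sqrt \<epsilon> *\<^sub>R W t \<omega> - F t)} \<longrightarrow>
          \<omega> \<in> {\<omega> \<in> space M. spath (sqrt \<epsilon>) \<omega> \<in> O'}"
        using AE_spath_holder0[OF s] by (rule eventually_mono) (auto intro: \<delta>(2) simp: spath_dyadic)
    qed
    finally show ?thesis .
  qed
  show ?thesis
    by (rule eventually_at_rightI[of 0 "min 1 (L / (2 * K))"]) (use main L K in auto)
qed

text \<open>It suffices to treat real \<open>l\<close> strictly below the infimum, which covers an
  infinite infimum, in particular that of an empty set. The tail estimate wants a second rate
  \<open>l'\<close> between \<open>l\<close> and the infimum.\<close>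

lemma LDP_upper:
  assumes A: "closedin (holder_topology \<alpha>) A"
  shows "Limsup (at_right 0) (\<lambda>\<epsilon>. ereal \<epsilon> * log_ereal (measure (scaled_law \<alpha> M W \<epsilon>) A))
    \<le> - enn2ereal (INF F\<in>A. schilder_rate Q F)" (is "?S \<le> - enn2ereal ?I")
proof -
  have "topspace (holder_topology \<alpha>) - A \<in> sets (borel_of (holder_topology \<alpha>))"
    using A by (intro openin_borel_of) (simp add: closedin_def)
  from sets.compl_sets[OF this] have A_sets: "A \<in> sets (borel_of (holder_topology \<alpha>))"
    unfolding space_borel_of double_diff[OF closedin_subset[OF A] order_refl] .
  have S: "?S = Limsup (at_right 0) (\<lambda>\<epsilon>. ereal \<epsilon> * log_ereal (prob {\<omega> \<in> space M. spath (sqrt \<epsilon>) \<omega> \<in> A}))"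
    by (rule Limsup_eq, rule eventually_at_rightI[of 0 1]) (simp_all add: scaled_law_measure[OF _ A_sets])
  have le: "?S \<le> - ereal l" if l: "0 < l" "ennreal l < ?I" for l
  proof -
    obtain b where b: "ennreal l < b" "b < ?I" using dense[OF l(2)] by blast
    then obtain l' where l': "b = ennreal l'" "0 \<le> l'" by (cases b) auto
    have ll: "l < l'" using b(1) l(1) unfolding l'(1) by (subst (asm) ennreal_less_iff) auto
    have rate: "\<not> schilder_rate Q F \<le> ennreal l'" if "F \<in> A" for F
      using INF_lower[OF that, of "schilder_rate Q"] b(2) unfolding l'(1) by (auto simp: not_le)
    obtain K where K: "K > 0" "\<And>\<epsilon>. 0 < \<epsilon> \<Longrightarrow> \<epsilon> \<le> 1 \<Longrightarrow>
        prob {\<omega> \<in> space M. spath (sqrt \<epsilon>) \<omega> \<in> A} \<le> K * exp (- l / \<epsilon>)"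
      by (rule prob_closed_le[OF A l(1) ll rate]) blast+
    show ?thesis unfolding S by (rule Limsup_log_le[OF K(1)]) (use K(2) in simp)
  qed
  \<comment> \<open>Probabilities are at most 1. This covers an infimum equal to 0 and ensures below
    that the separating real \<open>x\<close> is positive.\<close>
  have zero: "?S \<le> 0"
  proof -
    have "?S \<le> Limsup (at_right (0::real)) (\<lambda>_. 0)"
      unfolding S
    proof (rule Limsup_mono, rule eventually_at_rightI[of 0 1])
      fix \<epsilon> :: real assume \<epsilon>: "\<epsilon> \<in> {0<..<1}"
      let ?p = "prob {\<omega> \<in> space M. spath (sqrt \<epsilon>) \<omega> \<in> A}"
      have "?p = 0 \<or> ln ?p \<le> 0" using measure_nonneg[of M] prob_le_1 by (metis less_eq_real_def ln_le_zero_iff)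
      then show "ereal \<epsilon> * log_ereal ?p \<le> 0"
        using \<epsilon> by (auto simp: log_ereal_def zero_ereal_def mult_nonneg_nonpos)
    qed simp
    also have "\<dots> = 0" by (rule lim_imp_Limsup) simp_all
    finally show ?thesis .
  qed
  show ?thesis
  proof (rule ccontr)
    assume "\<not> ?S \<le> - enn2ereal ?I"
    then have "- ?S < enn2ereal ?I" by (simp add: ereal_uminus_less_reorder not_le)
    then obtain x where x: "- ?S < ereal x" "ereal x < enn2ereal ?I" using ereal_dense2 by blast
    have "0 \<le> - ?S" using zero by simp
    then have "0 < ereal x" using x(1) by (rule le_less_trans)
    then have x0: "0 < x" by simp
    have "ennreal x < ?I"
      using x(2) x0 by (simp add: less_ennreal.rep_eq enn2ereal_ennreal)
    from le[OF x0 this] x(1)[unfolded ereal_uminus_less_reorder[of ?S]] show False by (rule leD[THEN notE])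
  qed
qed

text \<open>If the bound failed, a real \<open>x\<close> would separate the infimum from the negated
  lower limit; a path in \<open>G\<close> of rate below \<open>x\<close> then contradicts
  \<open>prob_open_ge\<close>. An infinite infimum cannot occur in this situation.\<close>

lemma LDP_lower:
  assumes G: "openin (holder_topology \<alpha>) G"
  shows "- enn2ereal (INF F\<in>G. schilder_rate Q F)
    \<le> Liminf (at_right 0) (\<lambda>\<epsilon>. ereal \<epsilon> * log_ereal (measure (scaled_law \<alpha> M W \<epsilon>) G))" (is "- enn2ereal ?I \<le> ?S")
proof (rule ccontr)
  have G_sets: "G \<in> sets (borel_of (holder_topology \<alpha>))" by (rule openin_borel_of[OF G])
  have S: "?S = Liminf (at_right 0) (\<lambda>\<epsilon>. ereal \<epsilon> * log_ereal (prob {\<omega> \<in> space M. spath (sqrt \<epsilon>) \<omega> \<in> G}))"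
    by (rule Liminf_eq, rule eventually_at_rightI[of 0 1]) (simp_all add: scaled_law_measure[OF _ G_sets])
  assume "\<not> - enn2ereal ?I \<le> ?S"
  then have "enn2ereal ?I < - ?S" by (simp add: ereal_less_uminus_reorder not_le)
  then obtain x where x: "enn2ereal ?I < ereal x" "ereal x < - ?S" using ereal_dense2 by blast
  have x0: "0 \<le> x"
    using enn2ereal_nonneg[of ?I] x(1) by (metis ereal_less_eq(5) less_imp_le order_trans)
  have "?I < ennreal x" using x(1) x0 by (simp add: less_ennreal.rep_eq enn2ereal_ennreal)
  then obtain F where F: "F \<in> G" "schilder_rate Q F < ennreal x" unfolding INF_less_iff by blast
  have "- ereal x \<le> ?S"
    unfolding S using prob_open_ge[OF G F(1) less_imp_le[OF F(2)] x0] by (rule Liminf_log_ge[rotated]) simp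
  with x(2)[unfolded ereal_less_uminus_reorder[of "ereal x"]] show False by (rule leD[THEN notE, rotated])
qed

end

theorem lemma9:
  fixes \<alpha> :: real
    and Q :: "'h::{real_inner, banach, polish_space} \<Rightarrow> 'h"
    and M :: "'w measure"
    and W :: "real \<Rightarrow> 'w \<Rightarrow> 'h"
  assumes "0 < \<alpha>" and "\<alpha> < 1 / 2"
    and "positive_op Q" and "selfadjoint_op Q" and "trace_class Q"
    and "Q_Wiener_process M Q W"
  shows "(AE \<omega> in M. (\<lambda>t\<in>{0..1}. W t \<omega>) \<in> holder0 \<alpha>) \<and>
    good_rate_function (holder_topology \<alpha>) (schilder_rate Q) \<and>
    LDP (holder_topology \<alpha>) (scaled_law \<alpha> M W) (schilder_rate Q)"
proof -
  interpret wiener Q M W \<alpha> by unfold_locales (fact assms)+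
  have "AE \<omega> in M. (\<lambda>t\<in>{0..1}. W t \<omega>) \<in> holder0 \<alpha>"
    using AE_spath_holder0[of 1] by (simp add: spath_def)
  moreover have good: "good_rate_function (holder_topology \<alpha>) (schilder_rate Q)"
    by (rule schilder_rate_good[OF assms(1,2)])
  moreover have "LDP (holder_topology \<alpha>) (scaled_law \<alpha> M W) (schilder_rate Q)"
    unfolding LDP_def
  proof (intro conjI ballI allI impI)
    show "rate_function (holder_topology \<alpha>) (schilder_rate Q)"
      using good by (simp add: good_rate_function_def)
  qed (simp_all add: Hausdorff_holder[OF assms(1)] scaled_law_prob LDP_upper LDP_lower)
  ultimately show ?thesis by blast
qed

end
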